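(* Let $\Bbbk$ be a field of characteristic zero. Let $A$ be a Koszul algebra over $\Bbbk$, $\sigma$ a graded automorphism of $A$, and $B=A[z;\sigma]$. Then there is an isomorphism of graded algebras $E(B)\cong\Gamma(A^!,{}_\epsilon A^!_\psi(-1))$, where $\psi=(\sigma^{-1})^!$ is the automorphism of $A^!$ dual to $\sigma^{-1}$.
   Context: A quadratic algebra is $A=T(V)/(R)$ with $V$ finite dimensional and $R\subseteq V\otimes V$; its quadratic dual is $A^!=T(V^* )/(R^\perp)$, with $R^\perp\subseteq V^*\otimes V^*$ the orthogonal complement of $R$ under $(\alpha\otimes\beta)(v\otimes w)=\alpha(v)\beta(w)$. $A$ is Koszul if ${}_A\Bbbk$ has a graded projective resolution whose $n$-th term is generated in degree $n$ for all $n\ge0$. For a graded automorphism $\phi$ of $A$, the dual automorphism $\phi^!$ of $A^!$ is the one induced by the transpose of $\phi|_V$, $\alpha\mapsto\alpha\circ\phi|_V$ on $V^*$. $A[z;\sigma]$ is the skew polynomial algebra with $za=\sigma(a)z$, $z$ in degree 1. $E(B)=\bigoplus_{i\ge0}\mathrm{Ext}^i_B({}_B\Bbbk,{}_B\Bbbk)$ is the Yoneda algebra, with product given by composition: for classes $a'\in\mathrm{Ext}^k$, $a\in \mathrm{Ext}^n$ represented by maps $P^{-k}\to\Bbbk$, $P^{-n}\to\Bbbk$ on a projective resolution $P$, $a'*a$ is represented by $a'\circ g_k$, where $(g_j:P^{-n-j}\to P^{-j})_{j\geq 0}$ lifts $a$. $\epsilon$ is the automorphism $\epsilon(x)=(-1)^ix$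 for $x$ of degree $i$. For a graded bimodule $M$ over a graded algebra $E$ and automorphisms $\mu,\psi$ of $E$, ${}_\mu M_\psi$ is $M$ with actions $a*m*b=\mu(a)m\psi(b)$, and $M(n)_k=M_{n+k}$ (actions unchanged). The trivial extension $\Gamma(E,M)=E\oplus M$ is the graded algebra with product $(x_1,m_1)*(x_2,m_2)=(x_1x_2,\,x_1\cdot m_2+m_1\cdot x_2)$. *)

theory Defs
  imports
    Complex_Main
    "HOL-Algebra.QuotRing"
    "HOL-Algebra.Module"
    "HOL-Library.Poly_Mapping"
    "HOL-Library.Function_Algebras"
begin

section \<open>Graded algebras\<close>

text \<open>
  A graded algebra over the field \<^typ>\<open>'k\<close> is a (not necessarily commutative) ring record with
  scalar multiplication by \<^typ>\<open>'k\<close> and homogeneous components \<open>deg A i\<close>, \<open>i\<close> an integer.  For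
  modules and vector spaces the ring fields \<open>mult\<close> and \<open>one\<close> of the record are meaningless, as
  usual in HOL-Algebra.
\<close>

record ('k, 'a) graded_algebra = "('k, 'a) module" +
  deg :: "int \<Rightarrow> 'a set"

definition homog_decomp ::
  "('a, 'm, 'x) module_scheme \<Rightarrow> (int \<Rightarrow> 'm set) \<Rightarrow> 'm \<Rightarrow> (int \<Rightarrow> 'm) \<Rightarrow> bool" where
  "homog_decomp M gr m f \<longleftrightarrow>
     (\<forall>j. f j \<in> gr j) \<and> finite {j. f j \<noteq> \<zero>\<^bsub>M\<^esub>} \<and>
     m = (\<Oplus>\<^bsub>M\<^esub>j\<in>{j. f j \<noteq> \<zero>\<^bsub>M\<^esub>}. f j)"

definition homog_part :: "('k, 'a, 'x) graded_algebra_scheme \<Rightarrow> 'a \<Rightarrow> int \<Rightarrow> 'a" where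
  "homog_part A a = (THE f. homog_decomp A (deg A) a f)"

definition graded_hom ::
  "('k, 'a, 'x) graded_algebra_scheme \<Rightarrow> ('k, 'b, 'y) graded_algebra_scheme \<Rightarrow> ('a \<Rightarrow> 'b) set" where
  "graded_hom A B = {h \<in> ring_hom A B.
     (\<forall>c. \<forall>x\<in>carrier A. h (c \<odot>\<^bsub>A\<^esub> x) = c \<odot>\<^bsub>B\<^esub> h x) \<and> (\<forall>i. h ` deg A i \<subseteq> deg B i)}"

definition graded_iso ::
  "('k, 'a, 'x) graded_algebra_scheme \<Rightarrow> ('k, 'b, 'y) graded_algebra_scheme \<Rightarrow> ('a \<Rightarrow> 'b) set" where
  "graded_iso A B = {h \<in> graded_hom A B. bij_betw h (carrier A) (carrier B)}"

abbreviation graded_aut :: "('k, 'a, 'x) graded_algebra_scheme \<Rightarrow> ('a \<Rightarrow> 'a) set" where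
  "graded_aut A \<equiv> graded_iso A A"

definition graded_isomorphic ::
  "('k, 'a, 'x) graded_algebra_scheme \<Rightarrow> ('k, 'b, 'y) graded_algebra_scheme \<Rightarrow> bool" where
  "graded_isomorphic A B \<longleftrightarrow> graded_iso A B \<noteq> {}"

text \<open>The quotient by the two-sided ideal generated by a set \<open>S\<close> of homogeneous elements.\<close>

definition quot_proj :: "('k, 'a, 'x) graded_algebra_scheme \<Rightarrow> 'a set \<Rightarrow> 'a \<Rightarrow> 'a set" where
  "quot_proj A S x = (Idl\<^bsub>A\<^esub> S) +>\<^bsub>A\<^esub> x"

definition quot_algebra ::
  "('k, 'a, 'x) graded_algebra_scheme \<Rightarrow> 'a set \<Rightarrow> ('k, 'a set) graded_algebra" where
  "quot_algebra A S = (let Q = A Quot (Idl\<^bsub>A\<^esub> S) in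
     \<lparr>carrier = carrier Q, mult = mult Q, one = one Q, zero = zero Q, add = add Q,
      smult = (\<lambda>c X. \<Union>x\<in>X. quot_proj A S (c \<odot>\<^bsub>A\<^esub> x)),
      deg = (\<lambda>i. quot_proj A S ` deg A i)\<rparr>)"

section \<open>Tensor algebras and quadratic algebras\<close>

text \<open>Words under concatenation, so that \<^typ>\<open>'v list \<Rightarrow>\<^sub>0 'k\<close> is the free algebra on the set \<^typ>\<open>'v\<close>.\<close>

instantiation list :: (type) monoid_add
begin

definition zero_list :: "'a list" where "zero_list = []"

definition plus_list :: "'a list \<Rightarrow> 'a list \<Rightarrow> 'a list" where "plus_list = (@)"

instance by standard (simp_all add: zero_list_def plus_list_def)

end

definition free_alg :: "'v set \<Rightarrow> ('k::field, 'v list \<Rightarrow>\<^sub>0 'k) graded_algebra" where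
  "free_alg W =
     \<lparr>carrier = {p. Poly_Mapping.keys p \<subseteq> lists W}, mult = (*), one = 1, zero = 0, add = (+),
      smult = (\<lambda>c p. Poly_Mapping.map ((*) c) p),
      deg = (\<lambda>i. {p. Poly_Mapping.keys p \<subseteq> {w \<in> lists W. int (length w) = i}})\<rparr>"

text \<open>
  The tensor algebra of a vector space \<open>W\<close>, a subspace of the ambient type with scalar
  multiplication \<open>scale\<close>, is the free algebra on the set \<open>W\<close> modulo linearity of \<open>W \<rightarrow> T(W)\<close>.
  In particular \<open>deg (tensor_algebra scale W) 2\<close> is \<open>W \<otimes> W\<close>.
\<close>

definition lin_rels :: "('k::field \<Rightarrow> 'v::plus \<Rightarrow> 'v) \<Rightarrow> 'v set \<Rightarrow> ('v list \<Rightarrow>\<^sub>0 'k) set" where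
  "lin_rels scale W =
     {Poly_Mapping.single [u + w] 1 - Poly_Mapping.single [u] 1 - Poly_Mapping.single [w] 1
        | u w. u \<in> W \<and> w \<in> W} \<union>
     {Poly_Mapping.single [scale c u] 1 - Poly_Mapping.single [u] c | c u. u \<in> W}"

definition tensor_algebra ::
  "('k::field \<Rightarrow> 'v::plus \<Rightarrow> 'v) \<Rightarrow> 'v set \<Rightarrow> ('k, ('v list \<Rightarrow>\<^sub>0 'k) set) graded_algebra" where
  "tensor_algebra scale W = quot_algebra (free_alg W) (lin_rels scale W)"

definition quadratic_algebra ::
  "('k::field \<Rightarrow> 'v::plus \<Rightarrow> 'v) \<Rightarrow> 'v set \<Rightarrow> ('v list \<Rightarrow>\<^sub>0 'k) set set \<Rightarrow>
     ('k, ('v list \<Rightarrow>\<^sub>0 'k) set set) graded_algebra" where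
  "quadratic_algebra scale W R = quot_algebra (tensor_algebra scale W) R"

text \<open>The canonical map \<open>W \<rightarrow> T(W)/(R)\<close>.\<close>

definition gen ::
  "('k::field \<Rightarrow> 'v::plus \<Rightarrow> 'v) \<Rightarrow> 'v set \<Rightarrow> ('v list \<Rightarrow>\<^sub>0 'k) set set \<Rightarrow> 'v \<Rightarrow>
     ('v list \<Rightarrow>\<^sub>0 'k) set set" where
  "gen scale W R w =
     quot_proj (tensor_algebra scale W) R
       (quot_proj (free_alg W) (lin_rels scale W) (Poly_Mapping.single [w] 1))"

section \<open>The quadratic dual\<close>

text \<open>In this section \<open>V\<close> is the whole type \<^typ>\<open>'v\<close> with scalar multiplication \<open>scale\<close>.\<close>

definition dual_space :: "('k::field \<Rightarrow> 'v::ab_group_add \<Rightarrow> 'v) \<Rightarrow> ('v \<Rightarrow> 'k) set" where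
  "dual_space scale = {\<alpha>. Vector_Spaces.linear scale (*) \<alpha>}"

definition dual_scale :: "'k::field \<Rightarrow> ('v \<Rightarrow> 'k) \<Rightarrow> 'v \<Rightarrow> 'k" where
  "dual_scale c \<alpha> = (\<lambda>v. c * \<alpha> v)"

fun word_pairing :: "('v \<Rightarrow> 'k::field) list \<Rightarrow> 'v list \<Rightarrow> 'k" where
  "word_pairing [\<alpha>, \<beta>] [v, w] = \<alpha> v * \<beta> w"
| "word_pairing _ _ = 0"

definition free_pairing :: "(('v \<Rightarrow> 'k::field) list \<Rightarrow>\<^sub>0 'k) \<Rightarrow> ('v list \<Rightarrow>\<^sub>0 'k) \<Rightarrow> 'k" where
  "free_pairing p q = (\<Sum>s\<in>Poly_Mapping.keys p. \<Sum>t\<in>Poly_Mapping.keys q.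
     Poly_Mapping.lookup p s * Poly_Mapping.lookup q t * word_pairing s t)"

text \<open>
  On the tensor spaces the pairing is computed on representatives in the free algebras; its value
  does not depend on them since \<open>\<alpha>\<close>, \<open>\<beta>\<close> are linear and the operations on \<open>V\<^sup>*\<close> are pointwise.
\<close>

definition orth ::
  "('k::field \<Rightarrow> 'v::ab_group_add \<Rightarrow> 'v) \<Rightarrow> ('v list \<Rightarrow>\<^sub>0 'k) set set \<Rightarrow>
     (('v \<Rightarrow> 'k) list \<Rightarrow>\<^sub>0 'k) set set" where
  "orth scale R = {x \<in> deg (tensor_algebra dual_scale (dual_space scale)) 2.
     \<forall>r\<in>R. \<forall>p\<in>x. \<forall>q\<in>r. free_pairing p q = 0}"

definition quadratic_dual ::
  "('k::field \<Rightarrow> 'v::ab_group_add \<Rightarrow> 'v) \<Rightarrow> ('v list \<Rightarrow>\<^sub>0 'k) set set \<Rightarrow>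
     ('k, (('v \<Rightarrow> 'k) list \<Rightarrow>\<^sub>0 'k) set set) graded_algebra" where
  "quadratic_dual scale R = quadratic_algebra dual_scale (dual_space scale) (orth scale R)"

text \<open>\<open>\<phi>\<close> restricted to \<open>V\<close>, which is identified with the degree one part of \<open>T(V)/(R)\<close>.\<close>

definition restr_gen ::
  "('k::field \<Rightarrow> 'v::ab_group_add \<Rightarrow> 'v) \<Rightarrow> ('v list \<Rightarrow>\<^sub>0 'k) set set \<Rightarrow>
     (('v list \<Rightarrow>\<^sub>0 'k) set set \<Rightarrow> ('v list \<Rightarrow>\<^sub>0 'k) set set) \<Rightarrow> 'v \<Rightarrow> 'v" where
  "restr_gen scale R \<phi> v = (THE w. \<phi> (gen scale UNIV R v) = gen scale UNIV R w)"

definition dual_aut ::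
  "('k::field \<Rightarrow> 'v::ab_group_add \<Rightarrow> 'v) \<Rightarrow> ('v list \<Rightarrow>\<^sub>0 'k) set set \<Rightarrow>
     (('v list \<Rightarrow>\<^sub>0 'k) set set \<Rightarrow> ('v list \<Rightarrow>\<^sub>0 'k) set set) \<Rightarrow>
     (('v \<Rightarrow> 'k) list \<Rightarrow>\<^sub>0 'k) set set \<Rightarrow> (('v \<Rightarrow> 'k) list \<Rightarrow>\<^sub>0 'k) set set" where
  "dual_aut scale R \<phi> = (THE f.
     f \<in> graded_aut (quadratic_dual scale R) \<and>
     f \<in> extensional (carrier (quadratic_dual scale R)) \<and>
     (\<forall>\<alpha>\<in>dual_space scale.
        f (gen dual_scale (dual_space scale) (orth scale R) \<alpha>) =
        gen dual_scale (dual_space scale) (orth scale R) (\<alpha> \<circ> restr_gen scale R \<phi>)))"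

section \<open>Skew polynomial algebras\<close>

text \<open>A sequence \<open>f\<close> stands for the polynomial \<open>\<Sum>\<^sub>i f i z\<^sup>i\<close> with coefficients on the left.\<close>

definition skew_poly ::
  "('k, 'a, 'x) graded_algebra_scheme \<Rightarrow> ('a \<Rightarrow> 'a) \<Rightarrow> ('k, nat \<Rightarrow> 'a) graded_algebra" where
  "skew_poly A \<sigma> = (let C = {f. (\<forall>i. f i \<in> carrier A) \<and> finite {i. f i \<noteq> \<zero>\<^bsub>A\<^esub>}} in
     \<lparr>carrier = C,
      mult = (\<lambda>f g n. \<Oplus>\<^bsub>A\<^esub>i\<in>{..n}. f i \<otimes>\<^bsub>A\<^esub> (\<sigma> ^^ i) (g (n - i))),
      one = (\<lambda>i. if i = 0 then \<one>\<^bsub>A\<^esub> else \<zero>\<^bsub>A\<^esub>),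
      zero = (\<lambda>i. \<zero>\<^bsub>A\<^esub>),
      add = (\<lambda>f g i. f i \<oplus>\<^bsub>A\<^esub> g i),
      smult = (\<lambda>c f i. c \<odot>\<^bsub>A\<^esub> f i),
      deg = (\<lambda>j. {f \<in> C. \<forall>i. f i \<in> deg A (j - int i)})\<rparr>)"

section \<open>Modules and projective resolutions\<close>

text \<open>HOL-Algebra's \<^locale>\<open>module\<close> requires a commutative base ring.\<close>

locale left_module = A?: ring A + M?: abelian_group M
  for A :: "('a, 'x) ring_scheme" (structure) and M :: "('a, 'm, 'y) module_scheme" (structure) +
  assumes smult_closed:
      "\<lbrakk>a \<in> carrier A; x \<in> carrier M\<rbrakk> \<Longrightarrow> a \<odot>\<^bsub>M\<^esub> x \<in> carrier M"
    and smult_l_distr: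
      "\<lbrakk>a \<in> carrier A; b \<in> carrier A; x \<in> carrier M\<rbrakk> \<Longrightarrow>
       (a \<oplus>\<^bsub>A\<^esub> b) \<odot>\<^bsub>M\<^esub> x = a \<odot>\<^bsub>M\<^esub> x \<oplus>\<^bsub>M\<^esub> b \<odot>\<^bsub>M\<^esub> x"
    and smult_r_distr:
      "\<lbrakk>a \<in> carrier A; x \<in> carrier M; y \<in> carrier M\<rbrakk> \<Longrightarrow>
       a \<odot>\<^bsub>M\<^esub> (x \<oplus>\<^bsub>M\<^esub> y) = a \<odot>\<^bsub>M\<^esub> x \<oplus>\<^bsub>M\<^esub> a \<odot>\<^bsub>M\<^esub> y"
    and smult_assoc:
      "\<lbrakk>a \<in> carrier A; b \<in> carrier A; x \<in> carrier M\<rbrakk> \<Longrightarrow>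
       (a \<otimes>\<^bsub>A\<^esub> b) \<odot>\<^bsub>M\<^esub> x = a \<odot>\<^bsub>M\<^esub> (b \<odot>\<^bsub>M\<^esub> x)"
    and smult_one:
      "x \<in> carrier M \<Longrightarrow> \<one>\<^bsub>A\<^esub> \<odot>\<^bsub>M\<^esub> x = x"

definition module_hom ::
  "('a, 'x) ring_scheme \<Rightarrow> ('a, 'm, 'y) module_scheme \<Rightarrow> ('a, 'n, 'z) module_scheme \<Rightarrow>
     ('m \<Rightarrow> 'n) set" where
  "module_hom A M N = {f \<in> carrier M \<rightarrow> carrier N.
     (\<forall>x\<in>carrier M. \<forall>y\<in>carrier M. f (x \<oplus>\<^bsub>M\<^esub> y) = f x \<oplus>\<^bsub>N\<^esub> f y) \<and>
     (\<forall>a\<in>carrier A. \<forall>x\<in>carrier M. f (a \<odot>\<^bsub>M\<^esub> x) = a \<odot>\<^bsub>N\<^esub> f x)}"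

text \<open>
  Lifting along surjections \<open>g : N \<rightarrow> N'\<close>.  HOL cannot quantify over all types, so \<open>N\<close> and \<open>N'\<close> have
  elements in \<^typ>\<open>'m \<Rightarrow> 'a\<close> and \<^typ>\<open>'m\<close>.  This is no restriction: the free module on the set
  \<open>carrier M\<close> has its elements in \<^typ>\<open>'m \<Rightarrow> 'a\<close>, and lifting \<open>id\<close> along the canonical surjection
  from it to \<open>M\<close> already makes \<open>M\<close> a direct summand of a free module.
\<close>

definition projective :: "('a, 'x) ring_scheme \<Rightarrow> ('a, 'm) module \<Rightarrow> bool" where
  "projective A M \<longleftrightarrow> left_module A M \<and>
     (\<forall>(N :: ('a, 'm \<Rightarrow> 'a) module) (N' :: ('a, 'm) module) g f.
        left_module A N \<and> left_module A N' \<and>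
        g \<in> module_hom A N N' \<and> g ` carrier N = carrier N' \<and> f \<in> module_hom A M N' \<longrightarrow>
        (\<exists>h\<in>module_hom A M N. \<forall>x\<in>carrier M. g (h x) = f x))"

text \<open>
  A projective resolution \<open>\<dots> \<rightarrow> P 1 \<rightarrow> P 0 \<rightarrow> M \<rightarrow> 0\<close>, with \<open>d n : P (n+1) \<rightarrow> P n\<close> and augmentation
  \<open>e : P 0 \<rightarrow> M\<close>.
\<close>

definition proj_resolution ::
  "('a, 'x) ring_scheme \<Rightarrow> ('a, 'm) module \<Rightarrow> (nat \<Rightarrow> ('a, 'p) module) \<Rightarrow> (nat \<Rightarrow> 'p \<Rightarrow> 'p) \<Rightarrow>
     ('p \<Rightarrow> 'm) \<Rightarrow> bool" where
  "proj_resolution A M P d e \<longleftrightarrow>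
     (\<forall>n. projective A (P n)) \<and>
     (\<forall>n. d n \<in> module_hom A (P (Suc n)) (P n)) \<and>
     e \<in> module_hom A (P 0) M \<and>
     e ` carrier (P 0) = carrier M \<and>
     d 0 ` carrier (P 1) = {x \<in> carrier (P 0). e x = \<zero>\<^bsub>M\<^esub>} \<and>
     (\<forall>n. d (Suc n) ` carrier (P (Suc (Suc n))) =
            {x \<in> carrier (P (Suc n)). d n x = \<zero>\<^bsub>P n\<^esub>})"

text \<open>The trivial module \<open>\<k>\<close> of a connected graded algebra.\<close>

definition augmentation :: "('k, 'a, 'x) graded_algebra_scheme \<Rightarrow> 'a \<Rightarrow> 'k" where
  "augmentation A a = (THE c. homog_part A a 0 = c \<odot>\<^bsub>A\<^esub> \<one>\<^bsub>A\<^esub>)"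

definition trivial_module :: "('k::field, 'a, 'x) graded_algebra_scheme \<Rightarrow> ('a, 'k) module" where
  "trivial_module A =
     \<lparr>carrier = UNIV, mult = (*), one = 1, zero = 0, add = (+),
      smult = (\<lambda>a c. augmentation A a * c)\<rparr>"

definition graded_module ::
  "('k, 'a, 'x) graded_algebra_scheme \<Rightarrow> ('a, 'm) module \<Rightarrow> (int \<Rightarrow> 'm set) \<Rightarrow> bool" where
  "graded_module A M gr \<longleftrightarrow> left_module A M \<and>
     (\<forall>j. subgroup (gr j) (add_monoid M)) \<and>
     (\<forall>m\<in>carrier M. \<exists>!f. homog_decomp M gr m f) \<and>
     (\<forall>i j. \<forall>a\<in>deg A i. \<forall>m\<in>gr j. a \<odot>\<^bsub>M\<^esub> m \<in> gr (i + j))"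

definition generated_by :: "('a, 'x) ring_scheme \<Rightarrow> ('a, 'm) module \<Rightarrow> 'm set \<Rightarrow> bool" where
  "generated_by A M S \<longleftrightarrow>
     S \<subseteq> carrier M \<and> (\<forall>N. submodule N A M \<and> S \<subseteq> N \<longrightarrow> N = carrier M)"

text \<open>
  The type argument is the type of elements of the terms of the resolution.  A theorem assuming
  \<open>koszul TYPE('p) A\<close> for a free type variable \<^typ>\<open>'p\<close> covers resolutions over every type.
\<close>

definition koszul :: "'p itself \<Rightarrow> ('k::field, 'a, 'x) graded_algebra_scheme \<Rightarrow> bool" where
  "koszul _ A \<longleftrightarrow>
     (\<exists>(P :: nat \<Rightarrow> ('a, 'p) module) d e gr.
        proj_resolution A (trivial_module A) P d e \<and>
        (\<forall>n. graded_module A (P n) (gr n)) \<and>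
        (\<forall>n j. d n ` gr (Suc n) j \<subseteq> gr n j) \<and>
        (\<forall>j. e ` gr 0 j \<subseteq> (if j = 0 then UNIV else {0})) \<and>
        (\<forall>n. generated_by A (P n) (gr n (int n))))"

section \<open>The Yoneda algebra\<close>

text \<open>
  Throughout, \<open>P, d, e\<close> is a projective resolution of the trivial module over \<open>B\<close>.  Maps are only
  relevant on the carriers of their domains; a class in \<open>Ext\<^sup>n\<close> is the set of all cocycles, as
  functions on the whole type, that represent it.
\<close>

definition cocycles ::
  "('k::field, 'b, 'x) graded_algebra_scheme \<Rightarrow> (nat \<Rightarrow> ('b, 'p) module) \<Rightarrow> (nat \<Rightarrow> 'p \<Rightarrow> 'p) \<Rightarrow>
     nat \<Rightarrow> ('p \<Rightarrow> 'k) set" where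
  "cocycles B P d n = {f \<in> module_hom B (P n) (trivial_module B).
     \<forall>x\<in>carrier (P (Suc n)). f (d n x) = 0}"

fun coboundaries ::
  "('k::field, 'b, 'x) graded_algebra_scheme \<Rightarrow> (nat \<Rightarrow> ('b, 'p) module) \<Rightarrow> (nat \<Rightarrow> 'p \<Rightarrow> 'p) \<Rightarrow>
     nat \<Rightarrow> ('p \<Rightarrow> 'k) set" where
  "coboundaries B P d 0 = {f. \<forall>x\<in>carrier (P 0). f x = 0}"
| "coboundaries B P d (Suc n) =
     {f. \<exists>h\<in>module_hom B (P n) (trivial_module B). \<forall>x\<in>carrier (P (Suc n)). f x = h (d n x)}"

definition ext_class ::
  "('k::field, 'b, 'x) graded_algebra_scheme \<Rightarrow> (nat \<Rightarrow> ('b, 'p) module) \<Rightarrow> (nat \<Rightarrow> 'p \<Rightarrow> 'p) \<Rightarrow>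
     nat \<Rightarrow> ('p \<Rightarrow> 'k) \<Rightarrow> ('p \<Rightarrow> 'k) set" where
  "ext_class B P d n f = {f' \<in> cocycles B P d n. (\<lambda>x. f' x - f x) \<in> coboundaries B P d n}"

definition Ext ::
  "('k::field, 'b, 'x) graded_algebra_scheme \<Rightarrow> (nat \<Rightarrow> ('b, 'p) module) \<Rightarrow> (nat \<Rightarrow> 'p \<Rightarrow> 'p) \<Rightarrow>
     nat \<Rightarrow> ('k, ('p \<Rightarrow> 'k) set) module" where
  "Ext B P d n =
     \<lparr>carrier = ext_class B P d n ` cocycles B P d n, mult = undefined, one = undefined,
      zero = ext_class B P d n (\<lambda>x. 0),
      add = (\<lambda>X Y. \<Union>f\<in>X. \<Union>g\<in>Y. ext_class B P d n (\<lambda>x. f x + g x)),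
      smult = (\<lambda>c X. \<Union>f\<in>X. ext_class B P d n (\<lambda>x. c * f x))\<rparr>"

text \<open>Families \<open>g j : P (n + j) \<rightarrow> P j\<close> lifting \<open>a : P n \<rightarrow> \<k>\<close>.\<close>

definition lifts ::
  "('b, 'x) ring_scheme \<Rightarrow> (nat \<Rightarrow> ('b, 'p) module) \<Rightarrow> (nat \<Rightarrow> 'p \<Rightarrow> 'p) \<Rightarrow> ('p \<Rightarrow> 'k) \<Rightarrow>
     nat \<Rightarrow> ('p \<Rightarrow> 'k) \<Rightarrow> (nat \<Rightarrow> 'p \<Rightarrow> 'p) set" where
  "lifts B P d e n a = {g.
     (\<forall>j. g j \<in> module_hom B (P (n + j)) (P j)) \<and>
     (\<forall>x\<in>carrier (P n). e (g 0 x) = a x) \<and>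
     (\<forall>j. \<forall>x\<in>carrier (P (n + Suc j)). d j (g (Suc j) x) = g j (d (n + j) x))}"

text \<open>
  The product of \<open>X\<close> in \<open>Ext\<^sup>k\<close> and \<open>Y\<close> in \<open>Ext\<^sup>n\<close>.  The class of \<open>a' \<circ> g k\<close> does not depend on the
  choices, so the union is over copies of one and the same class.
\<close>

definition yoneda_prod ::
  "('k::field, 'b, 'x) graded_algebra_scheme \<Rightarrow> (nat \<Rightarrow> ('b, 'p) module) \<Rightarrow> (nat \<Rightarrow> 'p \<Rightarrow> 'p) \<Rightarrow>
     ('p \<Rightarrow> 'k) \<Rightarrow> nat \<Rightarrow> nat \<Rightarrow> ('p \<Rightarrow> 'k) set \<Rightarrow> ('p \<Rightarrow> 'k) set \<Rightarrow> ('p \<Rightarrow> 'k) set" where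
  "yoneda_prod B P d e k n X Y =
     (\<Union>a'\<in>X. \<Union>a\<in>Y. \<Union>g\<in>lifts B P d e n a. ext_class B P d (n + k) (a' \<circ> g k))"

text \<open>The direct sum of all \<open>Ext\<^sup>i\<close>, graded by \<open>i\<close>; the unit is the class of \<open>e\<close> in \<open>Ext\<^sup>0\<close>.\<close>

definition yoneda_algebra ::
  "('k::field, 'b, 'x) graded_algebra_scheme \<Rightarrow> (nat \<Rightarrow> ('b, 'p) module) \<Rightarrow> (nat \<Rightarrow> 'p \<Rightarrow> 'p) \<Rightarrow>
     ('p \<Rightarrow> 'k) \<Rightarrow> ('k, nat \<Rightarrow> ('p \<Rightarrow> 'k) set) graded_algebra" where
  "yoneda_algebra B P d e =
     (let E = Ext B P d;
          C = {x. (\<forall>n. x n \<in> carrier (E n)) \<and> finite {n. x n \<noteq> \<zero>\<^bsub>E n\<^esub>}} in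
     \<lparr>carrier = C,
      mult = (\<lambda>x y n. \<Oplus>\<^bsub>E n\<^esub>i\<in>{..n}. yoneda_prod B P d e i (n - i) (x i) (y (n - i))),
      one = (\<lambda>n. if n = 0 then ext_class B P d 0 e else \<zero>\<^bsub>E n\<^esub>),
      zero = (\<lambda>n. \<zero>\<^bsub>E n\<^esub>),
      add = (\<lambda>x y n. x n \<oplus>\<^bsub>E n\<^esub> y n),
      smult = (\<lambda>c x n. c \<odot>\<^bsub>E n\<^esub> x n),
      deg = (\<lambda>j. {x \<in> C. \<forall>n. int n \<noteq> j \<longrightarrow> x n = \<zero>\<^bsub>E n\<^esub>})\<rparr>)"

section \<open>Bimodules and trivial extensions\<close>

record ('e, 'm) graded_bimodule = "('e, 'm) module" +
  ract :: "'m \<Rightarrow> 'e \<Rightarrow> 'm"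
  bdeg :: "int \<Rightarrow> 'm set"

definition regular_bimodule :: "('k, 'e, 'x) graded_algebra_scheme \<Rightarrow> ('e, 'e) graded_bimodule" where
  "regular_bimodule E =
     \<lparr>carrier = carrier E, mult = mult E, one = one E, zero = zero E, add = add E,
      smult = mult E, ract = mult E, bdeg = deg E\<rparr>"

definition twist ::
  "('e \<Rightarrow> 'e) \<Rightarrow> ('e, 'm) graded_bimodule \<Rightarrow> ('e \<Rightarrow> 'e) \<Rightarrow> ('e, 'm) graded_bimodule" where
  "twist \<mu> M \<psi> =
     M\<lparr>smult := (\<lambda>a m. \<mu> a \<odot>\<^bsub>M\<^esub> m), ract := (\<lambda>m b. ract M m (\<psi> b))\<rparr>"

definition shift :: "('e, 'm) graded_bimodule \<Rightarrow> int \<Rightarrow> ('e, 'm) graded_bimodule" where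
  "shift M n = M\<lparr>bdeg := (\<lambda>k. bdeg M (n + k))\<rparr>"

text \<open>Scalars of the base field act on \<open>M\<close> through the left action of \<open>E\<close>.\<close>

definition trivial_extension ::
  "('k, 'e, 'x) graded_algebra_scheme \<Rightarrow> ('e, 'm) graded_bimodule \<Rightarrow>
     ('k, 'e \<times> 'm) graded_algebra" where
  "trivial_extension E M =
     \<lparr>carrier = carrier E \<times> carrier M,
      mult = (\<lambda>(x1, m1) (x2, m2). (x1 \<otimes>\<^bsub>E\<^esub> x2, (x1 \<odot>\<^bsub>M\<^esub> m2) \<oplus>\<^bsub>M\<^esub> ract M m1 x2)),
      one = (\<one>\<^bsub>E\<^esub>, \<zero>\<^bsub>M\<^esub>),
      zero = (\<zero>\<^bsub>E\<^esub>, \<zero>\<^bsub>M\<^esub>),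
      add = (\<lambda>(x1, m1) (x2, m2). (x1 \<oplus>\<^bsub>E\<^esub> x2, m1 \<oplus>\<^bsub>M\<^esub> m2)),
      smult = (\<lambda>c (x, m). (c \<odot>\<^bsub>E\<^esub> x, (c \<odot>\<^bsub>E\<^esub> \<one>\<^bsub>E\<^esub>) \<odot>\<^bsub>M\<^esub> m)),
      deg = (\<lambda>j. deg E j \<times> bdeg M j)\<rparr>"

definition sign_aut :: "('k, 'e, 'x) graded_algebra_scheme \<Rightarrow> 'e \<Rightarrow> 'e" where
  "sign_aut E x = (\<Oplus>\<^bsub>E\<^esub>j\<in>{j. homog_part E x j \<noteq> \<zero>\<^bsub>E\<^esub>}.
     if even j then homog_part E x j else \<ominus>\<^bsub>E\<^esub> homog_part E x j)"

end

theory Submission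
  imports Defs
begin

text \<open>
  Let \<open>W n\<close> be the subspace of \<open>V\<^sup>\<otimes>\<^sup>n\<close> annihilated by the ideal \<open>(R\<^sup>\<bottom>)\<close>, so that \<open>W n\<close> is dual to
  \<open>A\<^sup>!\<close> in degree \<open>n\<close>.  Koszulity of \<open>A\<close> means that the complex \<open>A \<otimes> W n\<close> resolves \<open>\<k>\<close>.  The mapping cone
  of right multiplication by \<open>z\<close>, twisted by \<open>\<sigma>\<^sup>-\<^sup>1\<close>, on \<open>B \<otimes> W n\<close> is then a resolution
  \<open>Q n = (B \<otimes> W n) \<oplus> (B \<otimes> W (n - 1))\<close> of \<open>\<k>\<close> over \<open>B\<close>.  It is minimal, so a class in \<open>Ext\<^sup>n\<close> is the same
  thing as a pair of functionals on \<open>W n\<close> and \<open>W (n - 1)\<close>, that is, a homogeneous element of \<open>\<Gamma>\<close>.  Such a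
  pair lifts explicitly to a chain map by contracting suffixes of words; composing with this lift
  gives precisely the product of \<open>\<Gamma>\<close>, the twist by \<open>\<epsilon>\<close> coming from the sign in the differential of the
  cone and the twist by \<open>\<psi>\<close> from the passage of \<open>z\<close> across \<open>W n\<close>.
\<close>

section \<open>Subspaces of finitely supported functions\<close>

text \<open>The resolution over \<open>B\<close> and the one witnessing Koszulity are arbitrary,
  with elements of unknown types, so nothing can be read off them directly. The proof works in
  coordinates: once a basis of \<open>V\<close> is fixed, tensors and functionals on tensors are
  both functions on words in the basis, paired by \<open>dp\<close>, and a tensor product
  \<open>C \<otimes> W\<close> is a space of \<open>C\<close>-valued functions cut out by the linear
  equations of \<open>W\<close>. Two obstacles shape the rest. Koszulity only says that some
  resolution is generated in the right degrees; a graded Nakayama argument identifies it, degree by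
  degree, with the explicit complex and transports exactness. And the Yoneda product is defined on
  the given resolution; comparison maps carry it to the minimal one, which requires lifting
  properties across different element types. The product formula comes out because the differential
  consumes the first letter of a word while a cochain consumes a suffix: in
  \<open>a' \<circ> g k\<close> the prefix is read by \<open>a'\<close> and the suffix by
  \<open>a\<close>, which is concatenation in the quadratic dual.\<close>

definition dp :: "'x set \<Rightarrow> ('x \<Rightarrow> 'k::field) \<Rightarrow> ('x \<Rightarrow> 'k) \<Rightarrow> 'k" where
  "dp X c w = (\<Sum>x\<in>X. c x * w x)"

text \<open>The support condition identifies such a \<open>W\<close> with a subspace of the
  finite-dimensional space of functions on \<open>X\<close>; finiteness of \<open>X\<close> is
  included so that all pairings are genuine sums.\<close>

definition fsub :: "'x set \<Rightarrow> ('x \<Rightarrow> 'k::field) set \<Rightarrow> bool" where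
  "fsub X W \<longleftrightarrow> finite X \<and> (\<lambda>_. 0) \<in> W \<and> (\<forall>v\<in>W. \<forall>w\<in>W. (\<lambda>x. v x + w x) \<in> W) \<and>
     (\<forall>c. \<forall>w\<in>W. (\<lambda>x. c * w x) \<in> W) \<and> (\<forall>w\<in>W. \<forall>x. x \<notin> X \<longrightarrow> w x = 0)"

lemma vector_space_fun: "vector_space (\<lambda>(c::'k::field) (f::'x \<Rightarrow> 'k) x. c * f x)"
  by unfold_locales (auto simp: fun_eq_iff algebra_simps)

lemma fsub_finite: "fsub X W \<Longrightarrow> finite X"
  and fsub_zero: "fsub X W \<Longrightarrow> (\<lambda>_. 0) \<in> W"
  and fsub_add: "fsub X W \<Longrightarrow> v \<in> W \<Longrightarrow> w \<in> W \<Longrightarrow> (\<lambda>x. v x + w x) \<in> W"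
  and fsub_scale: "fsub X W \<Longrightarrow> w \<in> W \<Longrightarrow> (\<lambda>x. c * w x) \<in> W"
  and fsub_outside: "fsub X W \<Longrightarrow> w \<in> W \<Longrightarrow> x \<notin> X \<Longrightarrow> w x = 0"
  by (auto simp: fsub_def)

lemma fsub_sum:
  assumes "fsub X W" "\<And>i. i \<in> I \<Longrightarrow> w i \<in> W"
  shows "(\<lambda>x. \<Sum>i\<in>I. c i * w i x) \<in> W"
  using assms(2)
proof (induction I rule: infinite_finite_induct)
  case (insert i I)
  have "(\<lambda>x. c i * w i x + (\<Sum>i\<in>I. c i * w i x)) \<in> W"
    by (intro fsub_add[OF assms(1)] fsub_scale[OF assms(1)] insert) auto
  then show ?case using insert by simp
qed (auto intro: fsub_zero[OF assms(1)])

text \<open>A linear projection onto \<open>W\<close> sends the indicator function of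
  \<open>y\<close> to \<open>p y\<close>; expanding \<open>w\<close> in indicators and projecting
  gives the formula. The \<open>p y\<close> span \<open>W\<close> with coefficients that are just
  values of \<open>w\<close>, which replaces the choice of a basis of \<open>W\<close> from here
  on.\<close>

lemma fsub_reproducing:
  fixes W :: "('x \<Rightarrow> 'k::field) set"
  assumes "fsub X W"
  shows "\<exists>p. (\<forall>y. p y \<in> W) \<and> (\<forall>w\<in>W. \<forall>x. w x = (\<Sum>y\<in>X. w y * p y x))"
proof -
  let ?s = "\<lambda>(c::'k) (f::'x \<Rightarrow> 'k) x. c * f x"
  interpret vector_space ?s by (rule vector_space_fun)
  interpret vector_space_pair ?s ?s by unfold_locales
  have "subspace W"
    using assms by (auto simp: subspace_def fsub_def plus_fun_def zero_fun_def)
  then obtain g where g: "Vector_Spaces.linear ?s ?s g" "range g \<subseteq> W" "\<forall>v\<in>W. g (id v) = v"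
    using linear_exists_left_inverse_on[of id W] module_hom_id linear_id by auto
  interpret g: Vector_Spaces.linear ?s ?s g by (rule g)
  let ?\<delta> = "\<lambda>y x. if x = y then 1 else (0::'k)"
  have fun_sum: "sum (\<lambda>y. f y) Y x = (\<Sum>y\<in>Y. f y x)" for f :: "'x \<Rightarrow> 'x \<Rightarrow> 'k" and Y x
    by (induction Y rule: infinite_finite_induct) auto
  have "w x = (\<Sum>y\<in>X. w y * g (?\<delta> y) x)" if w: "w \<in> W" for w x
  proof -
    have "w = (\<Sum>y\<in>X. ?s (w y) (?\<delta> y))"
    proof
      fix x
      have "(\<Sum>y\<in>X. ?s (w y) (?\<delta> y)) x = (\<Sum>y\<in>X. if x = y then w y else 0)"
        by (subst fun_sum) (auto intro!: sum.cong)
      then show "w x = (\<Sum>y\<in>X. ?s (w y) (?\<delta> y)) x"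
        using fsub_finite[OF assms] fsub_outside[OF assms w, of x] by simp
    qed
    then have "g w = g (\<Sum>y\<in>X. ?s (w y) (?\<delta> y))"
      by (rule arg_cong)
    also have "\<dots> = (\<Sum>y\<in>X. ?s (w y) (g (?\<delta> y)))"
      by (simp only: g.sum g.scale)
    finally have "w = (\<Sum>y\<in>X. ?s (w y) (g (?\<delta> y)))"
      using g(3) w by simp
    from fun_cong[OF this, of x] show ?thesis
      by (simp only: fun_sum)
  qed
  then show ?thesis using g(2) by (intro exI[of _ "\<lambda>y. g (?\<delta> y)"]) auto
qed

definition reproducing :: "'x set \<Rightarrow> ('x \<Rightarrow> 'k::field) set \<Rightarrow> 'x \<Rightarrow> 'x \<Rightarrow> 'k" where
  "reproducing X W = (SOME p. (\<forall>y. p y \<in> W) \<and> (\<forall>w\<in>W. \<forall>x. w x = (\<Sum>y\<in>X. w y * p y x)))"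

lemma
  assumes "fsub X W"
  shows reproducing_in: "reproducing X W y \<in> W"
    and reproducing: "w \<in> W \<Longrightarrow> w x = (\<Sum>y\<in>X. w y * reproducing X W y x)"
  using someI_ex[OF fsub_reproducing[OF assms]] unfolding reproducing_def by auto

text \<open>For each \<open>x\<close> in \<open>X\<close> the vector with entries
  \<open>\<delta> - p y x\<close> is orthogonal to \<open>J\<close> by the reproducing formula,
  hence orthogonal to \<open>c\<close>; so \<open>c\<close> obeys the same formula and is a
  combination of the \<open>p y\<close>. This is biduality for finite-dimensional spaces.\<close>

lemma double_perp:
  assumes "fsub X J" "\<And>x. x \<notin> X \<Longrightarrow> c x = 0"
    and "\<And>w. \<lbrakk>\<And>x. x \<notin> X \<Longrightarrow> w x = 0; \<And>r. r \<in> J \<Longrightarrow> dp X r w = 0\<rbrakk> \<Longrightarrow> dp X c w = 0"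
  shows "c \<in> J"
proof -
  let ?p = "reproducing X J"
  have fin: "finite X" using assms(1) by (rule fsub_finite)
  have dx: "dp X r (\<lambda>y. if y \<in> X then (if y = x then 1 else 0) - ?p y x else 0)
      = r x - (\<Sum>y\<in>X. r y * ?p y x)" if "x \<in> X" for r x
  proof -
    have "dp X r (\<lambda>y. if y \<in> X then (if y = x then 1 else 0) - ?p y x else 0)
        = (\<Sum>y\<in>X. (if y = x then r y else 0) - r y * ?p y x)"
      by (auto simp: dp_def algebra_simps intro!: sum.cong)
    then show ?thesis using fin that by (simp add: sum_subtractf)
  qed
  have "c x = (\<Sum>y\<in>X. c y * ?p y x)" for x
  proof (cases "x \<in> X")
    case True
    have "dp X c (\<lambda>y. if y \<in> X then (if y = x then 1 else 0) - ?p y x else 0) = 0"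
    proof (rule assms(3))
      fix r assume "r \<in> J"
      then show "dp X r (\<lambda>y. if y \<in> X then (if y = x then 1 else 0) - ?p y x else 0) = 0"
        using reproducing[OF assms(1), of r x] dx[OF True, of r] by simp
    qed auto
    then show ?thesis using dx[OF True, of c] by simp
  next
    case False
    then show ?thesis
      using assms(2) fsub_outside[OF assms(1) reproducing_in[OF assms(1)]] by simp
  qed
  then have "c = (\<lambda>x. \<Sum>y\<in>X. c y * ?p y x)" by (rule ext)
  also have "\<dots> \<in> J" by (intro fsub_sum[OF assms(1)] reproducing_in[OF assms(1)])
  finally show ?thesis .
qed

section \<open>Finite sums in abelian groups\<close>

text \<open>Meant for maps that are additive only on carriers, such as evaluation at a point or
  one-sided multiplication. Sums over infinite index sets are zero by convention, so that case
  reduces to \<open>f\<close> preserving zero.\<close>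

lemma finsum_additive:
  assumes "abelian_group M" "abelian_group N" "\<And>i. i \<in> I \<Longrightarrow> g i \<in> carrier M"
    and "f \<in> carrier M \<rightarrow> carrier N"
    and "\<And>x y. \<lbrakk>x \<in> carrier M; y \<in> carrier M\<rbrakk> \<Longrightarrow> f (x \<oplus>\<^bsub>M\<^esub> y) = f x \<oplus>\<^bsub>N\<^esub> f y"
  shows "f (\<Oplus>\<^bsub>M\<^esub>i\<in>I. g i) = (\<Oplus>\<^bsub>N\<^esub>i\<in>I. f (g i))"
proof -
  interpret M: abelian_group M by fact
  interpret N: abelian_group N by fact
  have f0: "f \<zero>\<^bsub>M\<^esub> = \<zero>\<^bsub>N\<^esub>"
    using assms(4) assms(5)[of "\<zero>\<^bsub>M\<^esub>" "\<zero>\<^bsub>M\<^esub>"]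
    by (metis M.l_zero M.zero_closed N.add.r_cancel_one' Pi_mem)
  show ?thesis
    using assms(3)
  proof (induction I rule: infinite_finite_induct)
    case (insert i I)
    have "f (\<Oplus>\<^bsub>M\<^esub>i\<in>insert i I. g i) = f (g i \<oplus>\<^bsub>M\<^esub> (\<Oplus>\<^bsub>M\<^esub>i\<in>I. g i))"
      using insert by (subst M.finsum_insert) auto
    also have "\<dots> = f (g i) \<oplus>\<^bsub>N\<^esub> (\<Oplus>\<^bsub>N\<^esub>i\<in>I. f (g i))"
      using insert assms(5) M.finsum_closed by (auto simp: Pi_iff)
    also have "\<dots> = (\<Oplus>\<^bsub>N\<^esub>i\<in>insert i I. f (g i))"
      using insert assms(4) by (subst N.finsum_insert) auto
    finally show ?case .
  qed (auto simp: f0)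
qed

context abelian_group
begin

lemma finsum_swap:
  assumes "finite X" "finite Y" "\<And>x y. x \<in> X \<Longrightarrow> y \<in> Y \<Longrightarrow> h x y \<in> carrier G"
  shows "(\<Oplus>x\<in>X. \<Oplus>y\<in>Y. h x y) = (\<Oplus>y\<in>Y. \<Oplus>x\<in>X. h x y)"
  using assms(1,3)
proof (induction X rule: finite_induct)
  case empty then show ?case by simp
next
  case (insert x X)
  have "(\<Oplus>x\<in>insert x X. \<Oplus>y\<in>Y. h x y) = (\<Oplus>y\<in>Y. h x y) \<oplus> (\<Oplus>y\<in>Y. \<Oplus>x\<in>X. h x y)"
    using insert by (subst finsum_insert) (auto intro!: finsum_closed)
  also have "\<dots> = (\<Oplus>y\<in>Y. h x y \<oplus> (\<Oplus>x\<in>X. h x y))"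
    using insert by (subst finsum_addf) (auto intro!: finsum_closed)
  also have "\<dots> = (\<Oplus>y\<in>Y. \<Oplus>x\<in>insert x X. h x y)"
    using insert by (intro finsum_cong') (auto intro!: finsum_closed)
  finally show ?case .
qed

lemma finsum_zeroI: "(\<And>x. x \<in> X \<Longrightarrow> f x = \<zero>) \<Longrightarrow> (\<Oplus>x\<in>X. f x) = \<zero>"
  by (rule add.finprod_one_eqI)

lemma finsum_delta:
  assumes "finite X" "a \<in> X" "f a \<in> carrier G" "\<And>x. x \<in> X \<Longrightarrow> x \<noteq> a \<Longrightarrow> f x = \<zero>"
  shows "(\<Oplus>x\<in>X. f x) = f a"
proof -
  have "(\<Oplus>x\<in>X. f x) = (\<Oplus>x\<in>X. if a = x then f x else \<zero>)"
    using assms by (intro finsum_cong') auto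
  also have "\<dots> = f a"
    using add.finprod_singleton[of a X f] assms
    by (smt (verit) Pi_I add.finprod_cong' add.one_closed)
  finally show ?thesis .
qed

lemma finsum_superset:
  assumes "finite Y" "X \<subseteq> Y" "\<And>x. x \<in> X \<Longrightarrow> f x \<in> carrier G" "\<And>x. x \<in> Y - X \<Longrightarrow> f x = \<zero>"
  shows "(\<Oplus>x\<in>X. f x) = (\<Oplus>x\<in>Y. f x)"
  using assms by (intro add.finprod_mono_neutral_cong_left) (auto, metis DiffI zero_closed)

lemma finsum_neg: "(\<And>x. x \<in> X \<Longrightarrow> f x \<in> carrier G) \<Longrightarrow> (\<Oplus>x\<in>X. \<ominus> f x) = \<ominus> (\<Oplus>x\<in>X. f x)"
  by (rule finsum_additive[symmetric, where M = G and N = G and f = "\<lambda>x. \<ominus> x"])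
    (auto intro: abelian_group_axioms minus_add)

lemma finsum_cong2: "(\<And>x. x \<in> X \<Longrightarrow> f x = g x) \<Longrightarrow> (\<And>x. x \<in> X \<Longrightarrow> g x \<in> carrier G) \<Longrightarrow>
  (\<Oplus>x\<in>X. f x) = (\<Oplus>x\<in>X. g x)"
  by (rule finsum_cong') auto

end

section \<open>Modules over noncommutative rings\<close>

context left_module
begin

lemma mod_ag: "abelian_group M" by unfold_locales
lemma smult_zero_right [simp]: "a \<in> carrier A \<Longrightarrow> a \<odot>\<^bsub>M\<^esub> \<zero>\<^bsub>M\<^esub> = \<zero>\<^bsub>M\<^esub>"
  by (metis M.add.r_cancel_one' M.l_zero M.zero_closed smult_closed smult_r_distr)

lemma smult_zero_left [simp]: "x \<in> carrier M \<Longrightarrow> \<zero> \<odot>\<^bsub>M\<^esub> x = \<zero>\<^bsub>M\<^esub>"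
  by (metis M.add.r_cancel_one' A.l_zero A.zero_closed smult_closed smult_l_distr)

lemma smult_neg_left: "a \<in> carrier A \<Longrightarrow> x \<in> carrier M \<Longrightarrow> (\<ominus> a) \<odot>\<^bsub>M\<^esub> x = \<ominus>\<^bsub>M\<^esub> (a \<odot>\<^bsub>M\<^esub> x)"
  by (metis A.a_inv_closed A.l_neg M.add.inv_equality smult_closed smult_l_distr smult_zero_left)

lemma smult_neg_right: "a \<in> carrier A \<Longrightarrow> x \<in> carrier M \<Longrightarrow> a \<odot>\<^bsub>M\<^esub> (\<ominus>\<^bsub>M\<^esub> x) = \<ominus>\<^bsub>M\<^esub> (a \<odot>\<^bsub>M\<^esub> x)"
  by (metis M.a_inv_closed M.l_neg M.add.inv_equality smult_closed smult_r_distr smult_zero_right)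

lemma smult_finsum_right:
  assumes "\<And>i. i \<in> I \<Longrightarrow> f i \<in> carrier M" "a \<in> carrier A"
  shows "a \<odot>\<^bsub>M\<^esub> (\<Oplus>\<^bsub>M\<^esub>i\<in>I. f i) = (\<Oplus>\<^bsub>M\<^esub>i\<in>I. a \<odot>\<^bsub>M\<^esub> f i)"
  by (rule finsum_additive[where f = "\<lambda>x. a \<odot>\<^bsub>M\<^esub> x"])
    (use assms in \<open>auto intro: smult_closed smult_r_distr M.abelian_group_axioms A.abelian_group_axioms\<close>)

end

lemma module_homI:
  assumes "\<And>x. x \<in> carrier M \<Longrightarrow> f x \<in> carrier N"
    and "\<And>x y. \<lbrakk>x \<in> carrier M; y \<in> carrier M\<rbrakk> \<Longrightarrow> f (x \<oplus>\<^bsub>M\<^esub> y) = f x \<oplus>\<^bsub>N\<^esub> f y"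
    and "\<And>a x. \<lbrakk>a \<in> carrier A; x \<in> carrier M\<rbrakk> \<Longrightarrow> f (a \<odot>\<^bsub>M\<^esub> x) = a \<odot>\<^bsub>N\<^esub> f x"
  shows "f \<in> module_hom A M N"
  using assms by (auto simp: module_hom_def)

lemma
  assumes "f \<in> module_hom A M N"
  shows module_hom_closed: "x \<in> carrier M \<Longrightarrow> f x \<in> carrier N"
    and module_hom_add: "\<lbrakk>x \<in> carrier M; y \<in> carrier M\<rbrakk> \<Longrightarrow> f (x \<oplus>\<^bsub>M\<^esub> y) = f x \<oplus>\<^bsub>N\<^esub> f y"
    and module_hom_smult: "\<lbrakk>a \<in> carrier A; x \<in> carrier M\<rbrakk> \<Longrightarrow> f (a \<odot>\<^bsub>M\<^esub> x) = a \<odot>\<^bsub>N\<^esub> f x"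
  using assms by (auto simp: module_hom_def)

lemma module_hom_zero:
  assumes "f \<in> module_hom A M N" "left_module A M" "left_module A N"
  shows "f \<zero>\<^bsub>M\<^esub> = \<zero>\<^bsub>N\<^esub>"
proof -
  interpret M: left_module A M by fact
  interpret N: left_module A N by fact
  show ?thesis
    using module_hom_smult[OF assms(1), of "\<zero>\<^bsub>A\<^esub>" "\<zero>\<^bsub>M\<^esub>"] module_hom_closed[OF assms(1), of "\<zero>\<^bsub>M\<^esub>"] by simp
qed

lemma module_hom_neg:
  assumes "f \<in> module_hom A M N" "left_module A M" "left_module A N" "x \<in> carrier M"
  shows "f (\<ominus>\<^bsub>M\<^esub> x) = \<ominus>\<^bsub>N\<^esub> f x"
proof -
  interpret M: left_module A M by fact
  interpret N: left_module A N by fact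
  have "f (\<ominus>\<^bsub>M\<^esub> x) \<oplus>\<^bsub>N\<^esub> f x = \<zero>\<^bsub>N\<^esub>"
    using module_hom_add[OF assms(1), of "\<ominus>\<^bsub>M\<^esub> x" x] module_hom_zero[OF assms(1-3)] assms(4)
    by (simp add: M.M.l_neg)
  then show ?thesis
    using module_hom_closed[OF assms(1)] assms(4) by (simp add: N.M.minus_equality)
qed

lemma module_hom_finsum:
  assumes "f \<in> module_hom A M N" "left_module A M" "left_module A N" "\<And>i. i \<in> I \<Longrightarrow> g i \<in> carrier M"
  shows "f (\<Oplus>\<^bsub>M\<^esub>i\<in>I. g i) = (\<Oplus>\<^bsub>N\<^esub>i\<in>I. f (g i))"
  by (rule finsum_additive)
    (use assms in \<open>auto intro: left_module.mod_ag module_hom_closed module_hom_add\<close>)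

lemma module_hom_comp:
  assumes "f \<in> module_hom A M N" "g \<in> module_hom A N L"
  shows "(\<lambda>x. g (f x)) \<in> module_hom A M L"
  using assms by (auto simp: module_hom_def Pi_iff)

lemma module_hom_plus:
  assumes "f \<in> module_hom A M N" "g \<in> module_hom A M N" "left_module A N"
  shows "(\<lambda>x. f x \<oplus>\<^bsub>N\<^esub> g x) \<in> module_hom A M N"
proof -
  interpret N: left_module A N by fact
  show ?thesis
    by (rule module_homI)
      (use assms in \<open>auto simp: module_hom_closed module_hom_add module_hom_smult N.smult_r_distr
         intro!: N.M.add.m_lcomm N.M.add.m_comm simp: N.M.a_ac\<close>)
qed

lemma module_hom_uminus:
  assumes "g \<in> module_hom A M N" "left_module A N"
  shows "(\<lambda>x. \<ominus>\<^bsub>N\<^esub> g x) \<in> module_hom A M N"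
proof -
  interpret N: left_module A N by fact
  show ?thesis
    by (rule module_homI)
      (use assms in \<open>auto simp: module_hom_closed module_hom_add module_hom_smult N.smult_neg_right
         N.M.minus_add\<close>)
qed

lemma module_hom_minus:
  assumes "f \<in> module_hom A M N" "g \<in> module_hom A M N" "left_module A N"
  shows "(\<lambda>x. f x \<ominus>\<^bsub>N\<^esub> g x) \<in> module_hom A M N"
  unfolding a_minus_def by (intro module_hom_plus module_hom_uminus assms)

lemma module_hom_0:
  assumes "left_module A N"
  shows "(\<lambda>x. \<zero>\<^bsub>N\<^esub>) \<in> module_hom A M N"
proof -
  interpret N: left_module A N by fact
  show ?thesis by (rule module_homI) auto
qed

lemma module_hom_id: "(\<lambda>x. x) \<in> module_hom A M M"
  by (rule module_homI) auto

section \<open>Algebras and tensor products with finite-dimensional spaces\<close>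

locale kalg = C?: ring C for C :: "('k::field, 'a, 'z) graded_algebra_scheme" (structure) +
  assumes ksm_closed [simp, intro]: "x \<in> carrier C \<Longrightarrow> c \<odot> x \<in> carrier C"
    and ksm_ladd: "x \<in> carrier C \<Longrightarrow> (c + c') \<odot> x = c \<odot> x \<oplus> c' \<odot> x"
    and ksm_radd: "x \<in> carrier C \<Longrightarrow> y \<in> carrier C \<Longrightarrow> c \<odot> (x \<oplus> y) = c \<odot> x \<oplus> c \<odot> y"
    and ksm_assoc: "x \<in> carrier C \<Longrightarrow> (c * c') \<odot> x = c \<odot> (c' \<odot> x)"
    and ksm_one [simp]: "x \<in> carrier C \<Longrightarrow> 1 \<odot> x = x"
    and ksm_multl: "x \<in> carrier C \<Longrightarrow> y \<in> carrier C \<Longrightarrow> (c \<odot> x) \<otimes> y = c \<odot> (x \<otimes> y)"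
    and ksm_multr: "x \<in> carrier C \<Longrightarrow> y \<in> carrier C \<Longrightarrow> x \<otimes> (c \<odot> y) = c \<odot> (x \<otimes> y)"
begin

lemma ksm_zero_left [simp]: "x \<in> carrier C \<Longrightarrow> 0 \<odot> x = \<zero>"
  using ksm_ladd[of x 0 0] ksm_closed[of x 0] by simp

lemma ksm_zero_right [simp]: "c \<odot> \<zero> = \<zero>"
  using ksm_multr[of \<zero> \<zero> c] by simp

lemma ksm_neg: "x \<in> carrier C \<Longrightarrow> (- c) \<odot> x = \<ominus> (c \<odot> x)"
  using ksm_ladd[of x "- c" c] by (intro C.minus_equality[symmetric]) auto

lemma ksm_minus_one: "x \<in> carrier C \<Longrightarrow> (- 1) \<odot> x = \<ominus> x"
  by (simp add: ksm_neg)

lemma ksm_neg_right: "x \<in> carrier C \<Longrightarrow> c \<odot> (\<ominus> x) = \<ominus> (c \<odot> x)"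
  using ksm_radd[of "\<ominus> x" x c] by (intro C.minus_equality[symmetric]) (auto simp: C.l_neg)

lemma ksm_sum: "x \<in> carrier C \<Longrightarrow> (\<Sum>i\<in>I. c i) \<odot> x = (\<Oplus>i\<in>I. c i \<odot> x)"
  by (induction I rule: infinite_finite_induct) (auto simp: ksm_ladd)

lemma ksm_finsum: "(\<And>i. i \<in> I \<Longrightarrow> f i \<in> carrier C) \<Longrightarrow> c \<odot> (\<Oplus>i\<in>I. f i) = (\<Oplus>i\<in>I. c \<odot> f i)"
  by (rule finsum_additive) (auto simp: ksm_radd C.abelian_group_axioms)

lemma finsum_rmult: "(\<And>i. i \<in> I \<Longrightarrow> f i \<in> carrier C) \<Longrightarrow> a \<in> carrier C \<Longrightarrow>
    (\<Oplus>i\<in>I. f i) \<otimes> a = (\<Oplus>i\<in>I. f i \<otimes> a)"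
  by (rule finsum_additive[where f = "\<lambda>x. x \<otimes> a"]) (auto simp: C.l_distr C.abelian_group_axioms)

lemma finsum_lmult: "(\<And>i. i \<in> I \<Longrightarrow> f i \<in> carrier C) \<Longrightarrow> a \<in> carrier C \<Longrightarrow>
    a \<otimes> (\<Oplus>i\<in>I. f i) = (\<Oplus>i\<in>I. a \<otimes> f i)"
  by (rule finsum_additive[where f = "\<lambda>x. a \<otimes> x"]) (auto simp: C.r_distr C.abelian_group_axioms)

lemma lin_comb_swap:
  assumes "finite X" "finite Y" "\<And>y. y \<in> Y \<Longrightarrow> f y \<in> carrier C"
  shows "(\<Oplus>x\<in>X. \<rho> x \<odot> (\<Oplus>y\<in>Y. \<Lambda> x y \<odot> f y)) = (\<Oplus>y\<in>Y. (\<Sum>x\<in>X. \<rho> x * \<Lambda> x y) \<odot> f y)"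
proof -
  have "(\<Oplus>x\<in>X. \<rho> x \<odot> (\<Oplus>y\<in>Y. \<Lambda> x y \<odot> f y)) = (\<Oplus>x\<in>X. \<Oplus>y\<in>Y. (\<rho> x * \<Lambda> x y) \<odot> f y)"
    using assms by (intro finsum_cong2) (auto simp: ksm_finsum ksm_assoc intro!: finsum_cong2 finsum_closed)
  also have "\<dots> = (\<Oplus>y\<in>Y. \<Oplus>x\<in>X. (\<rho> x * \<Lambda> x y) \<odot> f y)"
    using assms by (intro finsum_swap) auto
  also have "\<dots> = (\<Oplus>y\<in>Y. (\<Sum>x\<in>X. \<rho> x * \<Lambda> x y) \<odot> f y)"
    using assms by (intro finsum_cong2) (auto simp: ksm_sum)
  finally show ?thesis .
qed

end

lemma (in abelian_group) minus_eq_zeroD: "x \<oplus> \<ominus> y = \<zero> \<Longrightarrow> x \<in> carrier G \<Longrightarrow> y \<in> carrier G \<Longrightarrow> x = y"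
  using minus_equality[of x "\<ominus> y"] by simp

text \<open>
  \<open>C \<otimes> W\<close> for a space \<open>W\<close> of functions on a finite set \<open>X\<close>: the functions \<open>X \<rightarrow> C\<close> that satisfy all linear
  equations valid on \<open>W\<close>.
\<close>

definition tens :: "('k::field, 'a, 'z) graded_algebra_scheme \<Rightarrow> 'x set \<Rightarrow> ('x \<Rightarrow> 'k) set \<Rightarrow>
    ('a, 'x \<Rightarrow> 'a) module" where
  "tens C X W = \<lparr>carrier = {f. (\<forall>x\<in>X. f x \<in> carrier C) \<and> (\<forall>x. x \<notin> X \<longrightarrow> f x = \<zero>\<^bsub>C\<^esub>) \<and>
       (\<forall>\<rho>. (\<forall>w\<in>W. dp X \<rho> w = 0) \<longrightarrow> (\<Oplus>\<^bsub>C\<^esub>x\<in>X. \<rho> x \<odot>\<^bsub>C\<^esub> f x) = \<zero>\<^bsub>C\<^esub>)},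
     mult = undefined, one = undefined, zero = (\<lambda>x. \<zero>\<^bsub>C\<^esub>), add = (\<lambda>f g x. f x \<oplus>\<^bsub>C\<^esub> g x),
     smult = (\<lambda>a f x. a \<otimes>\<^bsub>C\<^esub> f x)\<rparr>"

lemma tens_simps [simp]:
  "\<zero>\<^bsub>tens C X W\<^esub> = (\<lambda>x. \<zero>\<^bsub>C\<^esub>)"
  "f \<oplus>\<^bsub>tens C X W\<^esub> g = (\<lambda>x. f x \<oplus>\<^bsub>C\<^esub> g x)"
  "a \<odot>\<^bsub>tens C X W\<^esub> f = (\<lambda>x. a \<otimes>\<^bsub>C\<^esub> f x)"
  by (simp_all add: tens_def)

text \<open>The element \<open>1 \<otimes> w\<close> of \<open>C \<otimes> W\<close>.\<close>

definition kvec :: "('k, 'a, 'z) graded_algebra_scheme \<Rightarrow> ('x \<Rightarrow> 'k) \<Rightarrow> 'x \<Rightarrow> 'a" where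
  "kvec C w = (\<lambda>x. w x \<odot>\<^bsub>C\<^esub> \<one>\<^bsub>C\<^esub>)"

locale ktensor = kalg C for C :: "('k::field, 'a, 'z) graded_algebra_scheme" (structure) +
  fixes X :: "'x set" and W :: "('x \<Rightarrow> 'k) set"
  assumes fsub: "fsub X W"
begin

abbreviation T where "T \<equiv> tens C X W"
abbreviation p where "p \<equiv> reproducing X W"

lemma finX [simp]: "finite X" using fsub by (rule fsub_finite)
lemmas p_in = reproducing_in[OF fsub]
lemmas p_eq = reproducing[OF fsub]

lemma T_iff: "f \<in> carrier T \<longleftrightarrow> (\<forall>x\<in>X. f x \<in> carrier C) \<and> (\<forall>x. x \<notin> X \<longrightarrow> f x = \<zero>) \<and>
       (\<forall>\<rho>. (\<forall>w\<in>W. dp X \<rho> w = 0) \<longrightarrow> (\<Oplus>x\<in>X. \<rho> x \<odot> f x) = \<zero>)"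
  by (simp add: tens_def)

lemma T_closed [simp]: "f \<in> carrier T \<Longrightarrow> f x \<in> carrier C"
  unfolding T_iff by (cases "x \<in> X") auto

lemma T_outside: "f \<in> carrier T \<Longrightarrow> x \<notin> X \<Longrightarrow> f x = \<zero>"
  unfolding T_iff by auto

lemma T_perp: "f \<in> carrier T \<Longrightarrow> (\<And>w. w \<in> W \<Longrightarrow> dp X \<rho> w = 0) \<Longrightarrow> (\<Oplus>x\<in>X. \<rho> x \<odot> f x) = \<zero>"
  unfolding T_iff by blast

lemma TI: "(\<And>x. x \<in> X \<Longrightarrow> f x \<in> carrier C) \<Longrightarrow> (\<And>x. x \<notin> X \<Longrightarrow> f x = \<zero>) \<Longrightarrow>
    (\<And>\<rho>. (\<And>w. w \<in> W \<Longrightarrow> dp X \<rho> w = 0) \<Longrightarrow> (\<Oplus>x\<in>X. \<rho> x \<odot> f x) = \<zero>) \<Longrightarrow> f \<in> carrier T"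
  unfolding T_iff by blast

lemma T_sum:
  assumes "\<And>i. i \<in> I \<Longrightarrow> f i \<in> carrier T"
  shows "(\<lambda>x. \<Oplus>i\<in>I. f i x) \<in> carrier T"
proof (rule TI)
  fix \<rho> assume \<rho>: "\<And>w. w \<in> W \<Longrightarrow> dp X \<rho> w = 0"
  show "(\<Oplus>x\<in>X. \<rho> x \<odot> (\<Oplus>i\<in>I. f i x)) = \<zero>"
  proof (cases "finite I")
    case True
    have "(\<Oplus>x\<in>X. \<rho> x \<odot> (\<Oplus>i\<in>I. f i x)) = (\<Oplus>x\<in>X. \<Oplus>i\<in>I. \<rho> x \<odot> f i x)"
      using assms by (intro finsum_cong2) (auto simp: ksm_finsum intro!: finsum_closed)
    also have "\<dots> = (\<Oplus>i\<in>I. \<Oplus>x\<in>X. \<rho> x \<odot> f i x)"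
      using assms True by (intro finsum_swap) auto
    also have "\<dots> = \<zero>"
      using assms \<rho> by (intro finsum_zeroI T_perp) auto
    finally show ?thesis .
  qed simp
qed (use assms in \<open>auto intro!: finsum_closed finsum_zeroI simp: T_outside\<close>)

lemma T_zero: "(\<lambda>x. \<zero>) \<in> carrier T"
  using T_sum[of "{}"] by simp

lemma T_add: "f \<in> carrier T \<Longrightarrow> g \<in> carrier T \<Longrightarrow> (\<lambda>x. f x \<oplus> g x) \<in> carrier T"
  by (rule TI) (auto simp: T_outside ksm_radd T_perp finsum_addf)

text \<open>This is \<open>\<phi> \<otimes> id\<close>: a linear map of coefficients commutes with
  the equations that cut out the tensor product. One-sided multiplications, homogeneous components
  and twists by powers of \<open>\<sigma>\<close> all enter through it.\<close>

lemma T_additive: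
  assumes "f \<in> carrier T" "\<And>x. x \<in> carrier C \<Longrightarrow> \<phi> x \<in> carrier C"
    "\<And>x y. x \<in> carrier C \<Longrightarrow> y \<in> carrier C \<Longrightarrow> \<phi> (x \<oplus> y) = \<phi> x \<oplus> \<phi> y"
    "\<And>c x. x \<in> carrier C \<Longrightarrow> \<phi> (c \<odot> x) = c \<odot> \<phi> x"
  shows "(\<lambda>x. \<phi> (f x)) \<in> carrier T"
proof (rule TI)
  have \<phi>0: "\<phi> \<zero> = \<zero>" using assms(4)[of \<zero> 0] assms(2)[of \<zero>] by simp
  then show "\<And>x. x \<notin> X \<Longrightarrow> \<phi> (f x) = \<zero>" using assms T_outside by simp
  fix \<rho> assume \<rho>: "\<And>w. w \<in> W \<Longrightarrow> dp X \<rho> w = 0"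
  have "(\<Oplus>x\<in>X. \<rho> x \<odot> \<phi> (f x)) = (\<Oplus>x\<in>X. \<phi> (\<rho> x \<odot> f x))"
    using assms by simp
  also have "\<dots> = \<phi> (\<Oplus>x\<in>X. \<rho> x \<odot> f x)"
    by (rule finsum_additive[symmetric]) (use assms in \<open>auto simp: C.abelian_group_axioms\<close>)
  also have "\<dots> = \<zero>" using T_perp[OF assms(1) \<rho>] \<phi>0 by simp
  finally show "(\<Oplus>x\<in>X. \<rho> x \<odot> \<phi> (f x)) = \<zero>" .
qed (use assms in auto)

lemma T_lmult: "f \<in> carrier T \<Longrightarrow> a \<in> carrier C \<Longrightarrow> (\<lambda>x. a \<otimes> f x) \<in> carrier T"
  by (rule T_additive[where \<phi> = "\<lambda>x. a \<otimes> x"]) (auto simp: r_distr ksm_multr)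

lemma T_rmult: "f \<in> carrier T \<Longrightarrow> a \<in> carrier C \<Longrightarrow> (\<lambda>x. f x \<otimes> a) \<in> carrier T"
  by (rule T_additive[where \<phi> = "\<lambda>x. x \<otimes> a"]) (auto simp: l_distr ksm_multl)

lemma T_scale: "f \<in> carrier T \<Longrightarrow> (\<lambda>x. c \<odot> f x) \<in> carrier T"
  by (rule T_additive[where \<phi> = "\<lambda>x. c \<odot> x"]) (auto simp: ksm_radd ksm_assoc[symmetric] mult.commute)

lemma T_uminus: "f \<in> carrier T \<Longrightarrow> (\<lambda>x. \<ominus> f x) \<in> carrier T"
  by (rule T_additive[where \<phi> = "\<lambda>x. \<ominus> x"]) (auto simp: minus_add ksm_neg_right)

lemma T_left_module: "left_module C T"
proof -
  have "abelian_group T"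
    by (rule abelian_groupI)
      (auto simp: T_zero T_add a_ac fun_eq_iff intro!: bexI[OF _ T_uminus] l_neg r_neg)
  then show ?thesis
    unfolding left_module_def left_module_axioms_def
    by (auto simp: C.ring_axioms T_lmult l_distr r_distr m_assoc fun_eq_iff)
qed

lemma finsum_T: "(\<And>i. i \<in> I \<Longrightarrow> f i \<in> carrier T) \<Longrightarrow> (\<Oplus>\<^bsub>T\<^esub>i\<in>I. f i) = (\<lambda>x. \<Oplus>i\<in>I. f i x)"
proof
  fix x
  assume f: "\<And>i. i \<in> I \<Longrightarrow> f i \<in> carrier T"
  show "(\<Oplus>\<^bsub>T\<^esub>i\<in>I. f i) x = (\<Oplus>i\<in>I. f i x)"
    by (rule finsum_additive[where f = "\<lambda>f. f x"])
      (use f in \<open>auto intro: left_module.mod_ag[OF T_left_module] C.abelian_group_axioms\<close>)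
qed

text \<open>The reproducing formula of \<open>W\<close> says that the coefficients
  \<open>p y x - \<delta>\<close> vanish on \<open>W\<close>, so it is one of the equations imposed
  on \<open>f\<close>. This is what shows that the solution space is no larger than
  \<open>C \<otimes> W\<close>.\<close>

lemma T_repr: "f \<in> carrier T \<Longrightarrow> f x = (\<Oplus>y\<in>X. p y x \<odot> f y)"
proof (cases "x \<in> X")
  case True
  assume f: "f \<in> carrier T"
  have m1: "(\<Oplus>y\<in>X. (p y x - (if y = x then 1 else 0)) \<odot> f y) = \<zero>"
  proof (rule T_perp[OF f])
    fix w assume w: "w \<in> W"
    have "dp X (\<lambda>y. p y x - (if y = x then 1 else 0)) w = (\<Sum>y\<in>X. w y * p y x - (if y = x then w y else 0))"
      unfolding dp_def by (intro sum.cong) (auto simp: algebra_simps)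
    also have "\<dots> = (\<Sum>y\<in>X. w y * p y x) - w x"
      using True by (simp add: sum_subtractf)
    finally show "dp X (\<lambda>y. p y x - (if y = x then 1 else 0)) w = 0"
      using p_eq[OF w, of x] by simp
  qed
  have m2: "(\<Oplus>y\<in>X. (p y x - (if y = x then 1 else 0)) \<odot> f y) =
     (\<Oplus>y\<in>X. p y x \<odot> f y) \<oplus> (\<Oplus>y\<in>X. (if y = x then \<ominus> f x else \<zero>))"
    using f by (subst finsum_addf[symmetric])
      (auto intro!: finsum_cong2 simp: ksm_ladd ksm_minus_one simp flip: add_uminus_conv_diff)
  have m3: "(\<Oplus>y\<in>X. (if y = x then \<ominus> f x else \<zero>)) = \<ominus> f x"
    using finsum_delta[of X x "\<lambda>y. if y = x then \<ominus> f x else \<zero>"] True f by simp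
  have m4: "(\<Oplus>y\<in>X. p y x \<odot> f y) \<in> carrier C" using f by (auto intro!: finsum_closed)
  have "(\<Oplus>y\<in>X. p y x \<odot> f y) \<oplus> \<ominus> f x = \<zero>"
    using m1 unfolding m2 m3 .
  from minus_eq_zeroD[OF this m4 T_closed[OF f]] show ?thesis by (rule sym)
next
  case False
  assume f: "f \<in> carrier T"
  then show ?thesis
    using finsum_zeroI[of X "\<lambda>y. p y x \<odot> f y"] T_outside[OF f False] fsub_outside[OF fsub p_in False] by simp
qed

lemma kvec_in: "w \<in> W \<Longrightarrow> kvec C w \<in> carrier T"
proof (rule TI)
  fix \<rho> assume w: "w \<in> W" and \<rho>: "\<And>w. w \<in> W \<Longrightarrow> dp X \<rho> w = 0"
  have "(\<Oplus>x\<in>X. \<rho> x \<odot> kvec C w x) = (\<Sum>x\<in>X. \<rho> x * w x) \<odot> \<one>"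
    by (simp add: kvec_def ksm_sum ksm_assoc)
  then show "(\<Oplus>x\<in>X. \<rho> x \<odot> kvec C w x) = \<zero>" using \<rho>[OF w] by (simp add: dp_def)
qed (auto simp: kvec_def fsub_outside[OF fsub])

text \<open>The elements \<open>1 \<otimes> p y\<close> generate, with the values of
  \<open>f\<close> as coefficients. They may be dependent, but this is enough to determine
  homomorphisms and to prove projectivity.\<close>

lemma T_expand: "f \<in> carrier T \<Longrightarrow> f = (\<Oplus>\<^bsub>T\<^esub>y\<in>X. f y \<odot>\<^bsub>T\<^esub> kvec C (p y))"
proof
  fix x assume f: "f \<in> carrier T"
  have "(\<Oplus>\<^bsub>T\<^esub>y\<in>X. f y \<odot>\<^bsub>T\<^esub> kvec C (p y)) x = (\<Oplus>y\<in>X. f y \<otimes> kvec C (p y) x)"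
    using f by (subst finsum_T) (auto intro!: T_lmult kvec_in p_in)
  also have "\<dots> = (\<Oplus>y\<in>X. p y x \<odot> f y)"
    using f by (intro finsum_cong2) (auto simp: kvec_def ksm_multr)
  finally show "f x = (\<Oplus>\<^bsub>T\<^esub>y\<in>X. f y \<odot>\<^bsub>T\<^esub> kvec C (p y)) x"
    using T_repr[OF f, of x] by simp
qed

lemma hom_expand:
  assumes "\<phi> \<in> module_hom C T N" "left_module C N" "f \<in> carrier T"
  shows "\<phi> f = (\<Oplus>\<^bsub>N\<^esub>y\<in>X. f y \<odot>\<^bsub>N\<^esub> \<phi> (kvec C (p y)))"
proof -
  interpret N: left_module C N by fact
  have "\<phi> f = \<phi> (\<Oplus>\<^bsub>T\<^esub>y\<in>X. f y \<odot>\<^bsub>T\<^esub> kvec C (p y))"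
    using T_expand[OF assms(3)] by (rule arg_cong)
  also have "\<dots> = (\<Oplus>\<^bsub>N\<^esub>y\<in>X. \<phi> (f y \<odot>\<^bsub>T\<^esub> kvec C (p y)))"
    using assms by (intro module_hom_finsum[OF assms(1) T_left_module assms(2)])
      (auto intro!: T_lmult kvec_in p_in)
  also have "\<dots> = (\<Oplus>\<^bsub>N\<^esub>y\<in>X. f y \<odot>\<^bsub>N\<^esub> \<phi> (kvec C (p y)))"
    using assms by (intro N.M.finsum_cong2)
      (auto intro!: N.smult_closed module_hom_closed[OF assms(1)] kvec_in p_in
        module_hom_smult[OF assms(1)] simp del: tens_simps)
  finally show ?thesis .
qed

text \<open>Restriction to \<open>C \<otimes> W\<close> of the map on the free module over
  \<open>X\<close> that sends the basis vector \<open>y\<close> to \<open>t y\<close>.\<close>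

lemma hom_from:
  assumes "left_module C N" "\<And>y. y \<in> X \<Longrightarrow> t y \<in> carrier N"
  shows "(\<lambda>f. \<Oplus>\<^bsub>N\<^esub>y\<in>X. f y \<odot>\<^bsub>N\<^esub> t y) \<in> module_hom C T N"
proof -
  interpret N: left_module C N by fact
  show ?thesis
  proof (rule module_homI)
    fix f g assume fg: "f \<in> carrier T" "g \<in> carrier T"
    show "(\<Oplus>\<^bsub>N\<^esub>y\<in>X. (f \<oplus>\<^bsub>T\<^esub> g) y \<odot>\<^bsub>N\<^esub> t y) =
      (\<Oplus>\<^bsub>N\<^esub>y\<in>X. f y \<odot>\<^bsub>N\<^esub> t y) \<oplus>\<^bsub>N\<^esub> (\<Oplus>\<^bsub>N\<^esub>y\<in>X. g y \<odot>\<^bsub>N\<^esub> t y)"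
      using fg assms(2) by (subst N.M.finsum_addf[symmetric])
        (auto intro!: N.M.finsum_cong2 N.smult_closed simp: N.smult_l_distr)
  next
    fix a f assume "f \<in> carrier T" "a \<in> carrier C"
    then show "(\<Oplus>\<^bsub>N\<^esub>y\<in>X. (a \<odot>\<^bsub>T\<^esub> f) y \<odot>\<^bsub>N\<^esub> t y) = a \<odot>\<^bsub>N\<^esub> (\<Oplus>\<^bsub>N\<^esub>y\<in>X. f y \<odot>\<^bsub>N\<^esub> t y)"
      using assms(2) by (subst N.smult_finsum_right)
        (auto intro!: N.M.finsum_cong2 N.smult_closed simp: N.smult_assoc)
  qed (use assms(2) in \<open>auto intro!: N.M.finsum_closed N.smult_closed\<close>)
qed

lemma hom_eqI:
  assumes "\<phi> \<in> module_hom C T N" "\<psi> \<in> module_hom C T N" "left_module C N" "f \<in> carrier T"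
    "\<And>w. w \<in> W \<Longrightarrow> \<phi> (kvec C w) = \<psi> (kvec C w)"
  shows "\<phi> f = \<psi> f"
  using hom_expand[OF assms(1,3,4)] hom_expand[OF assms(2,3,4)] assms(5)[OF p_in] by simp

text \<open>\<open>T_expand\<close> and \<open>hom_from\<close> exhibit \<open>C \<otimes> W\<close>
  as a direct summand of the free module on \<open>X\<close>: lifts are chosen for the images of the
  generators \<open>1 \<otimes> p y\<close> and extended. The modules \<open>N\<close> and
  \<open>N'\<close> may have any element types, and \<open>g\<close> need only cover the image of
  \<open>\<phi>\<close>.\<close>

lemma T_lift:
  assumes "left_module C N" "left_module C N'" "g \<in> module_hom C N N'" "\<phi> \<in> module_hom C T N'"
    "\<phi> ` carrier T \<subseteq> g ` carrier N"
  shows "\<exists>h\<in>module_hom C T N. \<forall>x\<in>carrier T. g (h x) = \<phi> x"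
proof -
  interpret N: left_module C N by fact
  interpret N': left_module C N' by fact
  have "\<forall>y. \<exists>t\<in>carrier N. g t = \<phi> (kvec C (p y))"
  proof
    fix y
    have "\<phi> (kvec C (p y)) \<in> g ` carrier N"
      using assms(5) kvec_in[OF p_in[of y]] by blast
    then show "\<exists>t\<in>carrier N. g t = \<phi> (kvec C (p y))" by (auto simp del: tens_simps)
  qed
  then obtain t where t: "\<And>y. t y \<in> carrier N" "\<And>y. g (t y) = \<phi> (kvec C (p y))" by metis
  show ?thesis
  proof (intro bexI ballI)
    show hom: "(\<lambda>f. \<Oplus>\<^bsub>N\<^esub>y\<in>X. f y \<odot>\<^bsub>N\<^esub> t y) \<in> module_hom C T N"
      by (rule hom_from) (use assms t in auto)
    fix f assume f: "f \<in> carrier T"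
    have "g (\<Oplus>\<^bsub>N\<^esub>y\<in>X. f y \<odot>\<^bsub>N\<^esub> t y) = (\<Oplus>\<^bsub>N'\<^esub>y\<in>X. g (f y \<odot>\<^bsub>N\<^esub> t y))"
      using f t by (intro module_hom_finsum[OF assms(3,1,2)]) (auto intro!: N.smult_closed)
    also have "\<dots> = \<phi> f"
      using f t by (subst hom_expand[OF assms(4,2) f])
        (auto intro!: N'.M.finsum_cong2 N'.smult_closed module_hom_closed[OF assms(4)] kvec_in p_in
          simp: module_hom_smult[OF assms(3)])
    finally show "g (\<Oplus>\<^bsub>N\<^esub>y\<in>X. f y \<odot>\<^bsub>N\<^esub> t y) = \<phi> f" .
  qed
qed

text \<open>A functional on \<open>W\<close> has many coefficient functions on \<open>X\<close>; its
  action on \<open>C \<otimes> W\<close> depends only on the functional.\<close>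

lemma T_cong_perp:
  assumes "f \<in> carrier T" "\<And>w. w \<in> W \<Longrightarrow> dp X \<alpha> w = dp X \<beta> w"
  shows "(\<Oplus>x\<in>X. \<alpha> x \<odot> f x) = (\<Oplus>x\<in>X. \<beta> x \<odot> f x)"
proof -
  have m1: "(\<Oplus>x\<in>X. (\<alpha> x + - \<beta> x) \<odot> f x) = \<zero>"
    using assms(2) by (intro T_perp[OF assms(1)])
      (auto simp: dp_def algebra_simps sum_subtractf)
  have m2: "(\<Oplus>x\<in>X. (\<alpha> x + - \<beta> x) \<odot> f x) = (\<Oplus>x\<in>X. \<alpha> x \<odot> f x) \<oplus> (\<Oplus>x\<in>X. \<ominus> (\<beta> x \<odot> f x))"
    using assms(1) by (subst finsum_addf[symmetric]) (simp_all add: ksm_ladd ksm_neg del: add_uminus_conv_diff)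
  have m3: "(\<Oplus>x\<in>X. \<ominus> (\<beta> x \<odot> f x)) = \<ominus> (\<Oplus>x\<in>X. \<beta> x \<odot> f x)"
    using assms(1) by (intro finsum_neg) auto
  have m4: "(\<Oplus>x\<in>X. \<alpha> x \<odot> f x) \<in> carrier C" "(\<Oplus>x\<in>X. \<beta> x \<odot> f x) \<in> carrier C"
    using assms(1) by (auto intro!: finsum_closed)
  show ?thesis
    using m1 unfolding m2 m3 by (rule minus_eq_zeroD[OF _ m4])
qed

end

lemma (in kalg) ktensor: "fsub X W \<Longrightarrow> ktensor C X W"
  by (simp add: ktensor_def ktensor_axioms_def kalg_axioms)

text \<open>This is the map \<open>id \<otimes> \<Lambda>\<close>. An equation valid on
  \<open>V\<close> pulls back along the transpose of \<open>\<Lambda>\<close> to one valid on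
  \<open>W\<close>.\<close>

lemma (in kalg) tens_matrix:
  assumes "ktensor C X W" "ktensor C Y V" "f \<in> carrier (tens C X W)"
    and \<Lambda>: "\<And>w. w \<in> W \<Longrightarrow> (\<lambda>y. \<Sum>x\<in>X. \<Lambda> y x * w x) \<in> V" "\<And>y x. y \<notin> Y \<Longrightarrow> \<Lambda> y x = 0"
  shows "(\<lambda>y. \<Oplus>x\<in>X. \<Lambda> y x \<odot> f x) \<in> carrier (tens C Y V)"
proof -
  interpret X: ktensor C X W by fact
  interpret Y: ktensor C Y V by fact
  show ?thesis
  proof (rule Y.TI)
    fix \<rho> assume \<rho>: "\<And>w. w \<in> V \<Longrightarrow> dp Y \<rho> w = 0"
    have "(\<Oplus>y\<in>Y. \<rho> y \<odot> (\<Oplus>x\<in>X. \<Lambda> y x \<odot> f x)) = (\<Oplus>x\<in>X. (\<Sum>y\<in>Y. \<rho> y * \<Lambda> y x) \<odot> f x)"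
      using assms by (intro lin_comb_swap) auto
    also have "\<dots> = \<zero>"
    proof (rule X.T_perp[OF assms(3)])
      fix w assume "w \<in> W"
      have "dp X (\<lambda>x. \<Sum>y\<in>Y. \<rho> y * \<Lambda> y x) w = (\<Sum>x\<in>X. \<Sum>y\<in>Y. \<rho> y * \<Lambda> y x * w x)"
        by (simp add: dp_def sum_distrib_right)
      also have "\<dots> = (\<Sum>y\<in>Y. \<Sum>x\<in>X. \<rho> y * \<Lambda> y x * w x)" by (rule sum.swap)
      also have "\<dots> = dp Y \<rho> (\<lambda>y. \<Sum>x\<in>X. \<Lambda> y x * w x)"
        by (simp add: dp_def sum_distrib_left mult.assoc)
      also have "\<dots> = 0" using \<open>w \<in> W\<close> by (intro \<rho> \<Lambda>)
      finally show "dp X (\<lambda>x. \<Sum>y\<in>Y. \<rho> y * \<Lambda> y x) w = 0" .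
    qed
    finally show "(\<Oplus>y\<in>Y. \<rho> y \<odot> (\<Oplus>x\<in>X. \<Lambda> y x \<odot> f x)) = \<zero>" .
  qed (use assms(3) \<Lambda>(2) in \<open>auto intro!: finsum_closed finsum_zeroI\<close>)
qed

lemma (in kalg) tens_restrict:
  assumes "ktensor C X W" "ktensor C Y V" "f \<in> carrier (tens C X W)" "j ` Y \<subseteq> X"
    and V: "\<And>w. w \<in> W \<Longrightarrow> (\<lambda>y. if y \<in> Y then w (j y) else 0) \<in> V"
  shows "(\<lambda>y. if y \<in> Y then f (j y) else \<zero>) \<in> carrier (tens C Y V)"
proof -
  interpret X: ktensor C X W by fact
  interpret Y: ktensor C Y V by fact
  let ?\<Lambda> = "\<lambda>y x. if y \<in> Y \<and> x = j y then 1 else (0::'k)"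
  have "(\<lambda>y. \<Oplus>x\<in>X. ?\<Lambda> y x \<odot> f x) \<in> carrier (tens C Y V)"
  proof (rule tens_matrix[OF assms(1-3)])
    fix w assume "w \<in> W"
    have "(\<lambda>y. \<Sum>x\<in>X. ?\<Lambda> y x * w x) = (\<lambda>y. if y \<in> Y then w (j y) else 0)"
    proof
      fix y
      have "(\<Sum>x\<in>X. ?\<Lambda> y x * w x) = (\<Sum>x\<in>X. if x = j y then (if y \<in> Y then w x else 0) else 0)"
        by (intro sum.cong) auto
      then show "(\<Sum>x\<in>X. ?\<Lambda> y x * w x) = (if y \<in> Y then w (j y) else 0)"
        using assms(4) by auto
    qed
    then show "(\<lambda>y. \<Sum>x\<in>X. ?\<Lambda> y x * w x) \<in> V" using V[OF \<open>w \<in> W\<close>] by simp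
  qed auto
  moreover have "(\<lambda>y. \<Oplus>x\<in>X. ?\<Lambda> y x \<odot> f x) = (\<lambda>y. if y \<in> Y then f (j y) else \<zero>)"
  proof
    fix y
    show "(\<Oplus>x\<in>X. ?\<Lambda> y x \<odot> f x) = (if y \<in> Y then f (j y) else \<zero>)"
    proof (cases "y \<in> Y")
      case True
      then show ?thesis
        using finsum_delta[of X "j y" "\<lambda>x. ?\<Lambda> y x \<odot> f x"] assms(3,4) by auto
    qed (use assms(3) in \<open>auto intro!: finsum_zeroI\<close>)
  qed
  ultimately show ?thesis by simp
qed

section \<open>Projective modules and comparison of resolutions\<close>

definition free_module :: "('a, 'x) ring_scheme \<Rightarrow> 'm set \<Rightarrow> ('a, 'm \<Rightarrow> 'a) module" where
  "free_module A S = \<lparr>carrier = {c. (\<forall>m\<in>S. c m \<in> carrier A) \<and> (\<forall>m. m \<notin> S \<longrightarrow> c m = \<zero>\<^bsub>A\<^esub>) \<and>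
       finite {m. c m \<noteq> \<zero>\<^bsub>A\<^esub>}},
     mult = undefined, one = undefined, zero = (\<lambda>x. \<zero>\<^bsub>A\<^esub>), add = (\<lambda>f g x. f x \<oplus>\<^bsub>A\<^esub> g x),
     smult = (\<lambda>a f x. a \<otimes>\<^bsub>A\<^esub> f x)\<rparr>"

lemma free_module_simps [simp]:
  "\<zero>\<^bsub>free_module A S\<^esub> = (\<lambda>x. \<zero>\<^bsub>A\<^esub>)"
  "f \<oplus>\<^bsub>free_module A S\<^esub> g = (\<lambda>x. f x \<oplus>\<^bsub>A\<^esub> g x)"
  "a \<odot>\<^bsub>free_module A S\<^esub> f = (\<lambda>x. a \<otimes>\<^bsub>A\<^esub> f x)"
  by (simp_all add: free_module_def)

lemma (in ring) free_module_iff: "c \<in> carrier (free_module R S) \<longleftrightarrow>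
  (\<forall>m. c m \<in> carrier R) \<and> (\<forall>m. m \<notin> S \<longrightarrow> c m = \<zero>) \<and> finite {m. c m \<noteq> \<zero>}"
  by (auto simp: free_module_def)

lemma (in ring) left_module_free: "left_module R (free_module R (S :: 'm set))"
proof -
  have fin_add: "finite {m. f m \<oplus> g m \<noteq> \<zero>}" if "finite {m. f m \<noteq> \<zero>}" "finite {m. g m \<noteq> \<zero>}" for f g :: "'m \<Rightarrow> 'a"
    by (rule finite_subset[of _ "{m. f m \<noteq> \<zero>} \<union> {m. g m \<noteq> \<zero>}"]) (use that in auto)
  have fin_smult: "finite {m. a \<otimes> g m \<noteq> \<zero>}" if "finite {m. g m \<noteq> \<zero>}" "a \<in> carrier R" for a and g :: "'m \<Rightarrow> 'a"
    by (rule finite_subset[OF _ that(1)]) (use that in auto)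
  have fin_neg: "finite {m. \<ominus> g m \<noteq> \<zero>}" if "finite {m. g m \<noteq> \<zero>}" for g :: "'m \<Rightarrow> 'a"
    by (rule finite_subset[OF _ that(1)]) (use that in auto)
  have "abelian_group (free_module R S)"
  proof (rule abelian_groupI)
    fix f assume "f \<in> carrier (free_module R S)"
    then show "\<exists>g\<in>carrier (free_module R S). g \<oplus>\<^bsub>free_module R S\<^esub> f = \<zero>\<^bsub>free_module R S\<^esub>"
      by (intro bexI[of _ "\<lambda>x. \<ominus> f x"]) (auto simp: free_module_iff fin_neg l_neg)
  qed (auto simp: free_module_iff fin_add a_ac fun_eq_iff)
  then show ?thesis
    unfolding left_module_def left_module_axioms_def
    by (auto simp: ring_axioms free_module_iff fin_smult l_distr r_distr m_assoc fun_eq_iff)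
qed

context left_module
begin

lemma free_lin_superset:
  assumes "c \<in> carrier (free_module A S)" "t \<in> S \<rightarrow> carrier M" "finite F" "{m. c m \<noteq> \<zero>} \<subseteq> F" "F \<subseteq> S"
  shows "(\<Oplus>\<^bsub>M\<^esub>m\<in>{m. c m \<noteq> \<zero>}. c m \<odot>\<^bsub>M\<^esub> t m) = (\<Oplus>\<^bsub>M\<^esub>m\<in>F. c m \<odot>\<^bsub>M\<^esub> t m)"
  using assms by (intro M.finsum_superset) (auto simp: A.free_module_iff Pi_iff intro!: smult_closed)

lemma free_lin_hom:
  assumes "t \<in> S \<rightarrow> carrier M"
  shows "(\<lambda>c. \<Oplus>\<^bsub>M\<^esub>m\<in>{m. c m \<noteq> \<zero>}. c m \<odot>\<^bsub>M\<^esub> t m) \<in> module_hom A (free_module A S) M"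
proof -
  have supp: "finite {m. c m \<noteq> \<zero>}" "{m. c m \<noteq> \<zero>} \<subseteq> S" "\<And>m. c m \<in> carrier A"
    if "c \<in> carrier (free_module A S)" for c
    using that by (auto simp: A.free_module_iff)
  have F: "left_module A (free_module A S)" by (rule A.left_module_free)
  interpret F: left_module A "free_module A S" by (rule F)
  have cl: "c m \<odot>\<^bsub>M\<^esub> t m \<in> carrier M" if "c \<in> carrier (free_module A S)" "m \<in> S" for c m
    using supp[OF that(1)] that assms by (auto intro!: smult_closed)
  show ?thesis
  proof (rule module_homI)
    fix c assume "c \<in> carrier (free_module A S)"
    then show "(\<Oplus>\<^bsub>M\<^esub>m\<in>{m. c m \<noteq> \<zero>}. c m \<odot>\<^bsub>M\<^esub> t m) \<in> carrier M"
      using supp cl by (intro M.finsum_closed) blast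
  next
    fix c c' assume c: "c \<in> carrier (free_module A S)" "c' \<in> carrier (free_module A S)"
    let ?F = "{m. c m \<noteq> \<zero>} \<union> {m. c' m \<noteq> \<zero>}"
    have cc: "c \<oplus>\<^bsub>free_module A S\<^esub> c' \<in> carrier (free_module A S)" using c by (rule F.M.a_closed)
    have F: "finite ?F" "?F \<subseteq> S" using supp c by auto
    have "(\<Oplus>\<^bsub>M\<^esub>m\<in>{m. (c \<oplus>\<^bsub>free_module A S\<^esub> c') m \<noteq> \<zero>}. (c \<oplus>\<^bsub>free_module A S\<^esub> c') m \<odot>\<^bsub>M\<^esub> t m)
        = (\<Oplus>\<^bsub>M\<^esub>m\<in>?F. (c \<oplus>\<^bsub>free_module A S\<^esub> c') m \<odot>\<^bsub>M\<^esub> t m)"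
      using F by (intro free_lin_superset[OF cc assms]) auto
    also have "\<dots> = (\<Oplus>\<^bsub>M\<^esub>m\<in>?F. c m \<odot>\<^bsub>M\<^esub> t m \<oplus>\<^bsub>M\<^esub> c' m \<odot>\<^bsub>M\<^esub> t m)"
    proof (rule M.finsum_cong2)
      fix m assume "m \<in> ?F"
      then have m: "m \<in> S" using F by blast
      show "(c \<oplus>\<^bsub>free_module A S\<^esub> c') m \<odot>\<^bsub>M\<^esub> t m = c m \<odot>\<^bsub>M\<^esub> t m \<oplus>\<^bsub>M\<^esub> c' m \<odot>\<^bsub>M\<^esub> t m"
        using supp(3)[OF c(1)] supp(3)[OF c(2)] funcset_mem[OF assms m] by (auto simp: smult_l_distr)
      show "c m \<odot>\<^bsub>M\<^esub> t m \<oplus>\<^bsub>M\<^esub> c' m \<odot>\<^bsub>M\<^esub> t m \<in> carrier M"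
        using cl[OF c(1) m] cl[OF c(2) m] by auto
    qed
    also have "\<dots> = (\<Oplus>\<^bsub>M\<^esub>m\<in>?F. c m \<odot>\<^bsub>M\<^esub> t m) \<oplus>\<^bsub>M\<^esub> (\<Oplus>\<^bsub>M\<^esub>m\<in>?F. c' m \<odot>\<^bsub>M\<^esub> t m)"
      using cl c F by (intro M.finsum_addf) blast+
    also have "(\<Oplus>\<^bsub>M\<^esub>m\<in>?F. c m \<odot>\<^bsub>M\<^esub> t m) = (\<Oplus>\<^bsub>M\<^esub>m\<in>{m. c m \<noteq> \<zero>}. c m \<odot>\<^bsub>M\<^esub> t m)"
      using F by (intro free_lin_superset[OF c(1) assms, symmetric]) auto
    also have "(\<Oplus>\<^bsub>M\<^esub>m\<in>?F. c' m \<odot>\<^bsub>M\<^esub> t m) = (\<Oplus>\<^bsub>M\<^esub>m\<in>{m. c' m \<noteq> \<zero>}. c' m \<odot>\<^bsub>M\<^esub> t m)"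
      using F by (intro free_lin_superset[OF c(2) assms, symmetric]) auto
    finally show "(\<Oplus>\<^bsub>M\<^esub>m\<in>{m. (c \<oplus>\<^bsub>free_module A S\<^esub> c') m \<noteq> \<zero>}. (c \<oplus>\<^bsub>free_module A S\<^esub> c') m \<odot>\<^bsub>M\<^esub> t m) =
      (\<Oplus>\<^bsub>M\<^esub>m\<in>{m. c m \<noteq> \<zero>}. c m \<odot>\<^bsub>M\<^esub> t m) \<oplus>\<^bsub>M\<^esub> (\<Oplus>\<^bsub>M\<^esub>m\<in>{m. c' m \<noteq> \<zero>}. c' m \<odot>\<^bsub>M\<^esub> t m)" .
  next
    fix a c assume a: "a \<in> carrier A" and c: "c \<in> carrier (free_module A S)"
    have ac: "a \<odot>\<^bsub>free_module A S\<^esub> c \<in> carrier (free_module A S)" using a c by (rule F.smult_closed)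
    have "(\<Oplus>\<^bsub>M\<^esub>m\<in>{m. (a \<odot>\<^bsub>free_module A S\<^esub> c) m \<noteq> \<zero>}. (a \<odot>\<^bsub>free_module A S\<^esub> c) m \<odot>\<^bsub>M\<^esub> t m)
        = (\<Oplus>\<^bsub>M\<^esub>m\<in>{m. c m \<noteq> \<zero>}. (a \<odot>\<^bsub>free_module A S\<^esub> c) m \<odot>\<^bsub>M\<^esub> t m)"
      using supp[OF c] a by (intro free_lin_superset[OF ac assms]) auto
    also have "\<dots> = (\<Oplus>\<^bsub>M\<^esub>m\<in>{m. c m \<noteq> \<zero>}. a \<odot>\<^bsub>M\<^esub> (c m \<odot>\<^bsub>M\<^esub> t m))"
    proof (rule M.finsum_cong2)
      fix m assume "m \<in> {m. c m \<noteq> \<zero>}"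
      then have m: "m \<in> S" using supp(2)[OF c] by blast
      show "(a \<odot>\<^bsub>free_module A S\<^esub> c) m \<odot>\<^bsub>M\<^esub> t m = a \<odot>\<^bsub>M\<^esub> (c m \<odot>\<^bsub>M\<^esub> t m)"
        using a supp(3)[OF c] funcset_mem[OF assms m] by (auto simp: smult_assoc)
      show "a \<odot>\<^bsub>M\<^esub> (c m \<odot>\<^bsub>M\<^esub> t m) \<in> carrier M" using a cl[OF c m] by (rule smult_closed)
    qed
    also have "\<dots> = a \<odot>\<^bsub>M\<^esub> (\<Oplus>\<^bsub>M\<^esub>m\<in>{m. c m \<noteq> \<zero>}. c m \<odot>\<^bsub>M\<^esub> t m)"
      using a cl[OF c] supp(2)[OF c] by (intro smult_finsum_right[symmetric]) auto
    finally show "(\<Oplus>\<^bsub>M\<^esub>m\<in>{m. (a \<odot>\<^bsub>free_module A S\<^esub> c) m \<noteq> \<zero>}. (a \<odot>\<^bsub>free_module A S\<^esub> c) m \<odot>\<^bsub>M\<^esub> t m)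
        = a \<odot>\<^bsub>M\<^esub> (\<Oplus>\<^bsub>M\<^esub>m\<in>{m. c m \<noteq> \<zero>}. c m \<odot>\<^bsub>M\<^esub> t m)" .
  qed
qed

end

text \<open>Lifting is asked for one pair of modules at a time, of arbitrary element types, and for
  maps whose image is covered by \<open>g\<close> rather than for surjective \<open>g\<close>; so
  exactness of a complex can be used without forming modules of cycles.\<close>

definition LP :: "('a, 'x) ring_scheme \<Rightarrow> ('a, 'm) module \<Rightarrow> ('a, 'n) module \<Rightarrow> ('a, 'l) module \<Rightarrow> bool" where
  "LP A M N N' \<longleftrightarrow> (\<forall>g\<in>module_hom A N N'. \<forall>f\<in>module_hom A M N'. f ` carrier M \<subseteq> g ` carrier N \<longrightarrow>
     (\<exists>h\<in>module_hom A M N. \<forall>x\<in>carrier M. g (h x) = f x))"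

lemma LPE:
  assumes "LP A M N N'" "g \<in> module_hom A N N'" "f \<in> module_hom A M N'"
    "\<And>x. x \<in> carrier M \<Longrightarrow> f x \<in> g ` carrier N"
  obtains h where "h \<in> module_hom A M N" "\<And>x. x \<in> carrier M \<Longrightarrow> g (h x) = f x"
  using assms unfolding LP_def by (metis image_subsetI)

text \<open>\<open>projective\<close> speaks only of modules on two fixed types. They suffice to
  split the canonical surjection \<open>\<pi>\<close> from the free module on
  \<open>carrier M\<close> by some \<open>s\<close>. Lifts \<open>t m\<close> of the values
  \<open>f m\<close> extend to a map \<open>h\<close> on the free module with
  \<open>g (h c) = f (\<pi> c)\<close>, and \<open>h\<close> after \<open>s\<close> is the required
  lift.\<close>

lemma projective_LP:
  assumes "projective A M" "left_module A N" "left_module A N'"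
  shows "LP A M N N'"
  unfolding LP_def
proof (intro ballI impI)
  fix g f assume g: "g \<in> module_hom A N N'" and f: "f \<in> module_hom A M N'"
    and im: "f ` carrier M \<subseteq> g ` carrier N"
  interpret M: left_module A M using assms(1) by (simp add: projective_def)
  interpret N: left_module A N by fact
  interpret N': left_module A N' by fact
  let ?F = "free_module A (carrier M)"
  interpret F: left_module A ?F by (rule M.A.left_module_free)
  define \<pi> where "\<pi> = (\<lambda>c. \<Oplus>\<^bsub>M\<^esub>m\<in>{m. c m \<noteq> \<zero>\<^bsub>A\<^esub>}. c m \<odot>\<^bsub>M\<^esub> m)"
  have \<pi>: "\<pi> \<in> module_hom A ?F M"
    unfolding \<pi>_def by (rule M.free_lin_hom[where t = "\<lambda>m. m"]) auto
  have "\<pi> ` carrier ?F = carrier M"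
  proof
    show "\<pi> ` carrier ?F \<subseteq> carrier M" using module_hom_closed[OF \<pi>] by auto
    show "carrier M \<subseteq> \<pi> ` carrier ?F"
    proof
      fix m assume m: "m \<in> carrier M"
      let ?c = "\<lambda>x. if x = m then \<one>\<^bsub>A\<^esub> else \<zero>\<^bsub>A\<^esub>"
      have c: "?c \<in> carrier ?F" using m by (auto simp: M.A.free_module_iff)
      have "\<pi> ?c = (\<Oplus>\<^bsub>M\<^esub>x\<in>{m}. ?c x \<odot>\<^bsub>M\<^esub> x)"
        unfolding \<pi>_def using m by (intro M.free_lin_superset[OF c]) auto
      also have "\<dots> = m" using M.M.finsum_delta[of "{m}" m "\<lambda>x. ?c x \<odot>\<^bsub>M\<^esub> x"] m
        by (simp add: M.smult_one M.smult_closed)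
      finally show "m \<in> \<pi> ` carrier ?F" using c by force
    qed
  qed
  then obtain s where s: "s \<in> module_hom A M ?F" "\<And>x. x \<in> carrier M \<Longrightarrow> \<pi> (s x) = x"
    using assms(1) \<pi> module_hom_id[of A M] M.left_module_axioms F.left_module_axioms
    unfolding projective_def by metis
  have "\<exists>t\<in>carrier N. g t = f m" if "m \<in> carrier M" for m
  proof -
    have "f m \<in> g ` carrier N" using im that by blast
    then show ?thesis by auto
  qed
  then obtain t where t: "\<And>m. m \<in> carrier M \<Longrightarrow> t m \<in> carrier N" "\<And>m. m \<in> carrier M \<Longrightarrow> g (t m) = f m"
    by metis
  define h where "h = (\<lambda>c. \<Oplus>\<^bsub>N\<^esub>m\<in>{m. c m \<noteq> \<zero>\<^bsub>A\<^esub>}. c m \<odot>\<^bsub>N\<^esub> t m)"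
  have h: "h \<in> module_hom A ?F N" unfolding h_def by (rule N.free_lin_hom) (use t in auto)
  have gh: "g (h c) = f (\<pi> c)" if c: "c \<in> carrier ?F" for c
  proof -
    have supp: "m \<in> carrier M" "c m \<in> carrier A" if "m \<in> {m. c m \<noteq> \<zero>\<^bsub>A\<^esub>}" for m
      using c that by (auto simp: M.A.free_module_iff)
    have "g (h c) = (\<Oplus>\<^bsub>N'\<^esub>m\<in>{m. c m \<noteq> \<zero>\<^bsub>A\<^esub>}. g (c m \<odot>\<^bsub>N\<^esub> t m))"
      unfolding h_def using supp t by (intro module_hom_finsum[OF g]) (auto intro: assms N.smult_closed)
    also have "\<dots> = (\<Oplus>\<^bsub>N'\<^esub>m\<in>{m. c m \<noteq> \<zero>\<^bsub>A\<^esub>}. f (c m \<odot>\<^bsub>M\<^esub> m))"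
    proof (rule N'.M.finsum_cong2)
      fix m assume m: "m \<in> {m. c m \<noteq> \<zero>\<^bsub>A\<^esub>}"
      show "g (c m \<odot>\<^bsub>N\<^esub> t m) = f (c m \<odot>\<^bsub>M\<^esub> m)"
        using supp[OF m] t by (simp add: module_hom_smult[OF f] module_hom_smult[OF g])
      show "f (c m \<odot>\<^bsub>M\<^esub> m) \<in> carrier N'"
        using supp[OF m] by (intro module_hom_closed[OF f] M.smult_closed)
    qed
    also have "\<dots> = f (\<pi> c)"
      unfolding \<pi>_def using supp
      by (intro module_hom_finsum[OF f, symmetric]) (auto intro: assms M.smult_closed M.left_module_axioms)
    finally show ?thesis .
  qed
  show "\<exists>h\<in>module_hom A M N. \<forall>x\<in>carrier M. g (h x) = f x"
    using module_hom_comp[OF s(1) h] gh[OF module_hom_closed[OF s(1)]] s(2) by (intro bexI) auto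
qed

text \<open>A resolution without projectivity, which is supplied separately as instances of
  \<open>LP\<close>; this treats the given resolution and an explicitly constructed one
  alike.\<close>

definition exact_res ::
  "('k::field, 'b, 'x) graded_algebra_scheme \<Rightarrow> (nat \<Rightarrow> ('b, 'p) module) \<Rightarrow> (nat \<Rightarrow> 'p \<Rightarrow> 'p) \<Rightarrow>
     ('p \<Rightarrow> 'k) \<Rightarrow> bool" where
  "exact_res B P d e \<longleftrightarrow> (\<forall>n. left_module B (P n)) \<and>
     (\<forall>n. d n \<in> module_hom B (P (Suc n)) (P n)) \<and>
     e \<in> module_hom B (P 0) (trivial_module B) \<and>
     e ` carrier (P 0) = UNIV \<and>
     d 0 ` carrier (P 1) = {x \<in> carrier (P 0). e x = 0} \<and>
     (\<forall>n. d (Suc n) ` carrier (P (Suc (Suc n))) = {x \<in> carrier (P (Suc n)). d n x = \<zero>\<^bsub>P n\<^esub>})"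

lemma proj_exact_res: "proj_resolution B (trivial_module B) P d e \<Longrightarrow> exact_res B P d e"
  by (auto simp: proj_resolution_def exact_res_def projective_def trivial_module_def)

text \<open>Unlike \<open>lifts\<close>, these are chain maps between two different resolutions.\<close>

definition clifts ::
  "('b, 'x) ring_scheme \<Rightarrow> (nat \<Rightarrow> ('b, 'p) module) \<Rightarrow> (nat \<Rightarrow> 'p \<Rightarrow> 'p) \<Rightarrow> (nat \<Rightarrow> ('b, 'q) module) \<Rightarrow>
     (nat \<Rightarrow> 'q \<Rightarrow> 'q) \<Rightarrow> ('q \<Rightarrow> 'k) \<Rightarrow> nat \<Rightarrow> ('p \<Rightarrow> 'k) \<Rightarrow> (nat \<Rightarrow> 'p \<Rightarrow> 'q) set" where
  "clifts B P d Q d' e' n a = {g.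
     (\<forall>j. g j \<in> module_hom B (P (n + j)) (Q j)) \<and>
     (\<forall>x\<in>carrier (P n). e' (g 0 x) = a x) \<and>
     (\<forall>j. \<forall>x\<in>carrier (P (n + Suc j)). d' j (g (Suc j) x) = g j (d (n + j) x))}"

lemma lifts_eq: "lifts B P d e n a = clifts B P d P d e n a"
  by (simp add: lifts_def clifts_def)

lemma trivial_simps [simp]:
  "carrier (trivial_module B) = UNIV" "\<zero>\<^bsub>trivial_module B\<^esub> = 0"
  "x \<oplus>\<^bsub>trivial_module B\<^esub> y = x + y" "a \<odot>\<^bsub>trivial_module B\<^esub> c = augmentation B a * c"
  by (simp_all add: trivial_module_def)

lemma trivial_minus [simp]: "left_module B (trivial_module B) \<Longrightarrow> \<ominus>\<^bsub>trivial_module B\<^esub> x = - x"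
proof -
  assume "left_module B (trivial_module B)"
  then interpret left_module B "trivial_module B" .
  show ?thesis by (rule M.minus_equality) auto
qed

section \<open>Cochains, chain maps and the comparison theorem\<close>

locale aug_algebra =
  fixes B :: "('k::field, 'b, 'x) graded_algebra_scheme"
  assumes triv: "left_module B (trivial_module B)"
begin

lemma exact_resD:
  assumes "exact_res B P d e"
  shows "left_module B (P n)" "d n \<in> module_hom B (P (Suc n)) (P n)"
    "e \<in> module_hom B (P 0) (trivial_module B)"
    "\<exists>x\<in>carrier (P 0). e x = c"
    "\<lbrakk>x \<in> carrier (P 0); e x = 0\<rbrakk> \<Longrightarrow> x \<in> d 0 ` carrier (P (Suc 0))"
    "\<lbrakk>x \<in> carrier (P (Suc n)); d n x = \<zero>\<^bsub>P n\<^esub>\<rbrakk> \<Longrightarrow> x \<in> d (Suc n) ` carrier (P (Suc (Suc n)))"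
    "y \<in> carrier (P (Suc 0)) \<Longrightarrow> e (d 0 y) = 0"
    "z \<in> carrier (P (Suc (Suc n))) \<Longrightarrow> d n (d (Suc n) z) = \<zero>\<^bsub>P n\<^esub>"
proof -
  have "c \<in> e ` carrier (P 0)" using assms unfolding exact_res_def by blast
  then show "\<exists>x\<in>carrier (P 0). e x = c" by auto
  assume "z \<in> carrier (P (Suc (Suc n)))"
  then have "d (Suc n) z \<in> {x \<in> carrier (P (Suc n)). d n x = \<zero>\<^bsub>P n\<^esub>}"
    using assms unfolding exact_res_def by blast
  then show "d n (d (Suc n) z) = \<zero>\<^bsub>P n\<^esub>" by simp
qed (use assms in \<open>auto simp: exact_res_def\<close>)

lemma cob_cong: "f \<in> coboundaries B P d n \<Longrightarrow> (\<And>x. x \<in> carrier (P n) \<Longrightarrow> f x = g x) \<Longrightarrow> g \<in> coboundaries B P d n"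
  by (cases n) auto

lemma cob_zero: "(\<And>x. x \<in> carrier (P n) \<Longrightarrow> f x = 0) \<Longrightarrow> f \<in> coboundaries B P d n"
  using module_hom_0[OF triv] by (cases n) (auto intro!: bexI[of _ "\<lambda>x. 0"])

lemma hom_add: "f \<in> module_hom B M (trivial_module B) \<Longrightarrow> g \<in> module_hom B M (trivial_module B) \<Longrightarrow>
  (\<lambda>x. f x + g x) \<in> module_hom B M (trivial_module B)"
  using module_hom_plus[OF _ _ triv] by simp

lemma hom_scale: "f \<in> module_hom B M (trivial_module B) \<Longrightarrow>
  (\<lambda>x. c * f x) \<in> module_hom B M (trivial_module B)"
  by (auto simp: module_hom_def algebra_simps)

lemma hom_diff: "f \<in> module_hom B M (trivial_module B) \<Longrightarrow> g \<in> module_hom B M (trivial_module B) \<Longrightarrow>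
  (\<lambda>x. f x - g x) \<in> module_hom B M (trivial_module B)"
  using hom_add[OF _ hom_scale[of g _ "-1"]] by simp

lemma cob_add: "f \<in> coboundaries B P d n \<Longrightarrow> g \<in> coboundaries B P d n \<Longrightarrow> (\<lambda>x. f x + g x) \<in> coboundaries B P d n"
  by (cases n) (auto intro!: bexI[OF _ hom_add])

lemma cob_scale: "f \<in> coboundaries B P d n \<Longrightarrow> (\<lambda>x. c * f x) \<in> coboundaries B P d n"
  by (cases n) (auto intro!: bexI[OF _ hom_scale])

lemma cob_diff: "f \<in> coboundaries B P d n \<Longrightarrow> g \<in> coboundaries B P d n \<Longrightarrow> (\<lambda>x. f x - g x) \<in> coboundaries B P d n"
  using cob_add[OF _ cob_scale[of g _ _ _ "-1"]] by simp

lemma cocycleD: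
  assumes "f \<in> cocycles B P d n"
  shows "f \<in> module_hom B (P n) (trivial_module B)" "x \<in> carrier (P (Suc n)) \<Longrightarrow> f (d n x) = 0"
  using assms by (auto simp: cocycles_def)

lemma cocycleI: "f \<in> module_hom B (P n) (trivial_module B) \<Longrightarrow>
    (\<And>x. x \<in> carrier (P (Suc n)) \<Longrightarrow> f (d n x) = 0) \<Longrightarrow> f \<in> cocycles B P d n"
  by (auto simp: cocycles_def)

lemma coc_add: "f \<in> cocycles B P d n \<Longrightarrow> g \<in> cocycles B P d n \<Longrightarrow> (\<lambda>x. f x + g x) \<in> cocycles B P d n"
  and coc_scale: "f \<in> cocycles B P d n \<Longrightarrow> (\<lambda>x. c * f x) \<in> cocycles B P d n"
  and coc_zero: "(\<lambda>x. 0) \<in> cocycles B P d n"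
  using module_hom_0[OF triv] by (auto simp: cocycles_def intro: hom_add hom_scale)

lemma cliftsD:
  assumes "g \<in> clifts B P d Q d' e' n a"
  shows "g j \<in> module_hom B (P (n + j)) (Q j)" "x \<in> carrier (P n) \<Longrightarrow> e' (g 0 x) = a x"
    "y \<in> carrier (P (n + Suc j)) \<Longrightarrow> d' j (g (Suc j) y) = g j (d (n + j) y)"
  using assms by (auto simp: clifts_def)

lemma cliftsI:
  assumes "\<And>j. g j \<in> module_hom B (P (n + j)) (Q j)" "\<And>x. x \<in> carrier (P n) \<Longrightarrow> e' (g 0 x) = a x"
    "\<And>j y. y \<in> carrier (P (n + Suc j)) \<Longrightarrow> d' j (g (Suc j) y) = g j (d (n + j) y)"
  shows "g \<in> clifts B P d Q d' e' n a"
  using assms by (auto simp: clifts_def)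

lemma coc_pull:
  assumes "g \<in> clifts B P d Q d' e' n a" "\<phi> \<in> cocycles B Q d' k" "\<And>n. d n \<in> module_hom B (P (Suc n)) (P n)"
  shows "(\<lambda>x. \<phi> (g k x)) \<in> cocycles B P d (n + k)"
proof (rule cocycleI)
  show "(\<lambda>x. \<phi> (g k x)) \<in> module_hom B (P (n + k)) (trivial_module B)"
    by (rule module_hom_comp[OF cliftsD(1)[OF assms(1)] cocycleD(1)[OF assms(2)]])
  fix x assume x: "x \<in> carrier (P (Suc (n + k)))"
  then have "g (Suc k) x \<in> carrier (Q (Suc k))"
    using module_hom_closed[OF cliftsD(1)[OF assms(1), of "Suc k"]] by simp
  then show "\<phi> (g k (d (n + k) x)) = 0"
    using cliftsD(3)[OF assms(1), of x k] cocycleD(2)[OF assms(2), of "g (Suc k) x"] x by simp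
qed

lemma cob_pull:
  assumes "g \<in> clifts B P d Q d' e' n a" "\<phi> \<in> coboundaries B Q d' k"
  shows "(\<lambda>x. \<phi> (g k x)) \<in> coboundaries B P d (n + k)"
proof (cases k)
  case 0
  then show ?thesis
    using assms(2) module_hom_closed[OF cliftsD(1)[OF assms(1), of 0]] by (intro cob_zero) auto
next
  case (Suc j)
  then obtain h where h: "h \<in> module_hom B (Q j) (trivial_module B)"
      "\<And>x. x \<in> carrier (Q (Suc j)) \<Longrightarrow> \<phi> x = h (d' j x)"
    using assms(2) by auto
  have "\<phi> (g (Suc j) x) = h (g j (d (n + j) x))" if "x \<in> carrier (P (Suc (n + j)))" for x
    using h(2) module_hom_closed[OF cliftsD(1)[OF assms(1), of "Suc j"]] that
      cliftsD(3)[OF assms(1), of x j] by simp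
  then show ?thesis
    using module_hom_comp[OF cliftsD(1)[OF assms(1), of j] h(1)] Suc by auto
qed

lemma clifts_comp:
  assumes "f \<in> clifts B P d Q d' e' n a" "g \<in> clifts B Q d' S d'' e'' m b"
  shows "(\<lambda>j x. g j (f (m + j) x)) \<in> clifts B P d S d'' e'' (n + m) (\<lambda>x. b (f m x))"
proof (rule cliftsI)
  show "(\<lambda>x. g j (f (m + j) x)) \<in> module_hom B (P (n + m + j)) (S j)" for j
    using module_hom_comp[OF cliftsD(1)[OF assms(1), of "m + j"] cliftsD(1)[OF assms(2), of j]]
    by (simp add: add.assoc)
  show "e'' (g 0 (f (m + 0) x)) = b (f m x)" if "x \<in> carrier (P (n + m))" for x
    using cliftsD(2)[OF assms(2)] module_hom_closed[OF cliftsD(1)[OF assms(1)]] that by simp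
  show "d'' j (g (Suc j) (f (m + Suc j) y)) = g j (f (m + j) (d (n + m + j) y))"
    if "y \<in> carrier (P (n + m + Suc j))" for j y
    using cliftsD(3)[OF assms(2), of "f (m + Suc j) y" j] cliftsD(3)[OF assms(1), of y "m + j"]
      module_hom_closed[OF cliftsD(1)[OF assms(1), of "m + Suc j"], of y] that
    by (simp add: add.assoc)
qed

lemma clifts_diff:
  assumes "f \<in> clifts B P d Q d' e' n a" "g \<in> clifts B P d Q d' e' n b" "exact_res B Q d' e'" "exact_res B P d e"
  shows "(\<lambda>j x. f j x \<ominus>\<^bsub>Q j\<^esub> g j x) \<in> clifts B P d Q d' e' n (\<lambda>x. a x - b x)"
proof -
  note Q = exact_resD[OF assms(3)]
  note cl = module_hom_closed[OF cliftsD(1)[OF assms(1)]] module_hom_closed[OF cliftsD(1)[OF assms(2)]]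
  interpret Q: left_module B "Q j" for j by (rule Q)
  show ?thesis
  proof (rule cliftsI)
    show "(\<lambda>x. f j x \<ominus>\<^bsub>Q j\<^esub> g j x) \<in> module_hom B (P (n + j)) (Q j)" for j
      by (intro module_hom_minus cliftsD(1)[OF assms(1)] cliftsD(1)[OF assms(2)] Q)
    show "e' (f 0 x \<ominus>\<^bsub>Q 0\<^esub> g 0 x) = a x - b x" if "x \<in> carrier (P n)" for x
      using that cl[of x 0]
      by (simp add: a_minus_def module_hom_add[OF Q(3)] module_hom_neg[OF Q(3) Q(1) triv] triv
          cliftsD(2)[OF assms(1)] cliftsD(2)[OF assms(2)])
    show "d' j (f (Suc j) y \<ominus>\<^bsub>Q (Suc j)\<^esub> g (Suc j) y) = f j (d (n + j) y) \<ominus>\<^bsub>Q j\<^esub> g j (d (n + j) y)"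
      if "y \<in> carrier (P (n + Suc j))" for j y
      using that cl[of y "Suc j"]
      by (simp add: a_minus_def module_hom_add[OF Q(2)] module_hom_neg[OF Q(2) Q(1) Q(1)]
          cliftsD(3)[OF assms(1)] cliftsD(3)[OF assms(2)])
  qed
qed

lemma clifts_id: "exact_res B P d e \<Longrightarrow> (\<lambda>j x. x) \<in> clifts B P d P d e 0 e"
  by (rule cliftsI) (auto simp: module_hom_id)

text \<open>For \<open>n = 0\<close> and \<open>\<phi> = e\<close> this is the comparison map of two
  resolutions; with \<open>Q = P\<close> it provides the lifts of a cocycle on which the Yoneda
  product is defined.\<close>

lemma comparison:
  assumes P: "exact_res B P d e" and Q: "exact_res B Q d' e'"
    and LP: "\<And>i m. LP B (P i) (Q (Suc m)) (Q m)" "\<And>i. LP B (P i) (Q 0) (trivial_module B)"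
    and \<phi>: "\<phi> \<in> cocycles B P d n"
  shows "\<exists>g. g \<in> clifts B P d Q d' e' n \<phi>"
proof -
  note PD = exact_resD[OF P] and QD = exact_resD[OF Q]
  \<comment> \<open>Besides being a lift so far, the map at stage \<open>j\<close> must send
    boundaries of \<open>P\<close> into the image of \<open>d' j\<close>. This is the hypothesis
    under which the next stage can be lifted, so the recursive choice has to carry it along.\<close>
  let ?ok = "\<lambda>j x. x \<in> module_hom B (P (n + j)) (Q j) \<and> (j = 0 \<longrightarrow> (\<forall>y\<in>carrier (P n). e' (x y) = \<phi> y)) \<and>
     (\<forall>y\<in>carrier (P (Suc (n + j))). x (d (n + j) y) \<in> d' j ` carrier (Q (Suc j)))"
  let ?st = "\<lambda>j x x'. \<forall>y\<in>carrier (P (n + Suc j)). d' j (x' y) = x (d (n + j) y)"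
  have "\<exists>g. \<forall>j. ?ok j (g j) \<and> ?st j (g j) (g (Suc j))"
  proof (rule dependent_nat_choice)
    obtain h where h: "h \<in> module_hom B (P n) (Q 0)" "\<And>x. x \<in> carrier (P n) \<Longrightarrow> e' (h x) = \<phi> x"
      by (rule LPE[OF LP(2) QD(3) cocycleD(1)[OF \<phi>]]) (use Q in \<open>auto simp: exact_res_def\<close>)
    have "h (d n y) \<in> d' 0 ` carrier (Q (Suc 0))" if "y \<in> carrier (P (Suc n))" for y
      using module_hom_closed[OF PD(2) that] h module_hom_closed[OF h(1)] cocycleD(2)[OF \<phi> that]
      by (intro QD(5)) auto
    then show "\<exists>x. ?ok 0 x" using h by (intro exI[of _ h]) auto
  next
    fix x j assume ok: "?ok j x"
    have hom: "(\<lambda>y. x (d (n + j) y)) \<in> module_hom B (P (Suc (n + j))) (Q j)"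
      using ok by (intro module_hom_comp[OF PD(2)]) auto
    have im: "x (d (n + j) y) \<in> d' j ` carrier (Q (Suc j))" if "y \<in> carrier (P (Suc (n + j)))" for y
      using ok that by blast
    obtain h where h: "h \<in> module_hom B (P (Suc (n + j))) (Q (Suc j))"
        "\<And>y. y \<in> carrier (P (Suc (n + j))) \<Longrightarrow> d' j (h y) = x (d (n + j) y)"
      by (rule LPE[OF LP(1) QD(2) hom]) (use im in auto)
    have "h (d (Suc (n + j)) y) \<in> d' (Suc j) ` carrier (Q (Suc (Suc j)))"
      if y: "y \<in> carrier (P (Suc (Suc (n + j))))" for y
    proof (rule QD(6))
      have y': "d (Suc (n + j)) y \<in> carrier (P (Suc (n + j)))" by (rule module_hom_closed[OF PD(2) y])
      then show "h (d (Suc (n + j)) y) \<in> carrier (Q (Suc j))" by (rule module_hom_closed[OF h(1)])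
      show "d' j (h (d (Suc (n + j)) y)) = \<zero>\<^bsub>Q j\<^esub>"
        using h(2)[OF y'] PD(8)[OF y] module_hom_zero[OF conjunct1[OF ok] PD(1) QD(1)] by simp
    qed
    then show "\<exists>x'. ?ok (Suc j) x' \<and> ?st j x x'"
      using h by (intro exI[of _ h]) auto
  qed
  then obtain g where "\<forall>j. ?ok j (g j) \<and> ?st j (g j) (g (Suc j))" ..
  note g = conjunct1[OF spec[OF this]] conjunct2[OF spec[OF this]]
  show ?thesis
  proof (intro exI[of _ g] cliftsI)
    show "g j \<in> module_hom B (P (n + j)) (Q j)" for j using g(1) by blast
    show "e' (g 0 x) = \<phi> x" if "x \<in> carrier (P n)" for x using g(1)[of 0] that by blast
    show "d' j (g (Suc j) y) = g j (d (n + j) y)" if "y \<in> carrier (P (n + Suc j))" for j y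
      using g(2) that by blast
  qed
qed

text \<open>A chain map that lifts a coboundary is homotopic to zero, so it pulls cocycles back to
  coboundaries. Applied to differences of lifts, this gives independence of all choices made in
  comparing resolutions and in forming products.\<close>

lemma clifts_null:
  assumes P: "exact_res B P d e" and Q: "exact_res B Q d' e'"
    and LP: "\<And>i m. LP B (P i) (Q (Suc m)) (Q m)" "\<And>i. LP B (P i) (Q 0) (trivial_module B)"
    and g: "g \<in> clifts B P d Q d' e' n \<phi>" and \<phi>: "\<phi> \<in> coboundaries B P d n"
    and a: "a \<in> cocycles B Q d' j"
  shows "(\<lambda>x. a (g j x)) \<in> coboundaries B P d (n + j)"
proof -
  note PD = exact_resD[OF P] and QD = exact_resD[OF Q]
  interpret Q: left_module B "Q i" for i by (rule QD)
  have null: "(\<lambda>x. a (g j x)) \<in> coboundaries B P d (n + j)"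
    if g: "g \<in> clifts B P d Q d' e' n (\<lambda>x. 0)" and a: "a \<in> cocycles B Q d' j" for g a j
  proof -
    \<comment> \<open>Of the homotopy relation only \<open>d' s d = g d\<close> is kept. It says
      that \<open>g (Suc j) - s d\<close> is a cycle; its lift \<open>s'\<close> is the next
      homotopy. A cocycle kills \<open>d' s'\<close>, so its values on \<open>g (Suc j)\<close> are
      those on \<open>s d\<close>, a coboundary.\<close>
    have "\<exists>s\<in>module_hom B (P (n + j)) (Q (Suc j)).
       (\<forall>x\<in>carrier (P (n + Suc j)). d' j (s (d (n + j) x)) = g j (d (n + j) x)) \<and>
       (\<forall>a\<in>cocycles B Q d' j. (\<lambda>x. a (g j x)) \<in> coboundaries B P d (n + j))"
    proof (induction j)
      case 0
      have g0: "g 0 \<in> module_hom B (P n) (Q 0)" using cliftsD(1)[OF g, of 0] by simp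
      obtain s where s: "s \<in> module_hom B (P n) (Q (Suc 0))" "\<And>x. x \<in> carrier (P n) \<Longrightarrow> d' 0 (s x) = g 0 x"
        by (rule LPE[OF LP(1) QD(2) g0])
          (use cliftsD(2)[OF g] module_hom_closed[OF g0] QD(5) in auto)
      have "a (g 0 x) = 0" if "a \<in> cocycles B Q d' 0" "x \<in> carrier (P n)" for a x
        using s(2)[OF that(2)] module_hom_closed[OF s(1) that(2)] cocycleD(2)[OF that(1)] by metis
      then show ?case using s module_hom_closed[OF PD(2)] by (intro bexI[of _ s]) (auto intro!: cob_zero)
    next
      case (Suc j)
      then obtain s where s: "s \<in> module_hom B (P (n + j)) (Q (Suc j))"
        "\<And>x. x\<in>carrier (P (Suc (n + j))) \<Longrightarrow> d' j (s (d (n + j) x)) = g j (d (n + j) x)" by auto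
      let ?sd = "\<lambda>x. s (d (n + j) x)"
      let ?f = "\<lambda>x. g (Suc j) x \<ominus>\<^bsub>Q (Suc j)\<^esub> ?sd x"
      have sd: "?sd \<in> module_hom B (P (Suc (n + j))) (Q (Suc j))"
        by (rule module_hom_comp[OF PD(2) s(1)])
      have gh: "g (Suc j) \<in> module_hom B (P (Suc (n + j))) (Q (Suc j))"
        using cliftsD(1)[OF g, of "Suc j"] by simp
      have fh: "?f \<in> module_hom B (P (Suc (n + j))) (Q (Suc j))"
        by (intro module_hom_minus gh sd QD)
      note cl = module_hom_closed[OF gh] module_hom_closed[OF sd]
      have im: "?f x \<in> d' (Suc j) ` carrier (Q (Suc (Suc j)))" if x: "x \<in> carrier (P (Suc (n + j)))" for x
      proof (rule QD(6))
        show "?f x \<in> carrier (Q (Suc j))" by (rule module_hom_closed[OF fh x])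
        have "d' j (?f x) = d' j (g (Suc j) x) \<ominus>\<^bsub>Q j\<^esub> d' j (?sd x)"
          using cl x by (simp add: a_minus_def module_hom_add[OF QD(2)] module_hom_neg[OF QD(2) QD(1) QD(1)])
        also have "\<dots> = \<zero>\<^bsub>Q j\<^esub>"
          using s(2)[OF x] cliftsD(3)[OF g, of x j] x module_hom_closed[OF QD(2) cl(2)[OF x]]
          by (simp add: a_minus_def Q.M.r_neg)
        finally show "d' j (?f x) = \<zero>\<^bsub>Q j\<^esub>" .
      qed
      obtain s' where s': "s' \<in> module_hom B (P (Suc (n + j))) (Q (Suc (Suc j)))"
          "\<And>x. x \<in> carrier (P (Suc (n + j))) \<Longrightarrow> d' (Suc j) (s' x) = ?f x"
        by (rule LPE[OF LP(1) QD(2) fh]) (use im in auto)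
      show ?case
      proof (intro bexI conjI ballI)
        show "s' \<in> module_hom B (P (n + Suc j)) (Q (Suc (Suc j)))" using s' by simp
        fix x assume "x \<in> carrier (P (n + Suc (Suc j)))"
        then have x: "x \<in> carrier (P (Suc (Suc (n + j))))" by simp
        have y: "d (Suc (n + j)) x \<in> carrier (P (Suc (n + j)))" by (rule module_hom_closed[OF PD(2) x])
        have "s (d (n + j) (d (Suc (n + j)) x)) = \<zero>\<^bsub>Q (Suc j)\<^esub>"
          using PD(8)[OF x] module_hom_zero[OF s(1) PD(1) QD(1)] by simp
        then show "d' (Suc j) (s' (d (n + Suc j) x)) = g (Suc j) (d (n + Suc j) x)"
          using s'(2)[OF y] cl(1)[OF y] by (simp add: a_minus_def)
      next
        fix a assume a: "a \<in> cocycles B Q d' (Suc j)"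
        have as: "(\<lambda>x. a (s x)) \<in> module_hom B (P (n + j)) (trivial_module B)"
          by (rule module_hom_comp[OF s(1) cocycleD(1)[OF a]])
        have "a (g (Suc j) x) = a (s (d (n + j) x))" if x: "x \<in> carrier (P (Suc (n + j)))" for x
        proof -
          have "0 = a (?f x)"
            using cocycleD(2)[OF a module_hom_closed[OF s'(1) x]] s'(2)[OF x] by simp
          also have "\<dots> = a (g (Suc j) x) - a (?sd x)"
            using cl[OF x] by (simp add: a_minus_def module_hom_add[OF cocycleD(1)[OF a]]
              module_hom_neg[OF cocycleD(1)[OF a] QD(1) triv] triv)
          finally show ?thesis by simp
        qed
        then show "(\<lambda>x. a (g (Suc j) x)) \<in> coboundaries B P d (n + Suc j)" using as by auto
      qed
    qed
    then show ?thesis using a by blast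
  qed
  show ?thesis
  proof (cases n)
    case 0
    then have "g \<in> clifts B P d Q d' e' n (\<lambda>x. 0)" using g \<phi> by (auto simp: clifts_def)
    from null[OF this a] show ?thesis .
  next
    case (Suc i)
    then obtain h where h: "h \<in> module_hom B (P i) (trivial_module B)"
      "\<And>x. x \<in> carrier (P (Suc i)) \<Longrightarrow> \<phi> x = h (d i x)" using \<phi> by auto
    obtain s where s: "s \<in> module_hom B (P i) (Q 0)" "\<And>x. x \<in> carrier (P i) \<Longrightarrow> e' (s x) = h x"
      by (rule LPE[OF LP(2) QD(3) h(1)]) (use Q in \<open>auto simp: exact_res_def\<close>)
    let ?sd = "\<lambda>x. s (d i x)"
    have sd: "?sd \<in> module_hom B (P n) (Q 0)" using module_hom_comp[OF PD(2) s(1)] Suc by simp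
    \<comment> \<open>With \<open>\<phi> = h d\<close> and \<open>s\<close> a lift of
      \<open>h\<close>, subtracting \<open>s d\<close> in degree zero turns \<open>g\<close> into a
      lift of zero. The other components stay as they are, since \<open>s d d = 0\<close>.\<close>
    define g' where "g' = (\<lambda>i. if i = 0 then (\<lambda>x. g 0 x \<ominus>\<^bsub>Q 0\<^esub> ?sd x) else g i)"
    have g0: "g 0 \<in> module_hom B (P n) (Q 0)" using cliftsD(1)[OF g, of 0] by simp
    note cl = module_hom_closed[OF g0] module_hom_closed[OF sd]
    have "g' \<in> clifts B P d Q d' e' n (\<lambda>x. 0)"
    proof (rule cliftsI)
      show "g' j \<in> module_hom B (P (n + j)) (Q j)" for j
        using cliftsD(1)[OF g, of j] module_hom_minus[OF g0 sd QD(1)] by (auto simp: g'_def)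
      show "e' (g' 0 x) = 0" if "x \<in> carrier (P n)" for x
        using cl[OF that] that h(2) s(2) cliftsD(2)[OF g that] module_hom_closed[OF PD(2), of x i] Suc
        by (simp add: g'_def a_minus_def module_hom_add[OF QD(3)] module_hom_neg[OF QD(3) QD(1) triv] triv)
      show "d' j (g' (Suc j) y) = g' j (d (n + j) y)" if y: "y \<in> carrier (P (n + Suc j))" for j y
      proof (cases j)
        case 0
        have yn: "d n y \<in> carrier (P n)" using module_hom_closed[OF PD(2)] y 0 by simp
        have "s (d i (d n y)) = \<zero>\<^bsub>Q 0\<^esub>"
          using PD(8)[of y i] y 0 Suc module_hom_zero[OF s(1) PD(1) QD(1)] by simp
        then show ?thesis using cliftsD(3)[OF g y] 0 cl(1)[OF yn] by (simp add: g'_def a_minus_def)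
      qed (use cliftsD(3)[OF g y] in \<open>auto simp: g'_def\<close>)
    qed
    note c = null[OF this a]
    show ?thesis
    proof (cases j)
      case 0
      have a0: "a \<in> module_hom B (Q 0) (trivial_module B)" using cocycleD(1)[OF a] 0 by simp
      have "(\<lambda>x. a (?sd x)) \<in> coboundaries B P d (n + j)"
        using module_hom_comp[OF s(1) a0] 0 Suc by auto
      from cob_add[OF c this] show ?thesis
      proof (rule cob_cong)
        fix x assume "x \<in> carrier (P (n + j))"
        then have "x \<in> carrier (P n)" using 0 by simp
        note cl = cl[OF this]
        show "a (g' j x) + a (?sd x) = a (g j x)"
          using cl 0 by (simp add: g'_def a_minus_def module_hom_add[OF a0] module_hom_neg[OF a0 QD(1) triv] triv)
      qed
    qed (use c in \<open>simp add: g'_def\<close>)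
  qed
qed

end

section \<open>Computing Ext from a minimal resolution\<close>

context aug_algebra
begin

lemma cls_eq_iff:
  assumes "f \<in> cocycles B P d n" "g \<in> cocycles B P d n"
  shows "ext_class B P d n f = ext_class B P d n g \<longleftrightarrow> (\<lambda>x. f x - g x) \<in> coboundaries B P d n"
proof
  assume eq: "ext_class B P d n f = ext_class B P d n g"
  have "(\<lambda>x. f x - f x) \<in> coboundaries B P d n" by (rule cob_zero) auto
  then have "f \<in> ext_class B P d n f" using assms by (simp add: ext_class_def)
  then show "(\<lambda>x. f x - g x) \<in> coboundaries B P d n" unfolding eq by (simp add: ext_class_def)
next
  assume fg: "(\<lambda>x. f x - g x) \<in> coboundaries B P d n"
  have "(\<lambda>x. h x - f x) \<in> coboundaries B P d n \<longleftrightarrow> (\<lambda>x. h x - g x) \<in> coboundaries B P d n" for h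
    using cob_add[OF _ fg, of "\<lambda>x. h x - f x"] cob_diff[OF _ fg, of "\<lambda>x. h x - g x"] by auto
  then show "ext_class B P d n f = ext_class B P d n g" by (auto simp: ext_class_def)
qed

lemma cls_self: "f \<in> cocycles B P d n \<Longrightarrow> f \<in> ext_class B P d n f"
  using cob_zero[of P n "\<lambda>x. f x - f x" d] by (simp add: ext_class_def)

lemma cls_mem: "f' \<in> ext_class B P d n f \<Longrightarrow> f' \<in> cocycles B P d n \<and> (\<lambda>x. f' x - f x) \<in> coboundaries B P d n"
  by (simp add: ext_class_def)

lemma Ext_carrier: "carrier (Ext B P d n) = ext_class B P d n ` cocycles B P d n"
  and Ext_zero: "\<zero>\<^bsub>Ext B P d n\<^esub> = ext_class B P d n (\<lambda>x. 0)"
  by (simp_all add: Ext_def)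

lemma Ext_add:
  assumes "f \<in> cocycles B P d n" "g \<in> cocycles B P d n"
  shows "ext_class B P d n f \<oplus>\<^bsub>Ext B P d n\<^esub> ext_class B P d n g = ext_class B P d n (\<lambda>x. f x + g x)"
proof -
  have "ext_class B P d n (\<lambda>x. f' x + g' x) = ext_class B P d n (\<lambda>x. f x + g x)"
    if "f' \<in> ext_class B P d n f" "g' \<in> ext_class B P d n g" for f' g'
    using cls_mem[OF that(1)] cls_mem[OF that(2)] assms
      cob_add[of "\<lambda>x. f' x - f x" P d n "\<lambda>x. g' x - g x"]
    by (subst cls_eq_iff) (auto intro: coc_add simp: algebra_simps)
  then have "(\<Union>f'\<in>ext_class B P d n f. \<Union>g'\<in>ext_class B P d n g. ext_class B P d n (\<lambda>x. f' x + g' x))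
     = ext_class B P d n (\<lambda>x. f x + g x)"
    using cls_self[OF assms(1)] cls_self[OF assms(2)] by blast
  then show ?thesis by (simp add: Ext_def)
qed

lemma Ext_smult:
  assumes "f \<in> cocycles B P d n"
  shows "c \<odot>\<^bsub>Ext B P d n\<^esub> ext_class B P d n f = ext_class B P d n (\<lambda>x. c * f x)"
proof -
  have "ext_class B P d n (\<lambda>x. c * f' x) = ext_class B P d n (\<lambda>x. c * f x)"
    if "f' \<in> ext_class B P d n f" for f'
    using cls_mem[OF that(1)] assms cob_scale[of "\<lambda>x. f' x - f x" P d n c]
    by (subst cls_eq_iff) (auto intro: coc_scale simp: algebra_simps)
  then have "(\<Union>f'\<in>ext_class B P d n f. ext_class B P d n (\<lambda>x. c * f' x)) = ext_class B P d n (\<lambda>x. c * f x)"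
    using cls_self[OF assms(1)] by blast
  then show ?thesis by (simp add: Ext_def)
qed

lemma aug_cocycle: "exact_res B P d e \<Longrightarrow> e \<in> cocycles B P d 0"
  by (rule cocycleI) (auto dest: exact_resD)

lemma Ext_abelian_group: "abelian_group (Ext B P d n)"
proof (rule abelian_groupI)
  fix X assume "X \<in> carrier (Ext B P d n)"
  then obtain f where f: "f \<in> cocycles B P d n" "X = ext_class B P d n f" by (auto simp: Ext_carrier)
  show "\<exists>Y\<in>carrier (Ext B P d n). Y \<oplus>\<^bsub>Ext B P d n\<^esub> X = \<zero>\<^bsub>Ext B P d n\<^esub>"
    using f coc_scale[OF f(1), of "-1"]
    by (intro bexI[of _ "ext_class B P d n (\<lambda>x. - 1 * f x)"]) (simp_all add: Ext_add Ext_carrier Ext_zero)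
qed (auto simp: Ext_carrier Ext_zero Ext_add coc_zero coc_add algebra_simps)

end

text \<open>\<open>yoneda_prod\<close> is a union over all representatives and all lifts; once a
  choice exists and every choice gives the same class, the union is that class.\<close>

lemma UN3_const:
  assumes "x \<in> X" "y \<in> Y" "z \<in> L y"
    "\<And>x y z. x \<in> X \<Longrightarrow> y \<in> Y \<Longrightarrow> z \<in> L y \<Longrightarrow> C x y z = c"
  shows "(\<Union>x\<in>X. \<Union>y\<in>Y. \<Union>z\<in>L y. C x y z) = c"
proof (rule subset_antisym)
  show "(\<Union>x\<in>X. \<Union>y\<in>Y. \<Union>z\<in>L y. C x y z) \<subseteq> c"
    by (intro UN_least) (simp only: assms(4) subset_refl)
  have "C x y z \<subseteq> (\<Union>z\<in>L y. C x y z)" by (rule UN_upper[OF assms(3)])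
  also have "\<dots> \<subseteq> (\<Union>y\<in>Y. \<Union>z\<in>L y. C x y z)" by (rule UN_upper[OF assms(2)])
  also have "\<dots> \<subseteq> (\<Union>x\<in>X. \<Union>y\<in>Y. \<Union>z\<in>L y. C x y z)" by (rule UN_upper[OF assms(1)])
  finally show "c \<subseteq> (\<Union>x\<in>X. \<Union>y\<in>Y. \<Union>z\<in>L y. C x y z)" using assms(4)[OF assms(1-3)] by simp
qed

text \<open>By \<open>minimal\<close> every cochain on \<open>Q\<close> is a cocycle and every
  coboundary vanishes, so the cochains of degree \<open>n\<close> on \<open>Q\<close> are the
  classes in \<open>Ext\<^sup>n\<close>. Lifting is required in all four combinations because
  comparison maps go both ways and are composed both ways.\<close>

locale ext_compare = aug_algebra B for B :: "('k::field, 'b, 'x) graded_algebra_scheme" +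
  fixes P :: "nat \<Rightarrow> ('b, 'p) module" and d e and Q :: "nat \<Rightarrow> ('b, 'q) module" and d' e'
  assumes resP: "exact_res B P d e" and resQ: "exact_res B Q d' e'"
    and LPPQ: "\<And>i m. LP B (P i) (Q (Suc m)) (Q m)" "\<And>i. LP B (P i) (Q 0) (trivial_module B)"
    and LPQP: "\<And>i m. LP B (Q i) (P (Suc m)) (P m)" "\<And>i. LP B (Q i) (P 0) (trivial_module B)"
    and LPPP: "\<And>i m. LP B (P i) (P (Suc m)) (P m)" "\<And>i. LP B (P i) (P 0) (trivial_module B)"
    and LPQQ: "\<And>i m. LP B (Q i) (Q (Suc m)) (Q m)" "\<And>i. LP B (Q i) (Q 0) (trivial_module B)"
    and minimal: "\<And>n a x. a \<in> module_hom B (Q n) (trivial_module B) \<Longrightarrow> x \<in> carrier (Q (Suc n)) \<Longrightarrow> a (d' n x) = 0"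
begin

definition F where "F = (SOME F. F \<in> clifts B P d Q d' e' 0 e)"

lemma F: "F \<in> clifts B P d Q d' e' 0 e"
  unfolding F_def using someI_ex[OF comparison[OF resP resQ LPPQ aug_cocycle[OF resP]]] .

lemma G_ex: "\<exists>G. G \<in> clifts B Q d' P d e 0 e'"
  by (rule comparison[OF resQ resP LPQP aug_cocycle[OF resQ]])

lemma hom_cocycle: "a \<in> module_hom B (Q n) (trivial_module B) \<Longrightarrow> a \<in> cocycles B Q d' n"
  by (rule cocycleI) (auto dest: minimal)

lemma cob_Q: "f \<in> coboundaries B Q d' n \<Longrightarrow> x \<in> carrier (Q n) \<Longrightarrow> f x = 0"
  by (cases n) (auto dest: minimal)

definition Theta where "Theta n a = ext_class B P d n (\<lambda>x. a (F n x))"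

lemma Theta_cocycle: "a \<in> module_hom B (Q n) (trivial_module B) \<Longrightarrow> (\<lambda>x. a (F n x)) \<in> cocycles B P d n"
  using coc_pull[OF F hom_cocycle exact_resD(2)[OF resP]] by simp

lemma Theta_in: "a \<in> module_hom B (Q n) (trivial_module B) \<Longrightarrow> Theta n a \<in> carrier (Ext B P d n)"
  unfolding Theta_def Ext_carrier using Theta_cocycle by blast

text \<open>A cocycle \<open>f\<close> on \<open>P\<close> gives the cochain
  \<open>f \<circ> G n\<close> on \<open>Q\<close>. The composite \<open>G F\<close> and the
  identity lift the same augmentation, so their difference lifts zero, and pulling back along
  \<open>F\<close> returns the class of \<open>f\<close>.\<close>

lemma Theta_surj:
  assumes "X \<in> carrier (Ext B P d n)"
  shows "\<exists>a\<in>module_hom B (Q n) (trivial_module B). X = Theta n a"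
proof -
  obtain f where f: "f \<in> cocycles B P d n" "X = ext_class B P d n f" using assms by (auto simp: Ext_carrier)
  obtain G where G: "G \<in> clifts B Q d' P d e 0 e'" using G_ex by blast
  have Gh: "G n \<in> module_hom B (Q n) (P n)" using cliftsD(1)[OF G, of n] by simp
  have Fh: "F n \<in> module_hom B (P n) (Q n)" using cliftsD(1)[OF F, of n] by simp
  let ?a = "\<lambda>x. f (G n x)"
  have a: "?a \<in> module_hom B (Q n) (trivial_module B)"
    by (rule module_hom_comp[OF Gh cocycleD(1)[OF f(1)]])
  have e'F: "\<And>x. x \<in> carrier (P 0) \<Longrightarrow> e' (F 0 x) = e x" using cliftsD(2)[OF F] .
  have "(\<lambda>j x. G j (F (0 + j) x)) \<in> clifts B P d P d e (0 + 0) (\<lambda>x. e' (F 0 x))"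
    by (rule clifts_comp[OF F G])
  then have GF: "(\<lambda>j x. G j (F j x)) \<in> clifts B P d P d e 0 (\<lambda>x. e' (F 0 x))" by simp
  note D = clifts_diff[OF GF clifts_id[OF resP] resP resP]
  have "(\<lambda>x. e' (F 0 x) - e x) \<in> coboundaries B P d 0" by (auto simp: e'F)
  from clifts_null[OF resP resP LPPP D this f(1)]
  have "(\<lambda>x. f (G n (F n x) \<ominus>\<^bsub>P n\<^esub> x)) \<in> coboundaries B P d n" by simp
  then have "(\<lambda>x. ?a (F n x) - f x) \<in> coboundaries B P d n"
  proof (rule cob_cong)
    fix x assume x: "x \<in> carrier (P n)"
    interpret Pn: left_module B "P n" by (rule exact_resD(1)[OF resP])
    have "G n (F n x) \<in> carrier (P n)" by (rule module_hom_closed[OF Gh module_hom_closed[OF Fh x]])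
    then show "f (G n (F n x) \<ominus>\<^bsub>P n\<^esub> x) = ?a (F n x) - f x"
      using x by (simp add: a_minus_def module_hom_add[OF cocycleD(1)[OF f(1)]]
          module_hom_neg[OF cocycleD(1)[OF f(1)] exact_resD(1)[OF resP] triv] triv)
  qed
  then have "Theta n ?a = X"
    unfolding Theta_def f(2) by (subst cls_eq_iff[OF Theta_cocycle[OF a] f(1)])
  then show ?thesis using a by blast
qed

lemma Theta_add:
  assumes "a \<in> module_hom B (Q n) (trivial_module B)" "b \<in> module_hom B (Q n) (trivial_module B)"
  shows "Theta n a \<oplus>\<^bsub>Ext B P d n\<^esub> Theta n b = Theta n (\<lambda>x. a x + b x)"
  unfolding Theta_def using assms by (intro Ext_add Theta_cocycle)

lemma Theta_smult:
  assumes "a \<in> module_hom B (Q n) (trivial_module B)"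
  shows "c \<odot>\<^bsub>Ext B P d n\<^esub> Theta n a = Theta n (\<lambda>x. c * a x)"
  unfolding Theta_def using assms by (intro Ext_smult Theta_cocycle)

lemma Theta_zero: "Theta n (\<lambda>x. 0) = \<zero>\<^bsub>Ext B P d n\<^esub>"
  by (simp add: Theta_def Ext_zero)

lemma Theta_cong:
  assumes "a \<in> module_hom B (Q n) (trivial_module B)" "b \<in> module_hom B (Q n) (trivial_module B)"
    "\<And>x. x \<in> carrier (Q n) \<Longrightarrow> a x = b x"
  shows "Theta n a = Theta n b"
proof -
  have Fh: "F n \<in> module_hom B (P n) (Q n)" using cliftsD(1)[OF F, of n] by simp
  show ?thesis
    unfolding Theta_def using assms module_hom_closed[OF Fh]
    by (subst cls_eq_iff) (auto intro!: Theta_cocycle cob_zero)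
qed

text \<open>Pulling the coboundary condition back along \<open>G\<close> gives an equation on
  \<open>Q\<close>, where coboundaries are zero; there \<open>F G\<close> is replaced by the
  identity through the same null-homotopy.\<close>

lemma Theta_inj:
  assumes "a \<in> module_hom B (Q n) (trivial_module B)" "b \<in> module_hom B (Q n) (trivial_module B)"
    "Theta n a = Theta n b" "x \<in> carrier (Q n)"
  shows "a x = b x"
proof -
  obtain G where G: "G \<in> clifts B Q d' P d e 0 e'" using G_ex by blast
  have Gh: "G n \<in> module_hom B (Q n) (P n)" using cliftsD(1)[OF G, of n] by simp
  have Fh: "F n \<in> module_hom B (P n) (Q n)" using cliftsD(1)[OF F, of n] by simp
  let ?c = "\<lambda>x. a x - b x"
  have c: "?c \<in> module_hom B (Q n) (trivial_module B)" by (rule hom_diff[OF assms(1,2)])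
  have "(\<lambda>x. ?c (F n x)) \<in> coboundaries B P d n"
    using assms(3) cls_eq_iff[OF Theta_cocycle[OF assms(1)] Theta_cocycle[OF assms(2)]] by (simp add: Theta_def)
  from cob_pull[OF G this] have "(\<lambda>x. ?c (F n (G n x))) \<in> coboundaries B Q d' n" by simp
  then have 1: "?c (F n (G n x)) = 0" using assms(4) by (rule cob_Q)
  have "(\<lambda>j x. F j (G (0 + j) x)) \<in> clifts B Q d' Q d' e' (0 + 0) (\<lambda>x. e (G 0 x))"
    by (rule clifts_comp[OF G F])
  then have FG: "(\<lambda>j x. F j (G j x)) \<in> clifts B Q d' Q d' e' 0 (\<lambda>x. e (G 0 x))" by simp
  note D = clifts_diff[OF FG clifts_id[OF resQ] resQ resQ]
  have "(\<lambda>x. e (G 0 x) - e' x) \<in> coboundaries B Q d' 0" using cliftsD(2)[OF G] by auto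
  from clifts_null[OF resQ resQ LPQQ D this hom_cocycle[OF c]]
  have "(\<lambda>x. ?c (F n (G n x) \<ominus>\<^bsub>Q n\<^esub> x)) \<in> coboundaries B Q d' n" by simp
  then have 2: "?c (F n (G n x) \<ominus>\<^bsub>Q n\<^esub> x) = 0" using assms(4) by (rule cob_Q)
  interpret Qn: left_module B "Q n" by (rule exact_resD(1)[OF resQ])
  have "F n (G n x) \<in> carrier (Q n)" by (rule module_hom_closed[OF Fh module_hom_closed[OF Gh assms(4)]])
  then have "?c (F n (G n x) \<ominus>\<^bsub>Q n\<^esub> x) = ?c (F n (G n x)) - ?c x"
    using assms(4) module_hom_add[OF c, of "F n (G n x)" "\<ominus>\<^bsub>Q n\<^esub> x"]
      module_hom_neg[OF c exact_resD(1)[OF resQ] triv assms(4)] triv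
    by (simp add: a_minus_def)
  then show ?thesis using 1 2 by simp
qed

lemma Theta_one: "Theta 0 e' = ext_class B P d 0 e"
proof -
  have e': "e' \<in> module_hom B (Q 0) (trivial_module B)" by (rule exact_resD(3)[OF resQ])
  show ?thesis unfolding Theta_def
    by (subst cls_eq_iff[OF Theta_cocycle[OF e'] aug_cocycle[OF resP]])
      (use cliftsD(2)[OF F] in auto)
qed

text \<open>The composites \<open>F g\<close> and \<open>\<gamma> F\<close> lift cocycles that
  differ by a coboundary, so composing with \<open>a'\<close> gives the same class. The product may
  therefore be computed with any lift on \<open>Q\<close>, where an explicit one will be written
  down.\<close>

lemma Theta_prod:
  assumes a': "a' \<in> module_hom B (Q k) (trivial_module B)" and a: "a \<in> module_hom B (Q n) (trivial_module B)"
    and \<gamma>: "\<gamma> \<in> clifts B Q d' Q d' e' n a"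
  shows "yoneda_prod B P d e k n (Theta k a') (Theta n a) = Theta (n + k) (\<lambda>x. a' (\<gamma> k x))"
proof -
  have \<gamma>h: "\<gamma> k \<in> module_hom B (Q (n + k)) (Q k)" by (rule cliftsD(1)[OF \<gamma>])
  have a\<gamma>: "(\<lambda>x. a' (\<gamma> k x)) \<in> module_hom B (Q (n + k)) (trivial_module B)"
    by (rule module_hom_comp[OF \<gamma>h a'])
  interpret Q: left_module B "Q i" for i by (rule exact_resD(1)[OF resQ])
  have all: "ext_class B P d (n + k) (a1' \<circ> g k) = Theta (n + k) (\<lambda>x. a' (\<gamma> k x))"
    if a1': "a1' \<in> Theta k a'" and a1: "a1 \<in> Theta n a" and g: "g \<in> lifts B P d e n a1" for a1' a1 g
  proof -
    note g' = g[unfolded lifts_eq]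
    have gh: "g k \<in> module_hom B (P (n + k)) (P k)" by (rule cliftsD(1)[OF g'])
    have Fh: "F i \<in> module_hom B (P i) (Q i)" for i using cliftsD(1)[OF F, of i] by simp
    have a1'': "a1' \<in> cocycles B P d k" "(\<lambda>x. a1' x - a' (F k x)) \<in> coboundaries B P d k"
      using cls_mem a1' unfolding Theta_def by blast+
    have a11: "(\<lambda>x. a1 x - a (F n x)) \<in> coboundaries B P d n"
      using cls_mem a1 unfolding Theta_def by blast
    have 1: "(\<lambda>x. a1' (g k x) - a' (F k (g k x))) \<in> coboundaries B P d (n + k)"
      using cob_pull[OF g' a1''(2)] .
    have "(\<lambda>j x. F j (g (0 + j) x)) \<in> clifts B P d Q d' e' (n + 0) (\<lambda>x. e (g 0 x))"
      by (rule clifts_comp[OF g' F])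
    then have "(\<lambda>j x. F j (g j x)) \<in> clifts B P d Q d' e' n (\<lambda>x. e (g 0 x))" by simp
    then have Fg: "(\<lambda>j x. F j (g j x)) \<in> clifts B P d Q d' e' n a1"
      using cliftsD(2)[OF g'] unfolding clifts_def by auto
    have "(\<lambda>j x. \<gamma> j (F (n + j) x)) \<in> clifts B P d Q d' e' (0 + n) (\<lambda>x. a (F n x))"
      by (rule clifts_comp[OF F \<gamma>])
    then have \<gamma>F: "(\<lambda>j x. \<gamma> j (F (n + j) x)) \<in> clifts B P d Q d' e' n (\<lambda>x. a (F n x))" by simp
    note D = clifts_diff[OF Fg \<gamma>F resQ resP]
    from clifts_null[OF resP resQ LPPQ D a11 hom_cocycle[OF a']]
    have 2: "(\<lambda>x. a' (F k (g k x) \<ominus>\<^bsub>Q k\<^esub> \<gamma> k (F (n + k) x))) \<in> coboundaries B P d (n + k)" .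
    have "(\<lambda>x. (a1' \<circ> g k) x - a' (\<gamma> k (F (n + k) x))) \<in> coboundaries B P d (n + k)"
    proof (rule cob_cong[OF cob_add[OF 1 2]])
      fix x assume x: "x \<in> carrier (P (n + k))"
      have "F k (g k x) \<in> carrier (Q k)" "\<gamma> k (F (n + k) x) \<in> carrier (Q k)"
        using module_hom_closed[OF Fh module_hom_closed[OF gh x]]
          module_hom_closed[OF \<gamma>h module_hom_closed[OF Fh x]] by auto
      then show "a1' (g k x) - a' (F k (g k x)) + a' (F k (g k x) \<ominus>\<^bsub>Q k\<^esub> \<gamma> k (F (n + k) x))
          = (a1' \<circ> g k) x - a' (\<gamma> k (F (n + k) x))"
        by (simp add: a_minus_def module_hom_add[OF a']
          module_hom_neg[OF a' exact_resD(1)[OF resQ] triv] triv)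
    qed
    moreover have "a1' \<circ> g k \<in> cocycles B P d (n + k)"
      using coc_pull[OF g' a1''(1) exact_resD(2)[OF resP]] by (simp add: comp_def)
    ultimately show ?thesis
      unfolding Theta_def using cls_eq_iff Theta_cocycle[OF a\<gamma>] by blast
  qed
  have ne': "(\<lambda>x. a' (F k x)) \<in> Theta k a'" and ne: "(\<lambda>x. a (F n x)) \<in> Theta n a"
    unfolding Theta_def using Theta_cocycle[OF a'] Theta_cocycle[OF a] cls_self by blast+
  obtain g where "g \<in> lifts B P d e n (\<lambda>x. a (F n x))"
    using comparison[OF resP resP LPPP Theta_cocycle[OF a]] unfolding lifts_eq by blast
  then show ?thesis
    unfolding yoneda_prod_def by (rule UN3_const[OF ne' ne _ all])
qed

end

section \<open>Gradings\<close>

text \<open>Only the additive part of \<open>graded_module\<close>, so that it applies to algebras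
  and modules alike; \<open>hpart\<close> generalises \<open>homog_part\<close> accordingly.\<close>

definition has_grading :: "('a, 'm, 'x) module_scheme \<Rightarrow> (int \<Rightarrow> 'm set) \<Rightarrow> bool" where
  "has_grading M gr \<longleftrightarrow> abelian_group M \<and> (\<forall>j. subgroup (gr j) (add_monoid M)) \<and>
     (\<forall>m\<in>carrier M. \<exists>!f. homog_decomp M gr m f)"

definition hpart :: "('a, 'm, 'x) module_scheme \<Rightarrow> (int \<Rightarrow> 'm set) \<Rightarrow> 'm \<Rightarrow> int \<Rightarrow> 'm" where
  "hpart M gr m = (THE f. homog_decomp M gr m f)"

lemma graded_module_has_grading: "graded_module A M gr \<Longrightarrow> has_grading M gr"
  by (auto simp: graded_module_def has_grading_def left_module.mod_ag)

lemma homog_part_hpart: "homog_part A a = hpart A (deg A) a"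
  by (simp add: homog_part_def hpart_def)

locale graded_group =
  fixes M :: "('a, 'm, 'x) module_scheme" (structure) and gr :: "int \<Rightarrow> 'm set"
  assumes grading: "has_grading M gr"
begin

sublocale abelian_group M using grading by (simp add: has_grading_def)

lemma gr_subgroup: "subgroup (gr j) (add_monoid M)" using grading by (simp add: has_grading_def)

lemma gr_closed: "x \<in> gr j \<Longrightarrow> x \<in> carrier M"
  using subgroup.mem_carrier[OF gr_subgroup] by simp

lemma gr_zero [simp]: "\<zero> \<in> gr j"
  using subgroup.one_closed[OF gr_subgroup[of j]] by simp

lemma gr_add: "x \<in> gr j \<Longrightarrow> y \<in> gr j \<Longrightarrow> x \<oplus> y \<in> gr j"
  using subgroup.m_closed[OF gr_subgroup[of j]] by simp

lemma gr_sum: "(\<And>i. i \<in> I \<Longrightarrow> f i \<in> gr j) \<Longrightarrow> (\<Oplus>i\<in>I. f i) \<in> gr j"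
proof (induction I rule: infinite_finite_induct)
  case (insert i I)
  have "(\<Oplus>i\<in>insert i I. f i) = f i \<oplus> (\<Oplus>i\<in>I. f i)"
    using insert by (intro finsum_insert) (auto intro: gr_closed)
  then show ?case using insert by (simp add: gr_add)
qed simp_all

lemma decomp_ex1: "m \<in> carrier M \<Longrightarrow> \<exists>!f. homog_decomp M gr m f"
  using grading unfolding has_grading_def by (elim conjE bspec)

lemma hpart_decomp: "m \<in> carrier M \<Longrightarrow> homog_decomp M gr m (hpart M gr m)"
  unfolding hpart_def by (rule theI'[OF decomp_ex1])

lemma hpart_in: "m \<in> carrier M \<Longrightarrow> hpart M gr m j \<in> gr j"
  and hpart_finite: "m \<in> carrier M \<Longrightarrow> finite {j. hpart M gr m j \<noteq> \<zero>}"
  and hpart_sum: "m \<in> carrier M \<Longrightarrow> m = (\<Oplus>j\<in>{j. hpart M gr m j \<noteq> \<zero>}. hpart M gr m j)"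
  using hpart_decomp[of m] unfolding homog_decomp_def by simp_all

lemma hpart_closed [simp]: "m \<in> carrier M \<Longrightarrow> hpart M gr m j \<in> carrier M"
  by (intro gr_closed[OF hpart_in])

lemma hpart_eqI:
  assumes "\<And>j. f j \<in> gr j" "finite F" "\<And>j. j \<notin> F \<Longrightarrow> f j = \<zero>" "m = (\<Oplus>j\<in>F. f j)"
  shows "hpart M gr m = f"
proof -
  have sub: "{j. f j \<noteq> \<zero>} \<subseteq> F" using assms(3) by blast
  have "m = (\<Oplus>j\<in>{j. f j \<noteq> \<zero>}. f j)"
    unfolding assms(4) using assms(2) sub gr_closed[OF assms(1)] by (intro finsum_superset[symmetric]) simp_all
  then have "homog_decomp M gr m f"
    using assms(1) sub assms(2) by (auto simp: homog_decomp_def intro: finite_subset)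
  moreover have "m \<in> carrier M" unfolding assms(4) using assms(1) gr_closed by (intro finsum_closed) auto
  ultimately show ?thesis
    unfolding hpart_def by (intro the1_equality decomp_ex1)
qed

lemma hpart_homog: "m \<in> gr i \<Longrightarrow> hpart M gr m j = (if j = i then m else \<zero>)"
proof -
  assume m: "m \<in> gr i"
  have "hpart M gr m = (\<lambda>j. if j = i then m else \<zero>)"
    by (rule hpart_eqI[where F = "{i}"]) (use m gr_closed[OF m] in \<open>auto simp: Pi_iff\<close>)
  then show ?thesis by simp
qed

lemma hpart_superset:
  assumes "m \<in> carrier M" "finite F" "{j. hpart M gr m j \<noteq> \<zero>} \<subseteq> F"
  shows "m = (\<Oplus>j\<in>F. hpart M gr m j)"
proof -
  have "(\<Oplus>j\<in>{j. hpart M gr m j \<noteq> \<zero>}. hpart M gr m j) = (\<Oplus>j\<in>F. hpart M gr m j)"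
    by (rule finsum_superset) (use assms in simp_all)
  then show ?thesis by (rule trans[OF hpart_sum[OF assms(1)]])
qed

lemma hpart_add:
  assumes "m \<in> carrier M" "m' \<in> carrier M"
  shows "hpart M gr (m \<oplus> m') j = hpart M gr m j \<oplus> hpart M gr m' j"
proof -
  let ?F = "{j. hpart M gr m j \<noteq> \<zero>} \<union> {j. hpart M gr m' j \<noteq> \<zero>}"
  have fin: "finite ?F" using assms by (auto intro: hpart_finite)
  have "m \<oplus> m' = (\<Oplus>j\<in>?F. hpart M gr m j) \<oplus> (\<Oplus>j\<in>?F. hpart M gr m' j)"
    using hpart_superset[OF assms(1) fin] hpart_superset[OF assms(2) fin] by simp
  also have "\<dots> = (\<Oplus>j\<in>?F. hpart M gr m j \<oplus> hpart M gr m' j)"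
    using assms by (subst finsum_addf) auto
  finally have eq: "m \<oplus> m' = (\<Oplus>j\<in>?F. hpart M gr m j \<oplus> hpart M gr m' j)" .
  have "hpart M gr (m \<oplus> m') = (\<lambda>j. hpart M gr m j \<oplus> hpart M gr m' j)"
    by (rule hpart_eqI[OF _ fin _ eq]) (use assms in \<open>auto intro: gr_add hpart_in\<close>)
  then show ?thesis by simp
qed

lemma hpart_finsum:
  assumes "\<And>i. i \<in> I \<Longrightarrow> f i \<in> carrier M"
  shows "hpart M gr (\<Oplus>i\<in>I. f i) j = (\<Oplus>i\<in>I. hpart M gr (f i) j)"
  by (rule finsum_additive[where f = "\<lambda>m. hpart M gr m j"])
    (use assms in \<open>auto simp: hpart_add abelian_group_axioms\<close>)

lemma hpart_zero_all: "m \<in> carrier M \<Longrightarrow> (\<And>j. hpart M gr m j = \<zero>) \<Longrightarrow> m = \<zero>"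
  using hpart_superset[of m "{}"] by auto

end

text \<open>Covers differentials and automorphisms with \<open>s = 0\<close>, and the action on a
  fixed homogeneous element with \<open>s\<close> its degree.\<close>

lemma hpart_map:
  assumes "has_grading M gr" "has_grading M' gr'" "m \<in> carrier M"
    and "\<And>x. x \<in> carrier M \<Longrightarrow> \<phi> x \<in> carrier M'"
    and "\<And>x y. x \<in> carrier M \<Longrightarrow> y \<in> carrier M \<Longrightarrow> \<phi> (x \<oplus>\<^bsub>M\<^esub> y) = \<phi> x \<oplus>\<^bsub>M'\<^esub> \<phi> y"
    and deg: "\<And>j x. x \<in> gr j \<Longrightarrow> \<phi> x \<in> gr' (j + s)"
  shows "hpart M' gr' (\<phi> m) j = \<phi> (hpart M gr m (j - s))"
proof -
  interpret M: graded_group M gr by unfold_locales fact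
  interpret M': graded_group M' gr' by unfold_locales fact
  let ?S = "{j. hpart M gr m j \<noteq> \<zero>\<^bsub>M\<^esub>}"
  have \<phi>0: "\<phi> \<zero>\<^bsub>M\<^esub> = \<zero>\<^bsub>M'\<^esub>"
    using finsum_additive[of M M' "{}" "\<lambda>x. \<zero>\<^bsub>M\<^esub>" \<phi>] assms M.abelian_group_axioms M'.abelian_group_axioms by simp
  have "\<phi> m = \<phi> (\<Oplus>\<^bsub>M\<^esub>j\<in>?S. hpart M gr m j)" using M.hpart_sum[OF assms(3)] by (rule arg_cong)
  also have "\<dots> = (\<Oplus>\<^bsub>M'\<^esub>j\<in>?S. \<phi> (hpart M gr m j))"
    by (rule finsum_additive) (use assms in \<open>auto simp: M.abelian_group_axioms M'.abelian_group_axioms\<close>)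
  also have "\<dots> = (\<Oplus>\<^bsub>M'\<^esub>j\<in>(\<lambda>j. j + s) ` ?S. \<phi> (hpart M gr m (j - s)))"
    using assms by (subst M'.finsum_reindex) (auto simp: inj_on_def)
  finally have eq: "\<phi> m = (\<Oplus>\<^bsub>M'\<^esub>j\<in>(\<lambda>j. j + s) ` ?S. \<phi> (hpart M gr m (j - s)))" .
  have "hpart M' gr' (\<phi> m) = (\<lambda>j. \<phi> (hpart M gr m (j - s)))"
  proof (rule M'.hpart_eqI[OF _ _ _ eq])
    show "\<phi> (hpart M gr m (j - s)) \<in> gr' j" for j
      using deg[OF M.hpart_in[OF assms(3), of "j - s"]] by simp
    show "finite ((\<lambda>j. j + s) ` ?S)" using M.hpart_finite[OF assms(3)] by simp
    show "\<phi> (hpart M gr m (j - s)) = \<zero>\<^bsub>M'\<^esub>" if "j \<notin> (\<lambda>j. j + s) ` ?S" for j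
    proof -
      have "j - s \<notin> ?S" using that by (metis diff_add_cancel image_eqI)
      then show ?thesis using \<phi>0 by simp
    qed
  qed
  then show ?thesis by simp
qed

text \<open>Component maps that are additive and correct on homogeneous elements force
  decompositions to be unique: apply \<open>c\<close> to any finite decomposition of
  \<open>m\<close>.\<close>

lemma
  assumes "abelian_group M" "\<And>j. subgroup (gr j) (add_monoid M)"
    and c: "\<And>m j. m \<in> carrier M \<Longrightarrow> c m j \<in> gr j" "\<And>m. m \<in> carrier M \<Longrightarrow> finite {j. c m j \<noteq> \<zero>\<^bsub>M\<^esub>}"
      "\<And>m. m \<in> carrier M \<Longrightarrow> m = (\<Oplus>\<^bsub>M\<^esub>j\<in>{j. c m j \<noteq> \<zero>\<^bsub>M\<^esub>}. c m j)"
      "\<And>m m' j. m \<in> carrier M \<Longrightarrow> m' \<in> carrier M \<Longrightarrow> c (m \<oplus>\<^bsub>M\<^esub> m') j = c m j \<oplus>\<^bsub>M\<^esub> c m' j"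
      "\<And>m i j. m \<in> gr i \<Longrightarrow> c m j = (if j = i then m else \<zero>\<^bsub>M\<^esub>)"
  shows has_gradingI: "has_grading M gr"
    and hpart_eq_component: "m \<in> carrier M \<Longrightarrow> hpart M gr m = c m"
proof -
  interpret abelian_group M by fact
  have gr: "x \<in> carrier M" if "x \<in> gr j" for x j
    using subgroup.mem_carrier[OF assms(2)] that by simp
  have uniq: "f = c m" if "homog_decomp M gr m f" for m f
  proof
    fix j
    let ?S = "{j. f j \<noteq> \<zero>\<^bsub>M\<^esub>}"
    have f: "\<And>j. f j \<in> gr j" "finite ?S" "m = (\<Oplus>\<^bsub>M\<^esub>j\<in>?S. f j)" using that by (auto simp: homog_decomp_def)
    have fc: "f j \<in> carrier M" for j by (rule gr[OF f(1)])
    have "c m j = (\<Oplus>\<^bsub>M\<^esub>i\<in>?S. c (f i) j)" unfolding f(3)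
      by (rule finsum_additive[where f = "\<lambda>m. c m j"])
        (use fc c(4) gr[OF c(1)] in \<open>auto simp: abelian_group_axioms\<close>)
    also have "\<dots> = (\<Oplus>\<^bsub>M\<^esub>i\<in>?S. if j = i then f i else \<zero>\<^bsub>M\<^esub>)"
      using c(5)[OF f(1)] fc by (intro finsum_cong2) auto
    also have "\<dots> = f j"
    proof (cases "f j = \<zero>\<^bsub>M\<^esub>")
      case True
      then show ?thesis by (intro trans[OF finsum_zeroI]) auto
    qed (use f(2) fc finsum_delta[of ?S j "\<lambda>i. if j = i then f i else \<zero>\<^bsub>M\<^esub>"] in auto)
    finally show "f j = c m j" by simp
  qed
  have ex: "homog_decomp M gr m (c m)" if "m \<in> carrier M" for m
    using c that by (auto simp: homog_decomp_def)
  show "has_grading M gr"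
    unfolding has_grading_def using assms(1,2) ex uniq by blast
  show "hpart M gr m = c m" if "m \<in> carrier M"
    unfolding hpart_def using ex[OF that] uniq by blast
qed

section \<open>Quotients of algebras\<close>

lemma idealI_closed:
  assumes "ring C" "S \<subseteq> carrier C" "\<zero>\<^bsub>C\<^esub> \<in> S" "\<And>x y. x \<in> S \<Longrightarrow> y \<in> S \<Longrightarrow> x \<oplus>\<^bsub>C\<^esub> y \<in> S"
    "\<And>a x. a \<in> carrier C \<Longrightarrow> x \<in> S \<Longrightarrow> a \<otimes>\<^bsub>C\<^esub> x \<in> S" "\<And>a x. a \<in> carrier C \<Longrightarrow> x \<in> S \<Longrightarrow> x \<otimes>\<^bsub>C\<^esub> a \<in> S"
  shows "ideal S C"
proof -
  interpret ring C by fact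
  have neg: "\<ominus>\<^bsub>C\<^esub> x \<in> S" if "x \<in> S" for x
    using assms(5)[of "\<ominus>\<^bsub>C\<^esub> \<one>\<^bsub>C\<^esub>" x] that assms(2) by (auto simp: l_minus)
  show ?thesis
  proof (rule idealI)
    show "ring C" by fact
    show "subgroup S (add_monoid C)"
      by (rule subgroup.intro) (use assms neg in \<open>auto simp flip: a_inv_def\<close>)
  qed (use assms in auto)
qed

context kalg
begin

context
  fixes S
  assumes S: "S \<subseteq> carrier C"
begin

abbreviation gen_ideal where "gen_ideal \<equiv> Idl S"
abbreviation qpr where "qpr \<equiv> quot_proj C S"
abbreviation qalg where "qalg \<equiv> quot_algebra C S"

lemma ideal_I: "ideal gen_ideal C" using S by (rule genideal_ideal)

lemma quot_eq: "x \<in> carrier C \<Longrightarrow> y \<in> carrier C \<Longrightarrow> qpr x = qpr y \<longleftrightarrow> x \<ominus> y \<in> gen_ideal"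
  unfolding quot_proj_def using quotient_eq_iff_same_a_r_cos[OF ideal_I] by auto

lemma quot_self: "x \<in> carrier C \<Longrightarrow> x \<in> qpr x"
  unfolding quot_proj_def a_r_coset_def'
  using additive_subgroup.zero_closed[OF ideal.axioms(1)[OF ideal_I]] by (auto intro!: bexI[of _ \<zero>])

lemma quot_mem: "x \<in> carrier C \<Longrightarrow> y \<in> qpr x \<Longrightarrow> y \<in> carrier C \<and> qpr y = qpr x"
proof -
  assume x: "x \<in> carrier C" and y: "y \<in> qpr x"
  then obtain h where h: "h \<in> gen_ideal" "y = h \<oplus> x"
    by (auto simp: quot_proj_def a_r_coset_def r_coset_def)
  have hc: "h \<in> carrier C" using h(1) ideal.Icarr[OF ideal_I] by blast
  have yc: "y \<in> carrier C" using h hc x by simp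
  have "y \<ominus> x = h" using h(2) hc x by (simp add: a_minus_def a_assoc r_neg)
  then show ?thesis using quot_eq[OF yc x] h(1) yc by simp
qed

lemma Q_simps:
  "carrier qalg = qpr ` carrier C" "deg qalg i = qpr ` deg C i" "\<zero>\<^bsub>qalg\<^esub> = qpr \<zero>" "\<one>\<^bsub>qalg\<^esub> = qpr \<one>"
proof -
  have "a_r_coset C gen_ideal \<zero> = gen_ideal"
    using additive_subgroup.a_subset[OF ideal.axioms(1)[OF ideal_I]]
    by (simp add: a_coset_add_zero)
  then show "\<zero>\<^bsub>qalg\<^esub> = qpr \<zero>" by (simp add: quot_algebra_def Let_def FactRing_def quot_proj_def)
qed (auto simp: quot_algebra_def Let_def FactRing_def A_RCOSETS_def' quot_proj_def)

lemma q_add: "x \<in> carrier C \<Longrightarrow> y \<in> carrier C \<Longrightarrow> qpr x \<oplus>\<^bsub>qalg\<^esub> qpr y = qpr (x \<oplus> y)"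
  using abelian_subgroup.a_rcos_sum[OF abelian_subgroupI3] ideal_I
  by (simp add: quot_algebra_def Let_def FactRing_def quot_proj_def ideal.axioms(1)
      abelian_group_axioms abelian_subgroup.a_rcos_sum abelian_subgroupI3)

lemma q_mult: "x \<in> carrier C \<Longrightarrow> y \<in> carrier C \<Longrightarrow> qpr x \<otimes>\<^bsub>qalg\<^esub> qpr y = qpr (x \<otimes> y)"
  using ideal.rcoset_mult_add[OF ideal_I]
  by (simp add: quot_algebra_def Let_def FactRing_def quot_proj_def)

lemma I_smult: "x \<in> gen_ideal \<Longrightarrow> c \<odot> x \<in> gen_ideal"
proof -
  assume x: "x \<in> gen_ideal"
  have xc: "x \<in> carrier C" using x ideal.Icarr[OF ideal_I] by blast
  have "c \<odot> x = (c \<odot> \<one>) \<otimes> x" using xc by (simp add: ksm_multl)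
  then show ?thesis using ideal.I_l_closed[OF ideal_I x] by simp
qed

text \<open>The scalar action on the quotient is a union over representatives; it is a single coset
  because the ideal is stable under scalars.\<close>

lemma q_smult: "x \<in> carrier C \<Longrightarrow> c \<odot>\<^bsub>qalg\<^esub> qpr x = qpr (c \<odot> x)"
proof -
  assume x: "x \<in> carrier C"
  have "qpr (c \<odot> y) = qpr (c \<odot> x)" if "y \<in> qpr x" for y
  proof -
    have y: "y \<in> carrier C" "y \<ominus> x \<in> gen_ideal" using quot_mem[OF x that] quot_eq x by auto
    have "c \<odot> y \<ominus> c \<odot> x = c \<odot> (y \<ominus> x)"
      using x y(1) by (simp add: a_minus_def ksm_radd ksm_neg_right)
    then show ?thesis using quot_eq[of "c \<odot> y" "c \<odot> x"] I_smult[OF y(2)] x y by simp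
  qed
  then have "(\<Union>y\<in>qpr x. qpr (c \<odot> y)) = qpr (c \<odot> x)" using quot_self[OF x] by blast
  then show ?thesis by (simp add: quot_algebra_def Let_def)
qed

lemma kalg_quot: "kalg qalg"
proof -
  have R: "ring (C Quot gen_ideal)" using ideal.quotient_is_ring[OF ideal_I] .
  have "ring qalg"
  proof (rule ringI)
    interpret Q: ring "C Quot gen_ideal" by (rule R)
    have ops: "carrier qalg = carrier (C Quot gen_ideal)" "add qalg = add (C Quot gen_ideal)" "mult qalg = mult (C Quot gen_ideal)"
      "zero qalg = zero (C Quot gen_ideal)" "one qalg = one (C Quot gen_ideal)"
      by (simp_all add: quot_algebra_def Let_def)
    show "abelian_group qalg"
      by (rule abelian_groupI) (auto simp: ops Q.a_ac intro: Q.l_neg Q.a_inv_closed)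
    show "Group.monoid qalg" by (rule monoidI) (auto simp: ops Q.m_assoc)
  qed (auto simp: Q_simps q_add q_mult l_distr r_distr)
  then show ?thesis
    unfolding kalg_def kalg_axioms_def
    by (auto simp: Q_simps q_add q_mult q_smult ksm_ladd ksm_radd ksm_assoc ksm_multl ksm_multr)
qed

lemma q_zero_iff: "x \<in> carrier C \<Longrightarrow> qpr x = \<zero>\<^bsub>qalg\<^esub> \<longleftrightarrow> x \<in> gen_ideal"
  unfolding Q_simps using quot_eq[of x \<zero>] by (simp add: a_minus_def)

lemma q_zero: "x \<in> S \<Longrightarrow> qpr x = \<zero>\<^bsub>qalg\<^esub>"
  using q_zero_iff[of x] genideal_self[OF S] S by blast

lemma I_minimal: "ideal J C \<Longrightarrow> S \<subseteq> J \<Longrightarrow> gen_ideal \<subseteq> J"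
  by (rule genideal_minimal)

end

end

section \<open>Words\<close>

definition words :: "'b set \<Rightarrow> nat \<Rightarrow> 'b list set" where
  "words X n = {y \<in> lists X. length y = n}"

lemma finite_words [simp]: "finite X \<Longrightarrow> finite (words X n)"
proof -
  have "words X n = {y. set y \<subseteq> X \<and> length y = n}" by (auto simp: words_def)
  then show "finite X \<Longrightarrow> finite (words X n)" by (simp add: finite_lists_length_eq)
qed

lemma words_0 [simp]: "words X 0 = {[]}"
  by (auto simp: words_def)

lemma Cons_words [simp]: "b # y \<in> words X (Suc n) \<longleftrightarrow> b \<in> X \<and> y \<in> words X n"
  by (auto simp: words_def)

lemma words_Suc: "words X (Suc n) = (\<Union>b\<in>X. (#) b ` words X n)"
  by (auto simp: words_def length_Suc_conv image_iff)

lemma append_words: "u \<in> words X m \<Longrightarrow> v \<in> words X n \<Longrightarrow> u @ v \<in> words X (m + n)"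
  by (auto simp: words_def)

lemma words_length: "y \<in> words X n \<Longrightarrow> length y = n"
  by (simp add: words_def)

lemma sum_words_Suc:
  assumes "finite X"
  shows "(\<Sum>y\<in>words X (Suc n). f y) = (\<Sum>b\<in>X. \<Sum>y\<in>words X n. f (b # y))"
  unfolding words_Suc using assms
  by (subst sum.UNION_disjoint) (auto simp: sum.reindex)

lemma sum_words_append:
  assumes "finite X"
  shows "(\<Sum>y\<in>words X (m + n). f y) = (\<Sum>u\<in>words X m. \<Sum>v\<in>words X n. f (u @ v))"
  by (induction m arbitrary: f) (auto simp: sum_words_Suc[OF assms])

lemma (in abelian_group) finsum_words_Suc:
  assumes "finite X" "\<And>y. y \<in> words X (Suc n) \<Longrightarrow> f y \<in> carrier G"
  shows "(\<Oplus>y\<in>words X (Suc n). f y) = (\<Oplus>b\<in>X. \<Oplus>y\<in>words X n. f (b # y))"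
proof -
  have "(\<Oplus>y\<in>words X (Suc n). f y) = (\<Oplus>b\<in>X. \<Oplus>y\<in>(#) b ` words X n. f y)"
    unfolding words_Suc using assms
    by (intro add.finprod_UN_disjoint) (auto simp: pairwise_def disjnt_def)
  also have "\<dots> = (\<Oplus>b\<in>X. \<Oplus>y\<in>words X n. f (b # y))"
    using assms by (intro finsum_cong2 finsum_reindex) (auto intro!: finsum_closed)
  finally show ?thesis .
qed

text \<open>\<open>wm cf s y\<close> is the coefficient of the basis word \<open>y\<close> in the
  tensor product of the vectors in \<open>s\<close>, so it is zero for unequal lengths. Applied to a
  matrix in place of \<open>cf\<close>, it gives the entries of the tensor powers of that
  matrix.\<close>

fun wm :: "('u \<Rightarrow> 'b \<Rightarrow> 'k::field) \<Rightarrow> 'u list \<Rightarrow> 'b list \<Rightarrow> 'k" where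
  "wm cf [] [] = 1"
| "wm cf (a # s) (b # y) = cf a b * wm cf s y"
| "wm cf _ _ = 0"

lemma wm_length: "length s \<noteq> length y \<Longrightarrow> wm cf s y = 0"
  by (induction cf s y rule: wm.induct) auto

lemma wm_append: "wm cf (s @ t) y = wm cf s (take (length s) y) * wm cf t (drop (length s) y)"
proof (induction s arbitrary: y)
  case (Cons a s) then show ?case by (cases y) auto
qed simp

lemma wm_Nil [simp]: "wm cf [] y = (if y = [] then 1 else 0)"
  by (cases y) auto

text \<open>
  Coordinates of elements of a tensor algebra: \<open>cf u\<close> are the coordinates of the vector \<open>u\<close> in a basis,
  and \<open>kap cf p y\<close> is the coefficient of the basis word \<open>y\<close> in the class of \<open>p\<close>.
\<close>

definition kap :: "('u \<Rightarrow> 'b \<Rightarrow> 'k::field) \<Rightarrow> ('u list \<Rightarrow>\<^sub>0 'k) \<Rightarrow> 'b list \<Rightarrow> 'k" where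
  "kap cf p y = (\<Sum>s\<in>Poly_Mapping.keys p. Poly_Mapping.lookup p s * wm cf s y)"

lemma kap_superset:
  "finite F \<Longrightarrow> Poly_Mapping.keys p \<subseteq> F \<Longrightarrow> kap cf p y = (\<Sum>s\<in>F. Poly_Mapping.lookup p s * wm cf s y)"
  unfolding kap_def by (intro sum.mono_neutral_left) (auto simp: in_keys_iff)

lemma kap_add: "kap cf (p + q) y = kap cf p y + kap cf q y"
  using Poly_Mapping.keys_add[of p q]
  by (simp add: kap_superset[where F = "Poly_Mapping.keys p \<union> Poly_Mapping.keys q"] lookup_add
      algebra_simps sum.distrib)

lemma kap_diff: "kap cf (p - q) y = kap cf p y - kap cf q y"
  using keys_diff[of p q]
  by (simp add: kap_superset[where F = "Poly_Mapping.keys p \<union> Poly_Mapping.keys q"] lookup_minus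
      algebra_simps sum_subtractf)

lemma kap_zero [simp]: "kap cf 0 y = 0" by (simp add: kap_def)

lemma kap_single [simp]: "kap cf (Poly_Mapping.single s c) y = c * wm cf s y"
  by (simp add: kap_def)

lemma kap_sum: "kap cf (\<Sum>i\<in>I. p i) y = (\<Sum>i\<in>I. kap cf (p i) y)"
  by (induction I rule: infinite_finite_induct) (auto simp: kap_add)

text \<open>What the concatenation product of a tensor algebra becomes on coefficient
  functions.\<close>

definition conv :: "('b list \<Rightarrow> 'k::field) \<Rightarrow> ('b list \<Rightarrow> 'k) \<Rightarrow> 'b list \<Rightarrow> 'k" where
  "conv c c' y = (\<Sum>i\<le>length y. c (take i y) * c' (drop i y))"

lemma pm_decomp: "(p :: 'a \<Rightarrow>\<^sub>0 'b::comm_monoid_add) = (\<Sum>s\<in>Poly_Mapping.keys p. Poly_Mapping.single s (Poly_Mapping.lookup p s))"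
proof (rule poly_mapping_eqI)
  fix k
  have "(\<Sum>s\<in>Poly_Mapping.keys p. Poly_Mapping.lookup (Poly_Mapping.single s (Poly_Mapping.lookup p s)) k)
    = (\<Sum>s\<in>Poly_Mapping.keys p. if s = k then Poly_Mapping.lookup p k else 0)"
    by (intro sum.cong) (auto simp: lookup_single)
  then show "Poly_Mapping.lookup p k = Poly_Mapping.lookup
     (\<Sum>s\<in>Poly_Mapping.keys p. Poly_Mapping.single s (Poly_Mapping.lookup p s)) k"
    by (simp add: lookup_sum in_keys_iff)
qed

lemma pm_induct [consumes 1, case_names zero add]:
  fixes p :: "'a \<Rightarrow>\<^sub>0 'b::comm_monoid_add"
  assumes "Poly_Mapping.keys p \<subseteq> S" "P 0"
    "\<And>q s c. Poly_Mapping.keys q \<subseteq> S \<Longrightarrow> s \<in> S \<Longrightarrow> P q \<Longrightarrow> P (Poly_Mapping.single s c + q)"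
  shows "P p"
proof -
  let ?f = "\<lambda>s. Poly_Mapping.single s (Poly_Mapping.lookup p s)"
  have "P (\<Sum>s\<in>F. ?f s) \<and> Poly_Mapping.keys (\<Sum>s\<in>F. ?f s) \<subseteq> S" if "finite F" "F \<subseteq> S" for F
    using that
  proof (induction F rule: finite_induct)
    case (insert s F)
    then have "Poly_Mapping.keys (?f s + (\<Sum>s\<in>F. ?f s)) \<subseteq> S"
      using Poly_Mapping.keys_add[of "?f s" "\<Sum>s\<in>F. ?f s"] by (auto split: if_splits)
    then show ?case using insert assms(3) by auto
  qed (simp add: assms(2))
  from this[OF _ assms(1)] show ?thesis using pm_decomp[of p] by simp
qed

lemma kap_mult: "kap cf (p * q) y = conv (kap cf p) (kap cf q) y"
proof -
  have "Poly_Mapping.keys p \<subseteq> UNIV" by simp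
  then show ?thesis
  proof (induction p rule: pm_induct)
    case zero then show ?case by (simp add: conv_def)
  next
    case (add p s c)
    have "kap cf (Poly_Mapping.single s c * q) y = conv (kap cf (Poly_Mapping.single s c)) (kap cf q) y"
    proof -
      have "Poly_Mapping.keys q \<subseteq> UNIV" by simp
      then show ?thesis
      proof (induction q rule: pm_induct)
        case zero then show ?case by (simp add: conv_def)
      next
        case (add q t c')
        have "conv (kap cf (Poly_Mapping.single s c)) (kap cf (Poly_Mapping.single t c')) y =
          (\<Sum>i\<le>length y. if i = length s then c * wm cf s (take i y) * (c' * wm cf t (drop i y)) else 0)"
          unfolding conv_def by (intro sum.cong) (auto simp: wm_length)
        also have "\<dots> = c * c' * wm cf (s @ t) y"
          by (auto simp: wm_append wm_length)
        finally have "kap cf (Poly_Mapping.single s c * Poly_Mapping.single t c') y =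
            conv (kap cf (Poly_Mapping.single s c)) (kap cf (Poly_Mapping.single t c')) y"
          by (simp add: mult_single plus_list_def)
        then show ?case using add
          by (simp add: distrib_left kap_add conv_def sum.distrib algebra_simps)
      qed
    qed
    then show ?case using add
      by (simp add: distrib_right kap_add conv_def sum.distrib algebra_simps)
  qed
qed

definition restr :: "('u list \<Rightarrow>\<^sub>0 'k::field) \<Rightarrow> nat \<Rightarrow> ('u list \<Rightarrow>\<^sub>0 'k)" where
  "restr p n = (\<Sum>s\<in>{s\<in>Poly_Mapping.keys p. length s = n}. Poly_Mapping.single s (Poly_Mapping.lookup p s))"

lemma lookup_restr: "Poly_Mapping.lookup (restr p n) s = (if length s = n then Poly_Mapping.lookup p s else 0)"
proof -
  have "Poly_Mapping.lookup (restr p n) s =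
    (\<Sum>t\<in>{s\<in>Poly_Mapping.keys p. length s = n}. if t = s then Poly_Mapping.lookup p s else 0)"
    unfolding restr_def lookup_sum by (intro sum.cong) (auto simp: lookup_single)
  then show ?thesis by (auto simp: in_keys_iff)
qed

lemma keys_restr: "Poly_Mapping.keys (restr p n) = {s \<in> Poly_Mapping.keys p. length s = n}"
  by (auto simp: in_keys_iff lookup_restr split: if_splits)

lemma restr_add: "restr (p + q) n = restr p n + restr q n"
  by (rule poly_mapping_eqI) (simp add: lookup_restr lookup_add)

lemma kap_restr: "kap cf (restr p n) y = (if length y = n then kap cf p y else 0)"
proof (cases "length y = n")
  case True
  have "kap cf p y = (\<Sum>s\<in>{s\<in>Poly_Mapping.keys p. length s = n}. Poly_Mapping.lookup p s * wm cf s y)"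
    unfolding kap_def using True by (intro sum.mono_neutral_right) (auto simp: wm_length)
  then show ?thesis using True unfolding kap_def keys_restr by (simp add: lookup_restr)
next
  case False
  then show ?thesis unfolding kap_def keys_restr by (auto intro!: sum.neutral simp: wm_length)
qed

lemma sum_restr:
  assumes "finite F" "length ` Poly_Mapping.keys p \<subseteq> F"
  shows "p = (\<Sum>n\<in>F. restr p n)"
proof (rule poly_mapping_eqI)
  fix s
  have "(\<Sum>n\<in>F. Poly_Mapping.lookup (restr p n) s) = (\<Sum>n\<in>F. if n = length s then Poly_Mapping.lookup p s else 0)"
    by (intro sum.cong) (auto simp: lookup_restr)
  then show "Poly_Mapping.lookup p s = Poly_Mapping.lookup (\<Sum>n\<in>F. restr p n) s"
    using assms by (auto simp: lookup_sum in_keys_iff image_subset_iff)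
qed

text \<open>The degree \<open>n\<close> component, in coordinates, of the annihilator of the ideal generated by the
  quadratic relations \<open>Rs\<close>.\<close>

definition Wsp :: "'b set \<Rightarrow> ('b list \<Rightarrow> 'k::field) set \<Rightarrow> nat \<Rightarrow> ('b list \<Rightarrow> 'k) set" where
  "Wsp X Rs n = {w. (\<forall>y. y \<notin> words X n \<longrightarrow> w y = 0) \<and>
     (\<forall>\<rho>\<in>Rs. \<forall>u v. (\<Sum>r\<in>words X 2. \<rho> r * w (u @ r @ v)) = 0)}"

lemma fsub_Wsp:
  fixes Rs :: "('b list \<Rightarrow> 'k::field) set"
  shows "finite X \<Longrightarrow> fsub (words X n) (Wsp X Rs n)"
proof -
  have "(\<Sum>r\<in>A. a r * (f r + g r)) = (\<Sum>r\<in>A. a r * f r) + (\<Sum>r\<in>A. a r * g r)" for A and a f g :: "'b list \<Rightarrow> 'k"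
    by (simp add: distrib_left sum.distrib)
  moreover have "(\<Sum>r\<in>A. a r * (c * f r)) = c * (\<Sum>r\<in>A. a r * f r)" for A c and a f :: "'b list \<Rightarrow> 'k"
    by (simp add: sum_distrib_left algebra_simps)
  ultimately show "finite X \<Longrightarrow> fsub (words X n) (Wsp X Rs n)"
    unfolding fsub_def Wsp_def by auto
qed

lemma Wsp_outside: "w \<in> Wsp X Rs n \<Longrightarrow> y \<notin> words X n \<Longrightarrow> w y = 0"
  by (simp add: Wsp_def)

lemma Wsp_rel: "w \<in> Wsp X Rs n \<Longrightarrow> \<rho> \<in> Rs \<Longrightarrow> (\<Sum>r\<in>words X 2. \<rho> r * w (u @ r @ v)) = 0"
  by (simp add: Wsp_def)

text \<open>The relations are imposed at every position of a word, so fixing a prefix and a suffix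
  preserves them. In dual terms this is the comultiplication matching the product of the quadratic
  algebra.\<close>

lemma Wsp_factor: "w \<in> Wsp X Rs m \<Longrightarrow> length u + n + length v = m \<Longrightarrow> (\<lambda>y. w (u @ y @ v)) \<in> Wsp X Rs n"
  unfolding Wsp_def
proof (intro CollectI conjI allI impI ballI)
  assume w: "w \<in> {w. (\<forall>y. y \<notin> words X m \<longrightarrow> w y = 0) \<and>
     (\<forall>\<rho>\<in>Rs. \<forall>u v. (\<Sum>r\<in>words X 2. \<rho> r * w (u @ r @ v)) = 0)}" and m: "length u + n + length v = m"
  show "w (u @ y @ v) = 0" if "y \<notin> words X n" for y
  proof -
    have "u @ y @ v \<notin> words X m" using that m by (auto simp: words_def)
    then show ?thesis using w by blast
  qed
  fix \<rho> u' v' assume "\<rho> \<in> Rs"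
  then have "(\<Sum>r\<in>words X 2. \<rho> r * w ((u @ u') @ r @ (v' @ v))) = 0" using w by blast
  then show "(\<Sum>r\<in>words X 2. \<rho> r * w (u @ (u' @ r @ v') @ v)) = 0" by simp
qed

lemmas Wsp_prefix = Wsp_factor[where v = "[]", simplified]
lemmas Wsp_suffix = Wsp_factor[where u = "[]", simplified]

section \<open>Free algebras\<close>

lemma free_alg_simps [simp]:
  "carrier (free_alg W) = {p. Poly_Mapping.keys p \<subseteq> lists W}"
  "p \<otimes>\<^bsub>free_alg W\<^esub> q = p * q" "\<one>\<^bsub>free_alg W\<^esub> = 1" "\<zero>\<^bsub>free_alg W\<^esub> = 0" "p \<oplus>\<^bsub>free_alg W\<^esub> q = p + q"
  "c \<odot>\<^bsub>free_alg W\<^esub> p = Poly_Mapping.single [] c * p"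
  "deg (free_alg W) i = {p. Poly_Mapping.keys p \<subseteq> {w \<in> lists W. int (length w) = i}}"
  by (simp_all add: free_alg_def mult_map_scale_conv_mult zero_list_def)

lemma single_scalar_commute: "p * Poly_Mapping.single [] c = Poly_Mapping.single [] c * (p :: 'u list \<Rightarrow>\<^sub>0 'k::field)"
proof -
  have "Poly_Mapping.keys p \<subseteq> UNIV" by simp
  then show ?thesis
    by (induction p rule: pm_induct) (auto simp: distrib_left distrib_right mult_single plus_list_def mult.commute)
qed

lemma keys_mult_lists: "Poly_Mapping.keys p \<subseteq> lists W \<Longrightarrow> Poly_Mapping.keys q \<subseteq> lists W \<Longrightarrow>
  Poly_Mapping.keys (p * q) \<subseteq> lists W" for p q :: "'u list \<Rightarrow>\<^sub>0 'k::field"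
  using keys_mult[of p q] by (fastforce simp: plus_list_def)

lemma kalg_free: "kalg (free_alg W :: ('k::field, 'v list \<Rightarrow>\<^sub>0 'k) graded_algebra)"
proof -
  let ?F = "free_alg W :: ('k::field, 'v list \<Rightarrow>\<^sub>0 'k) graded_algebra"
  have add: "Poly_Mapping.keys (p + q) \<subseteq> lists W" if "Poly_Mapping.keys p \<subseteq> lists W" "Poly_Mapping.keys q \<subseteq> lists W"
    for p q :: "'v list \<Rightarrow>\<^sub>0 'k" using Poly_Mapping.keys_add[of p q] that by blast
  have "ring ?F"
  proof (rule ringI)
    show "abelian_group ?F"
    proof (rule abelian_groupI)
      fix p assume "p \<in> carrier ?F"
      then show "\<exists>q\<in>carrier ?F. q \<oplus>\<^bsub>?F\<^esub> p = \<zero>\<^bsub>?F\<^esub>" by (intro bexI[of _ "- p"]) auto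
    qed (simp_all add: add add_ac)
    show "Group.monoid ?F"
    proof (rule monoidI)
      show "\<one>\<^bsub>?F\<^esub> \<in> carrier ?F" by (auto simp: zero_list_def simp flip: single_one)
    qed (simp_all add: keys_mult_lists mult.assoc)
  qed (auto simp: algebra_simps)
  show ?thesis
  proof (intro kalg.intro kalg_axioms.intro)
    show "ring ?F" by fact
  next
    fix x :: "'v list \<Rightarrow>\<^sub>0 'k" and c assume "x \<in> carrier ?F"
    then show "c \<odot>\<^bsub>?F\<^esub> x \<in> carrier ?F" by (simp add: keys_mult_lists)
  next
    fix x y :: "'v list \<Rightarrow>\<^sub>0 'k" and c
    show "c \<odot>\<^bsub>?F\<^esub> (x \<oplus>\<^bsub>?F\<^esub> y) = c \<odot>\<^bsub>?F\<^esub> x \<oplus>\<^bsub>?F\<^esub> c \<odot>\<^bsub>?F\<^esub> y" by (simp add: distrib_left)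
    show "(c \<odot>\<^bsub>?F\<^esub> x) \<otimes>\<^bsub>?F\<^esub> y = c \<odot>\<^bsub>?F\<^esub> (x \<otimes>\<^bsub>?F\<^esub> y)" by (simp add: mult.assoc)
    have "x * (Poly_Mapping.single [] c * y) = (x * Poly_Mapping.single [] c) * y" by (simp only: mult.assoc)
    then show "x \<otimes>\<^bsub>?F\<^esub> (c \<odot>\<^bsub>?F\<^esub> y) = c \<odot>\<^bsub>?F\<^esub> (x \<otimes>\<^bsub>?F\<^esub> y)"
      by (simp add: single_scalar_commute mult.assoc)
  next
    fix x :: "'v list \<Rightarrow>\<^sub>0 'k" and c c'
    show "(c + c') \<odot>\<^bsub>?F\<^esub> x = c \<odot>\<^bsub>?F\<^esub> x \<oplus>\<^bsub>?F\<^esub> c' \<odot>\<^bsub>?F\<^esub> x" by (simp add: single_add distrib_right)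
    have "Poly_Mapping.single [] (c * c') = Poly_Mapping.single [] c * (Poly_Mapping.single [] c' :: 'v list \<Rightarrow>\<^sub>0 'k)"
      by (simp add: mult_single plus_list_def)
    then show "(c * c') \<odot>\<^bsub>?F\<^esub> x = c \<odot>\<^bsub>?F\<^esub> (c' \<odot>\<^bsub>?F\<^esub> x)" by (simp add: mult.assoc)
    have "Poly_Mapping.single [] 1 = (1 :: 'v list \<Rightarrow>\<^sub>0 'k)" by (metis single_one zero_list_def)
    then show "1 \<odot>\<^bsub>?F\<^esub> x = x" by simp
  qed
qed

section \<open>Quadratic algebras in coordinates\<close>

lemma dp_conv:
  assumes "finite X"
  shows "dp (words X n) (conv c c') w =
    (\<Sum>i\<le>n. \<Sum>u\<in>words X i. \<Sum>v\<in>words X (n - i). c u * c' v * w (u @ v))"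
proof -
  have "dp (words X n) (conv c c') w = (\<Sum>y\<in>words X n. \<Sum>i\<le>n. c (take i y) * c' (drop i y) * w y)"
    unfolding dp_def conv_def by (intro sum.cong) (auto simp: words_length sum_distrib_right)
  also have "\<dots> = (\<Sum>i\<le>n. \<Sum>y\<in>words X n. c (take i y) * c' (drop i y) * w y)" by (rule sum.swap)
  also have "\<dots> = (\<Sum>i\<le>n. \<Sum>u\<in>words X i. \<Sum>v\<in>words X (n - i). c u * c' v * w (u @ v))"
  proof (rule sum.cong[OF refl])
    fix i assume "i \<in> {..n}"
    then have "n = i + (n - i)" by simp
    then have "(\<Sum>y\<in>words X n. c (take i y) * c' (drop i y) * w y) =
       (\<Sum>y\<in>words X (i + (n - i)). c (take i y) * c' (drop i y) * w y)" by simp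
    also have "\<dots> = (\<Sum>u\<in>words X i. \<Sum>v\<in>words X (n - i). c u * c' v * w (u @ v))"
      unfolding sum_words_append[OF assms] by (intro sum.cong) (auto simp: words_length)
    finally show "(\<Sum>y\<in>words X n. c (take i y) * c' (drop i y) * w y) =
      (\<Sum>u\<in>words X i. \<Sum>v\<in>words X (n - i). c u * c' v * w (u @ v))" .
  qed
  finally show ?thesis .
qed

text \<open>Used twice: for \<open>V\<close> with basis vectors \<open>g b = b\<close>, and for its
  dual with the dual basis, where the coordinates of a functional are its values on the basis of
  \<open>V\<close>. Both share the index set \<open>X\<close>, so words and the pairing
  \<open>dp\<close> are common to the algebra and its dual.\<close>

locale coord =
  fixes scale :: "'k::field \<Rightarrow> 'u::ab_group_add \<Rightarrow> 'u" and W :: "'u set" and X :: "'b set"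
    and g :: "'b \<Rightarrow> 'u" and cf :: "'u \<Rightarrow> 'b \<Rightarrow> 'k" and R :: "('u list \<Rightarrow>\<^sub>0 'k) set set"
  assumes finX [simp]: "finite X" and g_in: "b \<in> X \<Longrightarrow> g b \<in> W"
    and W0: "0 \<in> W" and W_add: "u \<in> W \<Longrightarrow> w \<in> W \<Longrightarrow> u + w \<in> W" and W_scale: "u \<in> W \<Longrightarrow> scale c u \<in> W"
    and cf_add: "u \<in> W \<Longrightarrow> w \<in> W \<Longrightarrow> cf (u + w) b = cf u b + cf w b"
    and cf_scale: "u \<in> W \<Longrightarrow> cf (scale c u) b = c * cf u b"
    and cf_expand: "u \<in> W \<Longrightarrow> u = (\<Sum>b\<in>X. scale (cf u b) (g b))"
    and cf_g: "b \<in> X \<Longrightarrow> b' \<in> X \<Longrightarrow> cf (g b) b' = (if b = b' then 1 else 0)"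
    and R_deg: "R \<subseteq> deg (tensor_algebra scale W) 2"
begin

abbreviation FA :: "('k, 'u list \<Rightarrow>\<^sub>0 'k) graded_algebra" where "FA \<equiv> free_alg W"
abbreviation LR where "LR \<equiv> lin_rels scale W"
abbreviation TA where "TA \<equiv> tensor_algebra scale W"
abbreviation QA where "QA \<equiv> quadratic_algebra scale W R"

definition tproj where "tproj = quot_proj FA LR"
definition proj where "proj p = quot_proj TA R (tproj p)"
definition Rs where "Rs = {\<rho>. \<exists>r\<in>R. \<exists>p\<in>r. \<rho> = kap cf p}"

abbreviation isF where "isF p \<equiv> Poly_Mapping.keys p \<subseteq> lists W"
abbreviation Wn where "Wn n \<equiv> Wsp X Rs n"
abbreviation s1 :: "'u list \<Rightarrow> ('u list \<Rightarrow>\<^sub>0 'k)" where "s1 s \<equiv> Poly_Mapping.single s 1"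

sublocale FA: kalg FA by (rule kalg_free)

lemma isF_add: "isF p \<Longrightarrow> isF q \<Longrightarrow> isF (p + q)" for p q :: "'u list \<Rightarrow>\<^sub>0 'k"
  using Poly_Mapping.keys_add[of p q] by blast

lemma isF_diff: "isF p \<Longrightarrow> isF q \<Longrightarrow> isF (p - q)" for p q :: "'u list \<Rightarrow>\<^sub>0 'k"
  using Poly_Mapping.keys_diff[of p q] by blast

lemma isF_mult: "isF p \<Longrightarrow> isF q \<Longrightarrow> isF (p * q)" for p q :: "'u list \<Rightarrow>\<^sub>0 'k"
  by (rule keys_mult_lists)

lemma isF_single: "s \<in> lists W \<Longrightarrow> isF (Poly_Mapping.single s c)" for c :: 'k
  by simp

lemma FA_minus: "isF p \<Longrightarrow> isF q \<Longrightarrow> p \<ominus>\<^bsub>FA\<^esub> q = p - q" for p q :: "'u list \<Rightarrow>\<^sub>0 'k"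
proof -
  assume "isF p" "isF q"
  then have "\<ominus>\<^bsub>FA\<^esub> q = - q" by (intro FA.minus_equality) auto
  then show ?thesis by (simp add: a_minus_def)
qed

lemma LR_sub: "LR \<subseteq> carrier FA"
proof
  fix p assume "p \<in> LR"
  then have "isF p"
    unfolding lin_rels_def
  proof (elim UnE CollectE exE conjE)
    fix u w assume p: "p = s1 [u + w] - s1 [u] - s1 [w]" "u \<in> W" "w \<in> W"
    show ?thesis unfolding p(1) by (intro isF_diff isF_single) (simp_all add: p W_add)
  next
    fix c u assume p: "p = s1 [scale c u] - Poly_Mapping.single [u] c" "u \<in> W"
    show ?thesis unfolding p(1) by (intro isF_diff isF_single) (simp_all add: p W_scale)
  qed
  then show "p \<in> carrier FA" by simp
qed

sublocale TA: kalg TA unfolding tensor_algebra_def by (rule FA.kalg_quot[OF LR_sub])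

lemma TA_simps:
  "carrier TA = tproj ` carrier FA" "deg TA i = tproj ` deg FA i" "\<zero>\<^bsub>TA\<^esub> = tproj 0" "\<one>\<^bsub>TA\<^esub> = tproj 1"
  unfolding tensor_algebra_def tproj_def FA.Q_simps[OF LR_sub] by simp_all

lemma deg_FA_sub: "deg FA i \<subseteq> carrier FA" by auto

lemma R_sub: "R \<subseteq> carrier TA"
  using R_deg deg_FA_sub[of 2] unfolding TA_simps by blast

sublocale QA: kalg QA unfolding quadratic_algebra_def by (rule TA.kalg_quot[OF R_sub])

lemma tproj_closed: "isF p \<Longrightarrow> tproj p \<in> carrier TA"
  unfolding TA_simps by auto

lemma tproj_ops:
  "isF p \<Longrightarrow> isF q \<Longrightarrow> tproj p \<oplus>\<^bsub>TA\<^esub> tproj q = tproj (p + q)"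
  "isF p \<Longrightarrow> isF q \<Longrightarrow> tproj p \<otimes>\<^bsub>TA\<^esub> tproj q = tproj (p * q)"
  "isF p \<Longrightarrow> c \<odot>\<^bsub>TA\<^esub> tproj p = tproj (Poly_Mapping.single [] c * p)"
  using FA.q_add[OF LR_sub, of p q] FA.q_mult[OF LR_sub, of p q] FA.q_smult[OF LR_sub, of p]
  by (simp_all add: tensor_algebra_def tproj_def)

lemma proj_simps:
  "carrier QA = proj ` carrier FA" "deg QA i = proj ` deg FA i" "\<zero>\<^bsub>QA\<^esub> = proj 0" "\<one>\<^bsub>QA\<^esub> = proj 1"
  unfolding quadratic_algebra_def TA.Q_simps[OF R_sub] TA_simps by (simp_all add: proj_def image_image)

lemma proj_closed: "isF p \<Longrightarrow> proj p \<in> carrier QA"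
  unfolding proj_simps by auto

lemma proj_surj: "a \<in> carrier QA \<Longrightarrow> \<exists>p. isF p \<and> a = proj p"
  unfolding proj_simps by auto

lemma proj_add: "isF p \<Longrightarrow> isF q \<Longrightarrow> proj (p + q) = proj p \<oplus>\<^bsub>QA\<^esub> proj q"
  and proj_mult: "isF p \<Longrightarrow> isF q \<Longrightarrow> proj (p * q) = proj p \<otimes>\<^bsub>QA\<^esub> proj q"
  and proj_smult: "isF p \<Longrightarrow> proj (Poly_Mapping.single [] c * p) = c \<odot>\<^bsub>QA\<^esub> proj p"
  using TA.q_add[OF R_sub, of "tproj p" "tproj q"] TA.q_mult[OF R_sub, of "tproj p" "tproj q"]
    TA.q_smult[OF R_sub, of "tproj p"] tproj_closed
  by (simp_all add: quadratic_algebra_def proj_def tproj_ops)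

lemma proj_single: "s \<in> lists W \<Longrightarrow> proj (Poly_Mapping.single s c) = c \<odot>\<^bsub>QA\<^esub> proj (s1 s)"
proof -
  assume "s \<in> lists W"
  moreover have "Poly_Mapping.single [] c * s1 s = Poly_Mapping.single s c"
    by (simp add: mult_single plus_list_def)
  ultimately show ?thesis using proj_smult[of "s1 s" c] by simp
qed

lemma proj_append: "s \<in> lists W \<Longrightarrow> t \<in> lists W \<Longrightarrow> proj (s1 (s @ t)) = proj (s1 s) \<otimes>\<^bsub>QA\<^esub> proj (s1 t)"
  using proj_mult[of "s1 s" "s1 t"] by (simp add: mult_single plus_list_def)

lemma proj_Nil: "proj (s1 []) = \<one>\<^bsub>QA\<^esub>"
  unfolding proj_simps by (metis single_one zero_list_def)

lemma gen_proj: "gen scale W R w = proj (s1 [w])"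
  by (simp add: gen_def proj_def tproj_def)

lemma tproj_rel:
  assumes "p - q \<in> LR" "isF p" "isF q"
  shows "tproj p = tproj q"
  unfolding tproj_def using assms FA.quot_eq[OF LR_sub, of p q] FA.genideal_self[OF LR_sub] FA_minus[of p q] by auto

lemma proj_gen_add: "u \<in> W \<Longrightarrow> w \<in> W \<Longrightarrow> proj (s1 [u + w]) = proj (s1 [u]) \<oplus>\<^bsub>QA\<^esub> proj (s1 [w])"
proof -
  assume uw: "u \<in> W" "w \<in> W"
  have "tproj (s1 [u + w]) = tproj (s1 [u] + s1 [w])"
    using uw W_add by (intro tproj_rel isF_add) (auto simp: lin_rels_def algebra_simps)
  then have "proj (s1 [u + w]) = proj (s1 [u] + s1 [w])" by (simp add: proj_def)
  then show ?thesis using uw proj_add[of "s1 [u]" "s1 [w]"] by simp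
qed

lemma proj_gen_scale: "u \<in> W \<Longrightarrow> proj (s1 [scale c u]) = c \<odot>\<^bsub>QA\<^esub> proj (s1 [u])"
proof -
  assume u: "u \<in> W"
  have "s1 [scale c u] - Poly_Mapping.single [u] c \<in> LR" using u unfolding lin_rels_def by blast
  then have "tproj (s1 [scale c u]) = tproj (Poly_Mapping.single [u] c)"
    using u W_scale by (intro tproj_rel) auto
  then have "proj (s1 [scale c u]) = proj (Poly_Mapping.single [u] c)" by (simp add: proj_def)
  then show ?thesis using u proj_single[of "[u]" c] by simp
qed

lemma proj_gen_closed [simp]: "w \<in> W \<Longrightarrow> proj (s1 [w]) \<in> carrier QA"
  by (intro proj_closed) simp

lemma proj_gen_zero: "proj (s1 [0]) = \<zero>\<^bsub>QA\<^esub>"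
  using proj_gen_add[OF W0 W0] proj_gen_closed[OF W0] by (simp add: QA.add.r_cancel_one)

lemma W_sum: "(\<And>b. b \<in> Y \<Longrightarrow> h b \<in> W) \<Longrightarrow> (\<Sum>b\<in>Y. scale (c b) (h b)) \<in> W"
  by (induction Y rule: infinite_finite_induct) (auto simp: W0 W_add W_scale)

lemma proj_gen_sum:
  assumes "\<And>b. b \<in> Y \<Longrightarrow> h b \<in> W"
  shows "proj (s1 [\<Sum>b\<in>Y. scale (c b) (h b)]) = (\<Oplus>\<^bsub>QA\<^esub>b\<in>Y. c b \<odot>\<^bsub>QA\<^esub> proj (s1 [h b]))"
  using assms
proof (induction Y rule: infinite_finite_induct)
  case (insert b Y)
  then have "proj (s1 [\<Sum>b\<in>insert b Y. scale (c b) (h b)]) =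
     c b \<odot>\<^bsub>QA\<^esub> proj (s1 [h b]) \<oplus>\<^bsub>QA\<^esub> (\<Oplus>\<^bsub>QA\<^esub>b\<in>Y. c b \<odot>\<^bsub>QA\<^esub> proj (s1 [h b]))"
    by (simp add: proj_gen_add proj_gen_scale W_scale W_sum)
  also have "\<dots> = (\<Oplus>\<^bsub>QA\<^esub>b\<in>insert b Y. c b \<odot>\<^bsub>QA\<^esub> proj (s1 [h b]))"
    using insert by (intro QA.finsum_insert[symmetric]) auto
  finally show ?case .
qed (simp_all add: proj_gen_zero)

definition xw where "xw y = proj (s1 (map g y))"

lemma g_lists: "y \<in> lists X \<Longrightarrow> map g y \<in> lists W"
  by (induction y) (auto intro: g_in)

lemma words_lists: "y \<in> words X n \<Longrightarrow> y \<in> lists X"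
  by (simp add: words_def)

lemma xw_closed: "y \<in> lists X \<Longrightarrow> xw y \<in> carrier QA"
  unfolding xw_def by (intro proj_closed isF_single g_lists)

lemma xw_words [simp]: "y \<in> words X n \<Longrightarrow> xw y \<in> carrier QA"
  by (rule xw_closed[OF words_lists])

lemma xw_append: "u \<in> lists X \<Longrightarrow> v \<in> lists X \<Longrightarrow> xw (u @ v) = xw u \<otimes>\<^bsub>QA\<^esub> xw v"
  unfolding xw_def map_append by (intro proj_append g_lists)

lemma xw_Nil: "xw [] = \<one>\<^bsub>QA\<^esub>"
  by (simp add: xw_def proj_Nil)

lemma xw_Cons: "b \<in> X \<Longrightarrow> y \<in> lists X \<Longrightarrow> xw (b # y) = xw [b] \<otimes>\<^bsub>QA\<^esub> xw y"
  using xw_append[of "[b]" y] by simp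

lemma xw_single [simp]: "b \<in> X \<Longrightarrow> xw [b] \<in> carrier QA"
  by (intro xw_closed) simp

lemma proj_gen_expand: "u \<in> W \<Longrightarrow> proj (s1 [u]) = (\<Oplus>\<^bsub>QA\<^esub>b\<in>X. cf u b \<odot>\<^bsub>QA\<^esub> xw [b])"
  using proj_gen_sum[of X g "cf u"] g_in cf_expand[of u] by (simp add: xw_def)

lemma proj_word_expand:
  "s \<in> lists W \<Longrightarrow> proj (s1 s) = (\<Oplus>\<^bsub>QA\<^esub>y\<in>words X (length s). wm cf s y \<odot>\<^bsub>QA\<^esub> xw y)"
proof (induction s)
  case Nil
  show ?case
    using QA.finsum_delta[of "{[]}" "[]" "\<lambda>y. wm cf [] y \<odot>\<^bsub>QA\<^esub> xw y"] by (simp add: proj_Nil xw_Nil)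
next
  case (Cons a s)
  then have a: "a \<in> W" and s: "s \<in> lists W" by auto
  let ?n = "length s"
  have "proj (s1 (a # s)) = proj (s1 [a]) \<otimes>\<^bsub>QA\<^esub> proj (s1 s)"
    using proj_append[of "[a]" s] a s by simp
  also have "\<dots> = (\<Oplus>\<^bsub>QA\<^esub>b\<in>X. cf a b \<odot>\<^bsub>QA\<^esub> xw [b]) \<otimes>\<^bsub>QA\<^esub> (\<Oplus>\<^bsub>QA\<^esub>y\<in>words X ?n. wm cf s y \<odot>\<^bsub>QA\<^esub> xw y)"
    using Cons.IH s proj_gen_expand[OF a] by simp
  also have "\<dots> = (\<Oplus>\<^bsub>QA\<^esub>b\<in>X. \<Oplus>\<^bsub>QA\<^esub>y\<in>words X ?n. (cf a b \<odot>\<^bsub>QA\<^esub> xw [b]) \<otimes>\<^bsub>QA\<^esub> (wm cf s y \<odot>\<^bsub>QA\<^esub> xw y))"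
    by (subst QA.finsum_rmult) (auto intro!: QA.finsum_closed QA.finsum_cong2 simp: QA.finsum_lmult)
  also have "\<dots> = (\<Oplus>\<^bsub>QA\<^esub>b\<in>X. \<Oplus>\<^bsub>QA\<^esub>y\<in>words X ?n. wm cf (a # s) (b # y) \<odot>\<^bsub>QA\<^esub> xw (b # y))"
  proof (intro QA.finsum_cong2)
    fix b y assume b: "b \<in> X" and y: "y \<in> words X ?n"
    show "(cf a b \<odot>\<^bsub>QA\<^esub> xw [b]) \<otimes>\<^bsub>QA\<^esub> (wm cf s y \<odot>\<^bsub>QA\<^esub> xw y) = wm cf (a # s) (b # y) \<odot>\<^bsub>QA\<^esub> xw (b # y)"
      using b y xw_Cons[OF b words_lists[OF y]]
      by (simp add: QA.ksm_multl QA.ksm_multr QA.ksm_assoc[symmetric] mult.commute)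
    show "wm cf (a # s) (b # y) \<odot>\<^bsub>QA\<^esub> xw (b # y) \<in> carrier QA"
      using b words_lists[OF y] by (intro QA.ksm_closed xw_closed) auto
  next
    fix b assume b: "b \<in> X"
    show "(\<Oplus>\<^bsub>QA\<^esub>y\<in>words X ?n. wm cf (a # s) (b # y) \<odot>\<^bsub>QA\<^esub> xw (b # y)) \<in> carrier QA"
      using b words_lists by (intro QA.finsum_closed funcsetI QA.ksm_closed xw_closed) auto
  qed
  also have "\<dots> = (\<Oplus>\<^bsub>QA\<^esub>y\<in>words X (length (a # s)). wm cf (a # s) y \<odot>\<^bsub>QA\<^esub> xw y)"
    using QA.finsum_words_Suc[OF finX, of ?n "\<lambda>y. wm cf (a # s) y \<odot>\<^bsub>QA\<^esub> xw y"] by (simp del: wm.simps)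
  finally show ?case .
qed

lemma proj_zero: "proj 0 = \<zero>\<^bsub>QA\<^esub>" by (simp add: proj_simps)

lemma proj_homog_expand:
  assumes "Poly_Mapping.keys p \<subseteq> {s \<in> lists W. length s = n}"
  shows "proj p = (\<Oplus>\<^bsub>QA\<^esub>y\<in>words X n. kap cf p y \<odot>\<^bsub>QA\<^esub> xw y)"
  using assms
proof (induction p rule: pm_induct)
  case zero
  show ?case by (simp add: proj_zero QA.finsum_zeroI)
next
  case (add q s c)
  then have s: "s \<in> lists W" "length s = n" and q: "isF q" by auto
  have "proj (Poly_Mapping.single s c + q) = c \<odot>\<^bsub>QA\<^esub> proj (s1 s) \<oplus>\<^bsub>QA\<^esub> proj q"
    using proj_add[of "Poly_Mapping.single s c" q] s q proj_single[OF s(1), of c] by simp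
  also have "\<dots> = (\<Oplus>\<^bsub>QA\<^esub>y\<in>words X n. (c * wm cf s y) \<odot>\<^bsub>QA\<^esub> xw y) \<oplus>\<^bsub>QA\<^esub> (\<Oplus>\<^bsub>QA\<^esub>y\<in>words X n. kap cf q y \<odot>\<^bsub>QA\<^esub> xw y)"
    using add.IH proj_word_expand[OF s(1)] s(2)
    by (simp add: QA.ksm_finsum QA.ksm_assoc cong: QA.finsum_cong)
  also have "\<dots> = (\<Oplus>\<^bsub>QA\<^esub>y\<in>words X n. (c * wm cf s y) \<odot>\<^bsub>QA\<^esub> xw y \<oplus>\<^bsub>QA\<^esub> kap cf q y \<odot>\<^bsub>QA\<^esub> xw y)"
    by (intro QA.finsum_addf[symmetric]) auto
  also have "\<dots> = (\<Oplus>\<^bsub>QA\<^esub>y\<in>words X n. kap cf (Poly_Mapping.single s c + q) y \<odot>\<^bsub>QA\<^esub> xw y)"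
    by (intro QA.finsum_cong2) (auto simp: kap_add QA.ksm_ladd)
  finally show ?case .
qed

lemma kap_mult_zero: "(\<And>y. kap cf p y = 0) \<Longrightarrow> kap cf (p * q) y = 0 \<and> kap cf (q * p) y = 0"
  by (simp add: kap_mult conv_def)

section \<open>The ideal of relations and its annihilator\<close>

lemma kap_LR: "p \<in> Idl\<^bsub>FA\<^esub> LR \<Longrightarrow> kap cf p y = 0"
proof -
  have "ideal {p \<in> carrier FA. \<forall>y. kap cf p y = 0} FA"
  proof (rule idealI_closed)
    show "{p \<in> carrier FA. \<forall>y. kap cf p y = 0} \<subseteq> carrier FA" by blast
  qed (simp_all add: FA.ring_axioms kap_add kap_mult_zero isF_mult isF_add)
  moreover have "LR \<subseteq> {p \<in> carrier FA. \<forall>y. kap cf p y = 0}"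
  proof
    fix p assume p: "p \<in> LR"
    have "kap cf p y = 0" for y
      using p unfolding lin_rels_def
    proof (elim UnE CollectE exE conjE)
      fix u w assume "p = s1 [u + w] - s1 [u] - s1 [w]" "u \<in> W" "w \<in> W"
      then show ?thesis by (cases y) (simp_all add: kap_diff cf_add distrib_right)
    next
      fix c u assume "p = s1 [scale c u] - Poly_Mapping.single [u] c" "u \<in> W"
      then show ?thesis by (cases y) (simp_all add: kap_diff cf_scale)
    qed
    then show "p \<in> {p \<in> carrier FA. \<forall>y. kap cf p y = 0}" using p LR_sub by blast
  qed
  ultimately have "Idl\<^bsub>FA\<^esub> LR \<subseteq> {p \<in> carrier FA. \<forall>y. kap cf p y = 0}" by (rule FA.I_minimal[OF LR_sub])
  then show "p \<in> Idl\<^bsub>FA\<^esub> LR \<Longrightarrow> kap cf p y = 0" by blast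
qed

lemma kap_tproj: "isF p \<Longrightarrow> isF q \<Longrightarrow> tproj p = tproj q \<Longrightarrow> kap cf p y = kap cf q y"
  using FA.quot_eq[OF LR_sub, of p q] kap_LR[of "p - q" y] FA_minus[of p q] by (simp add: tproj_def kap_diff)

text \<open>The coordinate form of membership in the ideal generated by \<open>R\<close>, as
  \<open>proj_zero_iff\<close> will show.\<close>

definition vanish where "vanish c \<longleftrightarrow> (\<forall>n. \<forall>w\<in>Wn n. dp (words X n) c w = 0)"

lemma vanish_add: "vanish c \<Longrightarrow> vanish c' \<Longrightarrow> vanish (\<lambda>y. c y + c' y)"
  by (simp add: vanish_def dp_def distrib_right sum.distrib)

text \<open>The pairing in degree \<open>n\<close> splits over the cuts of a word. With one part
  fixed, an element of \<open>W\<close> stays in \<open>W\<close> as a function of the other part,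
  so the part carrying \<open>c\<close> contributes zero.\<close>

lemma vanish_conv:
  assumes "vanish c"
  shows "vanish (conv c c')" "vanish (conv c' c)"
proof -
  have "(\<Sum>u\<in>words X i. \<Sum>v\<in>words X (n - i). c' u * c v * w (u @ v)) = 0"
    and "(\<Sum>u\<in>words X i. \<Sum>v\<in>words X (n - i). c u * c' v * w (u @ v)) = 0" if "w \<in> Wn n" "i \<le> n" for w i n
  proof -
    have "(\<Sum>v\<in>words X (n - i). c' u * c v * w (u @ v)) = 0" if u: "u \<in> words X i" for u
    proof -
      have "(\<lambda>v. w (u @ v)) \<in> Wn (n - i)"
        using \<open>w \<in> Wn n\<close> \<open>i \<le> n\<close> u by (intro Wsp_prefix) (auto simp: words_length)
      then have "c' u * dp (words X (n - i)) c (\<lambda>v. w (u @ v)) = 0" using assms by (simp add: vanish_def)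
      then show ?thesis by (simp add: dp_def sum_distrib_left mult.assoc)
    qed
    then show "(\<Sum>u\<in>words X i. \<Sum>v\<in>words X (n - i). c' u * c v * w (u @ v)) = 0" by simp
    have "(\<Sum>u\<in>words X i. c u * c' v * w (u @ v)) = 0" if v: "v \<in> words X (n - i)" for v
    proof -
      have "(\<lambda>u. w (u @ v)) \<in> Wn i"
        using \<open>w \<in> Wn n\<close> \<open>i \<le> n\<close> v by (intro Wsp_suffix) (auto simp: words_length)
      then have "c' v * dp (words X i) c (\<lambda>u. w (u @ v)) = 0" using assms by (simp add: vanish_def)
      then show ?thesis by (simp add: dp_def sum_distrib_left algebra_simps)
    qed
    then show "(\<Sum>u\<in>words X i. \<Sum>v\<in>words X (n - i). c u * c' v * w (u @ v)) = 0"
      by (subst sum.swap) simp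
  qed
  then show "vanish (conv c c')" "vanish (conv c' c)"
    by (auto simp: vanish_def dp_conv intro!: sum.neutral)
qed

lemma R_repr: "r \<in> R \<Longrightarrow> \<exists>p. r = tproj p \<and> Poly_Mapping.keys p \<subseteq> {s \<in> lists W. length s = 2} \<and> kap cf p \<in> Rs"
proof -
  assume r: "r \<in> R"
  then obtain p where p: "r = tproj p" "p \<in> deg FA 2" using R_deg unfolding TA_simps by blast
  have "p \<in> r" unfolding p(1) tproj_def using p(2) by (intro FA.quot_self[OF LR_sub]) auto
  then have "kap cf p \<in> Rs" using r unfolding Rs_def by blast
  then show ?thesis using p by (intro exI[of _ p]) auto
qed

text \<open>The tensors whose coordinates vanish on \<open>W\<close> form a two-sided ideal by
  \<open>vanish_conv\<close>, and it contains \<open>R\<close> because \<open>R\<close> annihilates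
  \<open>W\<close> in degree two and has no coordinates in other degrees.\<close>

lemma vanish_ideal:
  assumes "isF p" "tproj p \<in> Idl\<^bsub>TA\<^esub> R"
  shows "vanish (kap cf p)"
proof -
  \<comment> \<open>Defined through all representatives of a tensor; since coordinates do not depend
    on the representative, \<open>key\<close> allows membership to be checked on one of
    them.\<close>
  let ?J = "{t \<in> carrier TA. \<forall>p. isF p \<longrightarrow> tproj p = t \<longrightarrow> vanish (kap cf p)}"
  have key: "t \<in> ?J" if p: "isF p" "t = tproj p" "vanish (kap cf p)" for t p
  proof -
    have "vanish (kap cf q)" if "isF q" "tproj q = t" for q
    proof -
      have "kap cf q = kap cf p"
        using kap_tproj[OF that(1) p(1)] that p(2) by (intro ext) simp
      then show ?thesis using p(3) by simp
    qed
    moreover have "t \<in> carrier TA" unfolding p(2) by (rule tproj_closed[OF p(1)])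
    ultimately show ?thesis by blast
  qed
  have rep: "\<exists>p. isF p \<and> t = tproj p" if "t \<in> carrier TA" for t
    using that unfolding TA_simps by auto
  have JD: "vanish (kap cf p)" if "t \<in> ?J" "isF p" "t = tproj p" for t p
    using that by simp
  have Jc: "t \<in> carrier TA" if "t \<in> ?J" for t using that by simp
  have "ideal ?J TA"
  proof (rule idealI_closed)
    show "\<zero>\<^bsub>TA\<^esub> \<in> ?J" by (rule key[of 0]) (auto simp: TA_simps vanish_def dp_def)
    fix x y assume x: "x \<in> ?J" and y: "y \<in> ?J"
    obtain p where p: "isF p" "x = tproj p" using rep[OF Jc[OF x]] by blast
    obtain q where q: "isF q" "y = tproj q" using rep[OF Jc[OF y]] by blast
    have "vanish (kap cf (p + q))"
      using vanish_add[OF JD[OF x p] JD[OF y q]] kap_add[of cf p q] by presburger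
    then show "x \<oplus>\<^bsub>TA\<^esub> y \<in> ?J" using p q isF_add by (intro key[of "p + q"]) (simp_all add: tproj_ops)
  next
    fix a x assume a: "a \<in> carrier TA" and x: "x \<in> ?J"
    obtain p where p: "isF p" "x = tproj p" using rep[OF Jc[OF x]] by blast
    obtain q where q: "isF q" "a = tproj q" using rep[OF a] by blast
    have px: "vanish (kap cf p)" by (rule JD[OF x p])
    have "vanish (kap cf (p * q))" "vanish (kap cf (q * p))"
      using vanish_conv[OF px] kap_mult[of cf] by presburger+
    then show "a \<otimes>\<^bsub>TA\<^esub> x \<in> ?J" "x \<otimes>\<^bsub>TA\<^esub> a \<in> ?J"
      using p q isF_mult by (intro key[of "q * p"] key[of "p * q"]; simp add: tproj_ops)+
  qed (auto simp: TA.ring_axioms)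
  moreover have "R \<subseteq> ?J"
  proof
    fix r assume "r \<in> R"
    then obtain p where p: "r = tproj p" "Poly_Mapping.keys p \<subseteq> {s \<in> lists W. length s = 2}" "kap cf p \<in> Rs"
      using R_repr by blast
    have "vanish (kap cf p)"
      unfolding vanish_def
    proof (intro allI ballI)
      fix n w assume w: "w \<in> Wn n"
      show "dp (words X n) (kap cf p) w = 0"
      proof (cases "n = 2")
        case True
        then show ?thesis using Wsp_rel[OF w p(3), of "[]" "[]"] by (simp add: dp_def)
      next
        case False
        have "kap cf p y = 0" if "y \<in> words X n" for y
          unfolding kap_def using that p(2) False by (intro sum.neutral) (auto simp: words_length wm_length)
        then show ?thesis by (simp add: dp_def)
      qed
    qed
    then show "r \<in> ?J" using p by (intro key[of p]) auto
  qed
  ultimately have "Idl\<^bsub>TA\<^esub> R \<subseteq> ?J" by (rule TA.I_minimal[OF R_sub])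
  then show ?thesis using assms by blast
qed

lemma proj_zero_iff_ideal: "isF p \<Longrightarrow> proj p = \<zero>\<^bsub>QA\<^esub> \<longleftrightarrow> tproj p \<in> Idl\<^bsub>TA\<^esub> R"
  using TA.q_zero_iff[OF R_sub tproj_closed, of p] by (simp add: proj_def quadratic_algebra_def)

lemma rel_zero:
  assumes "\<rho> \<in> Rs"
  shows "(\<Oplus>\<^bsub>QA\<^esub>y\<in>words X 2. \<rho> y \<odot>\<^bsub>QA\<^esub> xw y) = \<zero>\<^bsub>QA\<^esub>"
proof -
  from assms obtain r p where r: "r \<in> R" "p \<in> r" "\<rho> = kap cf p" unfolding Rs_def mem_Collect_eq by (elim bexE)
  then obtain p' where p': "r = tproj p'" "Poly_Mapping.keys p' \<subseteq> {s \<in> lists W. length s = 2}" using R_repr by blast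
  then have F: "isF p'" by auto
  have p: "isF p" "tproj p = tproj p'"
    using FA.quot_mem[OF LR_sub, of p' p] r(2) F unfolding p'(1) tproj_def by auto
  have "\<rho> = kap cf p'" unfolding r(3) using kap_tproj[OF p(1) F p(2)] by blast
  moreover have "proj p' = \<zero>\<^bsub>QA\<^esub>"
    using TA.q_zero[OF R_sub r(1)] p'(1) by (simp add: proj_def quadratic_algebra_def)
  ultimately show ?thesis using proj_homog_expand[OF p'(2)] by simp
qed

text \<open>Let \<open>?J\<close> be the space of linear relations among the basis monomials of
  degree \<open>n\<close>. It contains every \<open>u \<rho> v\<close> with \<open>\<rho>\<close> a
  defining relation, so its orthogonal complement lies in \<open>W\<close>; a \<open>c\<close>
  orthogonal to \<open>W\<close> is then in \<open>?J\<close> by biduality.\<close>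

lemma vanish_homog_zero:
  assumes c: "\<And>w. w \<in> Wn n \<Longrightarrow> dp (words X n) c w = 0"
  shows "(\<Oplus>\<^bsub>QA\<^esub>y\<in>words X n. c y \<odot>\<^bsub>QA\<^esub> xw y) = \<zero>\<^bsub>QA\<^esub>"
proof -
  let ?S = "\<lambda>c. (\<Oplus>\<^bsub>QA\<^esub>y\<in>words X n. c y \<odot>\<^bsub>QA\<^esub> xw y)"
  let ?J = "{c. (\<forall>y. y \<notin> words X n \<longrightarrow> c y = 0) \<and> ?S c = \<zero>\<^bsub>QA\<^esub>}"
  let ?c = "\<lambda>y. if y \<in> words X n then c y else 0"
  have eq: "?S ?c = ?S c" by (intro QA.finsum_cong2) auto
  have "?c \<in> ?J"
  proof (rule double_perp)
    show "fsub (words X n) ?J"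
      unfolding fsub_def
    proof (intro conjI ballI allI)
      show "(\<lambda>_. 0) \<in> ?J" by (auto intro!: QA.finsum_zeroI)
      fix v w assume v: "v \<in> ?J" and w: "w \<in> ?J"
      have "?S (\<lambda>y. v y + w y) = (\<Oplus>\<^bsub>QA\<^esub>y\<in>words X n. v y \<odot>\<^bsub>QA\<^esub> xw y \<oplus>\<^bsub>QA\<^esub> w y \<odot>\<^bsub>QA\<^esub> xw y)"
        by (intro QA.finsum_cong2) (simp_all add: QA.ksm_ladd)
      also have "\<dots> = ?S v \<oplus>\<^bsub>QA\<^esub> ?S w" by (intro QA.finsum_addf) simp_all
      finally show "(\<lambda>y. v y + w y) \<in> ?J" using v w by simp
    next
      fix a v assume v: "v \<in> ?J"
      have "?S (\<lambda>y. a * v y) = (\<Oplus>\<^bsub>QA\<^esub>y\<in>words X n. a \<odot>\<^bsub>QA\<^esub> (v y \<odot>\<^bsub>QA\<^esub> xw y))"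
        by (intro QA.finsum_cong2) (simp_all add: QA.ksm_assoc)
      also have "\<dots> = a \<odot>\<^bsub>QA\<^esub> ?S v" by (intro QA.ksm_finsum[symmetric]) simp_all
      finally show "(\<lambda>y. a * v y) \<in> ?J" using v by simp
    qed auto
  next
    fix w assume w0: "\<And>y. y \<notin> words X n \<Longrightarrow> w y = 0" and wJ: "\<And>r. r \<in> ?J \<Longrightarrow> dp (words X n) r w = 0"
    have "w \<in> Wn n"
      unfolding Wsp_def
    proof (intro CollectI conjI allI impI ballI)
      fix \<rho> u v assume \<rho>: "\<rho> \<in> Rs"
      show "(\<Sum>r\<in>words X 2. \<rho> r * w (u @ r @ v)) = 0"
      proof (cases "u \<in> lists X \<and> v \<in> lists X \<and> length u + (2 + length v) = n")
        case True
        let ?\<Lambda> = "\<lambda>r y. if y = u @ r @ v then 1 else 0"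
        \<comment> \<open>The coefficient function of \<open>u \<rho> v\<close>. Pairing it with
          \<open>w\<close> is the condition that \<open>w\<close> satisfies the relation
          \<open>\<rho>\<close> between \<open>u\<close> and \<open>v\<close>.\<close>
        let ?r = "\<lambda>y. if y \<in> words X n then (\<Sum>r\<in>words X 2. \<rho> r * ?\<Lambda> r y) else 0"
        have uw: "u \<in> words X (length u)" "v \<in> words X (length v)" using True by (auto simp: words_def)
        have uvc: "xw u \<in> carrier QA" "xw v \<in> carrier QA" using True by (simp_all add: xw_closed)
        have inw: "u @ r @ v \<in> words X n" if "r \<in> words X 2" for r
          using append_words[OF uw(1) append_words[OF that uw(2)]] True by simp
        have \<Lambda>: "(\<Oplus>\<^bsub>QA\<^esub>y\<in>words X n. ?\<Lambda> r y \<odot>\<^bsub>QA\<^esub> xw y) = xw (u @ r @ v)" if "r \<in> words X 2" for r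
          using QA.finsum_delta[of "words X n" "u @ r @ v" "\<lambda>y. ?\<Lambda> r y \<odot>\<^bsub>QA\<^esub> xw y"] inw[OF that] by simp
        have urv: "xw (u @ r @ v) = xw u \<otimes>\<^bsub>QA\<^esub> xw r \<otimes>\<^bsub>QA\<^esub> xw v" if "r \<in> words X 2" for r
        proof -
          have l: "u \<in> lists X" "r \<in> lists X" "v \<in> lists X" using True words_lists[OF that] by blast+
          then have "r @ v \<in> lists X" by simp
          from xw_append[OF l(1) this] xw_append[OF l(2,3)] show ?thesis
            using uvc xw_words[OF that] by (simp add: QA.m_assoc)
        qed
        have "?S ?r = ?S (\<lambda>y. \<Sum>r\<in>words X 2. \<rho> r * ?\<Lambda> r y)"
          by (intro QA.finsum_cong2) simp_all
        also have "\<dots> = (\<Oplus>\<^bsub>QA\<^esub>r\<in>words X 2. \<rho> r \<odot>\<^bsub>QA\<^esub> (\<Oplus>\<^bsub>QA\<^esub>y\<in>words X n. ?\<Lambda> r y \<odot>\<^bsub>QA\<^esub> xw y))"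
          by (intro QA.lin_comb_swap[symmetric]) simp_all
        also have "\<dots> = (\<Oplus>\<^bsub>QA\<^esub>r\<in>words X 2. xw u \<otimes>\<^bsub>QA\<^esub> (\<rho> r \<odot>\<^bsub>QA\<^esub> xw r) \<otimes>\<^bsub>QA\<^esub> xw v)"
          using uvc by (intro QA.finsum_cong2) (simp_all only: \<Lambda> urv QA.ksm_multl QA.ksm_multr xw_words QA.m_closed QA.ksm_closed)
        also have "\<dots> = (\<Oplus>\<^bsub>QA\<^esub>r\<in>words X 2. xw u \<otimes>\<^bsub>QA\<^esub> (\<rho> r \<odot>\<^bsub>QA\<^esub> xw r)) \<otimes>\<^bsub>QA\<^esub> xw v"
          using uvc by (intro QA.finsum_rmult[symmetric]) simp_all
        also have "(\<Oplus>\<^bsub>QA\<^esub>r\<in>words X 2. xw u \<otimes>\<^bsub>QA\<^esub> (\<rho> r \<odot>\<^bsub>QA\<^esub> xw r)) = xw u \<otimes>\<^bsub>QA\<^esub> (\<Oplus>\<^bsub>QA\<^esub>r\<in>words X 2. \<rho> r \<odot>\<^bsub>QA\<^esub> xw r)"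
          using uvc by (intro QA.finsum_lmult[symmetric]) simp_all
        also have "\<dots> \<otimes>\<^bsub>QA\<^esub> xw v = \<zero>\<^bsub>QA\<^esub>"
          using rel_zero[OF \<rho>] uvc by simp
        finally have "?r \<in> ?J" by simp
        then have "dp (words X n) ?r w = 0" by (rule wJ)
        moreover have "dp (words X n) ?r w = (\<Sum>y\<in>words X n. \<Sum>r\<in>words X 2. \<rho> r * (?\<Lambda> r y * w y))"
          unfolding dp_def by (intro sum.cong) (simp_all add: sum_distrib_right mult.assoc)
        moreover have "\<dots> = (\<Sum>r\<in>words X 2. \<Sum>y\<in>words X n. \<rho> r * (?\<Lambda> r y * w y))" by (rule sum.swap)
        moreover have "\<dots> = (\<Sum>r\<in>words X 2. \<rho> r * w (u @ r @ v))"
        proof (rule sum.cong[OF refl])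
          fix r assume r: "r \<in> words X 2"
          have "(\<Sum>y\<in>words X n. \<rho> r * (?\<Lambda> r y * w y)) = (\<Sum>y\<in>words X n. if y = u @ r @ v then \<rho> r * w y else 0)"
            by (intro sum.cong) auto
          then show "(\<Sum>y\<in>words X n. \<rho> r * (?\<Lambda> r y * w y)) = \<rho> r * w (u @ r @ v)" using inw[OF r] by simp
        qed
        ultimately show ?thesis by simp
      next
        case False
        then have "w (u @ r @ v) = 0" if "r \<in> words X 2" for r
          using that by (intro w0) (auto simp: words_def)
        then show ?thesis by simp
      qed
    qed (use w0 in auto)
    then show "dp (words X n) ?c w = 0" using c[of w] by (simp add: dp_def)
  qed auto
  then have "?S ?c = \<zero>\<^bsub>QA\<^esub>" by simp
  then show ?thesis unfolding eq .
qed

lemma proj_sum: "(\<And>i. i \<in> I \<Longrightarrow> isF (p i)) \<Longrightarrow> proj (\<Sum>i\<in>I. p i) = (\<Oplus>\<^bsub>QA\<^esub>i\<in>I. proj (p i)) \<and> isF (\<Sum>i\<in>I. p i)"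
proof (induction I rule: infinite_finite_induct)
  case (insert i I)
  then have "isF (p i)" "isF (\<Sum>i\<in>I. p i)" by auto
  then show ?case using insert proj_closed by (simp add: proj_add isF_add)
qed (simp_all add: proj_zero)

lemma restr_isF: "isF p \<Longrightarrow> Poly_Mapping.keys (restr p n) \<subseteq> {s \<in> lists W. length s = n}"
  by (auto simp: keys_restr)

lemma restr_isF': "isF p \<Longrightarrow> isF (restr p n)"
  by (auto simp: keys_restr)

text \<open>One direction is \<open>vanish_ideal\<close>; for the other, \<open>p\<close> is split
  into homogeneous parts and each is treated by \<open>vanish_homog_zero\<close>. Later identities
  in quadratic algebras are reduced to pairings with \<open>W\<close> in this way.\<close>

theorem proj_zero_iff:
  assumes "isF p"
  shows "proj p = \<zero>\<^bsub>QA\<^esub> \<longleftrightarrow> vanish (kap cf p)"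
proof
  assume "proj p = \<zero>\<^bsub>QA\<^esub>"
  then show "vanish (kap cf p)" using proj_zero_iff_ideal[OF assms] vanish_ideal[OF assms] by blast
next
  assume v: "vanish (kap cf p)"
  let ?F = "length ` Poly_Mapping.keys p"
  have "proj (restr p n) = \<zero>\<^bsub>QA\<^esub>" for n
  proof -
    have "(\<Oplus>\<^bsub>QA\<^esub>y\<in>words X n. kap cf (restr p n) y \<odot>\<^bsub>QA\<^esub> xw y) = \<zero>\<^bsub>QA\<^esub>"
      using v by (intro vanish_homog_zero) (auto simp: vanish_def dp_def kap_restr words_length)
    then show ?thesis using proj_homog_expand[OF restr_isF[OF assms]] by simp
  qed
  then have "(\<Oplus>\<^bsub>QA\<^esub>n\<in>?F. proj (restr p n)) = \<zero>\<^bsub>QA\<^esub>" by (simp add: QA.finsum_zeroI)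
  then have "proj (\<Sum>n\<in>?F. restr p n) = \<zero>\<^bsub>QA\<^esub>" using proj_sum[of ?F "restr p"] restr_isF'[OF assms] by simp
  then show "proj p = \<zero>\<^bsub>QA\<^esub>" using sum_restr[of ?F p] by simp
qed

end

section \<open>Connected graded algebras\<close>

text \<open>The part of degree at least \<open>m\<close>, expressed by components so that membership
  of sums and products is easy to test.\<close>

definition filt :: "('a, 'm, 'x) module_scheme \<Rightarrow> (int \<Rightarrow> 'm set) \<Rightarrow> int \<Rightarrow> 'm set" where
  "filt M gr m = {x \<in> carrier M. \<forall>j<m. hpart M gr x j = \<zero>\<^bsub>M\<^esub>}"

context graded_group
begin

lemma hpart_zero [simp]: "hpart M gr \<zero> j = \<zero>"
  using hpart_homog[OF gr_zero, of _ j] by simp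

lemma filt_sum: "(\<And>i. i \<in> I \<Longrightarrow> f i \<in> filt M gr m) \<Longrightarrow> (\<Oplus>i\<in>I. f i) \<in> filt M gr m"
  by (auto simp: filt_def hpart_finsum intro!: finsum_closed finsum_zeroI)

lemma gr_filt: "x \<in> gr j \<Longrightarrow> m \<le> j \<Longrightarrow> x \<in> filt M gr m"
  by (auto simp: filt_def hpart_homog gr_closed)

lemma filt_all: "(\<And>m. m \<ge> m0 \<Longrightarrow> x \<in> filt M gr m) \<Longrightarrow> x = \<zero>"
proof -
  assume f: "\<And>m. m \<ge> m0 \<Longrightarrow> x \<in> filt M gr m"
  have "x \<in> carrier M" using f[of m0] by (simp add: filt_def)
  moreover have "hpart M gr x j = \<zero>" for j using f[of "max m0 (j + 1)"] by (simp add: filt_def)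
  ultimately show ?thesis by (rule hpart_zero_all)
qed

end

text \<open>A general biadditive \<open>\<mu>\<close> serves both the product of an algebra and its
  action on a module.\<close>

lemma filt_mult:
  assumes "has_grading M1 gr1" "has_grading M2 gr2" "has_grading M3 gr3"
    and cl: "\<And>x y. x \<in> carrier M1 \<Longrightarrow> y \<in> carrier M2 \<Longrightarrow> \<mu> x y \<in> carrier M3"
    and add1: "\<And>x x' y. x \<in> carrier M1 \<Longrightarrow> x' \<in> carrier M1 \<Longrightarrow> y \<in> carrier M2 \<Longrightarrow> \<mu> (x \<oplus>\<^bsub>M1\<^esub> x') y = \<mu> x y \<oplus>\<^bsub>M3\<^esub> \<mu> x' y"
    and add2: "\<And>x y y'. x \<in> carrier M1 \<Longrightarrow> y \<in> carrier M2 \<Longrightarrow> y' \<in> carrier M2 \<Longrightarrow> \<mu> x (y \<oplus>\<^bsub>M2\<^esub> y') = \<mu> x y \<oplus>\<^bsub>M3\<^esub> \<mu> x y'"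
    and deg: "\<And>i j x y. x \<in> gr1 i \<Longrightarrow> y \<in> gr2 j \<Longrightarrow> \<mu> x y \<in> gr3 (i + j)"
    and x: "x \<in> filt M1 gr1 m" and y: "y \<in> filt M2 gr2 n"
  shows "\<mu> x y \<in> filt M3 gr3 (m + n)"
proof -
  interpret M1: graded_group M1 gr1 by unfold_locales fact
  interpret M2: graded_group M2 gr2 by unfold_locales fact
  interpret M3: graded_group M3 gr3 by unfold_locales fact
  let ?S = "{j. hpart M1 gr1 x j \<noteq> \<zero>\<^bsub>M1\<^esub>}" and ?T = "{j. hpart M2 gr2 y j \<noteq> \<zero>\<^bsub>M2\<^esub>}"
  have xc: "x \<in> carrier M1" and yc: "y \<in> carrier M2" using x y by (auto simp: filt_def)
  have "\<mu> x y = \<mu> (\<Oplus>\<^bsub>M1\<^esub>i\<in>?S. hpart M1 gr1 x i) y" using M1.hpart_sum[OF xc] by (rule arg_cong)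
  also have "\<dots> = (\<Oplus>\<^bsub>M3\<^esub>i\<in>?S. \<mu> (hpart M1 gr1 x i) y)"
    by (rule finsum_additive[where f = "\<lambda>x. \<mu> x y"])
      (use xc yc cl add1 in \<open>simp_all add: M1.abelian_group_axioms M3.abelian_group_axioms\<close>)
  finally have eq: "\<mu> x y = (\<Oplus>\<^bsub>M3\<^esub>i\<in>?S. \<mu> (hpart M1 gr1 x i) y)" .
  show ?thesis unfolding eq
  proof (rule M3.filt_sum)
    fix i assume i: "i \<in> ?S"
    have im: "m \<le> i" using i x by (auto simp: filt_def not_le[symmetric])
    have "\<mu> (hpart M1 gr1 x i) y = \<mu> (hpart M1 gr1 x i) (\<Oplus>\<^bsub>M2\<^esub>j\<in>?T. hpart M2 gr2 y j)"
      using M2.hpart_sum[OF yc] by (rule arg_cong)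
    also have "\<dots> = (\<Oplus>\<^bsub>M3\<^esub>j\<in>?T. \<mu> (hpart M1 gr1 x i) (hpart M2 gr2 y j))"
      by (rule finsum_additive)
        (use xc yc cl add2 in \<open>simp_all add: M2.abelian_group_axioms M3.abelian_group_axioms\<close>)
    finally have eq2: "\<mu> (hpart M1 gr1 x i) y = (\<Oplus>\<^bsub>M3\<^esub>j\<in>?T. \<mu> (hpart M1 gr1 x i) (hpart M2 gr2 y j))" .
    show "\<mu> (hpart M1 gr1 x i) y \<in> filt M3 gr3 (m + n)"
      unfolding eq2
    proof (rule M3.filt_sum)
      fix j assume j: "j \<in> ?T"
      have "n \<le> j" using j y by (auto simp: filt_def not_le[symmetric])
      then show "\<mu> (hpart M1 gr1 x i) (hpart M2 gr2 y j) \<in> filt M3 gr3 (m + n)"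
        using im xc yc by (intro M3.gr_filt[OF deg[OF M1.hpart_in M2.hpart_in]]) auto
    qed
  qed
qed

text \<open>Connected graded algebras: nothing in negative degrees and only scalars in degree zero.
  These conditions make \<open>augmentation\<close> well defined and multiplicative.\<close>

locale galg = kalg A for A :: "('k::field, 'a, 'z) graded_algebra_scheme" (structure) +
  assumes A_grading: "has_grading A (deg A)"
    and deg_mult: "x \<in> deg A i \<Longrightarrow> y \<in> deg A j \<Longrightarrow> x \<otimes> y \<in> deg A (i + j)"
    and deg_neg: "i < 0 \<Longrightarrow> deg A i \<subseteq> {\<zero>}"
    and deg_0: "deg A 0 = range (\<lambda>c. c \<odot> \<one>)"
    and deg_smult: "x \<in> deg A i \<Longrightarrow> c \<odot> x \<in> deg A i"
    and smult_one_inj: "c \<odot> \<one> = \<zero> \<Longrightarrow> c = 0"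
begin

sublocale gr: graded_group A "deg A" by unfold_locales (rule A_grading)

abbreviation hp where "hp \<equiv> hpart A (deg A)"
abbreviation aug where "aug \<equiv> augmentation A"

lemma one_deg: "\<one> \<in> deg A 0"
  unfolding deg_0 using ksm_one[of \<one>] by (metis one_closed rangeI)

lemma smult_one_eq: "c \<odot> \<one> = c' \<odot> \<one> \<Longrightarrow> c = c'"
proof -
  assume eq: "c \<odot> \<one> = c' \<odot> \<one>"
  have "(c + - c') \<odot> \<one> = c \<odot> \<one> \<oplus> \<ominus> (c' \<odot> \<one>)"
    by (simp only: ksm_ladd ksm_neg one_closed)
  then have "(c + - c') \<odot> \<one> = \<zero>" using eq by (simp add: r_neg)
  then show ?thesis using smult_one_inj[of "c + - c'"] by simp
qed

lemma filt_0: "x \<in> carrier A \<Longrightarrow> x \<in> filt A (deg A) 0"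
  using deg_neg gr.hpart_in by (fastforce simp: filt_def)

lemma aug: "x \<in> carrier A \<Longrightarrow> hp x 0 = aug x \<odot> \<one>"
proof -
  assume x: "x \<in> carrier A"
  obtain c where c: "hp x 0 = c \<odot> \<one>" using gr.hpart_in[OF x, of 0] unfolding deg_0 by blast
  have "aug x = c"
    unfolding augmentation_def homog_part_hpart
    by (rule the_equality) (use c smult_one_eq in auto)
  then show ?thesis using c by simp
qed

lemma augI: "x \<in> carrier A \<Longrightarrow> hp x 0 = c \<odot> \<one> \<Longrightarrow> aug x = c"
  using aug[of x] smult_one_eq by simp

lemma aug_add: "x \<in> carrier A \<Longrightarrow> y \<in> carrier A \<Longrightarrow> aug (x \<oplus> y) = aug x + aug y"
  by (rule augI) (simp_all add: gr.hpart_add aug[of x] aug[of y] ksm_ladd)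

lemma hp_smult: "x \<in> carrier A \<Longrightarrow> hp (c \<odot> x) j = c \<odot> hp x j"
  using hpart_map[OF A_grading A_grading, of x "\<lambda>x. c \<odot> x" 0 j] by (simp add: ksm_radd deg_smult)

lemma aug_smult: "x \<in> carrier A \<Longrightarrow> aug (c \<odot> x) = c * aug x"
  by (rule augI) (simp_all add: hp_smult aug[of x] ksm_assoc)

lemma aug_deg: "x \<in> deg A j \<Longrightarrow> j \<noteq> 0 \<Longrightarrow> aug x = 0"
  by (rule augI) (simp_all add: gr.hpart_homog gr.gr_closed)

lemma aug_scalar [simp]: "aug (c \<odot> \<one>) = c"
  using gr.hpart_homog[OF deg_smult[OF one_deg], of c 0] by (intro augI) simp_all

lemma aug_one [simp]: "aug \<one> = 1"
  using aug_scalar[of 1] by simp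

lemma aug_zero [simp]: "aug \<zero> = 0"
  using aug_scalar[of 0] by simp

lemma aug_neg: "x \<in> carrier A \<Longrightarrow> aug (\<ominus> x) = - aug x"
  using aug_add[of x "\<ominus> x"] by (simp add: r_neg eq_neg_iff_add_eq_0 add.commute)

lemma aug_finsum: "(\<And>i. i \<in> I \<Longrightarrow> f i \<in> carrier A) \<Longrightarrow> aug (\<Oplus>i\<in>I. f i) = (\<Sum>i\<in>I. aug (f i))"
proof (induction I rule: infinite_finite_induct)
  case (insert i I)
  then have "aug (\<Oplus>i\<in>insert i I. f i) = aug (f i \<oplus> (\<Oplus>i\<in>I. f i))" by (subst finsum_insert) auto
  then show ?case using insert by (simp add: aug_add finsum_closed)
qed simp_all

lemma aug_zero_filt: "x \<in> carrier A \<Longrightarrow> aug x = 0 \<longleftrightarrow> x \<in> filt A (deg A) 1"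
proof -
  assume x: "x \<in> carrier A"
  have "hp x j = \<zero>" if "j < 0" for j using deg_neg[OF that] gr.hpart_in[OF x, of j] by blast
  moreover have "aug x = 0 \<longleftrightarrow> hp x 0 = \<zero>" using aug[OF x] smult_one_inj by auto
  moreover have "(j < 1) = (j < 0 \<or> j = 0)" for j :: int by auto
  ultimately show ?thesis using x by (auto simp: filt_def)
qed

lemma filt_mult_A: "x \<in> filt A (deg A) m \<Longrightarrow> y \<in> filt A (deg A) n \<Longrightarrow> x \<otimes> y \<in> filt A (deg A) (m + n)"
  by (rule filt_mult[OF A_grading A_grading A_grading]) (auto simp: l_distr r_distr deg_mult)

text \<open>Removing the scalar part of \<open>x\<close> leaves an element of positive degree, and
  the elements of positive degree absorb multiplication by the whole algebra.\<close>

lemma aug_mult: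
  assumes "x \<in> carrier A" "y \<in> carrier A"
  shows "aug (x \<otimes> y) = aug x * aug y"
proof -
  let ?x = "x \<oplus> \<ominus> (aug x \<odot> \<one>)"
  have x': "?x \<in> carrier A" "aug ?x = 0" using assms by (simp_all add: aug_add aug_neg)
  have "?x \<otimes> y \<in> filt A (deg A) (1 + 0)"
    using x' assms by (intro filt_mult_A filt_0) (simp_all add: aug_zero_filt)
  then have "aug (?x \<otimes> y) = 0" using x' assms by (simp add: aug_zero_filt)
  moreover have "x \<otimes> y = ?x \<otimes> y \<oplus> aug x \<odot> y"
    using assms by (simp add: l_distr l_minus ksm_multl a_assoc l_neg)
  ultimately show ?thesis using x' assms by (simp add: aug_add aug_smult)
qed

lemma triv: "left_module A (trivial_module A)"
proof -
  have "abelian_group (trivial_module A)"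
    by (rule abelian_groupI) (auto intro: exI[of _ "- x" for x] simp: add_eq_0_iff)
  then show ?thesis
    unfolding left_module_def left_module_axioms_def
    by (auto simp: ring_axioms aug_add aug_mult algebra_simps)
qed

end

lemma (in kalg) tens_factor:
  assumes X: "finite X" and f: "f \<in> carrier (tens C (words X m) (Wsp X Rs m))"
    and uv: "u \<in> words X a" "v \<in> words X b" "a + (n + b) = m"
  shows "(\<lambda>y. f (u @ y @ v)) \<in> carrier (tens C (words X n) (Wsp X Rs n))"
proof -
  interpret X: ktensor C "words X m" "Wsp X Rs m" by (rule ktensor[OF fsub_Wsp[OF X]])
  have mem: "u @ y @ v \<in> words X m \<longleftrightarrow> y \<in> words X n" for y
    using uv by (auto simp: words_def)
  have "(\<lambda>y. if y \<in> words X n then f (u @ y @ v) else \<zero>) \<in> carrier (tens C (words X n) (Wsp X Rs n))"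
  proof (rule tens_restrict[OF ktensor[OF fsub_Wsp[OF X]] ktensor[OF fsub_Wsp[OF X]] f])
    show "(\<lambda>y. u @ y @ v) ` words X n \<subseteq> words X m" using mem by auto
    fix w assume w: "w \<in> Wsp X Rs m"
    have "(\<lambda>y. if y \<in> words X n then w (u @ y @ v) else 0) = (\<lambda>y. w (u @ y @ v))"
      using Wsp_outside[OF w] mem by auto
    then show "(\<lambda>y. if y \<in> words X n then w (u @ y @ v) else 0) \<in> Wsp X Rs n"
      using Wsp_factor[OF w, of u n v] uv by (simp add: words_length)
  qed
  moreover have "(\<lambda>y. if y \<in> words X n then f (u @ y @ v) else \<zero>) = (\<lambda>y. f (u @ y @ v))"
    using X.T_outside[OF f] mem by auto
  ultimately show ?thesis by simp
qed

section \<open>Exactness of the Koszul complex\<close>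

text \<open>\<open>x_rel\<close> says that the quadratic relations of \<open>A\<close> are exactly
  the orthogonal complement of \<open>Rp\<close>. The annihilator \<open>Wn n\<close> of
  \<open>Rp\<close> is therefore the space of tensors that are relations of \<open>A\<close> at
  every pair of adjacent letters, the usual \<open>n\<close>-th Koszul space.\<close>

locale koszul_alg = galg A for A :: "('k::field, 'a, 'z) graded_algebra_scheme" (structure) +
  fixes X :: "'b set" and x :: "'b \<Rightarrow> 'a" and Rp :: "('b list \<Rightarrow> 'k) set"
  assumes finX [simp]: "finite X" and x_deg: "b \<in> X \<Longrightarrow> x b \<in> deg A 1"
    and deg_1: "a \<in> deg A 1 \<Longrightarrow> \<exists>c. a = (\<Oplus>b\<in>X. c b \<odot> x b)"
    and x_indep: "(\<Oplus>b\<in>X. c b \<odot> x b) = \<zero> \<Longrightarrow> b \<in> X \<Longrightarrow> c b = 0"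
    and x_rel: "(\<Oplus>b'\<in>X. \<Oplus>b\<in>X. h [b, b'] \<odot> (x b \<otimes> x b')) = \<zero> \<longleftrightarrow> (\<forall>\<rho>\<in>Rp. (\<Sum>r\<in>words X 2. \<rho> r * h r) = 0)"
begin

abbreviation Wn where "Wn n \<equiv> Wsp X Rp n"
abbreviation K where "K n \<equiv> tens A (words X n) (Wn n)"

lemma x_closed [simp]: "b \<in> X \<Longrightarrow> x b \<in> carrier A"
  by (rule gr.gr_closed[OF x_deg])

lemma kt: "ktensor A (words X n) (Wn n)"
  by (rule ktensor[OF fsub_Wsp[OF finX]])

sublocale K: ktensor A "words X n" "Wn n" for n by (rule kt)

text \<open>The Koszul differential
  \<open>a \<otimes> b w \<mapsto> a x\<^sub>b \<otimes> w\<close>. The letter multiplies on the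
  right, so that the map is linear for the left action of \<open>A\<close>.\<close>

definition dK :: "('b list \<Rightarrow> 'a) \<Rightarrow> 'b list \<Rightarrow> 'a" where
  "dK f w = (\<Oplus>b\<in>X. f (b # w) \<otimes> x b)"

lemma K_shift: "f \<in> carrier (K (Suc n)) \<Longrightarrow> b \<in> X \<Longrightarrow> (\<lambda>w. f (b # w)) \<in> carrier (K n)"
  using tens_factor[OF finX, of f "Suc n" Rp "[b]" 1 "[]" 0 n] by simp

lemma dK_closed: "f \<in> carrier (K (Suc n)) \<Longrightarrow> dK f \<in> carrier (K n)"
  unfolding dK_def[abs_def] by (intro K.T_sum K.T_rmult K_shift) auto

lemma dK_hom: "dK \<in> module_hom A (K (Suc n)) (K n)"
proof (rule module_homI)
  fix f g assume fg: "f \<in> carrier (K (Suc n))" "g \<in> carrier (K (Suc n))"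
  have "dK (\<lambda>x. f x \<oplus> g x) w = dK f w \<oplus> dK g w" for w
  proof -
    have "dK (\<lambda>x. f x \<oplus> g x) w = (\<Oplus>b\<in>X. f (b # w) \<otimes> x b \<oplus> g (b # w) \<otimes> x b)"
      unfolding dK_def using fg by (intro finsum_cong2) (simp_all add: l_distr)
    also have "\<dots> = dK f w \<oplus> dK g w"
      unfolding dK_def using fg by (intro finsum_addf) simp_all
    finally show ?thesis .
  qed
  then show "dK (f \<oplus>\<^bsub>K (Suc n)\<^esub> g) = dK f \<oplus>\<^bsub>K n\<^esub> dK g" by (simp add: fun_eq_iff)
next
  fix a f assume "a \<in> carrier A" "f \<in> carrier (K (Suc n))"
  then have "dK (\<lambda>x. a \<otimes> f x) w = a \<otimes> dK f w" for w
    unfolding dK_def by (subst finsum_lmult) (simp_all add: m_assoc cong: finsum_cong)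
  then show "dK (a \<odot>\<^bsub>K (Suc n)\<^esub> f) = a \<odot>\<^bsub>K n\<^esub> dK f" by (simp add: fun_eq_iff)
qed (rule dK_closed)

lemma dK_kvec: "dK (kvec A c) w = (\<Oplus>b\<in>X. c (b # w) \<odot> x b)"
  unfolding dK_def kvec_def by (intro finsum_cong2) (auto simp: ksm_multl)

text \<open>Two steps multiply the first two letters, and these form a relation of \<open>A\<close>
  because \<open>c\<close> lies in \<open>W\<close>.\<close>

lemma dK_dK_kvec:
  assumes "c \<in> Wn (Suc (Suc n))"
  shows "dK (dK (kvec A c)) w = \<zero>"
proof -
  have "dK (dK (kvec A c)) w = (\<Oplus>b'\<in>X. \<Oplus>b\<in>X. c ([b, b'] @ w) \<odot> (x b \<otimes> x b'))"
    unfolding dK_def[of "dK (kvec A c)"] dK_kvec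
    by (intro finsum_cong2) (auto simp: finsum_rmult ksm_multl intro!: finsum_cong2 finsum_closed)
  also have "\<dots> = \<zero>"
    using x_rel[of "\<lambda>r. c (r @ w)"] Wsp_rel[OF assms, of _ "[]" w] by simp
  finally show ?thesis .
qed

lemma dK_dK: "f \<in> carrier (K (Suc (Suc n))) \<Longrightarrow> dK (dK f) w = \<zero>"
proof -
  assume f: "f \<in> carrier (K (Suc (Suc n)))"
  have z: "(\<lambda>_ _. \<zero>) \<in> module_hom A (K (Suc (Suc n))) (K n)"
    using module_hom_0[OF K.T_left_module[of n], of "K (Suc (Suc n))"] by simp
  have "dK (dK f) = (\<lambda>_. \<zero>)"
    using K.hom_eqI[OF module_hom_comp[OF dK_hom dK_hom] z K.T_left_module f] dK_dK_kvec by blast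
  then show ?thesis by simp
qed

text \<open>Scalars embed in \<open>A\<close>, so the reproducing formula of \<open>T_repr\<close>
  can be read off for the coefficients themselves.\<close>

lemma kvec_mem: "kvec A c \<in> carrier (K n) \<Longrightarrow> c \<in> Wn n"
proof -
  assume f: "kvec A c \<in> carrier (K n)"
  have "c y = (\<Sum>y'\<in>words X n. c y' * K.p n y' y)" for y
  proof (rule smult_one_eq)
    have "c y \<odot> \<one> = (\<Oplus>y'\<in>words X n. K.p n y' y \<odot> kvec A c y')"
      using K.T_repr[OF f, of y] by (simp add: kvec_def)
    also have "\<dots> = (\<Sum>y'\<in>words X n. c y' * K.p n y' y) \<odot> \<one>"
      unfolding ksm_sum[OF one_closed] kvec_def
      by (intro finsum_cong2) (simp_all add: ksm_assoc[symmetric] mult.commute)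
    finally show "c y \<odot> \<one> = (\<Sum>y'\<in>words X n. c y' * K.p n y' y) \<odot> \<one>" .
  qed
  then have "c = (\<lambda>y. \<Sum>y'\<in>words X n. c y' * K.p n y' y)" by (rule ext)
  also have "\<dots> \<in> Wn n" by (intro fsub_sum[OF fsub_Wsp[OF finX]] K.p_in)
  finally show ?thesis .
qed

lemma K_hpart: "f \<in> carrier (K n) \<Longrightarrow> (\<lambda>y. hp (f y) j) \<in> carrier (K n)"
  by (rule K.T_additive[where \<phi> = "\<lambda>a. hp a j"]) (auto simp: gr.hpart_add hp_smult)

end

section \<open>Identification of the Koszul complex with a resolution generated in the right
  degrees\<close>

locale koszul_res = koszul_alg A X x Rp
  for A :: "('k::field, 'a, 'z) graded_algebra_scheme" (structure) and X :: "'b set" and x and Rp +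
  fixes P :: "nat \<Rightarrow> ('a, 'p) module" and d e and gr
  assumes res: "proj_resolution A (trivial_module A) P d e"
    and graded: "\<And>n. graded_module A (P n) (gr n)"
    and d_gr: "\<And>n j. d n ` gr (Suc n) j \<subseteq> gr n j"
    and e_gr: "\<And>j. e ` gr 0 j \<subseteq> (if j = 0 then UNIV else {0})"
    and gen: "\<And>n. generated_by A (P n) (gr n (int n))"
begin

lemma P_grading: "has_grading (P n) (gr n)"
  by (rule graded_module_has_grading[OF graded])

sublocale Pg: graded_group "P n" "gr n" for n by unfold_locales (rule P_grading)

lemma P_mod: "left_module A (P n)" using graded by (simp add: graded_module_def)

sublocale Pm: left_module A "P n" for n by (rule P_mod)
sublocale aug_algebra A by (rule aug_algebra.intro[OF triv])

lemmas PD = exact_resD[OF proj_exact_res[OF res]]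

lemma P_proj: "projective A (P n)" using res by (simp add: proj_resolution_def)

lemma gr_act: "a \<in> deg A i \<Longrightarrow> m \<in> gr n j \<Longrightarrow> a \<odot>\<^bsub>P n\<^esub> m \<in> gr n (i + j)"
  using graded by (simp add: graded_module_def)

lemma filt_act: "a \<in> filt A (deg A) i \<Longrightarrow> m \<in> filt (P n) (gr n) j \<Longrightarrow> a \<odot>\<^bsub>P n\<^esub> m \<in> filt (P n) (gr n) (i + j)"
  by (rule filt_mult[OF A_grading P_grading P_grading])
    (auto simp: Pm.smult_closed Pm.smult_l_distr Pm.smult_r_distr gr_act)

text \<open>The elements of degree at least \<open>n\<close> form a submodule, and it contains the
  generators.\<close>

lemma P_filt: "carrier (P n) = filt (P n) (gr n) (int n)"
proof -
  let ?N = "filt (P n) (gr n) (int n)"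
  have "submodule ?N A (P n)"
  proof (intro submodule.intro submodule_axioms.intro subgroup.intro)
    fix a m assume "a \<in> carrier A" "m \<in> ?N"
    then show "a \<odot>\<^bsub>P n\<^esub> m \<in> ?N" using filt_act[OF filt_0, of a m n "int n"] by simp
  next
    fix m assume m: "m \<in> ?N"
    then have "\<ominus>\<^bsub>A\<^esub> \<one> \<odot>\<^bsub>P n\<^esub> m \<in> ?N" using filt_act[OF filt_0, of "\<ominus> \<one>" m n "int n"] by simp
    moreover have "\<ominus>\<^bsub>A\<^esub> \<one> \<odot>\<^bsub>P n\<^esub> m = \<ominus>\<^bsub>P n\<^esub> m"
      using m by (simp add: filt_def Pm.smult_neg_left Pm.smult_one)
    ultimately show "inv\<^bsub>add_monoid (P n)\<^esub> m \<in> ?N" by (simp add: a_inv_def)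
  qed (auto simp: filt_def Pg.hpart_add Pg.hpart_zero)
  moreover have "gr n (int n) \<subseteq> ?N" using Pg.gr_filt by blast
  ultimately show ?thesis using gen[of n] unfolding generated_by_def by blast
qed

lemma hpart_low: "m \<in> carrier (P n) \<Longrightarrow> j < int n \<Longrightarrow> hpart (P n) (gr n) m j = \<zero>\<^bsub>P n\<^esub>"
proof -
  assume m: "m \<in> carrier (P n)" and j: "j < int n"
  have "m \<in> filt (P n) (gr n) (int n)" using P_filt[of n] m by blast
  then show ?thesis using j by (simp add: filt_def)
qed

lemma d_hpart: "m \<in> carrier (P (Suc n)) \<Longrightarrow> hpart (P n) (gr n) (d n m) j = d n (hpart (P (Suc n)) (gr (Suc n)) m j)"
  using hpart_map[where m = m and \<phi> = "d n" and s = 0 and j = j, OF P_grading P_grading] d_gr[of n]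
    module_hom_closed[OF PD(2)] module_hom_add[OF PD(2)] by (auto simp: image_subset_iff)

text \<open>Since \<open>P (n+1)\<close> starts in degree \<open>n + 1\<close>, the differentials (and the augmentation) are
  injective in the lowest degree, and every cycle one degree above the bottom is a boundary of a generator.\<close>

lemma low_boundary_zero:
  assumes "u \<in> gr n (int n)" "u \<in> d n ` carrier (P (Suc n))"
  shows "u = \<zero>\<^bsub>P n\<^esub>"
proof -
  obtain m where m: "m \<in> carrier (P (Suc n))" "u = d n m" using assms by blast
  have "u = hpart (P n) (gr n) u (int n)" using Pg.hpart_homog[OF assms(1)] by simp
  also have "\<dots> = d n (hpart (P (Suc n)) (gr (Suc n)) m (int n))" unfolding m(2) by (rule d_hpart[OF m(1)])
  also have "\<dots> = d n \<zero>\<^bsub>P (Suc n)\<^esub>" using hpart_low[OF m(1)] by simp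
  also have "\<dots> = \<zero>\<^bsub>P n\<^esub>" by (rule module_hom_zero[OF PD(2) P_mod P_mod])
  finally show ?thesis .
qed

lemma low_lift:
  assumes "y \<in> gr n (int n + 1)" "y \<in> d n ` carrier (P (Suc n))"
  shows "\<exists>u\<in>gr (Suc n) (int (Suc n)). d n u = y"
proof -
  obtain m where m: "m \<in> carrier (P (Suc n))" "y = d n m" using assms by blast
  have "y = hpart (P n) (gr n) y (int n + 1)" using Pg.hpart_homog[OF assms(1)] by simp
  also have "\<dots> = d n (hpart (P (Suc n)) (gr (Suc n)) m (int n + 1))" unfolding m(2) by (rule d_hpart[OF m(1)])
  finally have "d n (hpart (P (Suc n)) (gr (Suc n)) m (int n + 1)) = y" ..
  moreover have "hpart (P (Suc n)) (gr (Suc n)) m (int n + 1) \<in> gr (Suc n) (int n + 1)" by (rule Pg.hpart_in[OF m(1)])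
  moreover have "int n + 1 = int (Suc n)" by simp
  ultimately show ?thesis by metis
qed

text \<open>The candidate isomorphism from the Koszul complex to \<open>P n\<close>;
  \<open>\<tau>\<close> prescribes the images of the coordinate vectors of the ambient free
  module.\<close>

definition \<theta> :: "nat \<Rightarrow> ('b list \<Rightarrow> 'p) \<Rightarrow> ('b list \<Rightarrow> 'a) \<Rightarrow> 'p" where
  "\<theta> n \<tau> f = (\<Oplus>\<^bsub>P n\<^esub>y\<in>words X n. f y \<odot>\<^bsub>P n\<^esub> \<tau> y)"

lemma \<theta>_hom: "(\<And>y. y \<in> words X n \<Longrightarrow> \<tau> y \<in> carrier (P n)) \<Longrightarrow> \<theta> n \<tau> \<in> module_hom A (K n) (P n)"
  using K.hom_from[OF P_mod, of n \<tau> n] by (simp add: \<theta>_def[abs_def])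

lemma \<theta>_hpart:
  assumes "\<And>y. y \<in> words X n \<Longrightarrow> \<tau> y \<in> gr n (int n)" "f \<in> carrier (K n)"
  shows "hpart (P n) (gr n) (\<theta> n \<tau> f) (int n + j) = \<theta> n \<tau> (\<lambda>y. hp (f y) j)"
proof -
  have \<tau>: "\<tau> y \<in> carrier (P n)" if "y \<in> words X n" for y using assms(1)[OF that] by (rule Pg.gr_closed)
  have "hpart (P n) (gr n) (f y \<odot>\<^bsub>P n\<^esub> \<tau> y) (int n + j) = hp (f y) j \<odot>\<^bsub>P n\<^esub> \<tau> y" if "y \<in> words X n" for y
    using hpart_map[where m = "f y" and \<phi> = "\<lambda>a. a \<odot>\<^bsub>P n\<^esub> \<tau> y" and s = "int n" and j = "int n + j", OF A_grading P_grading]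
      assms \<tau> gr_act[OF _ assms(1)] that by (simp add: Pm.smult_closed Pm.smult_l_distr)
  then show ?thesis
    unfolding \<theta>_def using assms \<tau>
    by (subst Pg.hpart_finsum) (auto intro!: Pg.finsum_cong2 Pm.smult_closed)
qed

text \<open>Surjectivity holds because \<open>P n\<close> is generated in degree \<open>n\<close>.
  Projectivity gives a section \<open>s\<close>, and \<open>?h = 1 - s \<theta>\<close> is a
  projection onto the kernel. Injectivity in the lowest degree puts the coefficients of kernel
  elements in positive degree; expanding \<open>f = ?h f\<close> over generators, whose images lie
  in the kernel again, raises this bound without end and forces \<open>f = 0\<close>.\<close>

lemma nakayama:
  assumes \<tau>: "\<And>y. y \<in> words X n \<Longrightarrow> \<tau> y \<in> gr n (int n)"
    and inj: "\<And>w. w \<in> Wn n \<Longrightarrow> \<theta> n \<tau> (kvec A w) = \<zero>\<^bsub>P n\<^esub> \<Longrightarrow> w = (\<lambda>_. 0)"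
    and sur: "gr n (int n) \<subseteq> \<theta> n \<tau> ` carrier (K n)"
  shows "\<theta> n \<tau> ` carrier (K n) = carrier (P n)" "f \<in> carrier (K n) \<Longrightarrow> \<theta> n \<tau> f = \<zero>\<^bsub>P n\<^esub> \<Longrightarrow> f = (\<lambda>_. \<zero>)"
proof -
  have hom: "\<theta> n \<tau> \<in> module_hom A (K n) (P n)" using \<tau> Pg.gr_closed by (intro \<theta>_hom) blast
  have KM: "left_module A (K n)" by (rule K.T_left_module)
  interpret KM: left_module A "K n" by (rule KM)
  have "submodule (\<theta> n \<tau> ` carrier (K n)) A (P n)"
  proof (intro submodule.intro submodule_axioms.intro subgroup.intro)
    show "\<theta> n \<tau> ` carrier (K n) \<subseteq> carrier (add_monoid (P n))" using module_hom_closed[OF hom] by auto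
    fix m assume "m \<in> \<theta> n \<tau> ` carrier (K n)"
    then obtain f where f: "f \<in> carrier (K n)" "m = \<theta> n \<tau> f" by blast
    have "\<ominus>\<^bsub>P n\<^esub> m = \<theta> n \<tau> (\<ominus>\<^bsub>K n\<^esub> f)" unfolding f(2) by (rule module_hom_neg[OF hom KM P_mod f(1), symmetric])
    then show "inv\<^bsub>add_monoid (P n)\<^esub> m \<in> \<theta> n \<tau> ` carrier (K n)"
      using KM.M.a_inv_closed[OF f(1)] by (simp add: a_inv_def)
    fix a assume "a \<in> carrier A"
    then show "a \<odot>\<^bsub>P n\<^esub> m \<in> \<theta> n \<tau> ` carrier (K n)"
      unfolding f(2) using module_hom_smult[OF hom _ f(1), of a] KM.smult_closed[of a f] f(1) by (metis imageI)
  next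
    fix m m' assume "m \<in> \<theta> n \<tau> ` carrier (K n)" "m' \<in> \<theta> n \<tau> ` carrier (K n)"
    then obtain f f' where f: "f \<in> carrier (K n)" "m = \<theta> n \<tau> f" "f' \<in> carrier (K n)" "m' = \<theta> n \<tau> f'" by blast
    have "m \<oplus>\<^bsub>P n\<^esub> m' = \<theta> n \<tau> (f \<oplus>\<^bsub>K n\<^esub> f')"
      unfolding f(2,4) by (rule module_hom_add[OF hom f(1,3), symmetric])
    then have "m \<oplus>\<^bsub>P n\<^esub> m' \<in> \<theta> n \<tau> ` carrier (K n)" using KM.M.a_closed[OF f(1,3)] by (rule image_eqI)
    then show "m \<otimes>\<^bsub>add_monoid (P n)\<^esub> m' \<in> \<theta> n \<tau> ` carrier (K n)" by simp
  next
    show "\<one>\<^bsub>add_monoid (P n)\<^esub> \<in> \<theta> n \<tau> ` carrier (K n)"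
      using module_hom_zero[OF hom KM P_mod] KM.M.zero_closed by (metis imageI monoid.simps(2))
  qed
  then show surj: "\<theta> n \<tau> ` carrier (K n) = carrier (P n)"
    using gen[of n] sur unfolding generated_by_def by blast
  obtain s where s: "s \<in> module_hom A (P n) (K n)" "\<And>m. m \<in> carrier (P n) \<Longrightarrow> \<theta> n \<tau> (s m) = m"
    by (rule LPE[OF projective_LP[OF P_proj KM P_mod] hom module_hom_id]) (use surj in auto)
  let ?h = "\<lambda>f. f \<ominus>\<^bsub>K n\<^esub> s (\<theta> n \<tau> f)"
  have h: "?h \<in> module_hom A (K n) (K n)"
    by (intro module_hom_minus[OF module_hom_id module_hom_comp[OF hom s(1)] KM])
  have sc: "s (\<theta> n \<tau> f) \<in> carrier (K n)" if "f \<in> carrier (K n)" for f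
    by (rule module_hom_closed[OF s(1) module_hom_closed[OF hom that]])
  have hker: "\<theta> n \<tau> (?h f) = \<zero>\<^bsub>P n\<^esub>" if f: "f \<in> carrier (K n)" for f
  proof -
    have "\<theta> n \<tau> (?h f) = \<theta> n \<tau> f \<oplus>\<^bsub>P n\<^esub> \<ominus>\<^bsub>P n\<^esub> \<theta> n \<tau> (s (\<theta> n \<tau> f))"
      using module_hom_add[OF hom f KM.M.a_inv_closed[OF sc[OF f]]] module_hom_neg[OF hom KM P_mod sc[OF f]]
      by (simp only: a_minus_def)
    then show ?thesis using s(2)[OF module_hom_closed[OF hom f]] module_hom_closed[OF hom f] by (simp add: Pg.r_neg)
  qed
  \<comment> \<open>The part of \<open>\<theta> n \<tau> f\<close> in degree \<open>n\<close>
    involves only the scalar parts of the coefficients of \<open>f\<close>, and to these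
    \<open>inj\<close> applies.\<close>
  have f1: "f y \<in> filt A (deg A) 1" if f: "f \<in> carrier (K n)" "\<theta> n \<tau> f = \<zero>\<^bsub>P n\<^esub>" for f y
  proof -
    have eq: "kvec A (\<lambda>y. aug (f y)) = (\<lambda>y. hp (f y) 0)" using f(1) by (simp add: kvec_def aug)
    have "kvec A (\<lambda>y. aug (f y)) \<in> carrier (K n)" unfolding eq by (rule K_hpart[OF f(1)])
    then have w: "(\<lambda>y. aug (f y)) \<in> Wn n" by (rule kvec_mem)
    have "\<theta> n \<tau> (kvec A (\<lambda>y. aug (f y))) = hpart (P n) (gr n) (\<theta> n \<tau> f) (int n)"
      unfolding eq using \<theta>_hpart[of n \<tau> f 0, OF \<tau> f(1)] by simp
    also have "\<dots> = \<zero>\<^bsub>P n\<^esub>" unfolding f(2) by (simp add: Pg.hpart_zero)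
    finally have "(\<lambda>y. aug (f y)) = (\<lambda>_. 0)" by (rule inj[OF w])
    then show ?thesis using aug_zero_filt[of "f y"] f(1) by (simp add: fun_eq_iff)
  qed
  \<comment> \<open>In the expansion of \<open>f = ?h f\<close> the factors \<open>f z\<close> have
    positive degree by \<open>f1\<close>, and the values of \<open>?h\<close> satisfy the induction
    hypothesis as kernel elements; the bounds add up.\<close>
  have fm: "\<forall>f\<in>carrier (K n). \<theta> n \<tau> f = \<zero>\<^bsub>P n\<^esub> \<longrightarrow> (\<forall>y. f y \<in> filt A (deg A) (1 + int m))" for m
  proof (induction m)
    case 0 then show ?case using f1 by simp
  next
    case (Suc m)
    show ?case
    proof (intro ballI impI allI)
      fix f y assume f: "f \<in> carrier (K n)" "\<theta> n \<tau> f = \<zero>\<^bsub>P n\<^esub>"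
      have "?h f = f"
      proof -
        have "\<ominus>\<^bsub>K n\<^esub> \<zero>\<^bsub>K n\<^esub> = \<zero>\<^bsub>K n\<^esub>" by (rule KM.M.minus_equality[OF KM.M.l_zero]) (rule KM.M.zero_closed)+
        then show ?thesis
          using f module_hom_zero[OF s(1) P_mod KM] KM.M.r_zero[OF f(1)] by (simp only: a_minus_def)
      qed
      then have e1: "f = (\<Oplus>\<^bsub>K n\<^esub>y\<in>words X n. f y \<odot>\<^bsub>K n\<^esub> ?h (kvec A (K.p n y)))"
        using K.hom_expand[OF h KM f(1)] by simp
      have hk: "?h (kvec A (K.p n y)) \<in> carrier (K n)" for y
        by (rule module_hom_closed[OF h K.kvec_in[OF K.p_in]])
      have e2: "(\<Oplus>\<^bsub>K n\<^esub>y\<in>words X n. f y \<odot>\<^bsub>K n\<^esub> ?h (kvec A (K.p n y)))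
          = (\<lambda>z. \<Oplus>y\<in>words X n. f y \<otimes> ?h (kvec A (K.p n y)) z)"
        using hk f(1) by (subst K.finsum_T) (auto intro!: KM.smult_closed K.T_lmult)
      have eq: "f y = (\<Oplus>z\<in>words X n. f z \<otimes> ?h (kvec A (K.p n z)) y)"
        by (rule fun_cong[OF trans[OF e1 e2]])
      have "f z \<otimes> ?h (kvec A (K.p n z)) y \<in> filt A (deg A) (1 + (1 + int m))" for z
        using Suc.IH hk hker[OF K.kvec_in[OF K.p_in]] f1[OF f] by (intro filt_mult_A) auto
      then have "f y \<in> filt A (deg A) (1 + (1 + int m))" by (subst eq) (intro gr.filt_sum)
      then show "f y \<in> filt A (deg A) (1 + int (Suc m))" by (simp add: algebra_simps)
    qed
  qed
  show "f = (\<lambda>_. \<zero>)" if f: "f \<in> carrier (K n)" "\<theta> n \<tau> f = \<zero>\<^bsub>P n\<^esub>"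
  proof
    fix y
    show "f y = \<zero>"
    proof (rule gr.filt_all)
      fix m :: int assume "1 \<le> m"
      then have "1 + int (nat (m - 1)) = m" by simp
      then show "f y \<in> filt A (deg A) m" using fm[of "nat (m - 1)"] f by metis
    qed
  qed
qed

text \<open>\<open>\<theta> n \<tau>\<close> is an isomorphism that matches the cycles of
  \<open>P n\<close> with those of the Koszul complex. Compatibility with the map chosen one stage
  before is recorded only through cycles, so the induction on \<open>n\<close> needs no memory of
  earlier choices.\<close>

definition ok :: "nat \<Rightarrow> ('b list \<Rightarrow> 'p) \<Rightarrow> bool" where
  "ok n \<tau> \<longleftrightarrow> (\<forall>y. \<tau> y \<in> gr n (int n)) \<and> \<theta> n \<tau> ` carrier (K n) = carrier (P n) \<and>
     (\<forall>f\<in>carrier (K n). \<theta> n \<tau> f = \<zero>\<^bsub>P n\<^esub> \<longrightarrow> f = (\<lambda>_. \<zero>)) \<and>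
     (\<forall>f\<in>carrier (K n). case n of 0 \<Rightarrow> e (\<theta> n \<tau> f) = aug (f [])
        | Suc m \<Rightarrow> (d m (\<theta> n \<tau> f) = \<zero>\<^bsub>P m\<^esub> \<longleftrightarrow> dK f = (\<lambda>_. \<zero>)))"

definition cycle :: "nat \<Rightarrow> ('b list \<Rightarrow> 'a) \<Rightarrow> bool" where
  "cycle n f \<longleftrightarrow> f \<in> carrier (K n) \<and> (case n of 0 \<Rightarrow> aug (f []) = 0 | Suc m \<Rightarrow> dK f = (\<lambda>_. \<zero>))"

lemma
  assumes "ok n \<tau>"
  shows ok_gr: "\<tau> y \<in> gr n (int n)" and ok_surj: "\<theta> n \<tau> ` carrier (K n) = carrier (P n)"
    and ok_hom: "\<theta> n \<tau> \<in> module_hom A (K n) (P n)"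
    and ok_inj: "f \<in> carrier (K n) \<Longrightarrow> \<theta> n \<tau> f = \<zero>\<^bsub>P n\<^esub> \<Longrightarrow> f = (\<lambda>_. \<zero>)"
    and ok_cycle: "f \<in> carrier (K n) \<Longrightarrow> cycle n f \<longleftrightarrow> \<theta> n \<tau> f \<in> d n ` carrier (P (Suc n))"
proof -
  show g: "\<tau> y \<in> gr n (int n)" for y using assms unfolding ok_def by blast
  show hom: "\<theta> n \<tau> \<in> module_hom A (K n) (P n)" by (rule \<theta>_hom[OF Pg.gr_closed[OF g]])
  show "\<theta> n \<tau> ` carrier (K n) = carrier (P n)" using assms unfolding ok_def by blast
  show "f = (\<lambda>_. \<zero>)" if "f \<in> carrier (K n)" "\<theta> n \<tau> f = \<zero>\<^bsub>P n\<^esub>" using assms that unfolding ok_def by blast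
  show "cycle n f \<longleftrightarrow> \<theta> n \<tau> f \<in> d n ` carrier (P (Suc n))" if f: "f \<in> carrier (K n)"
  proof (cases n)
    case 0
    have *: "e (\<theta> n \<tau> f) = aug (f [])" using assms f 0 unfolding ok_def by auto
    have "\<theta> n \<tau> f \<in> carrier (P 0)" using module_hom_closed[OF hom f] 0 by simp
    then show ?thesis using * f 0 PD(5)[of "\<theta> n \<tau> f"] PD(7) by (auto simp: cycle_def)
  next
    case (Suc m)
    have *: "d m (\<theta> n \<tau> f) = \<zero>\<^bsub>P m\<^esub> \<longleftrightarrow> dK f = (\<lambda>_. \<zero>)" using assms f Suc unfolding ok_def by auto
    have "\<theta> n \<tau> f \<in> carrier (P (Suc m))" using module_hom_closed[OF hom f] Suc by simp
    then show ?thesis using * f Suc PD(6)[of "\<theta> n \<tau> f" m] PD(8)[of _ m] by (auto simp: cycle_def)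
  qed
qed

lemma cycle_dK: "f \<in> carrier (K (Suc n)) \<Longrightarrow> cycle n (dK f)"
proof (cases n)
  case 0
  assume f: "f \<in> carrier (K (Suc n))"
  have "aug (dK f []) = (\<Sum>b\<in>X. aug (f [b] \<otimes> x b))"
    unfolding dK_def using f by (intro aug_finsum) simp
  also have "\<dots> = 0" using f by (intro sum.neutral) (simp add: aug_mult aug_deg[OF x_deg])
  finally show ?thesis using dK_closed[OF f] 0 by (simp add: cycle_def)
next
  case (Suc m)
  assume f: "f \<in> carrier (K (Suc n))"
  then show ?thesis using dK_closed[OF f] dK_dK[of f m] Suc by (simp add: cycle_def fun_eq_iff)
qed

text \<open>A preimage of \<open>1\<close> under \<open>e\<close> may be replaced by its component
  of degree zero, since \<open>e\<close> kills the other components. This component generates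
  \<open>P 0\<close>.\<close>

lemma ok_0: "\<exists>\<tau>. ok 0 \<tau>"
proof -
  obtain m where m: "m \<in> carrier (P 0)" "e m = 1" using PD(4)[of 1] by blast
  let ?t = "hpart (P 0) (gr 0) m 0"
  have e0: "e (hpart (P 0) (gr 0) m j) = 0" if "j \<noteq> 0" for j
    using e_gr[of j] Pg.hpart_in[OF m(1), of j] that by auto
  have t: "?t \<in> gr 0 0" by (rule Pg.hpart_in[OF m(1)])
  have tc: "?t \<in> carrier (P 0)" by (rule Pg.gr_closed[OF t])
  have et: "e ?t = 1"
  proof -
    let ?S = "insert 0 {j. hpart (P 0) (gr 0) m j \<noteq> \<zero>\<^bsub>P 0\<^esub>}"
    have fin: "finite ?S" using Pg.hpart_finite[OF m(1)] by simp
    have "m = (\<Oplus>\<^bsub>P 0\<^esub>j\<in>?S. hpart (P 0) (gr 0) m j)" by (rule Pg.hpart_superset[OF m(1) fin]) auto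
    then have "e m = e (\<Oplus>\<^bsub>P 0\<^esub>j\<in>?S. hpart (P 0) (gr 0) m j)" by (rule arg_cong)
    also have "\<dots> = (\<Oplus>\<^bsub>trivial_module A\<^esub>j\<in>?S. e (hpart (P 0) (gr 0) m j))"
      by (intro module_hom_finsum[OF PD(3) P_mod triv]) (simp add: m)
    also have "\<dots> = e ?t"
      by (rule abelian_group.finsum_delta[OF left_module.mod_ag[OF triv] fin]) (simp_all add: e0)
    finally show ?thesis using m(2) by simp
  qed
  let ?\<tau> = "\<lambda>y. ?t"
  have \<theta>: "\<theta> 0 ?\<tau> f = f [] \<odot>\<^bsub>P 0\<^esub> ?t" if "f \<in> carrier (K 0)" for f
    unfolding \<theta>_def using K.T_closed[OF that, of "[]"] tc Pg.finsum_delta[of "{[]}" "[]" "\<lambda>y. f y \<odot>\<^bsub>P 0\<^esub> ?t"]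
    by (simp add: Pm.smult_closed)
  have ef: "e (\<theta> 0 ?\<tau> f) = aug (f [])" if "f \<in> carrier (K 0)" for f
    using K.T_closed[OF that, of "[]"] tc et \<theta>[OF that] by (simp add: module_hom_smult[OF PD(3)])
  have kv: "kvec A (\<lambda>y. if y = [] then c else 0) \<in> carrier (K 0)" for c
    by (rule K.kvec_in) (auto simp: Wsp_def intro!: sum.neutral simp: words_def)
  have inj: "w = (\<lambda>_. 0)" if w: "w \<in> Wn 0" "\<theta> 0 ?\<tau> (kvec A w) = \<zero>\<^bsub>P 0\<^esub>" for w
  proof
    fix y
    have "aug (kvec A w []) = e \<zero>\<^bsub>P 0\<^esub>" using ef[OF K.kvec_in[OF w(1)]] w(2) by simp
    then have "w [] = 0" using module_hom_zero[OF PD(3) P_mod triv] by (simp add: kvec_def)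
    then show "w y = 0" using Wsp_outside[OF w(1), of y] by (cases "y = []") auto
  qed
  have sur: "gr 0 (int 0) \<subseteq> \<theta> 0 ?\<tau> ` carrier (K 0)"
  proof
    fix u assume u: "u \<in> gr 0 (int 0)"
    then have u0: "u \<in> gr 0 0" and uc: "u \<in> carrier (P 0)" using Pg.gr_closed[OF u] by auto
    let ?f = "kvec A (\<lambda>y. if y = [] then e u else 0)"
    have \<theta>f: "\<theta> 0 ?\<tau> ?f = (e u \<odot> \<one>) \<odot>\<^bsub>P 0\<^esub> ?t" using \<theta>[OF kv] by (simp add: kvec_def)
    let ?v = "u \<ominus>\<^bsub>P 0\<^esub> \<theta> 0 ?\<tau> ?f"
    have fc: "\<theta> 0 ?\<tau> ?f \<in> carrier (P 0)" unfolding \<theta>f using tc by (simp add: Pm.smult_closed)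
    have f0: "\<theta> 0 ?\<tau> ?f \<in> gr 0 0"
      unfolding \<theta>f using gr_act[OF deg_smult[OF one_deg, of "e u"] t] by simp
    have "\<ominus>\<^bsub>P 0\<^esub> \<theta> 0 ?\<tau> ?f \<in> gr 0 0"
      using subgroup.m_inv_closed[OF Pg.gr_subgroup f0] by (simp add: a_inv_def)
    then have v: "?v \<in> gr 0 (int 0)" using Pg.gr_add[OF u0] by (simp add: a_minus_def)
    have "e ?v = 0"
      using uc fc ef[OF kv, of "e u"]
      by (simp add: a_minus_def module_hom_add[OF PD(3)] module_hom_neg[OF PD(3) P_mod triv] triv kvec_def)
    then have "?v \<in> d 0 ` carrier (P (Suc 0))" using Pg.gr_closed[OF v] by (intro PD(5)) simp_all
    then have "?v = \<zero>\<^bsub>P 0\<^esub>" by (rule low_boundary_zero[OF v])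
    then have "u = \<theta> 0 ?\<tau> ?f" unfolding a_minus_def by (rule Pg.minus_eq_zeroD[OF _ uc fc])
    then show "u \<in> \<theta> 0 ?\<tau> ` carrier (K 0)" using kv by (rule image_eqI)
  qed
  have "ok 0 ?\<tau>"
    unfolding ok_def
  proof (intro conjI allI ballI impI)
    show t': "?t \<in> gr 0 (int 0)" using t by simp
    show "\<theta> 0 ?\<tau> ` carrier (K 0) = carrier (P 0)"
      by (rule nakayama(1)[where n = 0 and \<tau> = ?\<tau>, OF t' inj sur])
    show "f = (\<lambda>_. \<zero>)" if "f \<in> carrier (K 0)" "\<theta> 0 ?\<tau> f = \<zero>\<^bsub>P 0\<^esub>" for f
      by (rule nakayama(2)[where n = 0 and \<tau> = ?\<tau> and f = f, OF t' inj sur that])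
    show "case (0::nat) of 0 \<Rightarrow> e (\<theta> 0 ?\<tau> f) = aug (f [])
        | Suc m \<Rightarrow> (d m (\<theta> 0 ?\<tau> f) = \<zero>\<^bsub>P m\<^esub> \<longleftrightarrow> dK f = (\<lambda>_. \<zero>))" if "f \<in> carrier (K 0)" for f
      using ef[OF that] by (simp only: nat.case)
  qed
  then show ?thesis by blast
qed

text \<open>The coefficients of \<open>h\<close> are combinations of the \<open>x b\<close>, which
  makes \<open>h\<close> a scalar array on words of length \<open>n + 1\<close>. It satisfies the
  relations placed after the first letter because \<open>h\<close> takes its words from
  \<open>W n\<close>, and those involving the first letter because \<open>h\<close> is a cycle. In
  this lowest degree, exactness is the very definition of \<open>W\<close>.\<close>

lemma low_cycle_lift:
  assumes h: "h \<in> carrier (K n)" "cycle n h" "\<And>y. h y \<in> deg A 1"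
  shows "\<exists>c\<in>Wn (Suc n). dK (kvec A c) = h"
proof -
  have "\<exists>c. h y = (\<Oplus>b\<in>X. c b \<odot> x b)" for y using deg_1[OF h(3)] .
  then obtain c where c: "\<And>y. h y = (\<Oplus>b\<in>X. c y b \<odot> x b)" by metis
  \<comment> \<open>The new first letter is the generator split off from the coefficient; zero
    elsewhere, to meet the support condition.\<close>
  let ?cc = "\<lambda>y. case y of [] \<Rightarrow> 0 | b # y' \<Rightarrow> if b \<in> X \<and> y' \<in> words X n then c y' b else 0"
  have cc: "(\<Oplus>b\<in>X. ?cc (b # y) \<odot> x b) = h y" for y
  proof (cases "y \<in> words X n")
    case True
    then show ?thesis unfolding c by (intro finsum_cong2) auto
  next
    case False
    then show ?thesis using K.T_outside[OF h(1)] by (simp add: finsum_zeroI)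
  qed
  \<comment> \<open>Independence of the \<open>x b\<close> allows coefficients to be compared in the
    reproducing formula of \<open>h\<close>.\<close>
  have cW: "(\<lambda>y. ?cc (b # y)) \<in> Wn n" if b: "b \<in> X" for b
  proof -
    have "?cc (b # y) = (\<Sum>y'\<in>words X n. ?cc (b # y') * K.p n y' y)" for y
    proof -
      have "(\<Oplus>b\<in>X. ?cc (b # y) \<odot> x b) = (\<Oplus>y'\<in>words X n. K.p n y' y \<odot> (\<Oplus>b\<in>X. ?cc (b # y') \<odot> x b))"
        unfolding cc by (rule K.T_repr[OF h(1)])
      also have "\<dots> = (\<Oplus>b\<in>X. (\<Sum>y'\<in>words X n. K.p n y' y * ?cc (b # y')) \<odot> x b)"
        by (rule lin_comb_swap) simp_all
      finally have eq: "(\<Oplus>b\<in>X. ?cc (b # y) \<odot> x b) = (\<Oplus>b\<in>X. (\<Sum>y'\<in>words X n. K.p n y' y * ?cc (b # y')) \<odot> x b)" .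
      have "(\<Oplus>b\<in>X. (?cc (b # y) + - (\<Sum>y'\<in>words X n. K.p n y' y * ?cc (b # y'))) \<odot> x b) =
        (\<Oplus>b\<in>X. ?cc (b # y) \<odot> x b \<oplus> \<ominus> ((\<Sum>y'\<in>words X n. K.p n y' y * ?cc (b # y')) \<odot> x b))"
        by (intro finsum_cong2) (simp_all only: ksm_ladd ksm_neg x_closed ksm_closed add.inv_closed a_closed)
      also have "\<dots> = (\<Oplus>b\<in>X. ?cc (b # y) \<odot> x b) \<oplus> (\<Oplus>b\<in>X. \<ominus> ((\<Sum>y'\<in>words X n. K.p n y' y * ?cc (b # y')) \<odot> x b))"
        by (intro finsum_addf) auto
      also have "(\<Oplus>b\<in>X. \<ominus> ((\<Sum>y'\<in>words X n. K.p n y' y * ?cc (b # y')) \<odot> x b)) = \<ominus> (\<Oplus>b\<in>X. ?cc (b # y) \<odot> x b)"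
        unfolding eq by (intro finsum_neg) auto
      also have "(\<Oplus>b\<in>X. ?cc (b # y) \<odot> x b) \<oplus> \<ominus> (\<Oplus>b\<in>X. ?cc (b # y) \<odot> x b) = \<zero>"
        by (intro r_neg finsum_closed) auto
      finally have "?cc (b # y) + - (\<Sum>y'\<in>words X n. K.p n y' y * ?cc (b # y')) = 0" using b by (rule x_indep)
      then show ?thesis by (simp add: mult.commute)
    qed
    then have "(\<lambda>y. ?cc (b # y)) = (\<lambda>y. \<Sum>y'\<in>words X n. ?cc (b # y') * K.p n y' y)" by (rule ext)
    also have "\<dots> \<in> Wn n" by (intro fsub_sum[OF fsub_Wsp[OF finX]] K.p_in)
    finally show ?thesis .
  qed
  have "?cc \<in> Wn (Suc n)"
    unfolding Wsp_def
  proof (intro CollectI conjI allI impI ballI)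
    show "?cc y = 0" if "y \<notin> words X (Suc n)" for y
      using that by (cases y) auto
    fix \<rho> u v assume \<rho>: "\<rho> \<in> Rp"
    show "(\<Sum>r\<in>words X 2. \<rho> r * ?cc (u @ r @ v)) = 0"
    proof (cases u)
      case (Cons b u')
      show ?thesis
      proof (cases "b \<in> X")
        case True
        then show ?thesis using Wsp_rel[OF cW[OF True] \<rho>, of u' v] Cons by simp
      qed (simp add: Cons)
    next
      \<comment> \<open>The relation covers the first two letters. For \<open>n = 0\<close> the
        words are too long for the support of \<open>?cc\<close>; otherwise \<open>x_rel\<close>
        translates the cycle condition.\<close>
      case Nil
      show ?thesis
      proof (cases n)
        case 0
        then show ?thesis using Nil by (intro sum.neutral) (auto simp: words_def length_Suc_conv numeral_2_eq_2)
      next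
        case (Suc m)
        have "\<zero> = dK h v" using h(2) Suc by (simp add: cycle_def)
        also have "\<dots> = (\<Oplus>b'\<in>X. (\<Oplus>b\<in>X. ?cc (b # b' # v) \<odot> x b) \<otimes> x b')"
          unfolding dK_def cc ..
        also have "\<dots> = (\<Oplus>b'\<in>X. \<Oplus>b\<in>X. ?cc ([b, b'] @ v) \<odot> (x b \<otimes> x b'))"
          by (intro finsum_cong2) (auto simp: finsum_rmult ksm_multl intro!: finsum_cong2 finsum_closed)
        finally show ?thesis using x_rel[of "\<lambda>r. ?cc (r @ v)"] \<rho> Nil by simp
      qed
    qed
  qed
  then show ?thesis using cc by (intro bexI[of _ ?cc]) (simp_all add: fun_eq_iff dK_kvec)
qed

text \<open>Images of the generators are found in the lowest degree by \<open>low_lift\<close>.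
  Injectivity there comes from independence of the \<open>x b\<close>. For surjectivity, the
  differential of a lowest-degree element corresponds to a cycle with linear coefficients, which
  \<open>low_cycle_lift\<close> turns into a boundary; the two elements then differ by a
  lowest-degree cycle, which is zero. \<open>nakayama\<close> extends this to all degrees.\<close>

lemma ok_Suc:
  assumes \<tau>: "ok n \<tau>"
  shows "\<exists>\<tau>'. ok (Suc n) \<tau>' \<and> (\<forall>f\<in>carrier (K (Suc n)). d n (\<theta> (Suc n) \<tau>' f) = \<theta> n \<tau> (dK f))"
proof -
  note hom = ok_hom[OF \<tau>]
  have deg1: "\<theta> n \<tau> f \<in> gr n (int n + 1)" if "\<And>y. f y \<in> deg A 1" for f
    unfolding \<theta>_def using gr_act[OF that ok_gr[OF \<tau>]] by (intro Pg.gr_sum) (simp add: add.commute)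
  have "\<exists>u\<in>gr (Suc n) (int (Suc n)). d n u = \<theta> n \<tau> (dK (kvec A (K.p (Suc n) y)))" for y
  proof (rule low_lift)
    let ?k = "kvec A (K.p (Suc n) y)"
    have k: "?k \<in> carrier (K (Suc n))" by (rule K.kvec_in[OF K.p_in])
    show "\<theta> n \<tau> (dK ?k) \<in> gr n (int n + 1)"
      unfolding dK_kvec[abs_def] by (intro deg1 gr.gr_sum deg_smult x_deg)
    show "\<theta> n \<tau> (dK ?k) \<in> d n ` carrier (P (Suc n))"
      using ok_cycle[OF \<tau> dK_closed[OF k]] cycle_dK[OF k] by simp
  qed
  then obtain \<tau>' where \<tau>': "\<And>y. \<tau>' y \<in> gr (Suc n) (int (Suc n))"
    "\<And>y. d n (\<tau>' y) = \<theta> n \<tau> (dK (kvec A (K.p (Suc n) y)))" by metis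
  have \<tau>'c: "\<tau>' y \<in> carrier (P (Suc n))" for y by (rule Pg.gr_closed[OF \<tau>'(1)])
  have hom': "\<theta> (Suc n) \<tau>' \<in> module_hom A (K (Suc n)) (P (Suc n))" by (rule \<theta>_hom[OF \<tau>'c])
  have compat: "d n (\<theta> (Suc n) \<tau>' f) = \<theta> n \<tau> (dK f)" if f: "f \<in> carrier (K (Suc n))" for f
  proof -
    have "d n (\<theta> (Suc n) \<tau>' f) = (\<Oplus>\<^bsub>P n\<^esub>y\<in>words X (Suc n). d n (f y \<odot>\<^bsub>P (Suc n)\<^esub> \<tau>' y))"
      unfolding \<theta>_def using f \<tau>'c by (intro module_hom_finsum[OF PD(2) P_mod P_mod]) (auto intro!: Pm.smult_closed)
    also have "\<dots> = (\<Oplus>\<^bsub>P n\<^esub>y\<in>words X (Suc n). f y \<odot>\<^bsub>P n\<^esub> \<theta> n \<tau> (dK (kvec A (K.p (Suc n) y))))"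
      using f \<tau>'c by (intro Pg.finsum_cong2)
        (auto simp: module_hom_smult[OF PD(2)] \<tau>'(2) intro!: Pm.smult_closed module_hom_closed[OF hom] dK_closed K.kvec_in K.p_in)
    also have "\<dots> = \<theta> n \<tau> (dK f)"
      by (rule K.hom_expand[OF module_hom_comp[OF dK_hom hom] P_mod f, symmetric])
    finally show ?thesis .
  qed
  have inj: "w = (\<lambda>_. 0)" if w: "w \<in> Wn (Suc n)" "\<theta> (Suc n) \<tau>' (kvec A w) = \<zero>\<^bsub>P (Suc n)\<^esub>" for w
  proof
    fix y
    have k: "kvec A w \<in> carrier (K (Suc n))" by (rule K.kvec_in[OF w(1)])
    have "\<theta> n \<tau> (dK (kvec A w)) = \<zero>\<^bsub>P n\<^esub>"
      using compat[OF k] w(2) module_hom_zero[OF PD(2) P_mod P_mod] by simp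
    then have z: "dK (kvec A w) = (\<lambda>_. \<zero>)" by (rule ok_inj[OF \<tau> dK_closed[OF k]])
    show "w y = 0"
    proof (cases "y \<in> words X (Suc n)")
      case True
      then obtain b y' where y: "y = b # y'" "b \<in> X" by (cases y) (auto simp: words_def)
      have "(\<Oplus>b\<in>X. w (b # y') \<odot> x b) = \<zero>" using fun_cong[OF z, of y'] by (simp add: dK_kvec)
      then show ?thesis using x_indep y by simp
    qed (rule Wsp_outside[OF w(1)])
  qed
  have sur: "gr (Suc n) (int (Suc n)) \<subseteq> \<theta> (Suc n) \<tau>' ` carrier (K (Suc n))"
  proof
    fix u assume u: "u \<in> gr (Suc n) (int (Suc n))"
    have uc: "u \<in> carrier (P (Suc n))" by (rule Pg.gr_closed[OF u])
    have duc: "d n u \<in> carrier (P n)" by (rule module_hom_closed[OF PD(2) uc])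
    have du: "d n u \<in> gr n (int n + 1)" using d_gr[of n "int (Suc n)"] u by (auto simp: add.commute)
    obtain h where h: "h \<in> carrier (K n)" "\<theta> n \<tau> h = d n u" using duc ok_surj[OF \<tau>] by (metis imageE)
    let ?h = "\<lambda>y. hp (h y) 1"
    have h1: "?h \<in> carrier (K n)" by (rule K_hpart[OF h(1)])
    have \<theta>h: "\<theta> n \<tau> ?h = d n u"
      using \<theta>_hpart[of n \<tau> h 1, OF ok_gr[OF \<tau>] h(1)] Pg.hpart_homog[OF du] h(2) by simp
    have cyc: "cycle n ?h" using ok_cycle[OF \<tau> h1] \<theta>h uc by simp
    obtain c where c: "c \<in> Wn (Suc n)" "dK (kvec A c) = ?h"
      using low_cycle_lift[OF h1 cyc] gr.hpart_in[of "h _" 1] h(1) K.T_closed by blast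
    let ?f = "kvec A c"
    have k: "?f \<in> carrier (K (Suc n))" by (rule K.kvec_in[OF c(1)])
    have fc: "\<theta> (Suc n) \<tau>' ?f \<in> carrier (P (Suc n))" by (rule module_hom_closed[OF hom' k])
    have "\<theta> (Suc n) \<tau>' ?f \<in> gr (Suc n) (0 + int (Suc n))"
      unfolding \<theta>_def kvec_def by (intro Pg.gr_sum gr_act \<tau>'(1) deg_smult one_deg)
    then have f0: "\<theta> (Suc n) \<tau>' ?f \<in> gr (Suc n) (int (Suc n))" by simp
    let ?v = "u \<ominus>\<^bsub>P (Suc n)\<^esub> \<theta> (Suc n) \<tau>' ?f"
    have "\<ominus>\<^bsub>P (Suc n)\<^esub> \<theta> (Suc n) \<tau>' ?f \<in> gr (Suc n) (int (Suc n))"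
      using subgroup.m_inv_closed[OF Pg.gr_subgroup f0] by (simp only: a_inv_def)
    then have v: "?v \<in> gr (Suc n) (int (Suc n))" unfolding a_minus_def by (rule Pg.gr_add[OF u])
    have "d n ?v = d n u \<oplus>\<^bsub>P n\<^esub> \<ominus>\<^bsub>P n\<^esub> d n (\<theta> (Suc n) \<tau>' ?f)"
      using module_hom_add[OF PD(2) uc Pg.a_inv_closed[OF fc]] module_hom_neg[OF PD(2) P_mod P_mod fc]
      by (simp only: a_minus_def)
    also have "\<dots> = \<zero>\<^bsub>P n\<^esub>" unfolding compat[OF k] c(2) \<theta>h by (rule Pg.r_neg[OF duc])
    finally have "?v \<in> d (Suc n) ` carrier (P (Suc (Suc n)))" by (intro PD(6) Pg.gr_closed[OF v])
    then have "?v = \<zero>\<^bsub>P (Suc n)\<^esub>" by (rule low_boundary_zero[OF v])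
    then have "u = \<theta> (Suc n) \<tau>' ?f" unfolding a_minus_def by (rule Pg.minus_eq_zeroD[OF _ uc fc])
    then show "u \<in> \<theta> (Suc n) \<tau>' ` carrier (K (Suc n))" using k by (rule image_eqI)
  qed
  note nak = nakayama[OF \<tau>'(1) inj sur]
  have ker: "d n (\<theta> (Suc n) \<tau>' f) = \<zero>\<^bsub>P n\<^esub> \<longleftrightarrow> dK f = (\<lambda>_. \<zero>)" if f: "f \<in> carrier (K (Suc n))" for f
    unfolding compat[OF f] using ok_inj[OF \<tau> dK_closed[OF f]] module_hom_zero[OF hom K.T_left_module P_mod]
    by auto
  have "ok (Suc n) \<tau>'"
    unfolding ok_def using \<tau>'(1) nak ker by simp
  then show ?thesis using compat by blast
qed

text \<open>A cycle is carried to a boundary in \<open>P n\<close>, a preimage in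
  \<open>P (Suc n)\<close> is carried back, and its differential is the cycle by injectivity of
  \<open>\<theta> n \<tau>\<close>.\<close>

theorem K_exact:
  assumes "cycle n f"
  shows "\<exists>f'\<in>carrier (K (Suc n)). dK f' = f"
proof -
  have "\<exists>\<tau>. ok n \<tau>" for n by (induction n) (use ok_0 ok_Suc in blast)+
  then obtain \<tau> where \<tau>: "ok n \<tau>" by blast
  obtain \<tau>' where \<tau>': "ok (Suc n) \<tau>'" "\<And>f. f \<in> carrier (K (Suc n)) \<Longrightarrow> d n (\<theta> (Suc n) \<tau>' f) = \<theta> n \<tau> (dK f)"
    using ok_Suc[OF \<tau>] by blast
  have f: "f \<in> carrier (K n)" using assms by (simp add: cycle_def)
  have "\<theta> n \<tau> f \<in> d n ` carrier (P (Suc n))" using ok_cycle[OF \<tau> f] assms by simp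
  then obtain m where m: "m \<in> carrier (P (Suc n))" "\<theta> n \<tau> f = d n m" by blast
  obtain f' where f': "f' \<in> carrier (K (Suc n))" "\<theta> (Suc n) \<tau>' f' = m"
    using m(1) ok_surj[OF \<tau>'(1)] by (metis imageE)
  have df': "dK f' \<in> carrier (K n)" by (rule dK_closed[OF f'(1)])
  interpret KM: left_module A "K n" by (rule K.T_left_module)
  have eq: "\<theta> n \<tau> f = \<theta> n \<tau> (dK f')" using m(2) \<tau>'(2)[OF f'(1)] f'(2) by simp
  have "\<theta> n \<tau> (f \<oplus>\<^bsub>K n\<^esub> \<ominus>\<^bsub>K n\<^esub> dK f') = \<theta> n \<tau> f \<oplus>\<^bsub>P n\<^esub> \<ominus>\<^bsub>P n\<^esub> \<theta> n \<tau> (dK f')"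
    using module_hom_add[OF ok_hom[OF \<tau>] f KM.M.a_inv_closed[OF df']]
      module_hom_neg[OF ok_hom[OF \<tau>] K.T_left_module P_mod df'] by simp
  also have "\<dots> = \<zero>\<^bsub>P n\<^esub>" unfolding eq by (rule Pg.r_neg[OF module_hom_closed[OF ok_hom[OF \<tau>] df']])
  finally have "f \<oplus>\<^bsub>K n\<^esub> \<ominus>\<^bsub>K n\<^esub> dK f' = (\<lambda>_. \<zero>)"
    by (intro ok_inj[OF \<tau>] KM.M.a_closed[OF f] KM.M.a_inv_closed[OF df'])
  then have "f \<oplus>\<^bsub>K n\<^esub> \<ominus>\<^bsub>K n\<^esub> dK f' = \<zero>\<^bsub>K n\<^esub>" by simp
  then have "f = dK f'" by (rule KM.M.minus_eq_zeroD[OF _ f df'])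
  then show ?thesis using f'(1) by blast
qed

end

section \<open>Quadratic algebras are connected graded\<close>

lemma delta_Wsp_0: "(\<lambda>y. if y = [] then c else 0) \<in> Wsp X Rs 0"
  by (auto simp: Wsp_def words_def intro!: sum.neutral)

lemma delta_Wsp_1: "b \<in> X \<Longrightarrow> (\<lambda>y. if y = [b] then 1 else 0) \<in> Wsp X Rs 1"
  by (auto simp: Wsp_def words_def intro!: sum.neutral) (auto simp: append_eq_Cons_conv)

context coord
begin

lemma proj_eq_iff:
  assumes "isF p" "isF q"
  shows "proj p = proj q \<longleftrightarrow> vanish (\<lambda>y. kap cf p y - kap cf q y)"
proof -
  have d: "isF (p - q)" by (rule isF_diff[OF assms])
  have "proj p = proj (p - q) \<oplus>\<^bsub>QA\<^esub> proj q" using proj_add[OF d assms(2)] by simp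
  then have "proj p = proj q \<longleftrightarrow> proj (p - q) = \<zero>\<^bsub>QA\<^esub>"
    using proj_closed[OF d] proj_closed[OF assms(2)] by (simp add: QA.add.r_cancel_one)
  also have "\<dots> \<longleftrightarrow> vanish (kap cf (p - q))" by (rule proj_zero_iff[OF d])
  also have "kap cf (p - q) = (\<lambda>y. kap cf p y - kap cf q y)" by (simp add: fun_eq_iff kap_diff)
  finally show ?thesis .
qed

text \<open>Components taken on a chosen representative in the free algebra;
  \<open>comp_proj\<close> shows that the choice does not matter, because \<open>vanish\<close> is
  tested degree by degree.\<close>

definition comp where
  "comp a j = (if j < 0 then proj 0 else proj (restr (SOME p. isF p \<and> a = proj p) (nat j)))"

lemma comp_proj: "isF p \<Longrightarrow> comp (proj p) j = (if j < 0 then proj 0 else proj (restr p (nat j)))"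
proof -
  assume p: "isF p"
  let ?q = "SOME q. isF q \<and> proj p = proj q"
  have q: "isF ?q \<and> proj p = proj ?q" by (rule someI[of _ p]) (use p in simp)
  have v: "vanish (\<lambda>y. kap cf ?q y - kap cf p y)" using proj_eq_iff[of ?q p] p q by simp
  have "dp (words X m) (\<lambda>y. kap cf (restr ?q n) y - kap cf (restr p n) y) w = 0" if "w \<in> Wn m" for m n w
  proof (cases "m = n")
    case True
    have "dp (words X m) (\<lambda>y. kap cf (restr ?q n) y - kap cf (restr p n) y) w =
      dp (words X m) (\<lambda>y. kap cf ?q y - kap cf p y) w"
      unfolding dp_def using True by (intro sum.cong) (simp_all add: kap_restr words_length)
    then show ?thesis using v that by (simp add: vanish_def)
  qed (auto simp: dp_def kap_restr words_length intro!: sum.neutral)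
  then have "proj (restr ?q (nat j)) = proj (restr p (nat j))"
    using p q by (subst proj_eq_iff) (simp_all only: restr_isF' vanish_def, simp)
  then show ?thesis by (simp add: comp_def)
qed

lemma deg_QA: "a \<in> deg QA i \<longleftrightarrow> (\<exists>p. a = proj p \<and> Poly_Mapping.keys p \<subseteq> {s \<in> lists W. int (length s) = i})"
  unfolding proj_simps by auto

lemma proj_deg: "Poly_Mapping.keys p \<subseteq> {s \<in> lists W. int (length s) = i} \<Longrightarrow> proj p \<in> deg QA i"
  unfolding deg_QA by blast

lemma comp_finsum:
  assumes p: "isF p"
  shows "finite {j. comp (proj p) j \<noteq> \<zero>\<^bsub>QA\<^esub>}" "proj p = (\<Oplus>\<^bsub>QA\<^esub>j\<in>{j. comp (proj p) j \<noteq> \<zero>\<^bsub>QA\<^esub>}. comp (proj p) j)"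
proof -
  let ?F = "length ` Poly_Mapping.keys p"
  have z: "comp (proj p) j = \<zero>\<^bsub>QA\<^esub>" if "j \<notin> int ` ?F" for j
  proof (cases "j < 0")
    case False
    have "Poly_Mapping.keys (restr p (nat j)) = {}" using that False by (auto simp: keys_restr image_iff)
    then have "restr p (nat j) = 0" by simp
    then show ?thesis using False by (simp add: comp_proj[OF p] proj_zero)
  qed (simp add: comp_proj[OF p] proj_zero)
  then have sub: "{j. comp (proj p) j \<noteq> \<zero>\<^bsub>QA\<^esub>} \<subseteq> int ` ?F" by blast
  then show "finite {j. comp (proj p) j \<noteq> \<zero>\<^bsub>QA\<^esub>}" by (rule finite_subset) simp
  have cl: "comp (proj p) j \<in> carrier QA" for j
    by (simp add: comp_proj[OF p] proj_closed restr_isF'[OF p] del: lists_eq_set)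
  have "proj p = proj (\<Sum>n\<in>?F. restr p n)" using sum_restr[of ?F p] by simp
  also have "\<dots> = (\<Oplus>\<^bsub>QA\<^esub>n\<in>?F. proj (restr p n))" using proj_sum[of ?F "restr p"] restr_isF'[OF p] by simp
  also have "\<dots> = (\<Oplus>\<^bsub>QA\<^esub>n\<in>?F. comp (proj p) (int n))"
    by (simp add: comp_proj[OF p])
  also have "\<dots> = (\<Oplus>\<^bsub>QA\<^esub>j\<in>int ` ?F. comp (proj p) j)"
    using cl by (intro QA.finsum_reindex[symmetric]) (simp_all add: inj_on_def)
  also have "\<dots> = (\<Oplus>\<^bsub>QA\<^esub>j\<in>{j. comp (proj p) j \<noteq> \<zero>\<^bsub>QA\<^esub>}. comp (proj p) j)"
    using sub cl by (intro QA.finsum_superset[symmetric]) simp_all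
  finally show "proj p = (\<Oplus>\<^bsub>QA\<^esub>j\<in>{j. comp (proj p) j \<noteq> \<zero>\<^bsub>QA\<^esub>}. comp (proj p) j)" .
qed

lemma comp_deg: "isF p \<Longrightarrow> comp (proj p) j \<in> deg QA j"
  using restr_isF[of p "nat j"] by (cases "j < 0") (auto simp: comp_proj intro!: proj_deg)

lemma comp_add: "isF p \<Longrightarrow> isF q \<Longrightarrow> comp (proj p \<oplus>\<^bsub>QA\<^esub> proj q) j = comp (proj p) j \<oplus>\<^bsub>QA\<^esub> comp (proj q) j"
proof -
  assume p: "isF p" and q: "isF q"
  have "comp (proj p \<oplus>\<^bsub>QA\<^esub> proj q) j = comp (proj (p + q)) j" using proj_add[OF p q] by simp
  also have "\<dots> = comp (proj p) j \<oplus>\<^bsub>QA\<^esub> comp (proj q) j"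
    using proj_add[OF restr_isF'[OF p] restr_isF'[OF q]] proj_add[of 0 0]
    unfolding comp_proj[OF isF_add[OF p q]] comp_proj[OF p] comp_proj[OF q] restr_add by simp
  finally show ?thesis .
qed

lemma comp_homog:
  assumes "Poly_Mapping.keys p \<subseteq> {s \<in> lists W. int (length s) = i}"
  shows "comp (proj p) j = (if j = i then proj p else \<zero>\<^bsub>QA\<^esub>)"
proof -
  have p: "isF p" using assms by blast
  have "restr p (nat j) = (if j = i then p else 0)" if "\<not> j < 0"
  proof (rule poly_mapping_eqI)
    fix s
    show "Poly_Mapping.lookup (restr p (nat j)) s = Poly_Mapping.lookup (if j = i then p else 0) s"
      using that assms by (cases "s \<in> Poly_Mapping.keys p") (auto simp: lookup_restr in_keys_iff)
  qed
  moreover have "p = 0" if "i < 0"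
  proof -
    have "Poly_Mapping.keys p = {}" using assms that by auto
    then show ?thesis by simp
  qed
  ultimately show ?thesis unfolding comp_proj[OF p] by (cases "j < 0"; cases "j = i") (simp_all add: proj_zero)
qed

lemma QA_neg: "isF p \<Longrightarrow> \<ominus>\<^bsub>QA\<^esub> proj p = proj (- p)"
proof -
  assume p: "isF p"
  then have m: "isF (- p)" by simp
  show ?thesis using proj_add[OF m p] by (intro QA.minus_equality) (simp_all add: proj_zero proj_closed p m del: lists_eq_set)
qed

lemma
  shows QA_grading: "has_grading QA (deg QA)"
    and hpart_comp: "isF p \<Longrightarrow> hpart QA (deg QA) (proj p) = comp (proj p)"
proof -
  have sg: "subgroup (deg QA i) (add_monoid QA)" for i
  proof (rule subgroup.intro)
    show "deg QA i \<subseteq> carrier (add_monoid QA)" unfolding proj_simps by auto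
    show "\<one>\<^bsub>add_monoid QA\<^esub> \<in> deg QA i" using proj_deg[of 0 i] by (simp add: proj_zero)
    fix x assume "x \<in> deg QA i"
    then obtain p where p: "x = proj p" "Poly_Mapping.keys p \<subseteq> {s \<in> lists W. int (length s) = i}" unfolding deg_QA by blast
    then have F: "isF p" by blast
    have "\<ominus>\<^bsub>QA\<^esub> x \<in> deg QA i" unfolding p(1) QA_neg[OF F] using p(2) by (intro proj_deg) simp
    then show "inv\<^bsub>add_monoid QA\<^esub> x \<in> deg QA i" by (simp only: a_inv_def)
    fix y assume "y \<in> deg QA i"
    then obtain q where q: "y = proj q" "Poly_Mapping.keys q \<subseteq> {s \<in> lists W. int (length s) = i}" unfolding deg_QA by blast
    then have Fq: "isF q" by blast
    have "x \<oplus>\<^bsub>QA\<^esub> y \<in> deg QA i"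
      unfolding p(1) q(1) proj_add[OF F Fq, symmetric] using p(2) q(2) Poly_Mapping.keys_add[of p q]
      by (intro proj_deg) blast
    then show "x \<otimes>\<^bsub>add_monoid QA\<^esub> y \<in> deg QA i" by simp
  qed
  have c1: "comp m j \<in> deg QA j" "finite {j. comp m j \<noteq> \<zero>\<^bsub>QA\<^esub>}"
    "m = (\<Oplus>\<^bsub>QA\<^esub>j\<in>{j. comp m j \<noteq> \<zero>\<^bsub>QA\<^esub>}. comp m j)" if m: "m \<in> carrier QA" for m j
  proof -
    obtain p where p: "isF p" "m = proj p" using proj_surj[OF m] by blast
    show "comp m j \<in> deg QA j" "finite {j. comp m j \<noteq> \<zero>\<^bsub>QA\<^esub>}"
      "m = (\<Oplus>\<^bsub>QA\<^esub>j\<in>{j. comp m j \<noteq> \<zero>\<^bsub>QA\<^esub>}. comp m j)"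
      unfolding p(2) by (rule comp_deg[OF p(1)] comp_finsum[OF p(1)])+
  qed
  have c2: "comp (m \<oplus>\<^bsub>QA\<^esub> m') j = comp m j \<oplus>\<^bsub>QA\<^esub> comp m' j" if m: "m \<in> carrier QA" "m' \<in> carrier QA" for m m' j
    using proj_surj[OF m(1)] proj_surj[OF m(2)] comp_add by blast
  have c3: "comp m j = (if j = i then m else \<zero>\<^bsub>QA\<^esub>)" if m: "m \<in> deg QA i" for m i j
  proof -
    obtain p where p: "m = proj p" "Poly_Mapping.keys p \<subseteq> {s \<in> lists W. int (length s) = i}" using m unfolding deg_QA by blast
    show ?thesis unfolding p(1) by (rule comp_homog[OF p(2)])
  qed
  show "has_grading QA (deg QA)"
    by (rule has_gradingI[where M = QA and gr = "deg QA" and c = comp, OF QA.abelian_group_axioms sg c1 c2 c3])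
  show "isF p \<Longrightarrow> hpart QA (deg QA) (proj p) = comp (proj p)"
    by (rule hpart_eq_component[where M = QA and gr = "deg QA" and c = comp, OF QA.abelian_group_axioms sg c1 c2 c3 proj_closed])
qed

lemma proj_scalar: "proj (Poly_Mapping.single [] c) = c \<odot>\<^bsub>QA\<^esub> \<one>\<^bsub>QA\<^esub>"
  using proj_single[of "[]" c] by (simp add: proj_Nil)

lemma galg_QA: "galg QA"
proof (intro galg.intro galg_axioms.intro)
  show "kalg QA" by (rule QA.kalg_axioms)
  show "has_grading QA (deg QA)" by (rule QA_grading)
next
  fix x y i j assume "x \<in> deg QA i" "y \<in> deg QA j"
  then obtain p q where p: "x = proj p" "Poly_Mapping.keys p \<subseteq> {s \<in> lists W. int (length s) = i}"
    and q: "y = proj q" "Poly_Mapping.keys q \<subseteq> {s \<in> lists W. int (length s) = j}" unfolding deg_QA by blast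
  then have F: "isF p" "isF q" by blast+
  have "Poly_Mapping.keys (p * q) \<subseteq> {s \<in> lists W. int (length s) = i + j}"
    using keys_mult[of p q] p(2) q(2) by (fastforce simp: plus_list_def)
  then show "x \<otimes>\<^bsub>QA\<^esub> y \<in> deg QA (i + j)" unfolding p(1) q(1) proj_mult[OF F, symmetric] by (rule proj_deg)
next
  fix i :: int assume i: "i < 0"
  show "deg QA i \<subseteq> {\<zero>\<^bsub>QA\<^esub>}"
  proof
    fix x assume "x \<in> deg QA i"
    then obtain p where p: "x = proj p" "Poly_Mapping.keys p \<subseteq> {s \<in> lists W. int (length s) = i}" unfolding deg_QA by blast
    have "Poly_Mapping.keys p = {}" using p(2) i by auto
    then show "x \<in> {\<zero>\<^bsub>QA\<^esub>}" using p(1) by (simp add: proj_zero)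
  qed
next
  show "deg QA 0 = range (\<lambda>c. c \<odot>\<^bsub>QA\<^esub> \<one>\<^bsub>QA\<^esub>)"
  proof (intro subset_antisym subsetI)
    fix x assume "x \<in> deg QA 0"
    then obtain p where p: "x = proj p" "Poly_Mapping.keys p \<subseteq> {s \<in> lists W. int (length s) = 0}" unfolding deg_QA by blast
    have "p = Poly_Mapping.single [] (Poly_Mapping.lookup p [])"
    proof (rule poly_mapping_eqI)
      fix s show "Poly_Mapping.lookup p s = Poly_Mapping.lookup (Poly_Mapping.single [] (Poly_Mapping.lookup p [])) s"
        using p(2) by (cases "s \<in> Poly_Mapping.keys p") (auto simp: lookup_single in_keys_iff when_def)
    qed
    then have "x = proj (Poly_Mapping.single [] (Poly_Mapping.lookup p []))" using p(1) by simp
    then show "x \<in> range (\<lambda>c. c \<odot>\<^bsub>QA\<^esub> \<one>\<^bsub>QA\<^esub>)" unfolding proj_scalar by blast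
  next
    fix x assume "x \<in> range (\<lambda>c. c \<odot>\<^bsub>QA\<^esub> \<one>\<^bsub>QA\<^esub>)"
    then obtain c where "x = proj (Poly_Mapping.single [] c)" unfolding proj_scalar by blast
    then show "x \<in> deg QA 0" by (auto intro!: proj_deg split: if_splits)
  qed
next
  fix x i c assume "x \<in> deg QA i"
  then obtain p where p: "x = proj p" "Poly_Mapping.keys p \<subseteq> {s \<in> lists W. int (length s) = i}" unfolding deg_QA by blast
  then have F: "isF p" by blast
  have "Poly_Mapping.keys (Poly_Mapping.single [] c * p) \<subseteq> {s \<in> lists W. int (length s) = i}"
    using keys_mult[of "Poly_Mapping.single [] c" p] p(2) by (fastforce simp: plus_list_def split: if_splits)
  then show "c \<odot>\<^bsub>QA\<^esub> x \<in> deg QA i" unfolding p(1) proj_smult[OF F, symmetric] by (rule proj_deg)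
next
  fix c assume "c \<odot>\<^bsub>QA\<^esub> \<one>\<^bsub>QA\<^esub> = \<zero>\<^bsub>QA\<^esub>"
  then have "proj (Poly_Mapping.single [] c) = \<zero>\<^bsub>QA\<^esub>" unfolding proj_scalar .
  then have "vanish (kap cf (Poly_Mapping.single [] c))" by (subst (asm) proj_zero_iff) auto
  \<comment> \<open>In degree zero \<open>W\<close> contains the function that is \<open>1\<close>
    on the empty word, and pairing with it detects the scalar.\<close>
  then have "dp (words X 0) (kap cf (Poly_Mapping.single [] c)) (\<lambda>y. if y = [] then 1 else 0) = 0"
    using delta_Wsp_0[of 1 X Rs] unfolding vanish_def by blast
  then show "c = 0" by (simp add: dp_def)
qed

lemma wm_map_g: "y \<in> words X n \<Longrightarrow> y' \<in> words X n \<Longrightarrow> wm cf (map g y') y = (if y' = y then 1 else 0)"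
proof (induction y' arbitrary: n y)
  case (Cons b y')
  then obtain m where n: "n = Suc m" by (cases n) auto
  with Cons.prems obtain c z where y: "y = c # z" by (cases y) (auto simp: words_def)
  show ?case using Cons.prems Cons.IH[of z m] n y by (auto simp: cf_g)
qed (auto simp: words_def)

lemma xw_deg: "y \<in> words X n \<Longrightarrow> xw y \<in> deg QA (int n)"
  unfolding xw_def using g_lists[OF words_lists] by (intro proj_deg) (simp add: words_length)

lemma array_repr:
  fixes c :: "'b list \<Rightarrow> 'k"
  shows "\<exists>p. Poly_Mapping.keys p \<subseteq> {s \<in> lists W. length s = n} \<and> (\<forall>y\<in>words X n. kap cf p y = c y)"
proof (intro exI conjI ballI)
  let ?p = "\<Sum>y\<in>words X n. Poly_Mapping.single (map g y) (c y)"
  show "Poly_Mapping.keys ?p \<subseteq> {s \<in> lists W. length s = n}"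
  proof (rule order.trans[OF keys_sum], rule UN_least)
    fix y assume "y \<in> words X n"
    then show "Poly_Mapping.keys (Poly_Mapping.single (map g y) (c y)) \<subseteq> {s \<in> lists W. length s = n}"
      using g_lists[OF words_lists] by (simp add: words_length)
  qed
  fix y assume y: "y \<in> words X n"
  have "kap cf ?p y = (\<Sum>y'\<in>words X n. if y' = y then c y' else 0)"
    unfolding kap_sum kap_single by (intro sum.cong) (simp_all add: wm_map_g[OF y])
  then show "kap cf ?p y = c y" using y by simp
qed

text \<open>Every coefficient function on words of length \<open>n\<close> comes from a homogeneous
  element of the free algebra, so \<open>proj_zero_iff\<close> becomes a criterion for linear
  relations among monomials.\<close>

lemma lin_zero:
  "(\<Oplus>\<^bsub>QA\<^esub>y\<in>words X n. c y \<odot>\<^bsub>QA\<^esub> xw y) = \<zero>\<^bsub>QA\<^esub> \<longleftrightarrow> (\<forall>w\<in>Wn n. dp (words X n) c w = 0)"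
proof
  assume z: "(\<Oplus>\<^bsub>QA\<^esub>y\<in>words X n. c y \<odot>\<^bsub>QA\<^esub> xw y) = \<zero>\<^bsub>QA\<^esub>"
  obtain p where p: "Poly_Mapping.keys p \<subseteq> {s \<in> lists W. length s = n}" "\<And>y. y \<in> words X n \<Longrightarrow> kap cf p y = c y"
    using array_repr[of n c] by blast
  have F: "isF p" using p(1) by blast
  have "proj p = (\<Oplus>\<^bsub>QA\<^esub>y\<in>words X n. c y \<odot>\<^bsub>QA\<^esub> xw y)"
    unfolding proj_homog_expand[OF p(1)] using p(2) by (intro QA.finsum_cong2) simp_all
  then have "vanish (kap cf p)" using z proj_zero_iff[OF F] by simp
  moreover have "dp (words X n) (kap cf p) w = dp (words X n) c w" for w
    unfolding dp_def using p(2) by (intro sum.cong) simp_all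
  ultimately show "\<forall>w\<in>Wn n. dp (words X n) c w = 0" unfolding vanish_def by metis
qed (rule vanish_homog_zero, blast)

lemma deg_expand: "a \<in> deg QA (int n) \<Longrightarrow> \<exists>c. a = (\<Oplus>\<^bsub>QA\<^esub>y\<in>words X n. c y \<odot>\<^bsub>QA\<^esub> xw y)"
proof -
  assume "a \<in> deg QA (int n)"
  then obtain p where p: "a = proj p" "Poly_Mapping.keys p \<subseteq> {s \<in> lists W. int (length s) = int n}" unfolding deg_QA by blast
  then have "Poly_Mapping.keys p \<subseteq> {s \<in> lists W. length s = n}" by simp
  from proj_homog_expand[OF this] show ?thesis unfolding p(1) by blast
qed

lemma finsum_words_1: "(\<Oplus>\<^bsub>QA\<^esub>y\<in>words X 1. c y \<odot>\<^bsub>QA\<^esub> xw y) = (\<Oplus>\<^bsub>QA\<^esub>b\<in>X. c [b] \<odot>\<^bsub>QA\<^esub> xw [b])"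
proof -
  have "(\<Oplus>\<^bsub>QA\<^esub>y\<in>words X (Suc 0). c y \<odot>\<^bsub>QA\<^esub> xw y) = (\<Oplus>\<^bsub>QA\<^esub>b\<in>X. \<Oplus>\<^bsub>QA\<^esub>y\<in>words X 0. c (b # y) \<odot>\<^bsub>QA\<^esub> xw (b # y))"
    by (intro QA.finsum_words_Suc) simp_all
  also have "\<dots> = (\<Oplus>\<^bsub>QA\<^esub>b\<in>X. c [b] \<odot>\<^bsub>QA\<^esub> xw [b])"
  proof (intro QA.finsum_cong2)
    fix b assume "b \<in> X"
    then show "(\<Oplus>\<^bsub>QA\<^esub>y\<in>words X 0. c (b # y) \<odot>\<^bsub>QA\<^esub> xw (b # y)) = c [b] \<odot>\<^bsub>QA\<^esub> xw [b]"
      using QA.finsum_delta[of "words X 0" "[]" "\<lambda>y. c (b # y) \<odot>\<^bsub>QA\<^esub> xw (b # y)"] by simp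
  qed simp
  finally show ?thesis by simp
qed

lemma finsum_words_2: "(\<Oplus>\<^bsub>QA\<^esub>y\<in>words X 2. c y \<odot>\<^bsub>QA\<^esub> xw y) =
  (\<Oplus>\<^bsub>QA\<^esub>b'\<in>X. \<Oplus>\<^bsub>QA\<^esub>b\<in>X. c [b, b'] \<odot>\<^bsub>QA\<^esub> (xw [b] \<otimes>\<^bsub>QA\<^esub> xw [b']))"
proof -
  have "(\<Oplus>\<^bsub>QA\<^esub>y\<in>words X (Suc 1). c y \<odot>\<^bsub>QA\<^esub> xw y) = (\<Oplus>\<^bsub>QA\<^esub>b\<in>X. \<Oplus>\<^bsub>QA\<^esub>y\<in>words X 1. c (b # y) \<odot>\<^bsub>QA\<^esub> xw (b # y))"
    by (intro QA.finsum_words_Suc) simp_all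
  also have "\<dots> = (\<Oplus>\<^bsub>QA\<^esub>b\<in>X. \<Oplus>\<^bsub>QA\<^esub>b'\<in>X. c [b, b'] \<odot>\<^bsub>QA\<^esub> (xw [b] \<otimes>\<^bsub>QA\<^esub> xw [b']))"
  proof (intro QA.finsum_cong2)
    fix b assume b: "b \<in> X"
    have "(\<Oplus>\<^bsub>QA\<^esub>y\<in>words X 1. c (b # y) \<odot>\<^bsub>QA\<^esub> xw (b # y)) = (\<Oplus>\<^bsub>QA\<^esub>y\<in>words X 1. xw [b] \<otimes>\<^bsub>QA\<^esub> (c (b # y) \<odot>\<^bsub>QA\<^esub> xw y))"
      using b xw_Cons[OF b words_lists[of _ 1]] by (intro QA.finsum_cong2) (simp_all add: QA.ksm_multr)
    also have "\<dots> = xw [b] \<otimes>\<^bsub>QA\<^esub> (\<Oplus>\<^bsub>QA\<^esub>y\<in>words X 1. c (b # y) \<odot>\<^bsub>QA\<^esub> xw y)"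
      using b by (intro QA.finsum_lmult[symmetric]) simp_all
    also have "\<dots> = (\<Oplus>\<^bsub>QA\<^esub>b'\<in>X. xw [b] \<otimes>\<^bsub>QA\<^esub> (c [b, b'] \<odot>\<^bsub>QA\<^esub> xw [b']))"
      unfolding finsum_words_1 using b by (intro QA.finsum_lmult) simp_all
    also have "\<dots> = (\<Oplus>\<^bsub>QA\<^esub>b'\<in>X. c [b, b'] \<odot>\<^bsub>QA\<^esub> (xw [b] \<otimes>\<^bsub>QA\<^esub> xw [b']))"
      using b by (intro QA.finsum_cong2) (simp_all add: QA.ksm_multr)
    finally show "(\<Oplus>\<^bsub>QA\<^esub>y\<in>words X 1. c (b # y) \<odot>\<^bsub>QA\<^esub> xw (b # y)) =
      (\<Oplus>\<^bsub>QA\<^esub>b'\<in>X. c [b, b'] \<odot>\<^bsub>QA\<^esub> (xw [b] \<otimes>\<^bsub>QA\<^esub> xw [b']))" .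
  qed (simp add: QA.finsum_closed)
  also have "\<dots> = (\<Oplus>\<^bsub>QA\<^esub>b'\<in>X. \<Oplus>\<^bsub>QA\<^esub>b\<in>X. c [b, b'] \<odot>\<^bsub>QA\<^esub> (xw [b] \<otimes>\<^bsub>QA\<^esub> xw [b']))"
    by (intro QA.finsum_swap) simp_all
  finally show ?thesis by (simp add: numeral_2_eq_2)
qed

text \<open>\<open>Wn\<close> is formed here from the relations of the algebra itself, while
  \<open>Rp\<close> will come from its dual; the assumption says that \<open>Rp\<close> and
  \<open>Wn 2\<close> have the same orthogonal complement.\<close>

lemma koszul_alg_QA:
  assumes "\<And>h. (\<forall>\<rho>\<in>Rp. (\<Sum>r\<in>words X 2. \<rho> r * h r) = 0) \<longleftrightarrow> (\<forall>w\<in>Wn 2. dp (words X 2) h w = 0)"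
  shows "koszul_alg QA X (\<lambda>b. xw [b]) Rp"
proof (intro koszul_alg.intro koszul_alg_axioms.intro)
  show "galg QA" by (rule galg_QA)
  show "finite X" by simp
  show "xw [b] \<in> deg QA 1" if "b \<in> X" for b using xw_deg[of "[b]" 1] that by simp
  show "\<exists>c. a = (\<Oplus>\<^bsub>QA\<^esub>b\<in>X. c b \<odot>\<^bsub>QA\<^esub> xw [b])" if a: "a \<in> deg QA 1" for a
  proof -
    obtain c where "a = (\<Oplus>\<^bsub>QA\<^esub>y\<in>words X 1. c y \<odot>\<^bsub>QA\<^esub> xw y)" using deg_expand[of a 1] a unfolding of_nat_1 by blast
    then show ?thesis unfolding finsum_words_1 by (rule exI[of _ "\<lambda>b. c [b]"])
  qed
  show "c b = 0" if z: "(\<Oplus>\<^bsub>QA\<^esub>b\<in>X. c b \<odot>\<^bsub>QA\<^esub> xw [b]) = \<zero>\<^bsub>QA\<^esub>" and b: "b \<in> X" for c b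
  proof -
    have "(\<Oplus>\<^bsub>QA\<^esub>y\<in>words X 1. c (hd y) \<odot>\<^bsub>QA\<^esub> xw y) = \<zero>\<^bsub>QA\<^esub>" unfolding finsum_words_1 using z by simp
    then have "dp (words X 1) (\<lambda>y. c (hd y)) (\<lambda>y. if y = [b] then 1 else 0) = 0"
      using lin_zero[of "\<lambda>y. c (hd y)" 1] delta_Wsp_1[OF b] by blast
    moreover have "dp (words X 1) (\<lambda>y. c (hd y)) (\<lambda>y. if y = [b] then 1 else 0) = (\<Sum>y\<in>words X 1. if y = [b] then c (hd y) else 0)"
      unfolding dp_def by (intro sum.cong) auto
    ultimately show ?thesis using b by simp
  qed
  show "(\<Oplus>\<^bsub>QA\<^esub>b'\<in>X. \<Oplus>\<^bsub>QA\<^esub>b\<in>X. h [b, b'] \<odot>\<^bsub>QA\<^esub> (xw [b] \<otimes>\<^bsub>QA\<^esub> xw [b'])) = \<zero>\<^bsub>QA\<^esub> \<longleftrightarrow>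
    (\<forall>\<rho>\<in>Rp. (\<Sum>r\<in>words X 2. \<rho> r * h r) = 0)" for h
    unfolding finsum_words_2[symmetric] lin_zero assms ..
qed

end

section \<open>Skew polynomial algebras\<close>

text \<open>That \<open>B\<close> is a ring is part of having any left module over it, so it can be
  read off from the given resolution.\<close>

locale skew = galg A for A :: "('k::field, 'a) graded_algebra" (structure) +
  fixes \<sigma> :: "'a \<Rightarrow> 'a"
  assumes \<sigma>: "\<sigma> \<in> graded_aut A" and B_ring: "ring (skew_poly A \<sigma>)"
begin

abbreviation B where "B \<equiv> skew_poly A \<sigma>"

lemma \<sigma>_closed: "a \<in> carrier A \<Longrightarrow> \<sigma> a \<in> carrier A"
  and \<sigma>_add: "a \<in> carrier A \<Longrightarrow> b \<in> carrier A \<Longrightarrow> \<sigma> (a \<oplus> b) = \<sigma> a \<oplus> \<sigma> b"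
  and \<sigma>_mult: "a \<in> carrier A \<Longrightarrow> b \<in> carrier A \<Longrightarrow> \<sigma> (a \<otimes> b) = \<sigma> a \<otimes> \<sigma> b"
  and \<sigma>_one: "\<sigma> \<one> = \<one>"
  and \<sigma>_smult: "a \<in> carrier A \<Longrightarrow> \<sigma> (c \<odot> a) = c \<odot> \<sigma> a"
  and \<sigma>_deg: "a \<in> deg A i \<Longrightarrow> \<sigma> a \<in> deg A i"
  and \<sigma>_bij: "bij_betw \<sigma> (carrier A) (carrier A)"
  using \<sigma> by (auto simp: graded_iso_def graded_hom_def ring_hom_def image_subset_iff)

abbreviation sg :: "nat \<Rightarrow> 'a \<Rightarrow> 'a" where "sg i \<equiv> \<sigma> ^^ i"

lemma sg_closed [simp]: "a \<in> carrier A \<Longrightarrow> sg i a \<in> carrier A"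
  by (induction i) (auto intro: \<sigma>_closed)
lemma sg_add: "a \<in> carrier A \<Longrightarrow> b \<in> carrier A \<Longrightarrow> sg i (a \<oplus> b) = sg i a \<oplus> sg i b"
  by (induction i) (auto simp: \<sigma>_add)
lemma sg_mult: "a \<in> carrier A \<Longrightarrow> b \<in> carrier A \<Longrightarrow> sg i (a \<otimes> b) = sg i a \<otimes> sg i b"
  by (induction i) (auto simp: \<sigma>_mult)
lemma sg_one [simp]: "sg i \<one> = \<one>"
  by (induction i) (auto simp: \<sigma>_one)
lemma sg_smult: "a \<in> carrier A \<Longrightarrow> sg i (c \<odot> a) = c \<odot> sg i a"
  by (induction i) (auto simp: \<sigma>_smult)
lemma sg_deg: "a \<in> deg A j \<Longrightarrow> sg i a \<in> deg A j"
  by (induction i) (auto simp: \<sigma>_deg)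
lemma sg_zero [simp]: "sg i \<zero> = \<zero>"
  using sg_smult[of \<zero> i 0] by simp
lemma sg_bij: "bij_betw (sg i) (carrier A) (carrier A)"
  by (rule bij_betw_funpow[OF \<sigma>_bij])
lemma sg_finsum: "(\<And>i. i \<in> I \<Longrightarrow> f i \<in> carrier A) \<Longrightarrow> sg n (\<Oplus>i\<in>I. f i) = (\<Oplus>i\<in>I. sg n (f i))"
  by (rule finsum_additive) (auto simp: sg_add abelian_group_axioms)

definition si :: "nat \<Rightarrow> 'a \<Rightarrow> 'a" where "si i = inv_into (carrier A) (sg i)"

lemma si_closed [simp]: "a \<in> carrier A \<Longrightarrow> si i a \<in> carrier A"
  unfolding si_def using bij_betw_imp_surj_on[OF sg_bij[of i]] by (intro inv_into_into) simp
lemma sg_si [simp]: "a \<in> carrier A \<Longrightarrow> sg i (si i a) = a"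
  unfolding si_def using bij_betw_imp_surj_on[OF sg_bij[of i]] by (intro f_inv_into_f) simp
lemma si_sg [simp]: "a \<in> carrier A \<Longrightarrow> si i (sg i a) = a"
  unfolding si_def using bij_betw_imp_inj_on[OF sg_bij[of i]] by (intro inv_into_f_f) simp
lemma si_eqI: "b \<in> carrier A \<Longrightarrow> sg i b = a \<Longrightarrow> si i a = b"
  by auto
lemma si_add: "a \<in> carrier A \<Longrightarrow> b \<in> carrier A \<Longrightarrow> si i (a \<oplus> b) = si i a \<oplus> si i b"
  by (rule si_eqI) (auto simp: sg_add)
lemma si_smult: "a \<in> carrier A \<Longrightarrow> si i (c \<odot> a) = c \<odot> si i a"
  by (rule si_eqI) (auto simp: sg_smult)

lemma aug_sg: "a \<in> carrier A \<Longrightarrow> aug (sg i a) = aug a"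
proof (rule augI)
  assume a: "a \<in> carrier A"
  have "hp (sg i a) 0 = sg i (hp a 0)"
    using hpart_map[where m = a and \<phi> = "sg i" and s = 0 and j = 0, OF A_grading A_grading] a sg_deg
    by (simp add: sg_add)
  then show "hp (sg i a) 0 = aug a \<odot> \<one>" using aug[OF a] by (simp add: sg_smult)
qed simp

lemma aug_si: "a \<in> carrier A \<Longrightarrow> aug (si i a) = aug a"
  using aug_sg[of "si i a" i] by simp

lemma B_iff: "f \<in> carrier B \<longleftrightarrow> (\<forall>i. f i \<in> carrier A) \<and> finite {i. f i \<noteq> \<zero>}"
  by (simp add: skew_poly_def Let_def)

lemma B_simps [simp]:
  "\<zero>\<^bsub>B\<^esub> = (\<lambda>i. \<zero>)" "f \<oplus>\<^bsub>B\<^esub> g = (\<lambda>i. f i \<oplus> g i)" "c \<odot>\<^bsub>B\<^esub> f = (\<lambda>i. c \<odot> f i)"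
  "\<one>\<^bsub>B\<^esub> = (\<lambda>i. if i = 0 then \<one> else \<zero>)"
  by (simp_all add: skew_poly_def Let_def)

lemma B_mult: "(f \<otimes>\<^bsub>B\<^esub> g) n = (\<Oplus>i\<in>{..n}. f i \<otimes> sg i (g (n - i)))"
  by (simp add: skew_poly_def Let_def)

lemma B_deg: "f \<in> deg B j \<longleftrightarrow> f \<in> carrier B \<and> (\<forall>i. f i \<in> deg A (j - int i))"
  by (auto simp: skew_poly_def Let_def)

lemma B_closed [simp]: "f \<in> carrier B \<Longrightarrow> f i \<in> carrier A"
  by (simp add: B_iff)

lemma B_finite: "f \<in> carrier B \<Longrightarrow> finite {i. f i \<noteq> \<zero>}"
  by (simp add: B_iff)

lemma B_sub_supp: "(\<And>i. f i \<in> carrier A) \<Longrightarrow> finite F \<Longrightarrow> (\<And>i. i \<notin> F \<Longrightarrow> f i = \<zero>) \<Longrightarrow> f \<in> carrier B"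
  unfolding B_iff by (auto intro: finite_subset[of _ F])

sublocale B: ring B by (rule B_ring)

lemma kalg_B: "kalg B"
proof (intro kalg.intro kalg_axioms.intro)
  show "ring B" by (rule B_ring)
  fix f :: "nat \<Rightarrow> 'a" and c c' :: 'k assume f: "f \<in> carrier B"
  show "c \<odot>\<^bsub>B\<^esub> f \<in> carrier B"
    by (rule B_sub_supp[OF _ B_finite[OF f]]) (use f in auto)
  show "(c + c') \<odot>\<^bsub>B\<^esub> f = c \<odot>\<^bsub>B\<^esub> f \<oplus>\<^bsub>B\<^esub> c' \<odot>\<^bsub>B\<^esub> f" "(c * c') \<odot>\<^bsub>B\<^esub> f = c \<odot>\<^bsub>B\<^esub> (c' \<odot>\<^bsub>B\<^esub> f)" "1 \<odot>\<^bsub>B\<^esub> f = f"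
    using f by (simp_all add: ksm_ladd ksm_assoc)
  fix g assume g: "g \<in> carrier B"
  show "c \<odot>\<^bsub>B\<^esub> (f \<oplus>\<^bsub>B\<^esub> g) = c \<odot>\<^bsub>B\<^esub> f \<oplus>\<^bsub>B\<^esub> c \<odot>\<^bsub>B\<^esub> g" using f g by (simp add: ksm_radd)
  show "(c \<odot>\<^bsub>B\<^esub> f) \<otimes>\<^bsub>B\<^esub> g = c \<odot>\<^bsub>B\<^esub> (f \<otimes>\<^bsub>B\<^esub> g)"
  proof
    fix n
    have "(\<Oplus>i\<in>{..n}. (c \<odot> f i) \<otimes> sg i (g (n - i))) = (\<Oplus>i\<in>{..n}. c \<odot> (f i \<otimes> sg i (g (n - i))))"
      using f g by (intro finsum_cong2) (simp_all add: ksm_multl)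
    also have "\<dots> = c \<odot> (\<Oplus>i\<in>{..n}. f i \<otimes> sg i (g (n - i)))"
      using f g by (intro ksm_finsum[symmetric]) simp
    finally show "((c \<odot>\<^bsub>B\<^esub> f) \<otimes>\<^bsub>B\<^esub> g) n = (c \<odot>\<^bsub>B\<^esub> (f \<otimes>\<^bsub>B\<^esub> g)) n" by (simp add: B_mult)
  qed
  show "f \<otimes>\<^bsub>B\<^esub> (c \<odot>\<^bsub>B\<^esub> g) = c \<odot>\<^bsub>B\<^esub> (f \<otimes>\<^bsub>B\<^esub> g)"
  proof
    fix n
    have "(\<Oplus>i\<in>{..n}. f i \<otimes> sg i (c \<odot> g (n - i))) = (\<Oplus>i\<in>{..n}. c \<odot> (f i \<otimes> sg i (g (n - i))))"
      using f g by (intro finsum_cong2) (simp_all add: ksm_multr sg_smult)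
    also have "\<dots> = c \<odot> (\<Oplus>i\<in>{..n}. f i \<otimes> sg i (g (n - i)))"
      using f g by (intro ksm_finsum[symmetric]) simp
    finally show "(f \<otimes>\<^bsub>B\<^esub> (c \<odot>\<^bsub>B\<^esub> g)) n = (c \<odot>\<^bsub>B\<^esub> (f \<otimes>\<^bsub>B\<^esub> g)) n" by (simp add: B_mult)
  qed
qed

sublocale B: kalg B by (rule kalg_B)

lemma B_finsum: "(\<And>i. i \<in> I \<Longrightarrow> F i \<in> carrier B) \<Longrightarrow> (\<Oplus>\<^bsub>B\<^esub>i\<in>I. F i) n = (\<Oplus>i\<in>I. F i n)"
  by (rule finsum_additive[where f = "\<lambda>f. f n"])
    (auto simp: B.abelian_group_axioms abelian_group_axioms)

lemma B_neg: "f \<in> carrier B \<Longrightarrow> (\<ominus>\<^bsub>B\<^esub> f) n = \<ominus> f n"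
  using B.ksm_neg[of f 1] ksm_neg[of "f n" 1] B.ksm_one[of f] by (metis B_closed B_simps(3) ksm_one)

definition \<iota> :: "'a \<Rightarrow> nat \<Rightarrow> 'a" where "\<iota> a = (\<lambda>i. if i = 0 then a else \<zero>)"
definition zz :: "nat \<Rightarrow> 'a" where "zz = (\<lambda>i. if i = 1 then \<one> else \<zero>)"

lemma \<iota>_closed [simp]: "a \<in> carrier A \<Longrightarrow> \<iota> a \<in> carrier B"
  by (rule B_sub_supp[where F = "{0}"]) (auto simp: \<iota>_def)

lemma zz_closed [simp]: "zz \<in> carrier B"
  by (rule B_sub_supp[where F = "{1}"]) (auto simp: zz_def)

lemma mult_\<iota>: "f \<in> carrier B \<Longrightarrow> a \<in> carrier A \<Longrightarrow> (f \<otimes>\<^bsub>B\<^esub> \<iota> a) n = f n \<otimes> sg n a"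
  unfolding B_mult by (subst finsum_delta[where a = n]) (auto simp: \<iota>_def)

lemma mult_zz: "f \<in> carrier B \<Longrightarrow> (f \<otimes>\<^bsub>B\<^esub> zz) n = (if n = 0 then \<zero> else f (n - 1))"
proof (cases n)
  case 0
  assume "f \<in> carrier B"
  then show ?thesis unfolding B_mult using 0 by (intro trans[OF finsum_zeroI]) (auto simp: zz_def)
next
  case (Suc m)
  assume "f \<in> carrier B"
  then show ?thesis unfolding B_mult Suc by (subst finsum_delta[where a = m]) (auto simp: zz_def Suc_diff_le)
qed

text \<open>In total degree \<open>j\<close> the coefficient of \<open>z\<^sup>i\<close> has degree
  \<open>j - i\<close> in \<open>A\<close>, so components are taken coefficientwise with this
  shift.\<close>

lemma
  shows B_grading: "has_grading B (deg B)"
    and B_hpart: "f \<in> carrier B \<Longrightarrow> hpart B (deg B) f = (\<lambda>j i. hp (f i) (j - int i))"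
proof -
  let ?c = "\<lambda>f j i. hp (f i) (j - int i)"
  have sub: "subgroup (deg B j) (add_monoid B)" for j
  proof (rule subgroup.intro)
    show "deg B j \<subseteq> carrier (add_monoid B)" by (auto simp: B_deg)
    show "\<one>\<^bsub>add_monoid B\<^esub> \<in> deg B j" by (simp add: B_deg B_iff)
    fix f assume f: "f \<in> deg B j"
    have fc: "f \<in> carrier B" using f by (simp add: B_deg)
    have "\<ominus> f i \<in> deg A (j - int i)" for i
      using f subgroup.m_inv_closed[OF gr.gr_subgroup, of "f i" "j - int i"] by (simp add: B_deg a_inv_def)
    then have "\<ominus>\<^bsub>B\<^esub> f \<in> deg B j" using B.a_inv_closed[OF fc] by (simp add: B_deg B_neg[OF fc])
    then show "inv\<^bsub>add_monoid B\<^esub> f \<in> deg B j" by (simp only: a_inv_def)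
    fix g assume g: "g \<in> deg B j"
    have gc: "g \<in> carrier B" using g by (simp add: B_deg)
    have "f \<oplus>\<^bsub>B\<^esub> g \<in> carrier B" using fc gc by (rule B.a_closed)
    then show "f \<otimes>\<^bsub>add_monoid B\<^esub> g \<in> deg B j" using f g gr.gr_add by (simp add: B_deg)
  qed
  have cB: "?c f j \<in> carrier B" if f: "f \<in> carrier B" for f j
    by (rule B_sub_supp[OF _ B_finite[OF f]]) (use f in auto)
  have c1: "?c f j \<in> deg B j" if f: "f \<in> carrier B" for f j
    unfolding B_deg using cB[OF f] f by (simp add: gr.hpart_in)
  \<comment> \<open>All total degrees that can occur in \<open>f\<close>; finite since finitely many
    coefficients are nonzero.\<close>
  let ?F = "\<lambda>f. \<Union>i\<in>{i. f i \<noteq> \<zero>}. (\<lambda>j. j + int i) ` {j. hp (f i) j \<noteq> \<zero>}"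
  have fin: "finite (?F f)" if f: "f \<in> carrier B" for f
    using B_finite[OF f] gr.hpart_finite[OF B_closed[OF f]] by auto
  have z: "?c f j = \<zero>\<^bsub>B\<^esub>" if "j \<notin> ?F f" for f j
  proof -
    have "hp (f i) (j - int i) = \<zero>" for i
    proof (rule ccontr)
      assume a: "hp (f i) (j - int i) \<noteq> \<zero>"
      then have "f i \<noteq> \<zero>" by auto
      moreover have "j = (j - int i) + int i" by simp
      ultimately show False using a that by blast
    qed
    then show ?thesis by simp
  qed
  have c2: "finite {j. ?c f j \<noteq> \<zero>\<^bsub>B\<^esub>}" if f: "f \<in> carrier B" for f
    using z by (intro finite_subset[OF _ fin[OF f]]) blast
  have c3: "f = (\<Oplus>\<^bsub>B\<^esub>j\<in>{j. ?c f j \<noteq> \<zero>\<^bsub>B\<^esub>}. ?c f j)" if f: "f \<in> carrier B" for f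
  proof
    fix i
    let ?S = "{j. ?c f j \<noteq> \<zero>\<^bsub>B\<^esub>}"
    have "(\<Oplus>\<^bsub>B\<^esub>j\<in>?S. ?c f j) i = (\<Oplus>j\<in>?S. hp (f i) (j - int i))"
      using cB[OF f] by (intro B_finsum)
    also have "\<dots> = (\<Oplus>j\<in>(\<lambda>j. j - int i) ` ?S. hp (f i) j)"
      using f by (intro finsum_reindex[symmetric]) (auto simp: inj_on_def)
    also have "\<dots> = f i"
    proof (rule gr.hpart_superset[symmetric])
      show "{j. hp (f i) j \<noteq> \<zero>} \<subseteq> (\<lambda>j. j - int i) ` ?S"
      proof
        fix j assume "j \<in> {j. hp (f i) j \<noteq> \<zero>}"
        then have "?c f (j + int i) i \<noteq> \<zero>" by simp
        then have "?c f (j + int i) \<noteq> \<zero>\<^bsub>B\<^esub>" by (metis B_simps(1))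
        then have "j + int i \<in> ?S" by blast
        then show "j \<in> (\<lambda>j. j - int i) ` ?S" by (rule rev_image_eqI) simp
      qed
    qed (use f c2[OF f] in auto)
    finally show "f i = (\<Oplus>\<^bsub>B\<^esub>j\<in>?S. ?c f j) i" by simp
  qed
  have c4: "?c (f \<oplus>\<^bsub>B\<^esub> g) j = ?c f j \<oplus>\<^bsub>B\<^esub> ?c g j" if "f \<in> carrier B" "g \<in> carrier B" for f g j
    using that by (simp add: gr.hpart_add)
  have c5: "?c f j = (if j = i then f else \<zero>\<^bsub>B\<^esub>)" if f: "f \<in> deg B i" for f i j
    using f gr.hpart_homog[of "f n" "i - int n" "j - int n" for n] by (auto simp: B_deg)
  show "has_grading B (deg B)"
    by (rule has_gradingI[where M = B and gr = "deg B" and c = ?c, OF B.abelian_group_axioms sub c1 c2 c3 c4 c5])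
  show "f \<in> carrier B \<Longrightarrow> hpart B (deg B) f = ?c f"
    by (rule hpart_eq_component[where M = B and gr = "deg B" and c = ?c, OF B.abelian_group_axioms sub c1 c2 c3 c4 c5])
qed

lemma galg_B: "galg B"
proof (intro galg.intro galg_axioms.intro)
  show "kalg B" by (rule kalg_B)
  show "has_grading B (deg B)" by (rule B_grading)
next
  fix f g i j assume f: "f \<in> deg B i" and g: "g \<in> deg B j"
  have fc: "f \<in> carrier B" "g \<in> carrier B" using f g by (auto simp: B_deg)
  have "(f \<otimes>\<^bsub>B\<^esub> g) n \<in> deg A (i + j - int n)" for n
    unfolding B_mult
  proof (rule gr.gr_sum)
    fix k assume k: "k \<in> {..n}"
    have "f k \<otimes> sg k (g (n - k)) \<in> deg A ((i - int k) + (j - int (n - k)))"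
      using f g by (intro deg_mult sg_deg) (simp_all add: B_deg)
    then show "f k \<otimes> sg k (g (n - k)) \<in> deg A (i + j - int n)" using k by (simp add: algebra_simps of_nat_diff)
  qed
  then show "f \<otimes>\<^bsub>B\<^esub> g \<in> deg B (i + j)" using B.m_closed[OF fc] by (simp add: B_deg)
next
  fix i :: int assume "i < 0"
  then have "deg A (i - int n) \<subseteq> {\<zero>}" for n by (intro deg_neg) simp
  then have "f = \<zero>\<^bsub>B\<^esub>" if "f \<in> deg B i" for f
    using that unfolding B_deg B_simps by (intro ext) blast
  then show "deg B i \<subseteq> {\<zero>\<^bsub>B\<^esub>}" by blast
next
  have neg: "f i = \<zero>" if "f \<in> deg B 0" "i > 0" for f i
    using that deg_neg[of "0 - int i"] by (auto simp: B_deg)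
  show "deg B 0 = range (\<lambda>c. c \<odot>\<^bsub>B\<^esub> \<one>\<^bsub>B\<^esub>)"
  proof (intro subset_antisym subsetI)
    fix f assume f: "f \<in> deg B 0"
    then have "f 0 \<in> deg A 0" using spec[of "\<lambda>i. f i \<in> deg A (0 - int i)" 0] by (simp add: B_deg)
    then obtain c where c: "f 0 = c \<odot> \<one>" unfolding deg_0 by blast
    have "f = c \<odot>\<^bsub>B\<^esub> \<one>\<^bsub>B\<^esub>" using c neg[OF f] by (auto simp: fun_eq_iff)
    then show "f \<in> range (\<lambda>c. c \<odot>\<^bsub>B\<^esub> \<one>\<^bsub>B\<^esub>)" by blast
  next
    fix f assume "f \<in> range (\<lambda>c. c \<odot>\<^bsub>B\<^esub> \<one>\<^bsub>B\<^esub>)"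
    then obtain c where f: "f = c \<odot>\<^bsub>B\<^esub> \<one>\<^bsub>B\<^esub>" by blast
    have "f \<in> carrier B" unfolding f by (intro B.ksm_closed B.one_closed)
    then show "f \<in> deg B 0" using deg_smult[OF one_deg, of c] by (simp add: B_deg f)
  qed
next
  fix f i c assume "f \<in> deg B i"
  then show "c \<odot>\<^bsub>B\<^esub> f \<in> deg B i" using B.ksm_closed[of f c] by (simp add: B_deg deg_smult)
next
  fix c assume "c \<odot>\<^bsub>B\<^esub> \<one>\<^bsub>B\<^esub> = \<zero>\<^bsub>B\<^esub>"
  then have "(c \<odot>\<^bsub>B\<^esub> \<one>\<^bsub>B\<^esub>) 0 = \<zero>\<^bsub>B\<^esub> 0" by (rule fun_cong)
  then show "c = 0" by (intro smult_one_inj) simp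
qed

sublocale B: galg B by (rule galg_B)

lemma aug_B: "f \<in> carrier B \<Longrightarrow> augmentation B f = aug (f 0)"
proof (rule B.augI)
  assume f: "f \<in> carrier B"
  have "hp (f i) (0 - int i) = \<zero>" if "i > 0" for i
    using deg_neg[of "0 - int i"] gr.hpart_in[OF B_closed[OF f], of i "0 - int i"] that by auto
  then show "hpart B (deg B) f 0 = aug (f 0) \<odot>\<^bsub>B\<^esub> \<one>\<^bsub>B\<^esub>"
    unfolding B_hpart[OF f] using aug[OF B_closed[OF f, of 0]] by (auto simp: fun_eq_iff)
qed

end

section \<open>The resolution over the skew polynomial algebra\<close>

lemma wm_append2: "length u' = length u \<Longrightarrow> wm T (u' @ v') (u @ v) = wm T u' u * wm T v' v"
  by (simp add: wm_append)

lemma (in abelian_group) finsum_words_append: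
  assumes "finite X" "\<And>y. y \<in> words X (m + n) \<Longrightarrow> f y \<in> carrier G"
  shows "(\<Oplus>y\<in>words X (m + n). f y) = (\<Oplus>u\<in>words X m. \<Oplus>v\<in>words X n. f (u @ v))"
  using assms(2)
proof (induction m arbitrary: f)
  case 0
  then have "(\<Oplus>v\<in>words X n. f v) \<in> carrier G" by (auto intro!: finsum_closed)
  then show ?case using finsum_delta[of "{[]}" "[]" "\<lambda>u. \<Oplus>v\<in>words X n. f (u @ v)"] by simp
next
  case (Suc m)
  have cl: "f (b # y) \<in> carrier G" if "b \<in> X" "y \<in> words X (m + n)" for b y using Suc.prems that by simp
  have "(\<Oplus>y\<in>words X (Suc m + n). f y) = (\<Oplus>b\<in>X. \<Oplus>y\<in>words X (m + n). f (b # y))"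
    using finsum_words_Suc[OF assms(1), of "m + n" f] Suc.prems by simp
  also have "\<dots> = (\<Oplus>b\<in>X. \<Oplus>u\<in>words X m. \<Oplus>v\<in>words X n. f (b # u @ v))"
    using cl cl[OF _ append_words] by (intro finsum_cong2 Suc.IH) (auto intro!: finsum_closed)
  also have "\<dots> = (\<Oplus>u\<in>words X (Suc m). \<Oplus>v\<in>words X n. f (u @ v))"
    using Suc.prems append_words[of _ X "Suc m" _ n]
    by (subst finsum_words_Suc[OF assms(1)]) (auto intro!: finsum_closed)
  finally show ?case .
qed

text \<open>The \<open>n\<close>-fold tensor power of the linear map sending \<open>b'\<close> to
  the sum of \<open>T b' b\<close> times \<open>b\<close>, acting on coefficient functions.\<close>

definition Tw :: "'b set \<Rightarrow> ('b \<Rightarrow> 'b \<Rightarrow> 'k::field) \<Rightarrow> nat \<Rightarrow> ('b list \<Rightarrow> 'k) \<Rightarrow> 'b list \<Rightarrow> 'k" where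
  "Tw X T n w = (\<lambda>y. if y \<in> words X n then \<Sum>y'\<in>words X n. wm T y' y * w y' else 0)"

text \<open>In view of \<open>x_rel\<close> this says that the tensor square of \<open>T\<close>
  maps quadratic relations of \<open>A\<close> to relations. It is phrased through \<open>Rp\<close>
  because membership in \<open>W\<close> is tested against \<open>Rp\<close>.\<close>

definition preserves_rel :: "'b set \<Rightarrow> ('b list \<Rightarrow> 'k::field) set \<Rightarrow> ('b \<Rightarrow> 'b \<Rightarrow> 'k) \<Rightarrow> bool" where
  "preserves_rel X Rp T \<longleftrightarrow> (\<forall>h. (\<forall>\<rho>\<in>Rp. (\<Sum>r\<in>words X 2. \<rho> r * h r) = 0) \<longrightarrow>
      (\<forall>\<rho>\<in>Rp. (\<Sum>r\<in>words X 2. \<rho> r * (\<Sum>r'\<in>words X 2. wm T r' r * h r')) = 0))"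

text \<open>Around a fixed position the tensor power factors into parts for prefix, middle and
  suffix. The sums over the outer words are pulled out, and \<open>preserves_rel\<close> deals with
  the middle.\<close>

lemma Tw_Wsp:
  assumes X: "finite X" and T: "preserves_rel X Rp T" and w: "w \<in> Wsp X Rp n"
  shows "Tw X T n w \<in> Wsp X Rp n"
  unfolding Wsp_def
proof (intro CollectI conjI allI impI ballI)
  show "Tw X T n w y = 0" if "y \<notin> words X n" for y using that by (simp add: Tw_def)
  fix \<rho> u v assume \<rho>: "\<rho> \<in> Rp"
  show "(\<Sum>r\<in>words X 2. \<rho> r * Tw X T n w (u @ r @ v)) = 0"
  proof (cases "u \<in> lists X \<and> v \<in> lists X \<and> length u + (2 + length v) = n")
    case False
    then have "Tw X T n w (u @ r @ v) = 0" if "r \<in> words X 2" for r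
      using that by (auto simp: Tw_def words_def)
    then show ?thesis by simp
  next
    case True
    let ?a = "length u" and ?b = "length v"
    have uv: "u \<in> words X ?a" "v \<in> words X ?b" using True by (auto simp: words_def)
    have n: "n = ?a + (2 + ?b)" using True by simp
    have "Tw X T n w (u @ r @ v) = (\<Sum>u'\<in>words X ?a. \<Sum>v'\<in>words X ?b. \<Sum>r'\<in>words X 2.
        wm T u' u * wm T v' v * (wm T r' r * w (u' @ r' @ v')))" if r: "r \<in> words X 2" for r
    proof -
      have "u @ r @ v \<in> words X n" unfolding n by (intro append_words uv r)
      then have "Tw X T n w (u @ r @ v) = (\<Sum>y'\<in>words X (?a + (2 + ?b)). wm T y' (u @ r @ v) * w y')"
        by (simp add: Tw_def n)
      also have "\<dots> = (\<Sum>u'\<in>words X ?a. \<Sum>r'\<in>words X 2. \<Sum>v'\<in>words X ?b. wm T (u' @ r' @ v') (u @ r @ v) * w (u' @ r' @ v'))"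
        unfolding sum_words_append[OF X] ..
      also have "\<dots> = (\<Sum>u'\<in>words X ?a. \<Sum>r'\<in>words X 2. \<Sum>v'\<in>words X ?b.
        wm T u' u * wm T v' v * (wm T r' r * w (u' @ r' @ v')))"
        using r by (intro sum.cong refl) (simp add: wm_append2 words_length)
      also have "\<dots> = (\<Sum>u'\<in>words X ?a. \<Sum>v'\<in>words X ?b. \<Sum>r'\<in>words X 2.
        wm T u' u * wm T v' v * (wm T r' r * w (u' @ r' @ v')))"
        by (intro sum.cong refl sum.swap)
      finally show ?thesis .
    qed
    then have "(\<Sum>r\<in>words X 2. \<rho> r * Tw X T n w (u @ r @ v)) =
      (\<Sum>r\<in>words X 2. \<Sum>u'\<in>words X ?a. \<Sum>v'\<in>words X ?b. \<rho> r * (\<Sum>r'\<in>words X 2.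
        wm T u' u * wm T v' v * (wm T r' r * w (u' @ r' @ v'))))"
      by (simp add: sum_distrib_left)
    also have "\<dots> = (\<Sum>u'\<in>words X ?a. \<Sum>v'\<in>words X ?b. \<Sum>r\<in>words X 2. \<rho> r * (\<Sum>r'\<in>words X 2.
        wm T u' u * wm T v' v * (wm T r' r * w (u' @ r' @ v'))))"
      by (subst sum.swap) (intro sum.cong refl sum.swap)
    also have "\<dots> = (\<Sum>u'\<in>words X ?a. \<Sum>v'\<in>words X ?b. wm T u' u * wm T v' v *
       (\<Sum>r\<in>words X 2. \<rho> r * (\<Sum>r'\<in>words X 2. wm T r' r * w (u' @ r' @ v'))))"
      by (intro sum.cong refl) (simp add: sum_distrib_left algebra_simps)
    also have "\<dots> = 0"
    proof (intro sum.neutral ballI)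
      fix u' v'
      have "\<forall>\<rho>\<in>Rp. (\<Sum>r\<in>words X 2. \<rho> r * w (u' @ r @ v')) = 0" using Wsp_rel[OF w] by blast
      then have "(\<Sum>r\<in>words X 2. \<rho> r * (\<Sum>r'\<in>words X 2. wm T r' r * w (u' @ r' @ v'))) = 0"
        using T[unfolded preserves_rel_def, rule_format, of "\<lambda>r. w (u' @ r @ v')" \<rho>] \<rho> by blast
      then show "wm T u' u * wm T v' v * (\<Sum>r\<in>words X 2. \<rho> r * (\<Sum>r'\<in>words X 2. wm T r' r * w (u' @ r' @ v'))) = 0" by simp
    qed
    finally show ?thesis .
  qed
qed

text \<open>By \<open>T_x\<close> the matrix \<open>T\<close> describes the inverse of
  \<open>\<sigma>\<close> on the generators. \<open>exact_0\<close> and \<open>exact_Suc\<close> are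
  the only trace left of the graded resolution over \<open>A\<close>.\<close>

locale skew_koszul = skew A \<sigma> + koszul_alg A X x Rp
  for A :: "('k::field, 'a) graded_algebra" (structure) and \<sigma> and X :: "'b set" and x and Rp +
  fixes T :: "'b \<Rightarrow> 'b \<Rightarrow> 'k"
  assumes exact_0: "f \<in> carrier (K 0) \<Longrightarrow> aug (f []) = 0 \<Longrightarrow> \<exists>f'\<in>carrier (K 1). dK f' = f"
    and exact_Suc: "f \<in> carrier (K (Suc n)) \<Longrightarrow> dK f = (\<lambda>_. \<zero>) \<Longrightarrow> \<exists>f'\<in>carrier (K (Suc (Suc n))). dK f' = f"
    and T_rel: "preserves_rel X Rp T"
    and T_x: "c \<in> X \<Longrightarrow> x c = (\<Oplus>b\<in>X. T c b \<odot> \<sigma> (x b))"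
begin

abbreviation D where "D n \<equiv> tens B (words X n) (Wn n)"

sublocale D: ktensor B "words X n" "Wn n" for n by (rule B.ktensor[OF fsub_Wsp[OF finX]])

text \<open>Index set for the summand whose degree is shifted by one. In degree zero it is empty,
  with \<open>W'\<close> the zero space, so that the bottom of the cone needs no separate
  definition.\<close>

definition words' where "words' n = (case n of 0 \<Rightarrow> {} | Suc m \<Rightarrow> words X m)"
definition W' where "W' n = (case n of 0 \<Rightarrow> {\<lambda>_. 0} | Suc m \<Rightarrow> Wn m)"

lemma words'_simps [simp]: "words' 0 = {}" "words' (Suc m) = words X m"
  and W'_simps [simp]: "W' 0 = {\<lambda>_. 0}" "W' (Suc m) = Wn m"
  by (simp_all add: words'_def W'_def)

lemma fsub_W': "fsub (words' n) (W' n)"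
proof (cases n)
  case 0 then show ?thesis by (simp add: fsub_def)
qed (simp add: fsub_Wsp)

abbreviation D' where "D' n \<equiv> tens B (words' n) (W' n)"

sublocale D': ktensor B "words' n" "W' n" for n by (rule B.ktensor[OF fsub_W'])

abbreviation fB :: "('b list \<Rightarrow> nat \<Rightarrow> 'a) \<Rightarrow> bool" where "fB f \<equiv> \<forall>w. f w \<in> carrier B"

text \<open>Coefficients of \<open>f\<close> after moving powers of \<open>z\<close> to the left:
  \<open>a z\<^sup>i = z\<^sup>i \<sigma>\<^sup>-\<^sup>i(a)\<close>. In this form right
  multiplication by elements of \<open>A\<close> does not see \<open>z\<close>, so the complex of
  the \<open>B \<otimes> W n\<close> becomes a direct sum of copies of the Koszul complex of
  \<open>A\<close>.\<close>

definition U :: "nat \<Rightarrow> ('b list \<Rightarrow> nat \<Rightarrow> 'a) \<Rightarrow> 'b list \<Rightarrow> 'a" where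
  "U i f = (\<lambda>w. si i (f w i))"

lemma coef_K: "f \<in> carrier (D n) \<Longrightarrow> (\<lambda>w. f w i) \<in> carrier (K n)"
proof (rule K.TI)
  fix \<rho> assume f: "f \<in> carrier (D n)" and \<rho>: "\<And>w. w \<in> Wn n \<Longrightarrow> dp (words X n) \<rho> w = 0"
  have "(\<Oplus>w\<in>words X n. \<rho> w \<odot> f w i) = (\<Oplus>\<^bsub>B\<^esub>w\<in>words X n. \<rho> w \<odot>\<^bsub>B\<^esub> f w) i"
    using D.T_closed[OF f] B.ksm_closed by (subst B_finsum) simp_all
  also have "\<dots> = \<zero>" using D.T_perp[OF f \<rho>] by simp
  finally show "(\<Oplus>w\<in>words X n. \<rho> w \<odot> f w i) = \<zero>" .
next
  fix w assume f: "f \<in> carrier (D n)"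
  show "f w i \<in> carrier A" using D.T_closed[OF f, of w] by simp
  assume "w \<notin> words X n"
  then show "f w i = \<zero>" using D.T_outside[OF f, of w] by simp
qed

lemma U_K: "f \<in> carrier (D n) \<Longrightarrow> U i f \<in> carrier (K n)"
  unfolding U_def by (rule K.T_additive[OF coef_K]) (simp_all add: si_add si_smult)

lemma D_I:
  assumes "fB f" "\<And>i. (\<lambda>w. f w i) \<in> carrier (K n)"
  shows "f \<in> carrier (D n)"
proof (rule D.TI)
  fix \<rho> assume \<rho>: "\<And>w. w \<in> Wn n \<Longrightarrow> dp (words X n) \<rho> w = 0"
  show "(\<Oplus>\<^bsub>B\<^esub>w\<in>words X n. \<rho> w \<odot>\<^bsub>B\<^esub> f w) = \<zero>\<^bsub>B\<^esub>"
  proof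
    fix i
    have "(\<Oplus>\<^bsub>B\<^esub>w\<in>words X n. \<rho> w \<odot>\<^bsub>B\<^esub> f w) i = (\<Oplus>w\<in>words X n. \<rho> w \<odot> f w i)"
      using assms(1) B.ksm_closed by (subst B_finsum) simp_all
    then show "(\<Oplus>\<^bsub>B\<^esub>w\<in>words X n. \<rho> w \<odot>\<^bsub>B\<^esub> f w) i = \<zero>\<^bsub>B\<^esub> i" using K.T_perp[OF assms(2) \<rho>] by simp
  qed
next
  fix w assume "w \<notin> words X n"
  then show "f w = \<zero>\<^bsub>B\<^esub>" using K.T_outside[OF assms(2)] by (simp add: fun_eq_iff)
qed (use assms(1) in blast)

definition dB :: "('b list \<Rightarrow> nat \<Rightarrow> 'a) \<Rightarrow> 'b list \<Rightarrow> nat \<Rightarrow> 'a" where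
  "dB f w = (\<Oplus>\<^bsub>B\<^esub>b\<in>X. f (b # w) \<otimes>\<^bsub>B\<^esub> \<iota> (x b))"

lemma dB_closed [simp]: "fB f \<Longrightarrow> dB f w \<in> carrier B"
  unfolding dB_def by (intro B.finsum_closed) (simp add: Pi_iff)

lemma dB_coef: "fB f \<Longrightarrow> dB f w i = (\<Oplus>b\<in>X. f (b # w) i \<otimes> sg i (x b))"
  unfolding dB_def by (subst B_finsum) (simp_all add: mult_\<iota> cong: finsum_cong)

lemma dB_D: "f \<in> carrier (D (Suc n)) \<Longrightarrow> dB f \<in> carrier (D n)"
proof -
  assume f: "f \<in> carrier (D (Suc n))"
  have "(\<lambda>w. f (b # w)) \<in> carrier (D n)" if "b \<in> X" for b
    using B.tens_factor[OF finX f, of "[b]" 1 "[]" 0 n] that by simp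
  then show ?thesis unfolding dB_def[abs_def] by (intro D.T_sum D.T_rmult) simp_all
qed

lemma dB_D': "f \<in> carrier (D' (Suc n)) \<Longrightarrow> dB f \<in> carrier (D' n)"
proof (cases n)
  case 0
  assume f: "f \<in> carrier (D' (Suc n))"
  then have "f (b # w) = \<zero>\<^bsub>B\<^esub>" for b w using D'.T_outside[OF f, of "b # w"] 0 by simp
  then have "dB f = (\<lambda>_. \<zero>\<^bsub>B\<^esub>)" unfolding dB_def[abs_def] by (intro ext B.finsum_zeroI) (simp only: B.l_null \<iota>_closed x_closed)
  then show ?thesis using D'.T_zero by simp
qed (simp add: dB_D)

lemma U_dB: "f \<in> carrier (D (Suc n)) \<Longrightarrow> U i (dB f) w = dK (U i f) w"
proof -
  assume f: "f \<in> carrier (D (Suc n))"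
  have fc: "f y i \<in> carrier A" for y using D.T_closed[OF f, of y] by simp
  have "sg i (dK (U i f) w) = (\<Oplus>b\<in>X. sg i (U i f (b # w) \<otimes> x b))"
    unfolding dK_def using fc by (intro sg_finsum) (simp add: U_def)
  also have "\<dots> = dB f w i"
    using fc D.T_closed[OF f] by (subst dB_coef) (auto simp: U_def sg_mult intro!: finsum_cong2)
  finally show ?thesis
    using K.T_closed[OF dK_closed[OF U_K[OF f]]] si_eqI by (metis U_def)
qed

lemma D_eq_zero: "f \<in> carrier (D n) \<Longrightarrow> (\<And>i w. U i f w = \<zero>) \<Longrightarrow> f w = \<zero>\<^bsub>B\<^esub>"
proof
  fix i assume f: "f \<in> carrier (D n)" and z: "\<And>i w. U i f w = \<zero>"
  have "f w i \<in> carrier A" using D.T_closed[OF f, of w] by simp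
  then show "f w i = \<zero>\<^bsub>B\<^esub> i" using z[of i w] sg_si[of "f w i" i] by (simp add: U_def)
qed

lemma dB_dB: "f \<in> carrier (D (Suc (Suc n))) \<Longrightarrow> dB (dB f) w = \<zero>\<^bsub>B\<^esub>"
proof (rule D_eq_zero[OF dB_D[OF dB_D]])
  fix i w assume f: "f \<in> carrier (D (Suc (Suc n)))"
  have "U i (dB (dB f)) w = dK (dK (U i f)) w"
    using U_dB[OF dB_D[OF f], of i w] U_dB[OF f, of i] by (simp add: dK_def)
  then show "U i (dB (dB f)) w = \<zero>" using dK_dK[OF U_K[OF f]] by simp
qed

text \<open>By \<open>U_dB\<close> the problem splits into one copy of the Koszul complex for each
  power of \<open>z\<close>; the bottom condition carries over because \<open>\<sigma>\<close>
  preserves the augmentation.\<close>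

lemma dB_exact:
  assumes f: "f \<in> carrier (D n)" and cyc: "case n of 0 \<Rightarrow> \<forall>i. aug (f [] i) = 0 | Suc m \<Rightarrow> \<forall>w. dB f w = \<zero>\<^bsub>B\<^esub>"
  shows "\<exists>f'\<in>carrier (D (Suc n)). dB f' = f"
proof -
  \<comment> \<open>The lift is required to be zero whenever \<open>U i f\<close> is. Only finitely
    many \<open>i\<close> then contribute, so the assembled function takes values in
    polynomials.\<close>
  have "\<exists>g\<in>carrier (K (Suc n)). dK g = U i f \<and> (U i f = (\<lambda>_. \<zero>) \<longrightarrow> g = (\<lambda>_. \<zero>))" for i
  proof (cases "U i f = (\<lambda>_. \<zero>)")
    case True
    then show ?thesis using K.T_zero[of "Suc n"] by (intro bexI[of _ "\<lambda>_. \<zero>"]) (auto simp: dK_def fun_eq_iff intro!: finsum_zeroI)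
  next
    case False
    have "\<exists>g\<in>carrier (K (Suc n)). dK g = U i f"
    proof (cases n)
      case 0
      have "f [] i \<in> carrier A" using D.T_closed[OF f, of "[]"] by simp
      then have "aug (U i f []) = 0" using cyc 0 by (simp add: U_def aug_si)
      then show ?thesis using exact_0[of "U i f"] U_K[OF f, of i] 0 by simp
    next
      case (Suc m)
      have "dK (U i f) w = \<zero>" for w
        using U_dB[of f m i w] f cyc Suc si_eqI[of \<zero> i \<zero>] by (simp add: U_def)
      then show ?thesis using exact_Suc[of "U i f" m] U_K[OF f, of i] Suc by auto
    qed
    then show ?thesis using False by blast
  qed
  then obtain g where g: "\<And>i. g i \<in> carrier (K (Suc n))" "\<And>i. dK (g i) = U i f"
    "\<And>i. U i f = (\<lambda>_. \<zero>) \<Longrightarrow> g i = (\<lambda>_. \<zero>)" by metis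
  let ?f = "\<lambda>w i. sg i (g i w)"
  have fB: "fB ?f"
  proof
    fix w
    let ?F = "\<Union>y\<in>words X n. {i. f y i \<noteq> \<zero>}"
    show "?f w \<in> carrier B"
    proof (rule B_sub_supp)
      show "sg i (g i w) \<in> carrier A" for i using K.T_closed[OF g(1)] by simp
      show "finite ?F" using B_finite[OF D.T_closed[OF f]] by simp
      fix i assume i: "i \<notin> ?F"
      have "f y i = \<zero>" for y using i D.T_outside[OF f, of y] by (cases "y \<in> words X n") auto
      then have "U i f = (\<lambda>_. \<zero>)" using si_eqI[of \<zero> i \<zero>] by (simp add: U_def)
      then show "sg i (g i w) = \<zero>" using g(3) by simp
    qed
  qed
  have D: "?f \<in> carrier (D (Suc n))"
    by (rule D_I[OF fB], rule K.T_additive[OF g(1)]) (simp_all add: sg_add sg_smult)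
  have "U i ?f = g i" for i using K.T_closed[OF g(1)] by (simp add: U_def)
  then have Ud: "U i (dB ?f) w = U i f w" for i w using U_dB[OF D, of i w] g(2) by simp
  have "dB ?f w i = f w i" for w i
  proof -
    have "dB ?f w i \<in> carrier A" "f w i \<in> carrier A" using D.T_closed[OF dB_D[OF D]] D.T_closed[OF f] by simp_all
    then show ?thesis using Ud[of i w] sg_si unfolding U_def by metis
  qed
  then have "dB ?f = f" by (intro ext)
  then show ?thesis using D by blast
qed

lemma dB_add: "fB f \<Longrightarrow> fB g \<Longrightarrow> dB (\<lambda>w. f w \<oplus>\<^bsub>B\<^esub> g w) w = dB f w \<oplus>\<^bsub>B\<^esub> dB g w"
proof -
  assume f: "fB f" and g: "fB g"
  have "dB (\<lambda>w. f w \<oplus>\<^bsub>B\<^esub> g w) w = (\<Oplus>\<^bsub>B\<^esub>b\<in>X. f (b # w) \<otimes>\<^bsub>B\<^esub> \<iota> (x b) \<oplus>\<^bsub>B\<^esub> g (b # w) \<otimes>\<^bsub>B\<^esub> \<iota> (x b))"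
    unfolding dB_def using f g by (intro B.finsum_cong2 B.l_distr) (simp_all del: B_simps)
  also have "\<dots> = dB f w \<oplus>\<^bsub>B\<^esub> dB g w"
    unfolding dB_def using f g by (intro B.finsum_addf) (simp_all add: Pi_iff del: B_simps)
  finally show ?thesis .
qed

lemma dB_lmult: "fB f \<Longrightarrow> a \<in> carrier B \<Longrightarrow> dB (\<lambda>w. a \<otimes>\<^bsub>B\<^esub> f w) w = a \<otimes>\<^bsub>B\<^esub> dB f w"
  unfolding dB_def by (subst B.finsum_lmult) (simp_all add: B.m_assoc cong: B.finsum_cong del: B_simps)

lemma dB_neg: "fB f \<Longrightarrow> dB (\<lambda>w. \<ominus>\<^bsub>B\<^esub> f w) w = \<ominus>\<^bsub>B\<^esub> dB f w"
  unfolding dB_def by (subst B.finsum_neg[symmetric]) (simp_all add: B.l_minus cong: B.finsum_cong del: B_simps)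

lemma dB_ksm: "fB f \<Longrightarrow> dB (\<lambda>w. c \<odot>\<^bsub>B\<^esub> f w) w = c \<odot>\<^bsub>B\<^esub> dB f w"
  unfolding dB_def by (subst B.ksm_finsum) (simp_all add: B.ksm_multl cong: B.finsum_cong del: B_simps)

text \<open>The same tensor power as \<open>Tw\<close>, acting on \<open>B \<otimes> W n\<close>
  through the second factor.\<close>

definition Tst where
  "Tst n f = (\<lambda>y. if y \<in> words X n then \<Oplus>\<^bsub>B\<^esub>y'\<in>words X n. wm T y' y \<odot>\<^bsub>B\<^esub> f y' else \<zero>\<^bsub>B\<^esub>)"

lemma Tst_closed [simp]: "fB f \<Longrightarrow> Tst n f w \<in> carrier B"
  unfolding Tst_def by (auto intro!: B.finsum_closed simp del: B_simps)

lemma Tst_D: "f \<in> carrier (D n) \<Longrightarrow> Tst n f \<in> carrier (D n)"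
proof -
  assume f: "f \<in> carrier (D n)"
  let ?\<Lambda> = "\<lambda>y y'. if y \<in> words X n then wm T y' y else 0"
  have "(\<lambda>y. \<Oplus>\<^bsub>B\<^esub>y'\<in>words X n. ?\<Lambda> y y' \<odot>\<^bsub>B\<^esub> f y') \<in> carrier (D n)"
  proof (rule B.tens_matrix[OF D.ktensor_axioms D.ktensor_axioms f])
    fix w assume w: "w \<in> Wn n"
    have "(\<lambda>y. \<Sum>y'\<in>words X n. ?\<Lambda> y y' * w y') = Tw X T n w"
      by (auto simp: Tw_def fun_eq_iff)
    then show "(\<lambda>y. \<Sum>y'\<in>words X n. ?\<Lambda> y y' * w y') \<in> Wn n" using Tw_Wsp[OF finX T_rel w] by simp
  qed simp
  moreover have "(\<lambda>y. \<Oplus>\<^bsub>B\<^esub>y'\<in>words X n. ?\<Lambda> y y' \<odot>\<^bsub>B\<^esub> f y') = Tst n f"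
  proof
    fix y show "(\<Oplus>\<^bsub>B\<^esub>y'\<in>words X n. ?\<Lambda> y y' \<odot>\<^bsub>B\<^esub> f y') = Tst n f y"
      using D.T_closed[OF f] by (cases "y \<in> words X n") (auto simp: Tst_def intro!: B.finsum_zeroI simp del: B_simps)
  qed
  ultimately show ?thesis by simp
qed

lemma Tst_add: "fB f \<Longrightarrow> fB g \<Longrightarrow> Tst n (\<lambda>w. f w \<oplus>\<^bsub>B\<^esub> g w) w = Tst n f w \<oplus>\<^bsub>B\<^esub> Tst n g w"
proof (cases "w \<in> words X n")
  case True
  assume f: "fB f" and g: "fB g"
  have "Tst n (\<lambda>w. f w \<oplus>\<^bsub>B\<^esub> g w) w = (\<Oplus>\<^bsub>B\<^esub>y'\<in>words X n. wm T y' w \<odot>\<^bsub>B\<^esub> f y' \<oplus>\<^bsub>B\<^esub> wm T y' w \<odot>\<^bsub>B\<^esub> g y')"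
    using f g True unfolding Tst_def by (simp add: B.ksm_radd del: B_simps)
  also have "\<dots> = Tst n f w \<oplus>\<^bsub>B\<^esub> Tst n g w"
    using f g True unfolding Tst_def by (subst B.finsum_addf) (simp_all add: Pi_iff del: B_simps)
  finally show ?thesis .
qed (simp add: Tst_def)

lemma Tst_lmult: "fB f \<Longrightarrow> a \<in> carrier B \<Longrightarrow> Tst n (\<lambda>w. a \<otimes>\<^bsub>B\<^esub> f w) w = a \<otimes>\<^bsub>B\<^esub> Tst n f w"
  unfolding Tst_def by (simp add: B.finsum_lmult B.ksm_multr cong: B.finsum_cong del: B_simps)

lemma Tst_neg: "fB f \<Longrightarrow> Tst n (\<lambda>w. \<ominus>\<^bsub>B\<^esub> f w) w = \<ominus>\<^bsub>B\<^esub> Tst n f w"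
  unfolding Tst_def by (simp add: B.finsum_neg[symmetric] B.ksm_neg_right cong: B.finsum_cong del: B_simps)

text \<open>Since \<open>T\<close> is the matrix of \<open>\<sigma>\<^sup>-\<^sup>1\<close>, moving \<open>z\<close> to the right past the generators undoes \<open>Tst\<close>.\<close>

lemma dB_Tst_z:
  assumes "fB g"
  shows "dB (\<lambda>w. Tst (Suc n) g w \<otimes>\<^bsub>B\<^esub> zz) w = Tst n (dB g) w \<otimes>\<^bsub>B\<^esub> zz"
proof (cases "w \<in> words X n")
  case False
  then have "Tst (Suc n) g (b # w) = \<zero>\<^bsub>B\<^esub>" for b by (simp add: Tst_def)
  then have "dB (\<lambda>w. Tst (Suc n) g w \<otimes>\<^bsub>B\<^esub> zz) w = \<zero>\<^bsub>B\<^esub>"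
    unfolding dB_def by (intro B.finsum_zeroI) (simp only: B.l_null \<iota>_closed x_closed zz_closed)
  moreover have "Tst n (dB g) w \<otimes>\<^bsub>B\<^esub> zz = \<zero>\<^bsub>B\<^esub>" using False by (simp add: Tst_def del: B_simps)
  ultimately show ?thesis by simp
next
  case True
  show ?thesis
  proof
    fix j
    have gB: "fB g" by (rule assms)
    have h: "fB (\<lambda>w. Tst (Suc n) g w \<otimes>\<^bsub>B\<^esub> zz)" using gB by simp
    have dg: "fB (dB g)" using gB by simp
    show "dB (\<lambda>w. Tst (Suc n) g w \<otimes>\<^bsub>B\<^esub> zz) w j = (Tst n (dB g) w \<otimes>\<^bsub>B\<^esub> zz) j"
    proof (cases j)
      case 0
      then show ?thesis using gB dg by (simp add: dB_coef[OF h] mult_zz del: B_simps) (auto intro!: finsum_zeroI)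
    next
      case (Suc i)
      let ?s = "\<lambda>b. sg (Suc i) (x b)"
      let ?G = "\<lambda>c w'. g (c # w') i"
      let ?m = "\<lambda>w'. wm T w' w"
      have Gc: "?G c w' \<in> carrier A" for c w' using gB by simp
      have s: "?s b \<in> carrier A" if "b \<in> X" for b using that by (intro sg_closed) simp
      have Tg: "Tst (Suc n) g (b # w) i = (\<Oplus>c\<in>X. \<Oplus>w'\<in>words X n. (T c b * ?m w') \<odot> ?G c w')" if b: "b \<in> X" for b
      proof -
        have "Tst (Suc n) g (b # w) i = (\<Oplus>y'\<in>words X (Suc n). wm T y' (b # w) \<odot> g y' i)"
          using True b gB B.ksm_closed by (simp add: Tst_def B_finsum)
        also have "\<dots> = (\<Oplus>c\<in>X. \<Oplus>w'\<in>words X n. wm T (c # w') (b # w) \<odot> g (c # w') i)"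
          using gB by (intro finsum_words_Suc) simp_all
        finally show ?thesis by simp
      qed
      have "dB (\<lambda>w. Tst (Suc n) g w \<otimes>\<^bsub>B\<^esub> zz) w j = (\<Oplus>b\<in>X. Tst (Suc n) g (b # w) i \<otimes> ?s b)"
        using gB Suc unfolding dB_coef[OF h] by (simp add: mult_zz)
      also have "\<dots> = (\<Oplus>b\<in>X. \<Oplus>c\<in>X. \<Oplus>w'\<in>words X n. (T c b * ?m w') \<odot> (?G c w' \<otimes> ?s b))"
      proof (intro finsum_cong2)
        fix b assume b: "b \<in> X"
        have "Tst (Suc n) g (b # w) i \<otimes> ?s b = (\<Oplus>c\<in>X. (\<Oplus>w'\<in>words X n. (T c b * ?m w') \<odot> ?G c w') \<otimes> ?s b)"
          unfolding Tg[OF b] using Gc s[OF b] by (intro finsum_rmult finsum_closed) simp_all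
        also have "\<dots> = (\<Oplus>c\<in>X. \<Oplus>w'\<in>words X n. (T c b * ?m w') \<odot> (?G c w' \<otimes> ?s b))"
          using Gc s[OF b] by (intro finsum_cong2) (simp_all add: finsum_rmult ksm_multl finsum_closed)
        finally show "Tst (Suc n) g (b # w) i \<otimes> ?s b = (\<Oplus>c\<in>X. \<Oplus>w'\<in>words X n. (T c b * ?m w') \<odot> (?G c w' \<otimes> ?s b))" .
      qed (use Gc s in \<open>simp add: finsum_closed\<close>)
      also have "\<dots> = (\<Oplus>c\<in>X. \<Oplus>b\<in>X. \<Oplus>w'\<in>words X n. (T c b * ?m w') \<odot> (?G c w' \<otimes> ?s b))"
        using Gc s by (intro finsum_swap) (simp_all add: finsum_closed)
      also have "\<dots> = (\<Oplus>c\<in>X. \<Oplus>w'\<in>words X n. \<Oplus>b\<in>X. (T c b * ?m w') \<odot> (?G c w' \<otimes> ?s b))"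
        using Gc s by (intro finsum_cong2 finsum_swap) (simp_all add: finsum_closed)
      also have "\<dots> = (\<Oplus>w'\<in>words X n. \<Oplus>c\<in>X. \<Oplus>b\<in>X. (T c b * ?m w') \<odot> (?G c w' \<otimes> ?s b))"
        using Gc s by (intro finsum_swap) (simp_all add: finsum_closed)
      \<comment> \<open>By \<open>T_x\<close> the sum over \<open>b\<close> of \<open>T c b\<close>
        times \<open>\<sigma>\<^sup>i\<^sup>+\<^sup>1(x b)\<close> is
        \<open>\<sigma>\<^sup>i(x c)\<close>: the additional \<open>\<sigma>\<close> caused by
        \<open>z\<close> cancels against the twist of the first letter.\<close>
      also have "\<dots> = (\<Oplus>w'\<in>words X n. ?m w' \<odot> (\<Oplus>c\<in>X. ?G c w' \<otimes> sg i (x c)))"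
      proof (intro finsum_cong2)
        fix w' assume "w' \<in> words X n"
        have "(\<Oplus>b\<in>X. (T c b * ?m w') \<odot> (?G c w' \<otimes> ?s b)) = ?m w' \<odot> (?G c w' \<otimes> sg i (x c))" if c: "c \<in> X" for c
        proof -
          have "sg i (x c) = sg i (\<Oplus>b\<in>X. T c b \<odot> \<sigma> (x b))" using T_x[OF c] by (rule arg_cong)
          also have "\<dots> = (\<Oplus>b\<in>X. sg i (T c b \<odot> \<sigma> (x b)))" by (intro sg_finsum) (simp add: \<sigma>_closed)
          also have "\<dots> = (\<Oplus>b\<in>X. T c b \<odot> ?s b)"
            by (intro finsum_cong2) (simp_all add: sg_smult \<sigma>_closed funpow_swap1)
          finally have e: "sg i (x c) = (\<Oplus>b\<in>X. T c b \<odot> ?s b)" .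
          have "?m w' \<odot> (?G c w' \<otimes> sg i (x c)) = ?m w' \<odot> (\<Oplus>b\<in>X. ?G c w' \<otimes> (T c b \<odot> ?s b))"
            unfolding e using Gc s by (subst finsum_lmult) simp_all
          also have "\<dots> = (\<Oplus>b\<in>X. ?m w' \<odot> (?G c w' \<otimes> (T c b \<odot> ?s b)))"
            using Gc s by (intro ksm_finsum) simp
          also have "\<dots> = (\<Oplus>b\<in>X. (T c b * ?m w') \<odot> (?G c w' \<otimes> ?s b))"
            using Gc s by (intro finsum_cong2) (simp_all add: ksm_multr ksm_assoc[symmetric] mult.commute)
          finally show ?thesis by simp
        qed
        then have "(\<Oplus>c\<in>X. \<Oplus>b\<in>X. (T c b * ?m w') \<odot> (?G c w' \<otimes> ?s b)) = (\<Oplus>c\<in>X. ?m w' \<odot> (?G c w' \<otimes> sg i (x c)))"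
          using Gc by (intro finsum_cong2) simp_all
        also have "\<dots> = ?m w' \<odot> (\<Oplus>c\<in>X. ?G c w' \<otimes> sg i (x c))"
          using Gc by (intro ksm_finsum[symmetric]) simp
        finally show "(\<Oplus>c\<in>X. \<Oplus>b\<in>X. (T c b * ?m w') \<odot> (?G c w' \<otimes> ?s b)) = ?m w' \<odot> (\<Oplus>c\<in>X. ?G c w' \<otimes> sg i (x c))" .
      qed (use Gc in \<open>simp add: finsum_closed\<close>)
      also have "\<dots> = Tst n (dB g) w i"
      proof -
        have "Tst n (dB g) w i = (\<Oplus>w'\<in>words X n. ?m w' \<odot> dB g w' i)"
          using True dg B.ksm_closed by (simp add: Tst_def B_finsum)
        then show ?thesis by (simp add: dB_coef[OF gB])
      qed
      also have "\<dots> = (Tst n (dB g) w \<otimes>\<^bsub>B\<^esub> zz) j" using Suc dg by (simp add: mult_zz)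
      finally show ?thesis .
    qed
  qed
qed

end

section \<open>The mapping cone and its exactness\<close>

context skew_koszul
begin

abbreviation pF where "pF f \<equiv> (\<lambda>w. f (False, w))"
abbreviation pT where "pT f \<equiv> (\<lambda>w. f (True, w))"

definition mk :: "('b list \<Rightarrow> 'c) \<Rightarrow> ('b list \<Rightarrow> 'c) \<Rightarrow> bool \<times> 'b list \<Rightarrow> 'c" where
  "mk f g = (\<lambda>(t, w). if t then g w else f w)"

lemma mk_simps [simp]: "mk f g (False, w) = f w" "mk f g (True, w) = g w"
  by (simp_all add: mk_def)

text \<open>
  The index sets of the two summands of \<open>Q n\<close> are tagged: \<open>False\<close> for \<open>B \<otimes> W n\<close> and \<open>True\<close> for
  \<open>B \<otimes> W (n - 1)\<close>, the latter being zero for \<open>n = 0\<close>.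
\<close>

definition Xq where "Xq n = Pair False ` words X n \<union> Pair True ` words' n"
definition Wq :: "nat \<Rightarrow> (bool \<times> 'b list \<Rightarrow> 'k) set" where "Wq n = {c. pF c \<in> Wn n \<and> pT c \<in> W' n}"

lemma fin_words' [simp]: "finite (words' n)" by (cases n) simp_all

lemma Xq_iff [simp]: "(False, w) \<in> Xq n \<longleftrightarrow> w \<in> words X n" "(True, w) \<in> Xq n \<longleftrightarrow> w \<in> words' n"
  by (auto simp: Xq_def)

lemma fin_Xq [simp]: "finite (Xq n)" by (simp add: Xq_def)

lemma sum_Xq: "(\<Sum>y\<in>Xq n. f y) = (\<Sum>w\<in>words X n. f (False, w)) + (\<Sum>w\<in>words' n. f (True, w))"
  unfolding Xq_def by (subst sum.union_disjoint) (auto simp: sum.reindex inj_on_def)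

lemma dp_Xq: "dp (Xq n) \<rho> c = dp (words X n) (pF \<rho>) (pF c) + dp (words' n) (pT \<rho>) (pT c)"
  by (simp add: dp_def sum_Xq)

lemma finsum_Xq: "(\<And>y. f y \<in> carrier B) \<Longrightarrow>
  (\<Oplus>\<^bsub>B\<^esub>y\<in>Xq n. f y) = (\<Oplus>\<^bsub>B\<^esub>w\<in>words X n. f (False, w)) \<oplus>\<^bsub>B\<^esub> (\<Oplus>\<^bsub>B\<^esub>w\<in>words' n. f (True, w))"
  unfolding Xq_def
  by (subst B.finsum_Un_disjoint) (auto simp: B.finsum_reindex inj_on_def Pi_iff simp del: B_simps)

lemma fsub_Wq: "fsub (Xq n) (Wq n)"
  unfolding fsub_def
proof (intro conjI ballI allI impI)
  show "(\<lambda>_. 0) \<in> Wq n" using fsub_zero[OF fsub_Wsp[OF finX]] fsub_zero[OF fsub_W'] by (simp add: Wq_def)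
  show "(\<lambda>y. v y + w y) \<in> Wq n" if "v \<in> Wq n" "w \<in> Wq n" for v w
    using that by (auto simp: Wq_def intro!: fsub_add[OF fsub_Wsp[OF finX]] fsub_add[OF fsub_W'])
  show "(\<lambda>y. c * v y) \<in> Wq n" if "v \<in> Wq n" for v c
    using that by (auto simp: Wq_def intro!: fsub_scale[OF fsub_Wsp[OF finX]] fsub_scale[OF fsub_W'])
  show "v y = 0" if "v \<in> Wq n" "y \<notin> Xq n" for v y
    using that fsub_outside[OF fsub_Wsp[OF finX], of "pF v"] fsub_outside[OF fsub_W', of "pT v"]
    by (cases y; cases "fst y") (auto simp: Wq_def)
qed simp

definition Qm where "Qm n = tens B (Xq n) (Wq n)"

lemma ktQ: "ktensor B (Xq n) (Wq n)" by (rule B.ktensor[OF fsub_Wq])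

sublocale Q: ktensor B "Xq n" "Wq n" for n by (rule ktQ)

lemma Qm_simps [simp]:
  "\<zero>\<^bsub>Qm n\<^esub> = (\<lambda>_. \<zero>\<^bsub>B\<^esub>)" "f \<oplus>\<^bsub>Qm n\<^esub> g = (\<lambda>y. f y \<oplus>\<^bsub>B\<^esub> g y)" "a \<odot>\<^bsub>Qm n\<^esub> f = (\<lambda>y. a \<otimes>\<^bsub>B\<^esub> f y)"
  unfolding Qm_def by simp_all

lemma Q_mod: "left_module B (Qm n)" unfolding Qm_def by (rule Q.T_left_module)

text \<open>\<open>Wq\<close> is the direct sum of its two parts, so an equation valid on one part,
  extended by zero, is among the equations of the sum, and conversely every equation splits.\<close>

lemma Qm_iff: "f \<in> carrier (Qm n) \<longleftrightarrow> pF f \<in> carrier (D n) \<and> pT f \<in> carrier (D' n)"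
proof
  assume "f \<in> carrier (Qm n)"
  then have f: "f \<in> carrier (tens B (Xq n) (Wq n))" by (simp add: Qm_def)
  have "(\<lambda>w. if w \<in> words X n then f (False, w) else \<zero>\<^bsub>B\<^esub>) \<in> carrier (D n)"
  proof (rule B.tens_restrict[OF Q.ktensor_axioms D.ktensor_axioms f])
    fix c assume "c \<in> Wq n"
    then have c: "pF c \<in> Wn n" by (simp add: Wq_def)
    then have "(\<lambda>y. if y \<in> words X n then c (False, y) else 0) = pF c" using Wsp_outside[OF c] by auto
    then show "(\<lambda>y. if y \<in> words X n then c (False, y) else 0) \<in> Wn n" using c by simp
  qed auto
  moreover have "(\<lambda>w. if w \<in> words X n then f (False, w) else \<zero>\<^bsub>B\<^esub>) = pF f"
    using Q.T_outside[OF f] by (intro ext) simp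
  moreover have "(\<lambda>w. if w \<in> words' n then f (True, w) else \<zero>\<^bsub>B\<^esub>) \<in> carrier (D' n)"
  proof (rule B.tens_restrict[OF Q.ktensor_axioms D'.ktensor_axioms f])
    fix c assume "c \<in> Wq n"
    then have c: "pT c \<in> W' n" by (simp add: Wq_def)
    then have "(\<lambda>y. if y \<in> words' n then c (True, y) else 0) = pT c" using fsub_outside[OF fsub_W' c] by auto
    then show "(\<lambda>y. if y \<in> words' n then c (True, y) else 0) \<in> W' n" using c by simp
  qed auto
  moreover have "(\<lambda>w. if w \<in> words' n then f (True, w) else \<zero>\<^bsub>B\<^esub>) = pT f"
    using Q.T_outside[OF f] by (intro ext) simp
  ultimately show "pF f \<in> carrier (D n) \<and> pT f \<in> carrier (D' n)" by metis
next
  assume "pF f \<in> carrier (D n) \<and> pT f \<in> carrier (D' n)"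
  then have f: "pF f \<in> carrier (D n)" and g: "pT f \<in> carrier (D' n)" by auto
  have cl: "f y \<in> carrier B" for y
    using D.T_closed[OF f, of "snd y"] D'.T_closed[OF g, of "snd y"] by (cases y; cases "fst y") auto
  show "f \<in> carrier (Qm n)"
    unfolding Qm_def
  proof (rule Q.TI)
    show "f y \<in> carrier B" for y by (rule cl)
    show "f y = \<zero>\<^bsub>B\<^esub>" if "y \<notin> Xq n" for y
      using that D.T_outside[OF f, of "snd y"] D'.T_outside[OF g, of "snd y"] by (cases y; cases "fst y") auto
    fix \<rho> assume \<rho>: "\<And>w. w \<in> Wq n \<Longrightarrow> dp (Xq n) \<rho> w = 0"
    have "dp (words X n) (pF \<rho>) w = 0" if "w \<in> Wn n" for w
    proof -
      have "mk w (\<lambda>_. 0) \<in> Wq n" using that fsub_zero[OF fsub_W'] by (simp add: Wq_def)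
      from \<rho>[OF this, unfolded dp_Xq] show ?thesis by (simp add: dp_def)
    qed
    then have "(\<Oplus>\<^bsub>B\<^esub>w\<in>words X n. pF \<rho> w \<odot>\<^bsub>B\<^esub> pF f w) = \<zero>\<^bsub>B\<^esub>" by (rule D.T_perp[OF f])
    moreover have "dp (words' n) (pT \<rho>) w = 0" if "w \<in> W' n" for w
    proof -
      have "mk (\<lambda>_. 0) w \<in> Wq n" using that fsub_zero[OF fsub_Wsp[OF finX]] by (simp add: Wq_def)
      from \<rho>[OF this, unfolded dp_Xq] show ?thesis by (simp add: dp_def)
    qed
    then have "(\<Oplus>\<^bsub>B\<^esub>w\<in>words' n. pT \<rho> w \<odot>\<^bsub>B\<^esub> pT f w) = \<zero>\<^bsub>B\<^esub>" by (rule D'.T_perp[OF g])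
    ultimately show "(\<Oplus>\<^bsub>B\<^esub>y\<in>Xq n. \<rho> y \<odot>\<^bsub>B\<^esub> f y) = \<zero>\<^bsub>B\<^esub>"
      using cl by (subst finsum_Xq) (simp_all del: B_simps)
  qed
qed

lemma QF: "f \<in> carrier (Qm n) \<Longrightarrow> pF f \<in> carrier (D n)"
  and QT: "f \<in> carrier (Qm n) \<Longrightarrow> pT f \<in> carrier (D' n)"
  by (simp_all add: Qm_iff)

lemma Q_closed: "f \<in> carrier (Qm n) \<Longrightarrow> f y \<in> carrier B"
  unfolding Qm_def by (rule Q.T_closed)

lemma mk_Q: "f \<in> carrier (D n) \<Longrightarrow> g \<in> carrier (D' n) \<Longrightarrow> mk f g \<in> carrier (Qm n)"
  by (simp add: Qm_iff)

lemma B_zero_carrier [simp]: "(\<lambda>_. \<zero>) \<in> carrier B"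
  using B.zero_closed by simp

text \<open>\<open>z\<close> multiplies on the right to keep the map linear on the left, and
  \<open>Tst\<close> is inserted so that this multiplication commutes with \<open>dB\<close>. The
  minus sign makes the two mixed terms in the square cancel.\<close>

definition dQ :: "nat \<Rightarrow> (bool \<times> 'b list \<Rightarrow> nat \<Rightarrow> 'a) \<Rightarrow> bool \<times> 'b list \<Rightarrow> nat \<Rightarrow> 'a" where
  "dQ n f = mk (\<lambda>w. dB (pF f) w \<oplus>\<^bsub>B\<^esub> Tst n (pT f) w \<otimes>\<^bsub>B\<^esub> zz) (\<lambda>w. \<ominus>\<^bsub>B\<^esub> dB (pT f) w)"

lemma dQ_simps: "dQ n f (False, w) = dB (pF f) w \<oplus>\<^bsub>B\<^esub> Tst n (pT f) w \<otimes>\<^bsub>B\<^esub> zz"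
  "dQ n f (True, w) = \<ominus>\<^bsub>B\<^esub> dB (pT f) w"
  unfolding dQ_def by (simp_all del: B_simps)

lemma QT': "f \<in> carrier (Qm (Suc n)) \<Longrightarrow> pT f \<in> carrier (D n)"
  using QT[of f "Suc n"] by simp

lemma dQ_closed: "f \<in> carrier (Qm (Suc n)) \<Longrightarrow> dQ n f \<in> carrier (Qm n)"
  unfolding dQ_def
  by (intro mk_Q D.T_add D.T_rmult dB_D dB_D' Tst_D D'.T_uminus QF QT QT') simp_all

lemma pair_ext: "(\<And>w. f (False, w) = g (False, w)) \<Longrightarrow> (\<And>w. f (True, w) = g (True, w)) \<Longrightarrow> f = g"
  by (metis (full_types) ext surj_pair)

lemma dQ_hom: "dQ n \<in> module_hom B (Qm (Suc n)) (Qm n)"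
proof (rule module_homI)
  fix f g assume f: "f \<in> carrier (Qm (Suc n))" and g: "g \<in> carrier (Qm (Suc n))"
  note c = Q_closed[OF f] Q_closed[OF g]
  show "dQ n (f \<oplus>\<^bsub>Qm (Suc n)\<^esub> g) = dQ n f \<oplus>\<^bsub>Qm n\<^esub> dQ n g"
    unfolding Qm_simps
    by (rule pair_ext)
      (simp_all only: dQ_simps dB_add Tst_add c simp_thms dB_closed Tst_closed B.l_distr B.minus_add
         B.m_closed B.a_closed zz_closed B.a_ac B.a_inv_closed)
next
  fix a f assume a: "a \<in> carrier B" and f: "f \<in> carrier (Qm (Suc n))"
  note c = Q_closed[OF f]
  show "dQ n (a \<odot>\<^bsub>Qm (Suc n)\<^esub> f) = a \<odot>\<^bsub>Qm n\<^esub> dQ n f"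
    unfolding Qm_simps
    by (rule pair_ext)
      (simp_all only: dQ_simps dB_lmult Tst_lmult c a simp_thms dB_closed Tst_closed B.r_distr B.r_minus
         B.m_closed B.a_closed zz_closed B.m_assoc B.a_inv_closed)
qed (rule dQ_closed)

lemma dQ_dQ: "f \<in> carrier (Qm (Suc (Suc n))) \<Longrightarrow> dQ n (dQ (Suc n) f) = \<zero>\<^bsub>Qm n\<^esub>"
proof (rule pair_ext)
  fix w assume f: "f \<in> carrier (Qm (Suc (Suc n)))"
  have c: "\<And>y. f y \<in> carrier B" by (rule Q_closed[OF f])
  have cT: "fB (pT f)" and cF: "fB (pF f)" using c by blast+
  have z: "fB (\<lambda>w. Tst (Suc n) (pT f) w \<otimes>\<^bsub>B\<^esub> zz)" using cT by simp
  have dT: "fB (dB (pT f))" and dF: "fB (dB (pF f))" using cT cF by simp_all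
  have dd: "dB (dB (pF f)) w = \<zero>\<^bsub>B\<^esub>" by (rule dB_dB[OF QF[OF f]])
  have "dQ n (dQ (Suc n) f) (False, w) =
    dB (\<lambda>w. dB (pF f) w \<oplus>\<^bsub>B\<^esub> Tst (Suc n) (pT f) w \<otimes>\<^bsub>B\<^esub> zz) w \<oplus>\<^bsub>B\<^esub> Tst n (\<lambda>w. \<ominus>\<^bsub>B\<^esub> dB (pT f) w) w \<otimes>\<^bsub>B\<^esub> zz"
    unfolding dQ_simps ..
  also have "\<dots> = (dB (dB (pF f)) w \<oplus>\<^bsub>B\<^esub> Tst n (dB (pT f)) w \<otimes>\<^bsub>B\<^esub> zz) \<oplus>\<^bsub>B\<^esub> (\<ominus>\<^bsub>B\<^esub> Tst n (dB (pT f)) w) \<otimes>\<^bsub>B\<^esub> zz"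
    unfolding dB_add[OF dF z] dB_Tst_z[OF cT] Tst_neg[OF dT] ..
  also have "\<dots> = \<zero>\<^bsub>B\<^esub>"
    unfolding dd using Tst_closed[OF dT, of n w]
    by (simp only: B.l_minus B.l_zero B.m_closed zz_closed B.r_neg)
  finally show "dQ n (dQ (Suc n) f) (False, w) = \<zero>\<^bsub>Qm n\<^esub> (False, w)" by simp
next
  fix w assume f: "f \<in> carrier (Qm (Suc (Suc n)))"
  have c: "\<And>y. f y \<in> carrier B" by (rule Q_closed[OF f])
  have dT: "fB (dB (pT f))" using c by simp
  have "dB (dB (pT f)) w = \<zero>\<^bsub>B\<^esub>"
  proof (cases n)
    case 0
    have "dB (pT f) \<in> carrier (D' (Suc 0))" using dB_D[OF QT'[OF f]] 0 by simp
    from dB_D'[OF this] show ?thesis using D'.T_outside[of "dB (dB (pT f))" 0 w] by simp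
  next
    case (Suc m)
    then show ?thesis using dB_dB[of "pT f" m w] QT'[OF f] by simp
  qed
  then have "dQ n (dQ (Suc n) f) (True, w) = \<ominus>\<^bsub>B\<^esub> (\<ominus>\<^bsub>B\<^esub> \<zero>\<^bsub>B\<^esub>)"
    unfolding dQ_simps dB_neg[OF dT] by (simp only:)
  then show "dQ n (dQ (Suc n) f) (True, w) = \<zero>\<^bsub>Qm n\<^esub> (True, w)"
    using B.minus_minus[OF B.zero_closed] by simp
qed

abbreviation augB where "augB \<equiv> augmentation B"

definition eQ :: "(bool \<times> 'b list \<Rightarrow> nat \<Rightarrow> 'a) \<Rightarrow> 'k" where "eQ f = augB (f (False, []))"

lemma eQ_hom: "eQ \<in> module_hom B (Qm 0) (trivial_module B)"
  by (rule module_homI) (simp_all add: eQ_def B.aug_add B.aug_mult Q_closed del: B_simps)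

text \<open>A polynomial is its constant term plus a multiple of \<open>z\<close> on the right. The
  second summand of \<open>Qm 1\<close> produces the multiple of \<open>z\<close>, and the constant
  term is a boundary of \<open>dB\<close> because its augmentation is zero.\<close>

lemma Q_exact_0:
  assumes f: "f \<in> carrier (Qm 0)" and e0: "eQ f = 0"
  shows "\<exists>f'\<in>carrier (Qm 1). dQ 0 f' = f"
proof -
  let ?a = "f (False, [])"
  have ac: "?a \<in> carrier B" by (rule Q_closed[OF f])
  have sh: "(\<lambda>i. ?a (Suc i)) \<in> carrier B"
    using ac finite_vimageI[OF B_finite[OF ac], of Suc] by (simp add: B_iff vimage_def)
  have one_vec: "(\<lambda>w :: 'b list. if w = [] then b else \<zero>\<^bsub>B\<^esub>) \<in> carrier (D 0)" if b: "b \<in> carrier B" for b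
  proof -
    have "(\<lambda>w :: 'b list. b \<otimes>\<^bsub>B\<^esub> kvec B (\<lambda>y. if y = [] then 1 else 0) w) \<in> carrier (D 0)"
      by (intro D.T_lmult D.kvec_in delta_Wsp_0 b)
    moreover have "(\<lambda>w :: 'b list. b \<otimes>\<^bsub>B\<^esub> kvec B (\<lambda>y. if y = [] then 1 else 0) w) = (\<lambda>w :: 'b list. if w = [] then b else \<zero>\<^bsub>B\<^esub>)"
      using b by (auto simp: kvec_def fun_eq_iff simp del: B_simps)
    ultimately show ?thesis by (simp only:)
  qed
  let ?g = "\<lambda>w. if w = [] then (\<lambda>i. ?a (Suc i)) else \<zero>\<^bsub>B\<^esub>"
  have g: "?g \<in> carrier (D 0)" by (rule one_vec[OF sh])
  let ?h = "\<lambda>w. if w = [] then \<iota> (?a 0) else \<zero>\<^bsub>B\<^esub>"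
  have a0: "?a 0 \<in> carrier A" using ac by simp
  have h: "?h \<in> carrier (D 0)" by (rule one_vec[OF \<iota>_closed[OF a0]])
  have "aug (?a 0) = 0" using e0 aug_B[OF ac] by (simp add: eQ_def)
  then have "\<exists>f'\<in>carrier (D (Suc 0)). dB f' = ?h" by (intro dB_exact[OF h]) (simp add: \<iota>_def)
  then obtain f' where f': "f' \<in> carrier (D (Suc 0))" "dB f' = ?h" by blast
  have "dQ 0 (mk f' ?g) = f"
  proof (rule pair_ext)
    fix w
    have Tg: "Tst 0 ?g [] = (\<lambda>i. ?a (Suc i))"
      using B.finsum_delta[of "{[]}" "[]" "\<lambda>y. wm T y [] \<odot>\<^bsub>B\<^esub> ?g y"] sh
      by (simp add: Tst_def del: B_simps)
    show "dQ 0 (mk f' ?g) (False, w) = f (False, w)"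
    proof (cases "w = []")
      case True
      have "\<iota> (?a 0) \<oplus>\<^bsub>B\<^esub> (\<lambda>i. ?a (Suc i)) \<otimes>\<^bsub>B\<^esub> zz = ?a"
      proof
        fix i show "(\<iota> (?a 0) \<oplus>\<^bsub>B\<^esub> (\<lambda>i. ?a (Suc i)) \<otimes>\<^bsub>B\<^esub> zz) i = ?a i"
          using ac by (cases i) (simp_all add: mult_zz[OF sh] \<iota>_def)
      qed
      then show ?thesis using True f'(2) Tg by (simp add: dQ_simps del: B_simps)
    next
      case False
      then have "Tst 0 ?g w = \<zero>\<^bsub>B\<^esub>" by (simp add: Tst_def)
      moreover have "f (False, w) = \<zero>\<^bsub>B\<^esub>" using D.T_outside[OF QF[OF f], of w] False by simp
      ultimately show ?thesis using f'(2) False by (simp add: dQ_simps del: B_simps)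
    qed
    have "dB ?g \<in> carrier (D' 0)" by (rule dB_D') (use g in simp)
    then have "dB ?g w = \<zero>\<^bsub>B\<^esub>" using D'.T_outside[of "dB ?g" 0 w] by simp
    moreover have "f (True, w) = \<zero>\<^bsub>B\<^esub>" using D'.T_outside[OF QT[OF f], of w] by simp
    ultimately show "dQ 0 (mk f' ?g) (True, w) = f (True, w)"
      using B.minus_equality[OF B.l_zero[OF B.zero_closed] B.zero_closed B.zero_closed] by (simp add: dQ_simps del: B_simps)
  qed
  moreover have "mk f' ?g \<in> carrier (Qm 1)" using f'(1) g by (intro mk_Q) simp_all
  ultimately show ?thesis by blast
qed

text \<open>The long exact sequence of the cone done by hand: the negated second component is a
  boundary \<open>dB g'\<close>, and removing the contribution of \<open>g'\<close> from the first
  component leaves a cycle of \<open>dB\<close>, which is again a boundary.\<close>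

lemma Q_exact_Suc:
  assumes f: "f \<in> carrier (Qm (Suc n))" and df: "dQ n f = \<zero>\<^bsub>Qm n\<^esub>"
  shows "\<exists>f'\<in>carrier (Qm (Suc (Suc n))). dQ (Suc n) f' = f"
proof -
  have c: "\<And>y. f y \<in> carrier B" by (rule Q_closed[OF f])
  have cT: "fB (pT f)" and cF: "fB (pF f)" using c by blast+
  have eF: "dB (pF f) w \<oplus>\<^bsub>B\<^esub> Tst n (pT f) w \<otimes>\<^bsub>B\<^esub> zz = \<zero>\<^bsub>B\<^esub>" for w
    using fun_cong[OF df, of "(False, w)"] unfolding dQ_simps by simp
  have eT: "dB (pT f) w = \<zero>\<^bsub>B\<^esub>" for w
  proof -
    have "\<ominus>\<^bsub>B\<^esub> dB (pT f) w = \<zero>\<^bsub>B\<^esub>" using fun_cong[OF df, of "(True, w)"] unfolding dQ_simps by simp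
    then show ?thesis using dB_closed[OF cT, of w] B.minus_minus B.minus_equality[OF B.l_zero[OF B.zero_closed] B.zero_closed B.zero_closed] by metis
  qed
  let ?g = "\<lambda>w. \<ominus>\<^bsub>B\<^esub> pT f w"
  have gD: "?g \<in> carrier (D n)" by (rule D.T_uminus[OF QT'[OF f]])
  have "\<exists>g'\<in>carrier (D (Suc n)). dB g' = ?g"
  proof (rule dB_exact[OF gD])
    show "case n of 0 \<Rightarrow> \<forall>i. aug (?g [] i) = 0 | Suc m \<Rightarrow> \<forall>w. dB ?g w = \<zero>\<^bsub>B\<^esub>"
    proof (cases n)
      case 0
      \<comment> \<open>At the bottom \<open>dB_exact\<close> asks for vanishing augmentation of
        every coefficient. The coefficient of \<open>z\<^sup>i\<^sup>+\<^sup>1\<close> in the cycle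
        equation gives it, because the coefficients of values of \<open>dB\<close> have augmentation
        zero.\<close>
      have "aug (f (True, []) i) = 0" for i
      proof -
        have "Tst 0 (pT f) [] = f (True, [])"
          using B.finsum_delta[of "{[]}" "[]" "\<lambda>y. wm T y [] \<odot>\<^bsub>B\<^esub> pT f y"] c
          by (simp add: Tst_def del: B_simps)
        then have "dB (pF f) [] \<oplus>\<^bsub>B\<^esub> f (True, []) \<otimes>\<^bsub>B\<^esub> zz = \<zero>\<^bsub>B\<^esub>" using eF[of "[]"] 0 by simp
        then have "(dB (pF f) [] \<oplus>\<^bsub>B\<^esub> f (True, []) \<otimes>\<^bsub>B\<^esub> zz) (Suc i) = \<zero>" by simp
        then have "dB (pF f) [] (Suc i) \<oplus> f (True, []) i = \<zero>" by (simp add: mult_zz[OF c])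
        then have "aug (dB (pF f) [] (Suc i)) + aug (f (True, []) i) = 0"
          using aug_add[of "dB (pF f) [] (Suc i)" "f (True, []) i"] B_closed[OF dB_closed[OF cF]] B_closed[OF c] by simp
        moreover have "aug (dB (pF f) [] (Suc i)) = (\<Sum>b\<in>X. aug (f (False, [b]) (Suc i) \<otimes> sg (Suc i) (x b)))"
          unfolding dB_coef[OF cF] using B_closed[OF c] sg_closed[OF x_closed, of _ "Suc i"] by (intro aug_finsum) simp
        moreover have "\<dots> = 0"
        proof (intro sum.neutral ballI)
          fix b assume b: "b \<in> X"
          show "aug (f (False, [b]) (Suc i) \<otimes> sg (Suc i) (x b)) = 0"
            using aug_mult[OF B_closed[OF c] sg_closed[OF x_closed[OF b], of "Suc i"]] aug_deg[OF sg_deg[OF x_deg[OF b]], of "Suc i"] by simp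
        qed
        ultimately show ?thesis by simp
      qed
      then show ?thesis using 0 B_neg[OF c] aug_neg[OF B_closed[OF c]] by simp
    next
      case (Suc m)
      have "dB ?g w = \<zero>\<^bsub>B\<^esub>" for w
        unfolding dB_neg[OF cT] eT by (rule B.minus_equality[OF B.l_zero[OF B.zero_closed] B.zero_closed B.zero_closed])
      then show ?thesis using Suc by (simp del: B_simps)
    qed
  qed
  then obtain g' where g': "g' \<in> carrier (D (Suc n))" "dB g' = ?g" by blast
  have cg': "fB g'" using D.T_closed[OF g'(1)] by blast
  have cg: "fB ?g" using D.T_closed[OF gD] by blast
  let ?z = "\<lambda>w. Tst (Suc n) g' w \<otimes>\<^bsub>B\<^esub> zz"
  have zD: "?z \<in> carrier (D (Suc n))" by (intro D.T_rmult Tst_D g') simp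
  have cz: "fB ?z" using cg' by simp
  have cnz: "fB (\<lambda>w. \<ominus>\<^bsub>B\<^esub> ?z w)" using cz by (simp del: B_simps)
  let ?h = "\<lambda>w. pF f w \<oplus>\<^bsub>B\<^esub> \<ominus>\<^bsub>B\<^esub> ?z w"
  have hD: "?h \<in> carrier (D (Suc n))" by (intro D.T_add D.T_uminus QF[OF f] zD)
  \<comment> \<open>\<open>dB_Tst_z\<close> turns the correction term into \<open>Tst\<close> of the
    negated second component, so the equation \<open>dB ?h = 0\<close> is the first component of the
    cycle condition.\<close>
  have "\<exists>h'\<in>carrier (D (Suc (Suc n))). dB h' = ?h"
  proof (rule dB_exact[OF hD], simp only: nat.case, intro allI)
    fix w
    have "dB ?h w = dB (pF f) w \<oplus>\<^bsub>B\<^esub> \<ominus>\<^bsub>B\<^esub> (Tst n ?g w \<otimes>\<^bsub>B\<^esub> zz)"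
      unfolding dB_add[OF cF cnz] dB_neg[OF cz] dB_Tst_z[OF cg'] g'(2) ..
    also have "\<dots> = dB (pF f) w \<oplus>\<^bsub>B\<^esub> Tst n (pT f) w \<otimes>\<^bsub>B\<^esub> zz"
      unfolding Tst_neg[OF cT] using Tst_closed[OF cT, of n w]
      by (simp only: B.l_minus zz_closed B.minus_minus B.m_closed)
    finally show "dB ?h w = \<zero>\<^bsub>B\<^esub>" unfolding eF .
  qed
  then obtain h' where h': "h' \<in> carrier (D (Suc (Suc n)))" "dB h' = ?h" by blast
  have "dQ (Suc n) (mk h' g') = f"
  proof (rule pair_ext)
    fix w
    show "dQ (Suc n) (mk h' g') (False, w) = f (False, w)"
      unfolding dQ_simps mk_simps h'(2) using c[of "(False, w)"] cz[rule_format, of w]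
      by (simp only: B.a_assoc B.a_inv_closed B.l_neg B.r_zero)
    show "dQ (Suc n) (mk h' g') (True, w) = f (True, w)"
      unfolding dQ_simps mk_simps g'(2) using c[of "(True, w)"] by (simp only: B.minus_minus)
  qed
  moreover have "mk h' g' \<in> carrier (Qm (Suc (Suc n)))" using h'(1) g'(1) by (intro mk_Q) simp_all
  ultimately show ?thesis by blast
qed

lemma kvec_eval: "c \<in> Wq n \<Longrightarrow> kvec B c \<in> carrier (Qm n)"
  unfolding Qm_def by (rule Q.kvec_in)

lemma augB_kvec: "augB (kvec B c y) = c y"
  using B.aug_scalar by (simp add: kvec_def del: B_simps)

lemma augB_dB: "fB f \<Longrightarrow> augB (dB f w) = 0"
proof -
  assume f: "fB f"
  have "augB (dB f w) = (\<Sum>b\<in>X. augB (f (b # w) \<otimes>\<^bsub>B\<^esub> \<iota> (x b)))"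
    unfolding dB_def using f by (intro B.aug_finsum) simp
  also have "\<dots> = 0"
  proof (intro sum.neutral ballI)
    fix b assume b: "b \<in> X"
    have "augB (\<iota> (x b)) = 0" using aug_B[OF \<iota>_closed[OF x_closed[OF b]]] aug_deg[OF x_deg[OF b]] by (simp add: \<iota>_def)
    then show "augB (f (b # w) \<otimes>\<^bsub>B\<^esub> \<iota> (x b)) = 0" using f b by (simp add: B.aug_mult)
  qed
  finally show ?thesis .
qed

lemma augB_zz: "f \<in> carrier B \<Longrightarrow> augB (f \<otimes>\<^bsub>B\<^esub> zz) = 0"
proof -
  assume f: "f \<in> carrier B"
  have "augB zz = 0" using aug_B[OF zz_closed] by (simp add: zz_def)
  then show ?thesis using f by (simp add: B.aug_mult)
qed

text \<open>The generators \<open>x b\<close> and \<open>z\<close> both have augmentation zero, and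
  each term of the differential contains one of them. This is minimality of the resolution.\<close>

lemma augB_dQ: "f \<in> carrier (Qm (Suc n)) \<Longrightarrow> augB (dQ n f y) = 0"
proof -
  assume f: "f \<in> carrier (Qm (Suc n))"
  have c: "fB (pF f)" "fB (pT f)" using Q_closed[OF f] by blast+
  show ?thesis
    by (cases y; cases "fst y")
      (simp_all add: dQ_simps B.aug_add B.aug_neg augB_dB augB_zz c dB_closed Tst_closed B.m_closed zz_closed del: B_simps)
qed

lemma exact_res_Q: "exact_res B Qm dQ eQ"
  unfolding exact_res_def
proof (intro conjI allI)
  show "left_module B (Qm n)" for n by (rule Q_mod)
  show "dQ n \<in> module_hom B (Qm (Suc n)) (Qm n)" for n by (rule dQ_hom)
  show "eQ \<in> module_hom B (Qm 0) (trivial_module B)" by (rule eQ_hom)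
  show "eQ ` carrier (Qm 0) = UNIV"
  proof (intro subset_antisym subsetI)
    fix c :: 'k
    let ?c = "mk (\<lambda>y. if y = [] then c else 0) (\<lambda>_. 0)"
    have "?c \<in> Wq 0" using delta_Wsp_0[of c X Rp] by (simp add: Wq_def)
    then have "kvec B ?c \<in> carrier (Qm 0)" by (rule kvec_eval)
    moreover have "eQ (kvec B ?c) = c" unfolding eQ_def augB_kvec by simp
    ultimately show "c \<in> eQ ` carrier (Qm 0)" by force
  qed simp
  show "dQ 0 ` carrier (Qm 1) = {f \<in> carrier (Qm 0). eQ f = 0}"
  proof (intro subset_antisym subsetI)
    fix f assume "f \<in> dQ 0 ` carrier (Qm 1)"
    then show "f \<in> {f \<in> carrier (Qm 0). eQ f = 0}" using dQ_closed[of _ 0] augB_dQ[of _ 0] by (auto simp: eQ_def)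
  next
    fix f assume "f \<in> {f \<in> carrier (Qm 0). eQ f = 0}"
    then show "f \<in> dQ 0 ` carrier (Qm 1)" using Q_exact_0[of f] by blast
  qed
  show "dQ (Suc n) ` carrier (Qm (Suc (Suc n))) = {f \<in> carrier (Qm (Suc n)). dQ n f = \<zero>\<^bsub>Qm n\<^esub>}" for n
  proof (intro subset_antisym subsetI)
    fix f assume "f \<in> dQ (Suc n) ` carrier (Qm (Suc (Suc n)))"
    then show "f \<in> {f \<in> carrier (Qm (Suc n)). dQ n f = \<zero>\<^bsub>Qm n\<^esub>}" using dQ_closed[of _ "Suc n"] dQ_dQ[of _ n] by blast
  next
    fix f assume "f \<in> {f \<in> carrier (Qm (Suc n)). dQ n f = \<zero>\<^bsub>Qm n\<^esub>}"
    then show "f \<in> dQ (Suc n) ` carrier (Qm (Suc (Suc n)))" using Q_exact_Suc[of f n] by blast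
  qed
qed

lemma Q_LP: "left_module B N \<Longrightarrow> left_module B N' \<Longrightarrow> LP B (Qm n) N N'"
  unfolding LP_def Qm_def using Q.T_lift by blast

end

section \<open>Cochains and their lifts\<close>

context skew_koszul
begin

text \<open>Contraction of the suffix with the functional \<open>\<alpha>\<close>; the index set
  \<open>S\<close> is a parameter so that it can also be the shifted one.\<close>

definition con where "con S \<alpha> f = (\<lambda>w. \<Oplus>\<^bsub>B\<^esub>v\<in>S. \<alpha> v \<odot>\<^bsub>B\<^esub> f (w @ v))"

lemma con_closed [simp]: "fB f \<Longrightarrow> con S \<alpha> f w \<in> carrier B"
  unfolding con_def by (intro B.finsum_closed funcsetI B.ksm_closed) blast

lemma con_D: "f \<in> carrier (D (n + j)) \<Longrightarrow> con (words X n) \<alpha> f \<in> carrier (D j)"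
proof -
  assume f: "f \<in> carrier (D (n + j))"
  have "(\<lambda>w. f (w @ v)) \<in> carrier (D j)" if "v \<in> words X n" for v
    using B.tens_factor[OF finX f, of "[]" 0 v n j] that by (simp add: add.commute)
  then show ?thesis unfolding con_def by (intro D.T_sum D.T_scale)
qed

lemma con_zero: "(\<And>w v. v \<in> S \<Longrightarrow> f (w @ v) = \<zero>\<^bsub>B\<^esub>) \<Longrightarrow> con S \<alpha> f = (\<lambda>_. \<zero>\<^bsub>B\<^esub>)"
  unfolding con_def by (intro ext B.finsum_zeroI) (simp only: B.ksm_zero_right)

lemma con_D'F: "f \<in> carrier (D' (n + j)) \<Longrightarrow> con (words' n) \<alpha> f \<in> carrier (D j)"
proof (cases n)
  case 0
  have "con (words' n) \<alpha> f = (\<lambda>_. \<zero>\<^bsub>B\<^esub>)" using 0 by (intro con_zero) simp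
  then show ?thesis using D.T_zero by (simp only:)
qed (simp add: con_D)

lemma con_D'T: "f \<in> carrier (D' (n + j)) \<Longrightarrow> con (words X n) \<alpha> f \<in> carrier (D' j)"
proof (cases j)
  case 0
  assume f: "f \<in> carrier (D' (n + j))"
  have "f (w @ v) = \<zero>\<^bsub>B\<^esub>" if "v \<in> words X n" for w v
  proof -
    have "w @ v \<notin> words' (n + j)" using 0 that by (cases n) (auto simp: words_def)
    then show ?thesis by (rule D'.T_outside[OF f])
  qed
  then have "con (words X n) \<alpha> f = (\<lambda>_. \<zero>\<^bsub>B\<^esub>)" by (rule con_zero)
  then show ?thesis using D'.T_zero by (simp only:)
qed (simp add: con_D)

lemma con_add: "fB f \<Longrightarrow> fB g \<Longrightarrow> con S \<alpha> (\<lambda>w. f w \<oplus>\<^bsub>B\<^esub> g w) w = con S \<alpha> f w \<oplus>\<^bsub>B\<^esub> con S \<alpha> g w"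
proof -
  assume f: "fB f" and g: "fB g"
  have "con S \<alpha> (\<lambda>w. f w \<oplus>\<^bsub>B\<^esub> g w) w = (\<Oplus>\<^bsub>B\<^esub>v\<in>S. \<alpha> v \<odot>\<^bsub>B\<^esub> f (w @ v) \<oplus>\<^bsub>B\<^esub> \<alpha> v \<odot>\<^bsub>B\<^esub> g (w @ v))"
    unfolding con_def using f g by (simp add: B.ksm_radd del: B_simps)
  also have "\<dots> = con S \<alpha> f w \<oplus>\<^bsub>B\<^esub> con S \<alpha> g w"
    unfolding con_def using f g by (intro B.finsum_addf) (simp_all add: Pi_iff del: B_simps)
  finally show ?thesis .
qed

lemma con_neg: "fB f \<Longrightarrow> con S \<alpha> (\<lambda>w. \<ominus>\<^bsub>B\<^esub> f w) w = \<ominus>\<^bsub>B\<^esub> con S \<alpha> f w"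
  unfolding con_def by (simp add: B.finsum_neg[symmetric] B.ksm_neg_right cong: B.finsum_cong del: B_simps)

lemma con_lmult: "fB f \<Longrightarrow> a \<in> carrier B \<Longrightarrow> con S \<alpha> (\<lambda>w. a \<otimes>\<^bsub>B\<^esub> f w) w = a \<otimes>\<^bsub>B\<^esub> con S \<alpha> f w"
  unfolding con_def by (simp add: B.finsum_lmult B.ksm_multr cong: B.finsum_cong del: B_simps)

lemma con_rmult: "fB f \<Longrightarrow> a \<in> carrier B \<Longrightarrow> con S \<alpha> (\<lambda>w. f w \<otimes>\<^bsub>B\<^esub> a) w = con S \<alpha> f w \<otimes>\<^bsub>B\<^esub> a"
  unfolding con_def by (simp add: B.finsum_rmult B.ksm_multl cong: B.finsum_cong del: B_simps)

text \<open>The differential removes the first letter and the contraction the last ones, so they act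
  on different ends of a word.\<close>

lemma dB_con:
  assumes "fB f" "finite S"
  shows "dB (con S \<alpha> f) w = con S \<alpha> (dB f) w"
proof -
  have f: "f y \<in> carrier B" for y using assms(1) by blast
  have "dB (con S \<alpha> f) w = (\<Oplus>\<^bsub>B\<^esub>b\<in>X. \<Oplus>\<^bsub>B\<^esub>v\<in>S. \<alpha> v \<odot>\<^bsub>B\<^esub> (f (b # w @ v) \<otimes>\<^bsub>B\<^esub> \<iota> (x b)))"
    unfolding dB_def con_def using f
    by (intro B.finsum_cong2) (simp_all add: B.finsum_rmult B.ksm_multl B.finsum_closed del: B_simps)
  also have "\<dots> = (\<Oplus>\<^bsub>B\<^esub>v\<in>S. \<Oplus>\<^bsub>B\<^esub>b\<in>X. \<alpha> v \<odot>\<^bsub>B\<^esub> (f (b # w @ v) \<otimes>\<^bsub>B\<^esub> \<iota> (x b)))"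
    using f assms(2) by (intro B.finsum_swap) (simp_all del: B_simps)
  also have "\<dots> = con S \<alpha> (dB f) w"
    unfolding dB_def con_def using f
    by (intro B.finsum_cong2) (simp_all add: B.ksm_finsum B.finsum_closed del: B_simps)
  finally show ?thesis .
qed

text \<open>The functional \<open>\<alpha>\<close> precomposed with the tensor power of
  \<open>T\<close>.\<close>

definition tr where "tr n \<alpha> v' = (\<Sum>v\<in>words X n. \<alpha> v * wm T v' v)"

text \<open>The tensor power acts on prefix and suffix separately; its action on the contracted
  suffix is absorbed into the functional.\<close>

lemma Tst_con:
  assumes "fB f"
  shows "Tst j (con (words X n) (tr n \<alpha>) f) w = con (words X n) \<alpha> (Tst (n + j) f) w"
proof (cases "w \<in> words X j")
  case False
  then have "w @ v \<notin> words X (n + j)" if "v \<in> words X n" for v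
    using that by (auto simp: words_def)
  then have "con (words X n) \<alpha> (Tst (n + j) f) w = \<zero>\<^bsub>B\<^esub>"
    unfolding con_def by (intro B.finsum_zeroI) (simp add: Tst_def B.ksm_zero_right del: B_simps)
  then show ?thesis using False by (simp add: Tst_def)
next
  case True
  have f: "f y \<in> carrier B" for y using assms by blast
  let ?m = "\<lambda>w'. wm T w' w"
  have "Tst j (con (words X n) (tr n \<alpha>) f) w =
    (\<Oplus>\<^bsub>B\<^esub>w'\<in>words X j. \<Oplus>\<^bsub>B\<^esub>v'\<in>words X n. \<Oplus>\<^bsub>B\<^esub>v\<in>words X n. (\<alpha> v * (?m w' * wm T v' v)) \<odot>\<^bsub>B\<^esub> f (w' @ v'))"
    unfolding Tst_def con_def using True f
    by (simp add: B.ksm_finsum B.ksm_assoc[symmetric] tr_def sum_distrib_left B.ksm_sum mult.left_commute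
        cong: B.finsum_cong del: B_simps)
  also have "\<dots> = (\<Oplus>\<^bsub>B\<^esub>w'\<in>words X j. \<Oplus>\<^bsub>B\<^esub>v\<in>words X n. \<Oplus>\<^bsub>B\<^esub>v'\<in>words X n. (\<alpha> v * (?m w' * wm T v' v)) \<odot>\<^bsub>B\<^esub> f (w' @ v'))"
    using f by (intro B.finsum_cong2 B.finsum_swap B.finsum_closed funcsetI) (simp_all add: B.finsum_closed del: B_simps)
  also have "\<dots> = (\<Oplus>\<^bsub>B\<^esub>v\<in>words X n. \<Oplus>\<^bsub>B\<^esub>w'\<in>words X j. \<Oplus>\<^bsub>B\<^esub>v'\<in>words X n. (\<alpha> v * (?m w' * wm T v' v)) \<odot>\<^bsub>B\<^esub> f (w' @ v'))"
    using f by (intro B.finsum_swap) (simp_all add: B.finsum_closed del: B_simps)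
  also have "\<dots> = (\<Oplus>\<^bsub>B\<^esub>v\<in>words X n. \<alpha> v \<odot>\<^bsub>B\<^esub> Tst (n + j) f (w @ v))"
  proof (intro B.finsum_cong2)
    fix v assume v: "v \<in> words X n"
    have wv: "w @ v \<in> words X (j + n)" by (rule append_words[OF True v])
    then have "Tst (n + j) f (w @ v) = (\<Oplus>\<^bsub>B\<^esub>y\<in>words X (j + n). wm T y (w @ v) \<odot>\<^bsub>B\<^esub> f y)"
      by (simp add: Tst_def add.commute)
    also have "\<dots> = (\<Oplus>\<^bsub>B\<^esub>w'\<in>words X j. \<Oplus>\<^bsub>B\<^esub>v'\<in>words X n. wm T (w' @ v') (w @ v) \<odot>\<^bsub>B\<^esub> f (w' @ v'))"
      using f by (intro B.finsum_words_append) (simp_all del: B_simps)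
    also have "\<dots> = (\<Oplus>\<^bsub>B\<^esub>w'\<in>words X j. \<Oplus>\<^bsub>B\<^esub>v'\<in>words X n. (?m w' * wm T v' v) \<odot>\<^bsub>B\<^esub> f (w' @ v'))"
      using f True words_length by (intro B.finsum_cong2) (simp_all add: wm_append2 words_length[OF True] words_length B.finsum_closed cong: B.finsum_cong del: B_simps)
    finally show "(\<Oplus>\<^bsub>B\<^esub>w'\<in>words X j. \<Oplus>\<^bsub>B\<^esub>v'\<in>words X n. (\<alpha> v * (?m w' * wm T v' v)) \<odot>\<^bsub>B\<^esub> f (w' @ v')) = \<alpha> v \<odot>\<^bsub>B\<^esub> Tst (n + j) f (w @ v)"
      using f by (simp add: B.ksm_finsum B.ksm_assoc B.finsum_closed cong: B.finsum_cong del: B_simps)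
  qed (use assms in \<open>simp del: B_simps\<close>)
  finally show ?thesis by (simp add: con_def)
qed

text \<open>
  The chain map \<open>Q (n + j) \<rightarrow> Q j\<close> lifting the pair of functionals \<open>(\<alpha>, \<beta>)\<close>.  The sign compensates the sign
  of the differential on the second summand, and \<open>tr\<close> is needed since \<open>z\<close> moves past the contracted word.
\<close>

definition \<gamma> where
  "\<gamma> n \<alpha> \<beta> j f = mk (\<lambda>w. con (words X n) \<alpha> (pF f) w \<oplus>\<^bsub>B\<^esub> (-1) ^ j \<odot>\<^bsub>B\<^esub> con (words' n) \<beta> (pT f) w)
     (con (words X n) (tr n \<alpha>) (pT f))"

lemma \<gamma>_simps: "\<gamma> n \<alpha> \<beta> j f (False, w) = con (words X n) \<alpha> (pF f) w \<oplus>\<^bsub>B\<^esub> (-1) ^ j \<odot>\<^bsub>B\<^esub> con (words' n) \<beta> (pT f) w"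
  "\<gamma> n \<alpha> \<beta> j f (True, w) = con (words X n) (tr n \<alpha>) (pT f) w"
  unfolding \<gamma>_def by (simp_all del: B_simps)

lemma \<gamma>_closed: "f \<in> carrier (Qm (n + j)) \<Longrightarrow> \<gamma> n \<alpha> \<beta> j f \<in> carrier (Qm j)"
  unfolding \<gamma>_def by (intro mk_Q D.T_add D.T_scale con_D con_D'F con_D'T QF QT)

lemma \<gamma>_hom: "\<gamma> n \<alpha> \<beta> j \<in> module_hom B (Qm (n + j)) (Qm j)"
proof (rule module_homI)
  fix f g assume f: "f \<in> carrier (Qm (n + j))" and g: "g \<in> carrier (Qm (n + j))"
  note c = Q_closed[OF f] Q_closed[OF g]
  show "\<gamma> n \<alpha> \<beta> j (f \<oplus>\<^bsub>Qm (n + j)\<^esub> g) = \<gamma> n \<alpha> \<beta> j f \<oplus>\<^bsub>Qm j\<^esub> \<gamma> n \<alpha> \<beta> j g"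
    unfolding Qm_simps
    by (rule pair_ext)
      (simp_all only: \<gamma>_simps con_add c simp_thms con_closed B.ksm_radd B.ksm_closed B.a_closed B.a_ac)
next
  fix a f assume a: "a \<in> carrier B" and f: "f \<in> carrier (Qm (n + j))"
  note c = Q_closed[OF f]
  show "\<gamma> n \<alpha> \<beta> j (a \<odot>\<^bsub>Qm (n + j)\<^esub> f) = a \<odot>\<^bsub>Qm j\<^esub> \<gamma> n \<alpha> \<beta> j f"
    unfolding Qm_simps
    by (rule pair_ext)
      (simp_all only: \<gamma>_simps con_lmult c a simp_thms con_closed B.r_distr B.ksm_multr B.ksm_closed)
qed (rule \<gamma>_closed)

text \<open>The terms match one by one: \<open>dB_con\<close> for the contractions,
  \<open>Tst_con\<close> for the term with \<open>z\<close>, and the change of sign from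
  \<open>j\<close> to \<open>j + 1\<close> against the minus sign in the second component of
  \<open>dQ\<close>.\<close>

lemma dQ_\<gamma>:
  assumes f: "f \<in> carrier (Qm (n + Suc j))"
  shows "dQ j (\<gamma> n \<alpha> \<beta> (Suc j) f) = \<gamma> n \<alpha> \<beta> j (dQ (n + j) f)"
proof -
  have c: "\<And>y. f y \<in> carrier B" by (rule Q_closed[OF f])
  have cF: "fB (pF f)" and cT: "fB (pT f)" using c by blast+
  let ?cF = "con (words X n) \<alpha>" and ?c\<beta> = "con (words' n) \<beta>" and ?cT = "con (words X n) (tr n \<alpha>)"
  let ?s = "(-1) ^ j :: 'k"
  have k1: "fB (?cF (pF f))" and k2: "fB (\<lambda>w. (-1) ^ Suc j \<odot>\<^bsub>B\<^esub> ?c\<beta> (pT f) w)" and k3: "fB (?c\<beta> (pT f))"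
    and dF: "fB (dB (pF f))" and dT: "fB (dB (pT f))" and tz: "fB (\<lambda>w. Tst (n + j) (pT f) w \<otimes>\<^bsub>B\<^esub> zz)"
    and tt: "fB (Tst (n + j) (pT f))"
    using cF cT by (simp_all del: B_simps)
  show ?thesis
  proof (rule pair_ext)
    fix w
    let ?a = "?cF (dB (pF f)) w" and ?b = "?c\<beta> (dB (pT f)) w" and ?t = "?cF (Tst (n + j) (pT f)) w \<otimes>\<^bsub>B\<^esub> zz"
    have ac: "?a \<in> carrier B" "?b \<in> carrier B" "?t \<in> carrier B" using dF dT tt by (simp_all del: B_simps)
    have "dQ j (\<gamma> n \<alpha> \<beta> (Suc j) f) (False, w) =
      dB (\<lambda>w. ?cF (pF f) w \<oplus>\<^bsub>B\<^esub> (-1) ^ Suc j \<odot>\<^bsub>B\<^esub> ?c\<beta> (pT f) w) w \<oplus>\<^bsub>B\<^esub> Tst j (?cT (pT f)) w \<otimes>\<^bsub>B\<^esub> zz"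
      unfolding dQ_simps \<gamma>_simps ..
    also have "\<dots> = (?a \<oplus>\<^bsub>B\<^esub> (-1) ^ Suc j \<odot>\<^bsub>B\<^esub> ?b) \<oplus>\<^bsub>B\<^esub> ?t"
      unfolding dB_add[OF k1 k2] dB_ksm[OF k3] dB_con[OF cF finite_words[OF finX]] dB_con[OF cT fin_words'] Tst_con[OF cT] ..
    also have "(-1) ^ Suc j \<odot>\<^bsub>B\<^esub> ?b = ?s \<odot>\<^bsub>B\<^esub> (\<ominus>\<^bsub>B\<^esub> ?b)"
      using ac B.ksm_neg[of ?b ?s] B.ksm_neg_right[of ?b ?s] by (simp del: B_simps)
    also have "(?a \<oplus>\<^bsub>B\<^esub> ?s \<odot>\<^bsub>B\<^esub> (\<ominus>\<^bsub>B\<^esub> ?b)) \<oplus>\<^bsub>B\<^esub> ?t = (?a \<oplus>\<^bsub>B\<^esub> ?t) \<oplus>\<^bsub>B\<^esub> ?s \<odot>\<^bsub>B\<^esub> (\<ominus>\<^bsub>B\<^esub> ?b)"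
      using ac by (simp only: B.a_ac B.ksm_closed B.a_inv_closed B.a_closed)
    also have "\<dots> = \<gamma> n \<alpha> \<beta> j (dQ (n + j) f) (False, w)"
      unfolding \<gamma>_simps dQ_simps con_add[OF dF tz] con_rmult[OF tt zz_closed] con_neg[OF dT] ..
    finally show "dQ j (\<gamma> n \<alpha> \<beta> (Suc j) f) (False, w) = \<gamma> n \<alpha> \<beta> j (dQ (n + j) f) (False, w)" .
  next
    fix w
    show "dQ j (\<gamma> n \<alpha> \<beta> (Suc j) f) (True, w) = \<gamma> n \<alpha> \<beta> j (dQ (n + j) f) (True, w)"
      unfolding \<gamma>_simps dQ_simps con_neg[OF dT] dB_con[OF cT finite_words[OF finX]] ..
  qed
qed

text \<open>A homomorphism to the trivial module sees only the scalar parts of the coefficients, so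
  it amounts to a functional on each of the two summands.\<close>

definition fn :: "nat \<Rightarrow> ('b list \<Rightarrow> 'k) \<Rightarrow> ('b list \<Rightarrow> 'k) \<Rightarrow> (bool \<times> 'b list \<Rightarrow> nat \<Rightarrow> 'a) \<Rightarrow> 'k" where
  "fn n \<alpha> \<beta> f = (\<Sum>w\<in>words X n. \<alpha> w * augB (f (False, w))) + (\<Sum>w\<in>words' n. \<beta> w * augB (f (True, w)))"

lemma fn_hom: "fn n \<alpha> \<beta> \<in> module_hom B (Qm n) (trivial_module B)"
  by (rule module_homI)
    (simp_all add: fn_def B.aug_add B.aug_mult Q_closed distrib_left sum.distrib sum_distrib_left mult.left_commute del: B_simps)

lemma triv_finsum: "finite I \<Longrightarrow> (\<Oplus>\<^bsub>trivial_module B\<^esub>i\<in>I. f i) = (\<Sum>i\<in>I. f i :: 'k)"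
proof (induction I rule: finite_induct)
  interpret triv: left_module B "trivial_module B" by (rule B.triv)
  case empty
  show ?case using triv.M.finsum_empty by simp
next
  interpret triv: left_module B "trivial_module B" by (rule B.triv)
  case (insert i I)
  then show ?case by (subst triv.M.finsum_insert) simp_all
qed

lemma fn_repr:
  assumes "a \<in> module_hom B (Qm n) (trivial_module B)"
  shows "\<exists>\<alpha> \<beta>. \<forall>f\<in>carrier (Qm n). a f = fn n \<alpha> \<beta> f"
proof -
  let ?c = "\<lambda>y. a (kvec B (Q.p n y))"
  have "a f = fn n (pF ?c) (pT ?c) f" if f: "f \<in> carrier (Qm n)" for f
  proof -
    have "a f = (\<Oplus>\<^bsub>trivial_module B\<^esub>y\<in>Xq n. f y \<odot>\<^bsub>trivial_module B\<^esub> ?c y)"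
      using Q.hom_expand[of a n "trivial_module B" f] assms B.triv f by (simp add: Qm_def)
    also have "\<dots> = (\<Sum>y\<in>Xq n. augB (f y) * ?c y)" by (simp add: triv_finsum)
    also have "\<dots> = fn n (pF ?c) (pT ?c) f" unfolding sum_Xq fn_def by (simp add: mult.commute)
    finally show ?thesis .
  qed
  then show ?thesis by blast
qed

text \<open>Together with \<open>fn_eqD\<close>: coefficient functions matter exactly modulo those
  vanishing on \<open>W\<close>, which is how elements of the quadratic dual are
  represented.\<close>

lemma fn_cong:
  assumes f: "f \<in> carrier (Qm n)"
    and \<alpha>: "\<And>w. w \<in> Wn n \<Longrightarrow> dp (words X n) \<alpha> w = dp (words X n) \<alpha>' w"
    and \<beta>: "\<And>w. w \<in> W' n \<Longrightarrow> dp (words' n) \<beta> w = dp (words' n) \<beta>' w"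
  shows "fn n \<alpha> \<beta> f = fn n \<alpha>' \<beta>' f"
proof -
  have c: "f y \<in> carrier B" for y by (rule Q_closed[OF f])
  have "(\<Sum>w\<in>words X n. \<alpha> w * augB (f (False, w))) = augB (\<Oplus>\<^bsub>B\<^esub>w\<in>words X n. \<alpha> w \<odot>\<^bsub>B\<^esub> f (False, w))" for \<alpha>
    using c by (subst B.aug_finsum) (simp_all add: B.aug_smult del: B_simps)
  moreover have "(\<Sum>w\<in>words' n. \<beta> w * augB (f (True, w))) = augB (\<Oplus>\<^bsub>B\<^esub>w\<in>words' n. \<beta> w \<odot>\<^bsub>B\<^esub> f (True, w))" for \<beta>
    using c by (subst B.aug_finsum) (simp_all add: B.aug_smult del: B_simps)
  ultimately show ?thesis
    unfolding fn_def using D.T_cong_perp[OF QF[OF f] \<alpha>] D'.T_cong_perp[OF QT[OF f] \<beta>] by simp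
qed

lemma fn_kvec: "fn n \<alpha> \<beta> (kvec B c) = dp (words X n) \<alpha> (pF c) + dp (words' n) \<beta> (pT c)"
  by (simp add: fn_def augB_kvec dp_def)

lemma fn_eqD:
  assumes "\<And>f. f \<in> carrier (Qm n) \<Longrightarrow> fn n \<alpha> \<beta> f = fn n \<alpha>' \<beta>' f"
  shows "w \<in> Wn n \<Longrightarrow> dp (words X n) \<alpha> w = dp (words X n) \<alpha>' w"
    and "w \<in> W' n \<Longrightarrow> dp (words' n) \<beta> w = dp (words' n) \<beta>' w"
proof -
  show "dp (words X n) \<alpha> w = dp (words X n) \<alpha>' w" if "w \<in> Wn n"
  proof -
    have "mk w (\<lambda>_. 0) \<in> Wq n" using that fsub_zero[OF fsub_W'] by (simp add: Wq_def)
    from assms[OF kvec_eval[OF this]] show ?thesis by (simp add: fn_kvec dp_def)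
  qed
  show "dp (words' n) \<beta> w = dp (words' n) \<beta>' w" if "w \<in> W' n"
  proof -
    have "mk (\<lambda>_. 0) w \<in> Wq n" using that fsub_zero[OF fsub_Wsp[OF finX]] by (simp add: Wq_def)
    from assms[OF kvec_eval[OF this]] show ?thesis by (simp add: fn_kvec dp_def)
  qed
qed

lemma augB_con: "fB f \<Longrightarrow> augB (con S \<alpha> f w) = (\<Sum>v\<in>S. \<alpha> v * augB (f (w @ v)))"
  unfolding con_def by (subst B.aug_finsum) (simp_all add: B.aug_smult del: B_simps)

lemma \<gamma>_clifts: "\<gamma> n \<alpha> \<beta> \<in> clifts B Qm dQ Qm dQ eQ n (fn n \<alpha> \<beta>)"
  unfolding clifts_def
proof (intro CollectI conjI allI ballI)
  show "\<gamma> n \<alpha> \<beta> j \<in> module_hom B (Qm (n + j)) (Qm j)" for j by (rule \<gamma>_hom)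
  show "dQ j (\<gamma> n \<alpha> \<beta> (Suc j) f) = \<gamma> n \<alpha> \<beta> j (dQ (n + j) f)" if "f \<in> carrier (Qm (n + Suc j))" for j f
    by (rule dQ_\<gamma>[OF that])
  fix f assume f: "f \<in> carrier (Qm n)"
  have c: "fB (pF f)" "fB (pT f)" using Q_closed[OF f] by blast+
  show "eQ (\<gamma> n \<alpha> \<beta> 0 f) = fn n \<alpha> \<beta> f"
    unfolding eQ_def \<gamma>_simps using c
    by (simp add: B.aug_add augB_con fn_def con_closed del: B_simps)
qed

text \<open>\<open>\<alpha>'\<close> and \<open>\<beta>'\<close> read the prefix that survives the
  contraction. Words of the second summand of \<open>Qm (n + k)\<close> have length
  \<open>n + k - 1\<close>, hence the cut at \<open>k - 1\<close> when \<open>\<beta>'\<close> is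
  involved; the case distinctions drop the terms whose summand is absent in degree zero.\<close>

lemma fn_\<gamma>:
  assumes f: "f \<in> carrier (Qm (n + k))"
  shows "fn k \<alpha>' \<beta>' (\<gamma> n \<alpha> \<beta> k f) = fn (n + k) (\<lambda>y. \<alpha>' (take k y) * \<alpha> (drop k y))
    (\<lambda>y. (if n = 0 then 0 else (-1) ^ k * \<alpha>' (take k y) * \<beta> (drop k y)) +
         (if k = 0 then 0 else \<beta>' (take (k - 1) y) * tr n \<alpha> (drop (k - 1) y))) f"
proof -
  have c: "fB (pF f)" "fB (pT f)" using Q_closed[OF f] by blast+
  let ?F = "\<lambda>y. augB (f (False, y))" and ?T = "\<lambda>y. augB (f (True, y))"
  have "fn k \<alpha>' \<beta>' (\<gamma> n \<alpha> \<beta> k f) =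
    (\<Sum>w\<in>words X k. \<alpha>' w * ((\<Sum>v\<in>words X n. \<alpha> v * ?F (w @ v)) + (-1) ^ k * (\<Sum>v\<in>words' n. \<beta> v * ?T (w @ v)))) +
    (\<Sum>w\<in>words' k. \<beta>' w * (\<Sum>v\<in>words X n. tr n \<alpha> v * ?T (w @ v)))"
    unfolding fn_def \<gamma>_simps using c
    by (simp add: B.aug_add B.aug_smult augB_con con_closed del: B_simps)
  also have "\<dots> = (\<Sum>w\<in>words X k. \<Sum>v\<in>words X n. \<alpha>' w * \<alpha> v * ?F (w @ v)) +
    (\<Sum>w\<in>words X k. \<Sum>v\<in>words' n. (-1) ^ k * \<alpha>' w * \<beta> v * ?T (w @ v)) +
    (\<Sum>w\<in>words' k. \<Sum>v\<in>words X n. \<beta>' w * tr n \<alpha> v * ?T (w @ v))"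
    by (simp add: distrib_left sum.distrib sum_distrib_left ac_simps)
  also have "(\<Sum>w\<in>words X k. \<Sum>v\<in>words X n. \<alpha>' w * \<alpha> v * ?F (w @ v)) =
    (\<Sum>y\<in>words X (n + k). \<alpha>' (take k y) * \<alpha> (drop k y) * ?F y)"
    unfolding add.commute[of n k] sum_words_append[OF finX] by (intro sum.cong refl) (simp add: words_length)
  also have "(\<Sum>w\<in>words X k. \<Sum>v\<in>words' n. (-1) ^ k * \<alpha>' w * \<beta> v * ?T (w @ v)) =
    (\<Sum>y\<in>words' (n + k). (if n = 0 then 0 else (-1) ^ k * \<alpha>' (take k y) * \<beta> (drop k y)) * ?T y)"
  proof (cases n)
    case (Suc m)
    have "words' (n + k) = words X (k + m)" using Suc by (simp add: add.commute)
    then show ?thesis using Suc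
      by (simp only: sum_words_append[OF finX] words'_simps) (intro sum.cong refl, simp add: words_length)
  qed simp
  also have "(\<Sum>w\<in>words' k. \<Sum>v\<in>words X n. \<beta>' w * tr n \<alpha> v * ?T (w @ v)) =
    (\<Sum>y\<in>words' (n + k). (if k = 0 then 0 else \<beta>' (take (k - 1) y) * tr n \<alpha> (drop (k - 1) y)) * ?T y)"
  proof (cases k)
    case (Suc m)
    have "words' (n + k) = words X (m + n)" using Suc by (simp add: add.commute)
    then show ?thesis using Suc
      by (simp only: sum_words_append[OF finX] words'_simps) (intro sum.cong refl, simp add: words_length)
  qed simp
  finally show ?thesis by (simp add: fn_def sum.distrib distrib_right)
qed

lemma ext_compare_Q:
  assumes "proj_resolution B (trivial_module B) P d e"
  shows "ext_compare B P d e Qm dQ eQ"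
proof (intro ext_compare.intro ext_compare_axioms.intro)
  have P: "projective B (P n)" for n using assms by (simp add: proj_resolution_def)
  then have Pm: "left_module B (P n)" for n by (simp add: projective_def)
  note T = B.triv
  show "aug_algebra B" by (rule aug_algebra.intro[OF T])
  show "exact_res B P d e" by (rule proj_exact_res[OF assms])
  show "exact_res B Qm dQ eQ" by (rule exact_res_Q)
  show "LP B (P i) (Qm (Suc m)) (Qm m)" "LP B (P i) (P (Suc m)) (P m)" "LP B (P i) (Qm 0) (trivial_module B)"
    "LP B (P i) (P 0) (trivial_module B)" for i m
    by (intro projective_LP P Pm Q_mod T)+
  show "LP B (Qm i) (Qm (Suc m)) (Qm m)" "LP B (Qm i) (P (Suc m)) (P m)" "LP B (Qm i) (Qm 0) (trivial_module B)"
    "LP B (Qm i) (P 0) (trivial_module B)" for i m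
    by (intro Q_LP Pm Q_mod T)+
  \<comment> \<open>Every such functional reads augmentations only, and the entries of
    \<open>dQ n f\<close> have none.\<close>
  show "a (dQ n f) = 0" if a: "a \<in> module_hom B (Qm n) (trivial_module B)" and f: "f \<in> carrier (Qm (Suc n))" for n a f
  proof -
    obtain \<alpha> \<beta> where "\<forall>f\<in>carrier (Qm n). a f = fn n \<alpha> \<beta> f" using fn_repr[OF a] by blast
    then show ?thesis using dQ_closed[OF f] augB_dQ[OF f] by (simp add: fn_def)
  qed
qed

end

section \<open>The quadratic dual in coordinates\<close>

lemma fun_sum_apply: "(\<Sum>i\<in>I. f i) y = (\<Sum>i\<in>I. f i y)"
  for f :: "'i \<Rightarrow> 'x \<Rightarrow> 'k::comm_monoid_add"
  by (induction I rule: infinite_finite_induct) auto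

lemma wm_map: "wm cf (map f s) y = wm (\<lambda>a. cf (f a)) s y"
proof (induction s arbitrary: y)
  case (Cons a s) then show ?case by (cases y) auto
qed simp

text \<open>Tensor powers of a product of matrices are products of tensor powers.\<close>

lemma wm_expand:
  assumes "finite X" "\<And>a b. a \<in> set s \<Longrightarrow> cf' a b = (\<Sum>c\<in>X. cf a c * T b c)"
  shows "wm cf' s y = (\<Sum>w\<in>words X (length y). wm cf s w * wm T y w)"
  using assms(2)
proof (induction s arbitrary: y)
  case Nil
  show ?case
  proof (cases y)
    case (Cons b y')
    then show ?thesis by (simp add: sum_words_Suc[OF assms(1)])
  qed simp
next
  case (Cons a s)
  show ?case
  proof (cases y)
    case Nil then show ?thesis by simp
  next
    case (Cons b y')
    have IH: "wm cf' s y' = (\<Sum>w\<in>words X (length y'). wm cf s w * wm T y' w)"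
      using Cons.IH Cons.prems by simp
    have "wm cf' (a # s) y = (\<Sum>c\<in>X. cf a c * T b c) * (\<Sum>w\<in>words X (length y'). wm cf s w * wm T y' w)"
      using Cons IH Cons.prems by simp
    also have "\<dots> = (\<Sum>w\<in>words X (length y). wm cf (a # s) w * wm T y w)"
      unfolding Cons list.size add_0_right add_Suc_right sum_product
      by (simp add: sum_words_Suc[OF assms(1)] ac_simps)
    finally show ?thesis .
  qed
qed

text \<open>The endomorphism of the free algebra induced by a map of letters.\<close>

definition Mp :: "('u \<Rightarrow> 'u) \<Rightarrow> ('u list \<Rightarrow>\<^sub>0 'k::field) \<Rightarrow> ('u list \<Rightarrow>\<^sub>0 'k)" where
  "Mp f p = (\<Sum>s\<in>Poly_Mapping.keys p. Poly_Mapping.single (map f s) (Poly_Mapping.lookup p s))"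

lemma Mp_superset: "finite F \<Longrightarrow> Poly_Mapping.keys p \<subseteq> F \<Longrightarrow>
    Mp f p = (\<Sum>s\<in>F. Poly_Mapping.single (map f s) (Poly_Mapping.lookup p s))"
  unfolding Mp_def by (intro sum.mono_neutral_left) (auto simp: in_keys_iff)

lemma Mp_add: "Mp f (p + q) = Mp f p + Mp f q"
  using Poly_Mapping.keys_add[of p q]
  by (simp add: Mp_superset[where F = "Poly_Mapping.keys p \<union> Poly_Mapping.keys q"] lookup_add
      single_add sum.distrib)

lemma Mp_zero [simp]: "Mp f 0 = 0" by (simp add: Mp_def)

lemma Mp_single [simp]: "Mp f (Poly_Mapping.single s c) = Poly_Mapping.single (map f s) c"
  by (simp add: Mp_def)

lemma Mp_mult: "Mp f (p * q) = Mp f p * Mp f q"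
proof -
  have "Poly_Mapping.keys p \<subseteq> UNIV" by simp
  then show ?thesis
  proof (induction p rule: pm_induct)
    case (add p s c)
    have "Poly_Mapping.keys q \<subseteq> UNIV" by simp
    then have "Mp f (Poly_Mapping.single s c * q) = Mp f (Poly_Mapping.single s c) * Mp f q"
      by (induction q rule: pm_induct) (simp_all add: distrib_left Mp_add mult_single plus_list_def)
    then show ?case using add by (simp add: distrib_right Mp_add)
  qed simp
qed

lemma keys_Mp: "Poly_Mapping.keys (Mp f p) \<subseteq> map f ` Poly_Mapping.keys p"
  unfolding Mp_def by (rule order.trans[OF keys_sum]) (auto split: if_splits)

lemma Mp_Mp: "Mp f (Mp h p) = Mp (\<lambda>a. f (h a)) p"
proof -
  have "Poly_Mapping.keys p \<subseteq> UNIV" by simp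
  then show ?thesis by (induction p rule: pm_induct) (simp_all add: Mp_add comp_def)
qed

lemma Mp_id: "(\<And>s a. s \<in> Poly_Mapping.keys p \<Longrightarrow> a \<in> set s \<Longrightarrow> f a = a) \<Longrightarrow> Mp f p = p"
proof -
  assume a: "\<And>s a. s \<in> Poly_Mapping.keys p \<Longrightarrow> a \<in> set s \<Longrightarrow> f a = a"
  have "Mp f p = (\<Sum>s\<in>Poly_Mapping.keys p. Poly_Mapping.single s (Poly_Mapping.lookup p s))"
    unfolding Mp_def using a by (intro sum.cong refl) (simp add: map_idI)
  then show ?thesis using pm_decomp[of p] by simp
qed

lemma kap_Mp: "kap cf (Mp f p) y = kap (\<lambda>a. cf (f a)) p y"
proof -
  have "Poly_Mapping.keys p \<subseteq> UNIV" by simp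
  then show ?thesis by (induction p rule: pm_induct) (simp_all add: Mp_add kap_add wm_map)
qed

definition sgnp :: "('u list \<Rightarrow>\<^sub>0 'k::field) \<Rightarrow> ('u list \<Rightarrow>\<^sub>0 'k)" where
  "sgnp p = (\<Sum>s\<in>Poly_Mapping.keys p. Poly_Mapping.single s ((-1) ^ length s * Poly_Mapping.lookup p s))"

lemma lookup_sgnp: "Poly_Mapping.lookup (sgnp p) s = (-1) ^ length s * Poly_Mapping.lookup p s"
proof -
  have "Poly_Mapping.lookup (sgnp p) s =
    (\<Sum>t\<in>Poly_Mapping.keys p. if t = s then (-1) ^ length s * Poly_Mapping.lookup p s else 0)"
    unfolding sgnp_def lookup_sum by (intro sum.cong) (auto simp: lookup_single)
  then show ?thesis by (auto simp: in_keys_iff)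
qed

lemma keys_sgnp [simp]: "Poly_Mapping.keys (sgnp p) = Poly_Mapping.keys p"
  by (auto simp: in_keys_iff lookup_sgnp)

lemma kap_sgnp: "kap cf (sgnp p) y = (-1) ^ length y * kap cf p y"
proof -
  have "Poly_Mapping.lookup (sgnp p) s * wm cf s y = (-1) ^ length y * (Poly_Mapping.lookup p s * wm cf s y)" for s
    by (cases "length s = length y") (simp_all add: lookup_sgnp wm_length)
  then show ?thesis by (simp only: kap_def sum_distrib_left keys_sgnp)
qed

text \<open>A component is zero exactly if its negative is, so the sum defining
  \<open>sign_aut\<close> runs over the nonzero components of \<open>sgnp p\<close>, which are those
  of \<open>p\<close> up to sign.\<close>

lemma (in coord) sign_aut_proj:
  assumes p: "isF p"
  shows "sign_aut QA (proj p) = proj (sgnp p)"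
proof -
  have s: "isF (sgnp p)" using p by simp
  have res: "restr (sgnp p) n = Poly_Mapping.single [] ((-1) ^ n) * restr p n" for n
  proof (rule poly_mapping_eqI)
    fix t
    have "Poly_Mapping.lookup (Poly_Mapping.single [] ((-1) ^ n) * restr p n) t = (-1) ^ n * Poly_Mapping.lookup (restr p n) t"
      unfolding zero_list_def[symmetric] mult_map_scale_conv_mult[symmetric] by (simp add: Poly_Mapping.map.rep_eq when_def)
    then show "Poly_Mapping.lookup (restr (sgnp p) n) t = Poly_Mapping.lookup (Poly_Mapping.single [] ((-1) ^ n) * restr p n) t"
      by (simp add: lookup_restr lookup_sgnp)
  qed
  interpret G: galg QA by (rule galg_QA)
  have hp: "G.hp (proj (sgnp p)) j = (if even j then G.hp (proj p) j else \<ominus>\<^bsub>QA\<^esub> G.hp (proj p) j)" for j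
  proof (cases "j < 0")
    case True
    have "\<ominus>\<^bsub>QA\<^esub> \<zero>\<^bsub>QA\<^esub> = \<zero>\<^bsub>QA\<^esub>" by (rule QA.minus_equality) simp_all
    then show ?thesis using True by (simp add: hpart_comp[OF p] hpart_comp[OF s] comp_proj[OF p] comp_proj[OF s] proj_zero)
  next
    case False
    have c: "proj (restr p (nat j)) \<in> carrier QA" by (rule proj_closed[OF restr_isF'[OF p]])
    have "proj (restr (sgnp p) (nat j)) = (-1) ^ nat j \<odot>\<^bsub>QA\<^esub> proj (restr p (nat j))"
      unfolding res by (rule proj_smult[OF restr_isF'[OF p]])
    moreover have "even (nat j) = even j" using False by (simp add: even_nat_iff)
    ultimately show ?thesis using False c
      by (simp add: hpart_comp[OF p] hpart_comp[OF s] comp_proj[OF p] comp_proj[OF s] QA.ksm_minus_one)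
  qed
  have pc: "proj p \<in> carrier QA" "proj (sgnp p) \<in> carrier QA" by (rule proj_closed[OF p] proj_closed[OF s])+
  have iff: "G.hp (proj (sgnp p)) j \<noteq> \<zero>\<^bsub>QA\<^esub> \<longleftrightarrow> G.hp (proj p) j \<noteq> \<zero>\<^bsub>QA\<^esub>" for j
    using QA.add.inv_eq_1_iff[of "G.hp (proj p) j"] pc by (simp add: hp a_inv_def)
  have "sign_aut QA (proj p) = (\<Oplus>\<^bsub>QA\<^esub>j\<in>{j. G.hp (proj (sgnp p)) j \<noteq> \<zero>\<^bsub>QA\<^esub>}. G.hp (proj (sgnp p)) j)"
    unfolding sign_aut_def homog_part_hpart iff unfolding hp ..
  also have "\<dots> = proj (sgnp p)" by (rule G.gr.hpart_sum[OF pc(2), symmetric])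
  finally show ?thesis .
qed

locale quad_setting = finite_dimensional_vector_space scale Basis
  for scale :: "'k::field \<Rightarrow> 'v::ab_group_add \<Rightarrow> 'v" and Basis :: "'v set" +
  fixes R :: "('v list \<Rightarrow>\<^sub>0 'k) set set"
  assumes R2: "R \<subseteq> deg (tensor_algebra scale UNIV) 2"
begin

abbreviation crd where "crd \<equiv> representation Basis"

lemma crd_add: "crd (u + v) b = crd u b + crd v b"
  using representation_add[OF independent_Basis, of v u] span_Basis by simp

lemma crd_scale: "crd (scale c v) b = c * crd v b"
  using representation_scale[OF independent_Basis, of v c] span_Basis by simp

lemma crd_expand: "v = (\<Sum>b\<in>Basis. scale (crd v b) b)"
  using sum_representation_eq[OF independent_Basis _ finite_Basis order.refl, of v] span_Basis by simp

lemma crd_basis: "b \<in> Basis \<Longrightarrow> crd b b' = (if b = b' then 1 else 0)"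
  using representation_basis[OF independent_Basis, of b] by auto

sublocale V: coord scale UNIV Basis "\<lambda>b. b" crd R
  by unfold_locales (auto simp: finite_Basis crd_add crd_scale crd_basis R2 intro: crd_expand)

abbreviation Vs where "Vs \<equiv> dual_space scale"

lemma Vs_iff: "\<alpha> \<in> Vs \<longleftrightarrow> (\<forall>u v. \<alpha> (u + v) = \<alpha> u + \<alpha> v) \<and> (\<forall>c v. \<alpha> (scale c v) = c * \<alpha> v)"
proof -
  have "vector_space ((*) :: 'k \<Rightarrow> 'k \<Rightarrow> 'k)" by unfold_locales (auto simp: algebra_simps)
  then show ?thesis
    unfolding dual_space_def Vector_Spaces.linear_iff
    using vector_space_axioms by (auto simp: module_iff_vector_space)
qed

lemma Vs_expand: "\<alpha> \<in> Vs \<Longrightarrow> \<alpha> v = (\<Sum>b\<in>Basis. \<alpha> b * crd v b)"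
proof -
  assume a: "\<alpha> \<in> Vs"
  have "\<alpha> 0 = 0" using a unfolding Vs_iff by (metis add_cancel_right_right)
  then have "\<alpha> (\<Sum>b\<in>S. scale (crd v b) b) = (\<Sum>b\<in>S. \<alpha> b * crd v b)" for S
    using a by (induction S rule: infinite_finite_induct) (auto simp: Vs_iff)
  from this[of Basis] show ?thesis using crd_expand[of v] by simp
qed

lemma orth_deg: "orth scale R \<subseteq> deg (tensor_algebra dual_scale Vs) 2"
  by (auto simp: orth_def)

sublocale Vd: coord dual_scale Vs Basis "\<lambda>b v. crd v b" "\<lambda>\<alpha>. \<alpha>" "orth scale R"
proof
  show "u = (\<Sum>b\<in>Basis. dual_scale (u b) (\<lambda>v. crd v b))" if u: "u \<in> Vs" for u
  proof
    fix v
    show "u v = (\<Sum>b\<in>Basis. dual_scale (u b) (\<lambda>v. crd v b)) v"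
      unfolding fun_sum_apply dual_scale_def by (rule Vs_expand[OF u])
  qed
  show "orth scale R \<subseteq> deg (tensor_algebra dual_scale Vs) 2" by (rule orth_deg)
qed (auto simp: finite_Basis Vs_iff crd_add crd_scale crd_basis dual_scale_def algebra_simps)

lemma dual_eq: "quadratic_dual scale R = Vd.QA"
  by (simp add: quadratic_dual_def)

abbreviation Rp where "Rp \<equiv> Vd.Rs"

text \<open>With respect to dual bases the evaluation pairing is the dot product of
  coordinates.\<close>

lemma word_pairing_wm:
  assumes "s \<in> lists Vs"
  shows "word_pairing s t = (\<Sum>y\<in>words Basis 2. wm (\<lambda>\<alpha>. \<alpha>) s y * wm crd t y)"
proof (cases "length s = 2 \<and> length t = 2")
  case True
  then obtain \<alpha> \<beta> v w where st: "s = [\<alpha>, \<beta>]" "t = [v, w]"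
    by (auto simp: numeral_2_eq_2 length_Suc_conv)
  have "(\<Sum>y\<in>words Basis 2. wm (\<lambda>\<alpha>. \<alpha>) s y * wm crd t y) = (\<Sum>b\<in>Basis. \<Sum>b'\<in>Basis. (\<alpha> b * crd v b) * (\<beta> b' * crd w b'))"
    unfolding numeral_2_eq_2 st by (simp add: sum_words_Suc[OF finite_Basis] ac_simps)
  also have "\<dots> = \<alpha> v * \<beta> w"
    using assms st by (simp add: sum_product[symmetric] Vs_expand[of \<alpha> v] Vs_expand[of \<beta> w])
  finally show ?thesis using st by simp
next
  case False
  have "word_pairing s t = 0" using False by (induction s t rule: word_pairing.induct) auto
  moreover have "wm (\<lambda>\<alpha>. \<alpha>) s y * wm crd t y = 0" if "y \<in> words Basis 2" for y
    using that False words_length[OF that] wm_length[of s y] wm_length[of t y] by auto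
  ultimately show ?thesis by (simp only: sum.neutral_const cong: sum.cong)
qed

lemma free_pairing_kap:
  assumes "Vd.isF p"
  shows "free_pairing p q = (\<Sum>y\<in>words Basis 2. kap (\<lambda>\<alpha>. \<alpha>) p y * kap crd q y)"
proof -
  have "free_pairing p q = (\<Sum>s\<in>Poly_Mapping.keys p. \<Sum>t\<in>Poly_Mapping.keys q. \<Sum>y\<in>words Basis 2.
     (Poly_Mapping.lookup p s * wm (\<lambda>\<alpha>. \<alpha>) s y) * (Poly_Mapping.lookup q t * wm crd t y))"
    unfolding free_pairing_def
  proof (intro sum.cong refl)
    fix s t assume "s \<in> Poly_Mapping.keys p"
    then have "s \<in> lists Vs" using assms by blast
    then show "Poly_Mapping.lookup p s * Poly_Mapping.lookup q t * word_pairing s t =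
      (\<Sum>y\<in>words Basis 2. (Poly_Mapping.lookup p s * wm (\<lambda>\<alpha>. \<alpha>) s y) * (Poly_Mapping.lookup q t * wm crd t y))"
      by (simp add: word_pairing_wm sum_distrib_left ac_simps)
  qed
  also have "\<dots> = (\<Sum>s\<in>Poly_Mapping.keys p. \<Sum>y\<in>words Basis 2. \<Sum>t\<in>Poly_Mapping.keys q.
     (Poly_Mapping.lookup p s * wm (\<lambda>\<alpha>. \<alpha>) s y) * (Poly_Mapping.lookup q t * wm crd t y))"
    by (intro sum.cong refl sum.swap)
  also have "\<dots> = (\<Sum>y\<in>words Basis 2. \<Sum>s\<in>Poly_Mapping.keys p. \<Sum>t\<in>Poly_Mapping.keys q.
     (Poly_Mapping.lookup p s * wm (\<lambda>\<alpha>. \<alpha>) s y) * (Poly_Mapping.lookup q t * wm crd t y))"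
    by (rule sum.swap)
  also have "\<dots> = (\<Sum>y\<in>words Basis 2. kap (\<lambda>\<alpha>. \<alpha>) p y * kap crd q y)"
    unfolding kap_def by (intro sum.cong refl) (simp add: sum_product)
  finally show ?thesis .
qed

text \<open>\<open>Rp\<close> consists of the coordinates of \<open>R\<^sup>\<bottom>\<close>, and
  restricted to basis words of length two these are exactly the functions annihilated by
  \<open>R\<close>. So the spaces built from the dual relations are the Koszul spaces of the algebra
  itself.\<close>

lemma Rp_iff: "(\<forall>\<rho>\<in>Rp. (\<Sum>r\<in>words Basis 2. \<rho> r * h r) = 0) \<longleftrightarrow> (\<forall>w\<in>V.Wn 2. dp (words Basis 2) h w = 0)"
proof (intro iffI ballI)
  fix w assume h: "\<forall>\<rho>\<in>Rp. (\<Sum>r\<in>words Basis 2. \<rho> r * h r) = 0" and w: "w \<in> V.Wn 2"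
  obtain p where p: "Poly_Mapping.keys p \<subseteq> {s \<in> lists Vs. length s = 2}" "\<And>y. y \<in> words Basis 2 \<Longrightarrow> kap (\<lambda>\<alpha>. \<alpha>) p y = w y"
    using Vd.array_repr[of 2 w] by blast
  have F: "Vd.isF p" using p(1) by blast
  have pm: "p \<in> Vd.tproj p" unfolding Vd.tproj_def using F by (intro Vd.FA.quot_self[OF Vd.LR_sub]) simp
  have "Vd.tproj p \<in> orth scale R"
    unfolding orth_def
  proof (intro CollectI conjI ballI)
    show "Vd.tproj p \<in> deg (tensor_algebra dual_scale Vs) 2"
      unfolding Vd.TA_simps using p(1) by auto
    fix r p' q assume r: "r \<in> R" and p': "p' \<in> Vd.tproj p" and q: "q \<in> r"
    have p'F: "Vd.isF p'" "Vd.tproj p' = Vd.tproj p"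
      using Vd.FA.quot_mem[OF Vd.LR_sub, of p p'] p' F unfolding Vd.tproj_def by auto
    have "free_pairing p' q = (\<Sum>y\<in>words Basis 2. kap (\<lambda>\<alpha>. \<alpha>) p y * kap crd q y)"
      unfolding free_pairing_kap[OF p'F(1)] using Vd.kap_tproj[OF p'F(1) F p'F(2)] by simp
    also have "\<dots> = (\<Sum>y\<in>words Basis 2. kap crd q y * w y)"
      using p(2) by (intro sum.cong refl) simp
    also have "\<dots> = 0" using Wsp_rel[OF w, of "kap crd q" "[]" "[]"] r q by (auto simp: V.Rs_def)
    finally show "free_pairing p' q = 0" .
  qed
  then have "kap (\<lambda>\<alpha>. \<alpha>) p \<in> Rp" unfolding Vd.Rs_def using pm by blast
  then have "(\<Sum>r\<in>words Basis 2. kap (\<lambda>\<alpha>. \<alpha>) p r * h r) = 0" using h by blast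
  then show "dp (words Basis 2) h w = 0" unfolding dp_def using p(2) by (simp add: mult.commute)
next
  fix \<rho> assume h: "\<forall>w\<in>V.Wn 2. dp (words Basis 2) h w = 0" and "\<rho> \<in> Rp"
  then obtain t p where t: "t \<in> orth scale R" "p \<in> t" "\<rho> = kap (\<lambda>\<alpha>. \<alpha>) p" unfolding Vd.Rs_def by blast
  have "t \<in> deg (tensor_algebra dual_scale Vs) 2" using t(1) orth_deg by blast
  then obtain p0 where p0: "t = Vd.tproj p0" "Vd.isF p0" unfolding Vd.TA_simps by auto
  have F: "Vd.isF p"
    using Vd.FA.quot_mem[OF Vd.LR_sub, of p0 p] t(2) p0 unfolding Vd.tproj_def by auto
  let ?w = "\<lambda>y. if y \<in> words Basis 2 then \<rho> y else 0"
  have "?w \<in> V.Wn 2"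
    unfolding Wsp_def
  proof (intro CollectI conjI allI impI ballI)
    fix \<rho>' u v assume "\<rho>' \<in> V.Rs"
    then obtain r q where r: "r \<in> R" "q \<in> r" "\<rho>' = kap crd q" unfolding V.Rs_def by blast
    show "(\<Sum>r\<in>words Basis 2. \<rho>' r * ?w (u @ r @ v)) = 0"
    proof (cases "u = [] \<and> v = []")
      case True
      have "(\<Sum>r\<in>words Basis 2. \<rho>' r * ?w (u @ r @ v)) = free_pairing p q"
        unfolding free_pairing_kap[OF F] r(3) t(3) using True by (intro sum.cong) (simp_all add: mult.commute)
      also have "\<dots> = 0" using t(1,2) r(1,2) unfolding orth_def by blast
      finally show ?thesis .
    qed (auto simp: words_def intro!: sum.neutral)
  qed simp
  then have "dp (words Basis 2) h ?w = 0" using h by blast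
  then show "(\<Sum>r\<in>words Basis 2. \<rho> r * h r) = 0" by (simp add: dp_def mult.commute cong: sum.cong)
qed

sublocale VK: koszul_alg V.QA Basis "\<lambda>b. V.xw [b]" Rp
  by (rule V.koszul_alg_QA[OF Rp_iff])

abbreviation gn where "gn v \<equiv> gen scale UNIV R v"

lemma gn_proj: "gn v = V.proj (V.s1 [v])" by (rule V.gen_proj)

lemma gn_closed [simp]: "gn v \<in> carrier V.QA" unfolding gn_proj by (rule V.proj_gen_closed) simp

lemma gn_add: "gn (u + v) = gn u \<oplus>\<^bsub>V.QA\<^esub> gn v" unfolding gn_proj by (rule V.proj_gen_add) simp_all

lemma gn_scale: "gn (scale c u) = c \<odot>\<^bsub>V.QA\<^esub> gn u" unfolding gn_proj by (rule V.proj_gen_scale) simp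

lemma gn_expand: "gn v = (\<Oplus>\<^bsub>V.QA\<^esub>b\<in>Basis. crd v b \<odot>\<^bsub>V.QA\<^esub> V.xw [b])"
  unfolding gn_proj by (rule V.proj_gen_expand) simp

lemma xw_gn: "V.xw [b] = gn b" by (simp add: V.xw_def gn_proj)

text \<open>The generators are independent in degree one. This is what gives the description in
  \<open>restr_gen\<close> a unique value.\<close>

lemma gn_inj: "gn u = gn v \<Longrightarrow> u = v"
proof -
  assume "gn u = gn v"
  then have "gn (u - v) \<oplus>\<^bsub>V.QA\<^esub> gn v = gn v" using gn_add[of "u - v" v] by simp
  then have z: "gn (u - v) = \<zero>\<^bsub>V.QA\<^esub>" by (simp add: V.QA.add.r_cancel_one)
  have "crd (u - v) b = 0" if "b \<in> Basis" for b
    using VK.x_indep[of "crd (u - v)" b] z that unfolding gn_expand by simp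
  then have "u - v = 0" using crd_expand[of "u - v"] by simp
  then show ?thesis by simp
qed

lemma gn_deg: "gn v \<in> deg V.QA 1"
  unfolding gn_proj by (rule V.proj_deg) simp

lemma deg_1_gn: "a \<in> deg V.QA 1 \<Longrightarrow> \<exists>v. a = gn v"
proof -
  assume "a \<in> deg V.QA 1"
  then obtain c where c: "a = (\<Oplus>\<^bsub>V.QA\<^esub>b\<in>Basis. c b \<odot>\<^bsub>V.QA\<^esub> V.xw [b])" using VK.deg_1 by blast
  have "gn (\<Sum>b\<in>Basis. scale (c b) b) = a"
    unfolding gn_proj c V.xw_def by (subst V.proj_gen_sum) simp_all
  then show ?thesis by blast
qed

definition ghom where "ghom \<phi> \<longleftrightarrow> \<phi> \<in> graded_hom V.QA V.QA"

abbreviation rs where "rs \<phi> \<equiv> restr_gen scale R \<phi>"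

lemma ghomD:
  assumes "ghom \<phi>"
  shows "a \<in> carrier V.QA \<Longrightarrow> \<phi> a \<in> carrier V.QA"
    "a \<in> carrier V.QA \<Longrightarrow> b \<in> carrier V.QA \<Longrightarrow> \<phi> (a \<oplus>\<^bsub>V.QA\<^esub> b) = \<phi> a \<oplus>\<^bsub>V.QA\<^esub> \<phi> b"
    "a \<in> carrier V.QA \<Longrightarrow> b \<in> carrier V.QA \<Longrightarrow> \<phi> (a \<otimes>\<^bsub>V.QA\<^esub> b) = \<phi> a \<otimes>\<^bsub>V.QA\<^esub> \<phi> b"
    "\<phi> \<one>\<^bsub>V.QA\<^esub> = \<one>\<^bsub>V.QA\<^esub>" "a \<in> carrier V.QA \<Longrightarrow> \<phi> (c \<odot>\<^bsub>V.QA\<^esub> a) = c \<odot>\<^bsub>V.QA\<^esub> \<phi> a"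
    "a \<in> deg V.QA i \<Longrightarrow> \<phi> a \<in> deg V.QA i"
  using assms by (auto simp: ghom_def graded_hom_def ring_hom_def image_subset_iff)

lemma rs: "ghom \<phi> \<Longrightarrow> \<phi> (gn v) = gn (rs \<phi> v)"
proof -
  assume g: "ghom \<phi>"
  obtain w where w: "\<phi> (gn v) = gn w" using deg_1_gn[OF ghomD(6)[OF g gn_deg]] by blast
  show ?thesis unfolding restr_gen_def by (rule theI[of _ w]) (use w gn_inj in auto)
qed

lemma rs_eqI: "ghom \<phi> \<Longrightarrow> \<phi> (gn v) = gn w \<Longrightarrow> rs \<phi> v = w"
  using rs[of \<phi> v] gn_inj by simp

lemma rs_add: "ghom \<phi> \<Longrightarrow> rs \<phi> (u + v) = rs \<phi> u + rs \<phi> v"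
  by (rule rs_eqI) (simp_all add: gn_add ghomD(2) rs)

lemma rs_scale: "ghom \<phi> \<Longrightarrow> rs \<phi> (scale c u) = scale c (rs \<phi> u)"
  by (rule rs_eqI) (simp_all add: gn_scale ghomD(5) rs)

abbreviation Tm where "Tm \<phi> \<equiv> (\<lambda>c. crd (rs \<phi> c))"

lemma ghom_word: "ghom \<phi> \<Longrightarrow> \<phi> (V.proj (V.s1 s)) = V.proj (V.s1 (map (rs \<phi>) s))"
proof (induction s)
  case Nil
  then show ?case by (simp add: V.proj_Nil ghomD(4))
next
  case (Cons a s)
  have c: "V.proj (V.s1 s) \<in> carrier V.QA" by (rule V.proj_closed) simp
  have "\<phi> (V.proj (V.s1 (a # s))) = \<phi> (gn a \<otimes>\<^bsub>V.QA\<^esub> V.proj (V.s1 s))"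
    using V.proj_append[of "[a]" s] by (simp add: gn_proj)
  also have "\<dots> = gn (rs \<phi> a) \<otimes>\<^bsub>V.QA\<^esub> V.proj (V.s1 (map (rs \<phi>) s))"
    using Cons c by (simp add: ghomD(3) rs)
  also have "\<dots> = V.proj (V.s1 (map (rs \<phi>) (a # s)))"
    using V.proj_append[of "[rs \<phi> a]" "map (rs \<phi>) s"] by (simp add: gn_proj)
  finally show ?case .
qed

lemma ghom_xw: "ghom \<phi> \<Longrightarrow> y \<in> words Basis n \<Longrightarrow> \<phi> (V.xw y) = (\<Oplus>\<^bsub>V.QA\<^esub>y'\<in>words Basis n. wm (Tm \<phi>) y y' \<odot>\<^bsub>V.QA\<^esub> V.xw y')"
  using V.proj_word_expand[of "map (rs \<phi>) y"] ghom_word[of \<phi> y]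
  by (simp add: V.xw_def words_length wm_map)

text \<open>Applying \<open>\<phi>\<close> to a vanishing combination of monomials of degree two
  gives another one, whose coefficients are transformed by the tensor square of
  \<open>Tm \<phi>\<close>.\<close>

lemma Tm_preserves: "ghom \<phi> \<Longrightarrow> preserves_rel Basis Rp (Tm \<phi>)"
  unfolding preserves_rel_def Rp_iff
proof (intro allI impI)
  fix h assume g: "ghom \<phi>" and "\<forall>w\<in>V.Wn 2. dp (words Basis 2) h w = 0"
  then have z: "(\<Oplus>\<^bsub>V.QA\<^esub>y\<in>words Basis 2. h y \<odot>\<^bsub>V.QA\<^esub> V.xw y) = \<zero>\<^bsub>V.QA\<^esub>" by (simp only: V.lin_zero)
  have "(\<Oplus>\<^bsub>V.QA\<^esub>y'\<in>words Basis 2. (\<Sum>y\<in>words Basis 2. h y * wm (Tm \<phi>) y y') \<odot>\<^bsub>V.QA\<^esub> V.xw y') =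
    (\<Oplus>\<^bsub>V.QA\<^esub>y\<in>words Basis 2. h y \<odot>\<^bsub>V.QA\<^esub> \<phi> (V.xw y))"
    by (subst V.QA.lin_comb_swap[symmetric]) (simp_all add: ghom_xw[OF g] finite_Basis cong: V.QA.finsum_cong)
  also have "\<dots> = (\<Oplus>\<^bsub>V.QA\<^esub>y\<in>words Basis 2. \<phi> (h y \<odot>\<^bsub>V.QA\<^esub> V.xw y))"
    by (intro V.QA.finsum_cong2) (simp_all add: ghomD(1,5)[OF g])
  also have "\<dots> = \<phi> (\<Oplus>\<^bsub>V.QA\<^esub>y\<in>words Basis 2. h y \<odot>\<^bsub>V.QA\<^esub> V.xw y)"
    by (rule finsum_additive[symmetric]) (simp_all add: V.QA.abelian_group_axioms ghomD(1,2)[OF g])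
  also have "\<dots> = \<zero>\<^bsub>V.QA\<^esub>"
    unfolding z using ghomD(5)[OF g V.QA.zero_closed, of 0] ghomD(1)[OF g V.QA.zero_closed] by simp
  finally have "\<forall>w\<in>V.Wn 2. dp (words Basis 2) (\<lambda>y'. \<Sum>y\<in>words Basis 2. h y * wm (Tm \<phi>) y y') w = 0"
    by (simp only: V.lin_zero)
  then show "\<forall>w\<in>V.Wn 2. dp (words Basis 2) (\<lambda>r. \<Sum>r'\<in>words Basis 2. wm (Tm \<phi>) r' r * h r') w = 0"
    by (simp only: mult.commute)
qed

end

section \<open>The dual automorphism\<close>

text \<open>The operations of the target are known only through \<open>h\<close>, so they are
  transported from the source. Degrees have to be reflected by \<open>h\<close>, since it is the
  inverse that must be graded.\<close>

lemma graded_iso_inv: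
  assumes bij: "bij_betw h (carrier A) (carrier B)"
    and one: "\<one>\<^bsub>A\<^esub> \<in> carrier A" "h \<one>\<^bsub>A\<^esub> = \<one>\<^bsub>B\<^esub>"
    and add: "\<And>x y. x \<in> carrier A \<Longrightarrow> y \<in> carrier A \<Longrightarrow> x \<oplus>\<^bsub>A\<^esub> y \<in> carrier A \<and> h (x \<oplus>\<^bsub>A\<^esub> y) = h x \<oplus>\<^bsub>B\<^esub> h y"
    and mult: "\<And>x y. x \<in> carrier A \<Longrightarrow> y \<in> carrier A \<Longrightarrow> x \<otimes>\<^bsub>A\<^esub> y \<in> carrier A \<and> h (x \<otimes>\<^bsub>A\<^esub> y) = h x \<otimes>\<^bsub>B\<^esub> h y"
    and smult: "\<And>c x. x \<in> carrier A \<Longrightarrow> c \<odot>\<^bsub>A\<^esub> x \<in> carrier A \<and> h (c \<odot>\<^bsub>A\<^esub> x) = c \<odot>\<^bsub>B\<^esub> h x"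
    and deg: "\<And>i x. x \<in> carrier A \<Longrightarrow> h x \<in> deg B i \<Longrightarrow> x \<in> deg A i" "\<And>i. deg B i \<subseteq> carrier B"
  shows "inv_into (carrier A) h \<in> graded_iso B A"
proof -
  let ?k = "inv_into (carrier A) h"
  have kc: "?k y \<in> carrier A" and hk: "h (?k y) = y" if "y \<in> carrier B" for y
    using that bij_betw_imp_surj_on[OF bij] by (auto intro: inv_into_into f_inv_into_f)
  have eqI: "?k y = x" if "x \<in> carrier A" "h x = y" for x y
    using inv_into_f_f[OF bij_betw_imp_inj_on[OF bij] that(1)] that(2) by simp
  have "?k \<in> graded_hom B A"
    unfolding graded_hom_def
  proof (intro CollectI conjI allI ballI ring_hom_memI)
    show "?k x \<in> carrier A" if "x \<in> carrier B" for x by (rule kc[OF that])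
    show "?k (x \<otimes>\<^bsub>B\<^esub> y) = ?k x \<otimes>\<^bsub>A\<^esub> ?k y" if "x \<in> carrier B" "y \<in> carrier B" for x y
      using mult[OF kc[OF that(1)] kc[OF that(2)]] by (intro eqI) (simp_all add: hk that)
    show "?k (x \<oplus>\<^bsub>B\<^esub> y) = ?k x \<oplus>\<^bsub>A\<^esub> ?k y" if "x \<in> carrier B" "y \<in> carrier B" for x y
      using add[OF kc[OF that(1)] kc[OF that(2)]] by (intro eqI) (simp_all add: hk that)
    show "?k \<one>\<^bsub>B\<^esub> = \<one>\<^bsub>A\<^esub>" by (rule eqI[OF one])
    show "?k (c \<odot>\<^bsub>B\<^esub> x) = c \<odot>\<^bsub>A\<^esub> ?k x" if "x \<in> carrier B" for c x
      using smult[OF kc[OF that]] by (intro eqI) (simp_all add: hk that)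
    show "?k ` deg B i \<subseteq> deg A i" for i
    proof (rule image_subsetI)
      fix y assume y: "y \<in> deg B i"
      then have yB: "y \<in> carrier B" using deg(2) by blast
      show "?k y \<in> deg A i" by (rule deg(1)[OF kc[OF yB]]) (simp only: hk[OF yB] y)
    qed
  qed
  then show ?thesis unfolding graded_iso_def using bij_betw_inv_into[OF bij] by simp
qed

text \<open>A graded bijection reflects degrees: if \<open>\<sigma> x\<close> is homogeneous, the
  other components of \<open>x\<close> are sent to zero and hence vanish.\<close>

lemma (in galg) inv_graded_aut:
  assumes "\<sigma> \<in> graded_aut A"
  shows "inv_into (carrier A) \<sigma> \<in> graded_aut A"
proof (rule graded_iso_inv)
  have hom: "\<sigma> \<in> graded_hom A A" and bij: "bij_betw \<sigma> (carrier A) (carrier A)"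
    using assms by (simp_all add: graded_iso_def)
  note h = hom[unfolded graded_hom_def ring_hom_def]
  show "bij_betw \<sigma> (carrier A) (carrier A)" by (rule bij)
  show "\<one> \<in> carrier A" "\<sigma> \<one> = \<one>" using h by auto
  have cl: "\<sigma> x \<in> carrier A" if "x \<in> carrier A" for x using h that by auto
  have add: "\<sigma> (x \<oplus> y) = \<sigma> x \<oplus> \<sigma> y" if "x \<in> carrier A" "y \<in> carrier A" for x y using h that by auto
  have sm: "\<sigma> (c \<odot> x) = c \<odot> \<sigma> x" if "x \<in> carrier A" for c x using h that by auto
  show "x \<oplus> y \<in> carrier A \<and> \<sigma> (x \<oplus> y) = \<sigma> x \<oplus> \<sigma> y" if "x \<in> carrier A" "y \<in> carrier A" for x y
    using add that by simp
  show "x \<otimes> y \<in> carrier A \<and> \<sigma> (x \<otimes> y) = \<sigma> x \<otimes> \<sigma> y" if "x \<in> carrier A" "y \<in> carrier A" for x y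
    using h that by auto
  show "c \<odot> x \<in> carrier A \<and> \<sigma> (c \<odot> x) = c \<odot> \<sigma> x" if "x \<in> carrier A" for c x using sm that by simp
  show "deg A i \<subseteq> carrier A" for i using gr.gr_closed by blast
  have z: "\<sigma> \<zero> = \<zero>" using sm[of \<zero> 0] cl[of \<zero>] by simp
  fix i x assume x: "x \<in> carrier A" and d: "\<sigma> x \<in> deg A i"
  have \<sigma>d: "\<sigma> y \<in> deg A (j + 0)" if "y \<in> deg A j" for y j
    using h that by (simp add: image_subset_iff)
  have "\<sigma> (hp x j) = hp (\<sigma> x) j" for j
    using hpart_map[where m = x and \<phi> = \<sigma> and s = 0 and j = j, OF A_grading A_grading x cl add \<sigma>d] by simp
  then have "\<sigma> (hp x j) = \<sigma> \<zero>" if "j \<noteq> i" for j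
    using gr.hpart_homog[OF d, of j] that z by simp
  then have "hp x j = \<zero>" if "j \<noteq> i" for j
    using inj_onD[OF bij_betw_imp_inj_on[OF bij], of "hp x j" \<zero>] that x by simp
  then have "x = (\<Oplus>j\<in>{i}. hp x j)" by (intro gr.hpart_superset[OF x]) auto
  also have "\<dots> = hp x i" using x by simp
  finally show "x \<in> deg A i" using gr.hpart_in[OF x, of i] by simp
qed

context coord
begin

lemma graded_hom_QA:
  assumes "f \<in> graded_hom QA QA"
  shows "f \<one>\<^bsub>QA\<^esub> = \<one>\<^bsub>QA\<^esub>"
    and "a \<in> carrier QA \<Longrightarrow> b \<in> carrier QA \<Longrightarrow> f (a \<oplus>\<^bsub>QA\<^esub> b) = f a \<oplus>\<^bsub>QA\<^esub> f b"
    and "a \<in> carrier QA \<Longrightarrow> b \<in> carrier QA \<Longrightarrow> f (a \<otimes>\<^bsub>QA\<^esub> b) = f a \<otimes>\<^bsub>QA\<^esub> f b"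
    and "a \<in> carrier QA \<Longrightarrow> f (c \<odot>\<^bsub>QA\<^esub> a) = c \<odot>\<^bsub>QA\<^esub> f a"
    and "f \<zero>\<^bsub>QA\<^esub> = \<zero>\<^bsub>QA\<^esub>"
proof -
  have r: "f \<in> ring_hom QA QA" and sm: "\<forall>c. \<forall>x\<in>carrier QA. f (c \<odot>\<^bsub>QA\<^esub> x) = c \<odot>\<^bsub>QA\<^esub> f x"
    using assms unfolding graded_hom_def mem_Collect_eq by - (elim conjE, assumption)+
  show "f \<one>\<^bsub>QA\<^esub> = \<one>\<^bsub>QA\<^esub>" by (rule ring_hom_one[OF r])
  show "a \<in> carrier QA \<Longrightarrow> b \<in> carrier QA \<Longrightarrow> f (a \<oplus>\<^bsub>QA\<^esub> b) = f a \<oplus>\<^bsub>QA\<^esub> f b" by (rule ring_hom_add[OF r])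
  show "a \<in> carrier QA \<Longrightarrow> b \<in> carrier QA \<Longrightarrow> f (a \<otimes>\<^bsub>QA\<^esub> b) = f a \<otimes>\<^bsub>QA\<^esub> f b" by (rule ring_hom_mult[OF r])
  show s: "f (c \<odot>\<^bsub>QA\<^esub> a) = c \<odot>\<^bsub>QA\<^esub> f a" if "a \<in> carrier QA" for c a by (rule bspec[OF spec[OF sm] that])
  have "f \<zero>\<^bsub>QA\<^esub> = 0 \<odot>\<^bsub>QA\<^esub> f \<zero>\<^bsub>QA\<^esub>" using s[OF QA.zero_closed, of 0] by simp
  also have "\<dots> = \<zero>\<^bsub>QA\<^esub>" by (rule QA.ksm_zero_left[OF ring_hom_closed[OF r QA.zero_closed]])
  finally show "f \<zero>\<^bsub>QA\<^esub> = \<zero>\<^bsub>QA\<^esub>" .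
qed

lemma graded_hom_QA_eqI:
  assumes f: "f \<in> graded_hom QA QA" and f': "f' \<in> graded_hom QA QA"
    and eq: "\<And>w. w \<in> W \<Longrightarrow> f (gen scale W R w) = f' (gen scale W R w)" and a: "a \<in> carrier QA"
  shows "f a = f' a"
proof -
  note h = graded_hom_QA[OF f] and h' = graded_hom_QA[OF f']
  have word: "f (proj (s1 s)) = f' (proj (s1 s))" if "s \<in> lists W" for s
    using that
  proof (induction s)
    case Nil
    show ?case unfolding proj_Nil by (simp only: h(1) h'(1))
  next
    case (Cons w s)
    have c: "proj (s1 [w]) \<in> carrier QA" "proj (s1 s) \<in> carrier QA"
      using Cons.hyps by (auto intro!: proj_closed)
    have "proj (s1 (w # s)) = proj (s1 [w]) \<otimes>\<^bsub>QA\<^esub> proj (s1 s)"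
      using proj_append[of "[w]" s] Cons.hyps by simp
    moreover have "f (proj (s1 [w])) = f' (proj (s1 [w]))" using eq[OF Cons.hyps(1)] unfolding gen_proj .
    ultimately show ?case by (simp only: h(3)[OF c] h'(3)[OF c] Cons.IH)
  qed
  obtain p where p: "isF p" "a = proj p" using proj_surj[OF a] by blast
  have "f (proj p) = f' (proj p)" using p(1)
  proof (induction p rule: pm_induct)
    case zero
    show ?case unfolding proj_zero by (simp only: h(5) h'(5))
  next
    case (add p s c)
    have sl: "s \<in> lists W" and F: "isF p" using add.hyps by blast+
    have F': "isF (Poly_Mapping.single s c)" by (rule isF_single[OF sl])
    have c: "proj (s1 s) \<in> carrier QA" by (rule proj_closed[OF isF_single[OF sl]])
    note c' = QA.ksm_closed[OF c, of c] and cp = proj_closed[OF F]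
    show ?case
      unfolding proj_add[OF F' F] proj_single[OF sl, of c]
      by (simp only: h(2)[OF c' cp] h'(2)[OF c' cp] h(2)[OF cp c'] h'(2)[OF cp c'] h(4)[OF c] h'(4)[OF c] word[OF sl] add.IH)
  qed
  then show ?thesis using p(2) by simp
qed

end

context quad_setting
begin

abbreviation E where "E \<equiv> Vd.QA"
abbreviation ke :: "(('v \<Rightarrow> 'k) list \<Rightarrow>\<^sub>0 'k) \<Rightarrow> 'v list \<Rightarrow> 'k" where "ke \<equiv> kap (\<lambda>\<alpha>. \<alpha>)"
abbreviation dm where "dm \<phi> \<equiv> Mp (\<lambda>\<alpha>. \<alpha> \<circ> rs \<phi>)"

lemma comp_rs_Vs: "ghom \<phi> \<Longrightarrow> \<alpha> \<in> Vs \<Longrightarrow> \<alpha> \<circ> rs \<phi> \<in> Vs"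
  by (simp add: Vs_iff rs_add rs_scale)

lemma dm_isF: "ghom \<phi> \<Longrightarrow> Vd.isF p \<Longrightarrow> Vd.isF (dm \<phi> p)"
  by (rule order.trans[OF keys_Mp]) (auto simp: image_subset_iff subset_iff in_lists_conv_set comp_rs_Vs)

lemma ke_dm:
  assumes "Vd.isF p"
  shows "ke (dm \<phi> p) y = (\<Sum>w\<in>words Basis (length y). ke p w * wm (Tm \<phi>) y w)"
proof -
  have "ke (dm \<phi> p) y = (\<Sum>s\<in>Poly_Mapping.keys p. Poly_Mapping.lookup p s * wm (\<lambda>\<alpha>. \<alpha> \<circ> rs \<phi>) s y)"
    unfolding kap_Mp unfolding kap_def ..
  also have "\<dots> = (\<Sum>s\<in>Poly_Mapping.keys p. Poly_Mapping.lookup p s *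
      (\<Sum>w\<in>words Basis (length y). wm (\<lambda>\<alpha>. \<alpha>) s w * wm (Tm \<phi>) y w))"
  proof (intro sum.cong refl arg_cong2[where f = "(*)"] wm_expand finite_Basis)
    fix s \<alpha> b assume "s \<in> Poly_Mapping.keys p" "\<alpha> \<in> set s"
    then have "\<alpha> \<in> Vs" using assms by (auto simp: subset_iff in_lists_conv_set)
    then show "(\<alpha> \<circ> rs \<phi>) b = (\<Sum>c\<in>Basis. \<alpha> c * crd (rs \<phi> b) c)"
      unfolding comp_apply by (rule Vs_expand)
  qed
  also have "\<dots> = (\<Sum>w\<in>words Basis (length y). ke p w * wm (Tm \<phi>) y w)"
    unfolding kap_def sum_distrib_left sum_distrib_right by (subst sum.swap) (simp only: mult.assoc)
  finally show ?thesis .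
qed

text \<open>By transposition the difference of the images pairs with \<open>w\<close> as the
  original difference pairs with \<open>Tw\<close> of \<open>w\<close>, and \<open>Tw\<close>
  preserves \<open>W\<close>.\<close>

lemma dm_proj_eq:
  assumes g: "ghom \<phi>" and F: "Vd.isF p" "Vd.isF q" and eq: "Vd.proj p = Vd.proj q"
  shows "Vd.proj (dm \<phi> p) = Vd.proj (dm \<phi> q)"
proof -
  have v: "Vd.vanish (\<lambda>y. ke p y - ke q y)" using Vd.proj_eq_iff[OF F] eq by simp
  have "dp (words Basis n) (\<lambda>y. ke (dm \<phi> p) y - ke (dm \<phi> q) y) w = 0" if w: "w \<in> Vd.Wn n" for n w
  proof -
    have tw: "Tw Basis (Tm \<phi>) n w \<in> Vd.Wn n" by (rule Tw_Wsp[OF finite_Basis Tm_preserves[OF g] w])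
    have "dp (words Basis n) (\<lambda>y. ke (dm \<phi> p) y - ke (dm \<phi> q) y) w =
      (\<Sum>y\<in>words Basis n. \<Sum>w'\<in>words Basis n. (ke p w' - ke q w') * (wm (Tm \<phi>) y w' * w y))"
      unfolding dp_def
      by (intro sum.cong refl) (simp add: ke_dm F words_length sum_subtractf sum_distrib_right sum_distrib_left algebra_simps)
    also have "\<dots> = (\<Sum>w'\<in>words Basis n. \<Sum>y\<in>words Basis n. (ke p w' - ke q w') * (wm (Tm \<phi>) y w' * w y))"
      by (rule sum.swap)
    also have "\<dots> = dp (words Basis n) (\<lambda>y. ke p y - ke q y) (Tw Basis (Tm \<phi>) n w)"
      unfolding dp_def Tw_def by (intro sum.cong refl) (simp add: sum_distrib_left)
    also have "\<dots> = 0" using v tw unfolding Vd.vanish_def by blast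
    finally show ?thesis .
  qed
  then show ?thesis
    unfolding Vd.proj_eq_iff[OF dm_isF[OF g F(1)] dm_isF[OF g F(2)]] Vd.vanish_def by blast
qed

text \<open>Restricted to the carrier because \<open>dual_aut\<close> singles out an extensional
  function.\<close>

definition Psi where
  "Psi \<phi> = (\<lambda>a\<in>carrier E. Vd.proj (dm \<phi> (SOME p. Vd.isF p \<and> a = Vd.proj p)))"

lemma Psi_proj: "ghom \<phi> \<Longrightarrow> Vd.isF p \<Longrightarrow> Psi \<phi> (Vd.proj p) = Vd.proj (dm \<phi> p)"
proof -
  assume g: "ghom \<phi>" and p: "Vd.isF p"
  let ?q = "SOME q. Vd.isF q \<and> Vd.proj p = Vd.proj q"
  have q: "Vd.isF ?q \<and> Vd.proj p = Vd.proj ?q" by (rule someI[of _ p]) (use p in simp)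
  have "Psi \<phi> (Vd.proj p) = Vd.proj (dm \<phi> ?q)"
    unfolding Psi_def restrict_def using Vd.proj_closed[OF p] by simp
  also have "\<dots> = Vd.proj (dm \<phi> p)" by (rule dm_proj_eq[OF g conjunct1[OF q] p conjunct2[OF q, symmetric]])
  finally show ?thesis .
qed

lemma Psi_hom:
  assumes g: "ghom \<phi>"
  shows "Psi \<phi> \<in> graded_hom E E"
  unfolding graded_hom_def
proof (intro CollectI conjI allI ballI ring_hom_memI)
  fix x assume "x \<in> carrier E"
  then obtain p where p: "Vd.isF p" "x = Vd.proj p" using Vd.proj_surj by blast
  have dp: "Vd.isF (dm \<phi> p)" by (rule dm_isF[OF g p(1)])
  show "Psi \<phi> x \<in> carrier E" unfolding p(2) Psi_proj[OF g p(1)] by (rule Vd.proj_closed[OF dp])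
  have sc: "Vd.isF (Poly_Mapping.single [] c * p)" for c by (rule Vd.isF_mult[OF Vd.isF_single p(1)]) simp
  show "Psi \<phi> (c \<odot>\<^bsub>E\<^esub> x) = c \<odot>\<^bsub>E\<^esub> Psi \<phi> x" for c
    unfolding p(2) Vd.proj_smult[OF p(1), symmetric] Psi_proj[OF g p(1)] Psi_proj[OF g sc] Mp_mult Mp_single
    using Vd.proj_smult[OF dp, of c] by simp
  fix y assume "y \<in> carrier E"
  then obtain q where q: "Vd.isF q" "y = Vd.proj q" using Vd.proj_surj by blast
  have dq: "Vd.isF (dm \<phi> q)" by (rule dm_isF[OF g q(1)])
  show "Psi \<phi> (x \<otimes>\<^bsub>E\<^esub> y) = Psi \<phi> x \<otimes>\<^bsub>E\<^esub> Psi \<phi> y"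
    unfolding p(2) q(2) Vd.proj_mult[OF p(1) q(1), symmetric] Psi_proj[OF g Vd.isF_mult[OF p(1) q(1)]]
      Psi_proj[OF g p(1)] Psi_proj[OF g q(1)] Mp_mult by (rule Vd.proj_mult[OF dp dq])
  show "Psi \<phi> (x \<oplus>\<^bsub>E\<^esub> y) = Psi \<phi> x \<oplus>\<^bsub>E\<^esub> Psi \<phi> y"
    unfolding p(2) q(2) Vd.proj_add[OF p(1) q(1), symmetric] Psi_proj[OF g Vd.isF_add[OF p(1) q(1)]]
      Psi_proj[OF g p(1)] Psi_proj[OF g q(1)] Mp_add by (rule Vd.proj_add[OF dp dq])
next
  have "Vd.isF (Vd.s1 [])" by simp
  then show "Psi \<phi> \<one>\<^bsub>E\<^esub> = \<one>\<^bsub>E\<^esub>" unfolding Vd.proj_Nil[symmetric] using Psi_proj[OF g, of "Vd.s1 []"] by simp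
  show "Psi \<phi> ` deg E i \<subseteq> deg E i" for i
  proof (rule image_subsetI)
    fix x assume "x \<in> deg E i"
    then obtain p where p: "x = Vd.proj p" "Poly_Mapping.keys p \<subseteq> {s \<in> lists Vs. int (length s) = i}"
      unfolding Vd.deg_QA by blast
    have F: "Vd.isF p" using p(2) by blast
    have "Poly_Mapping.keys (dm \<phi> p) \<subseteq> {s \<in> lists Vs. int (length s) = i}"
      using keys_Mp[of "\<lambda>\<alpha>. \<alpha> \<circ> rs \<phi>" p] dm_isF[OF g F] p(2) by fastforce
    then show "Psi \<phi> x \<in> deg E i" unfolding p(1) Psi_proj[OF g F] by (rule Vd.proj_deg)
  qed
qed

text \<open>Dualising reverses the order of composition, so a left inverse of \<open>\<phi>\<close>
  becomes a right inverse of \<open>Psi \<phi>\<close>.\<close>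

lemma Psi_Psi:
  assumes g: "ghom \<phi>" "ghom \<phi>'" and inv: "\<And>a. a \<in> carrier V.QA \<Longrightarrow> \<phi>' (\<phi> a) = a" and a: "a \<in> carrier E"
  shows "Psi \<phi> (Psi \<phi>' a) = a"
proof -
  obtain p where p: "Vd.isF p" "a = Vd.proj p" using Vd.proj_surj[OF a] by blast
  have "gn (rs \<phi>' (rs \<phi> v)) = gn v" for v using inv[of "gn v"] by (simp add: rs g)
  then have r: "rs \<phi>' (rs \<phi> v) = v" for v by (rule gn_inj)
  have "Psi \<phi> (Psi \<phi>' a) = Vd.proj (dm \<phi> (dm \<phi>' p))"
    unfolding p(2) Psi_proj[OF g(2) p(1)] by (rule Psi_proj[OF g(1) dm_isF[OF g(2) p(1)]])
  also have "dm \<phi> (dm \<phi>' p) = p" unfolding Mp_Mp by (rule Mp_id) (simp add: fun_eq_iff r)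
  finally show ?thesis using p(2) by simp
qed

text \<open>\<open>Psi \<tau>\<close> is bijective with inverse \<open>Psi \<sigma>\<close> and has
  the prescribed values on generators; these values and extensionality leave no other
  candidate.\<close>

lemma dual_aut_Psi:
  assumes \<sigma>: "\<sigma> \<in> graded_aut V.QA" and \<tau>: "\<tau> = inv_into (carrier V.QA) \<sigma>"
  shows "ghom \<tau>" "dual_aut scale R \<tau> = Psi \<tau>"
proof -
  have bij: "bij_betw \<sigma> (carrier V.QA) (carrier V.QA)" using \<sigma> by (simp add: graded_iso_def)
  have inv: "\<sigma> (\<tau> a) = a" "\<tau> (\<sigma> a) = a" if "a \<in> carrier V.QA" for a
    unfolding \<tau> using bij that
    by (simp_all add: bij_betw_inv_into_right bij_betw_inv_into_left)
  have gs: "ghom \<sigma>" using \<sigma> by (simp add: ghom_def graded_iso_def)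
  show g: "ghom \<tau>" using VK.inv_graded_aut[OF \<sigma>] by (simp add: ghom_def graded_iso_def \<tau>)
  have hom: "Psi \<tau> \<in> graded_hom E E" by (rule Psi_hom[OF g])
  have cl: "Psi \<phi> a \<in> carrier E" if "ghom \<phi>" "a \<in> carrier E" for \<phi> a
    using Psi_hom[OF that(1)] that(2) by (auto simp: graded_hom_def ring_hom_def)
  have "bij_betw (Psi \<tau>) (carrier E) (carrier E)"
    by (rule bij_betwI[where g = "Psi \<sigma>"])
      (use cl g gs Psi_Psi[OF g gs inv(1)] Psi_Psi[OF gs g inv(2)] in auto)
  then have aut: "Psi \<tau> \<in> graded_aut E" using hom by (simp add: graded_iso_def)
  let ?g = "gen dual_scale Vs (orth scale R)"
  have gens: "Psi \<tau> (?g \<alpha>) = ?g (\<alpha> \<circ> rs \<tau>)" if "\<alpha> \<in> Vs" for \<alpha>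
    unfolding Vd.gen_proj using Psi_proj[OF g, of "Vd.s1 [\<alpha>]"] that by simp
  show "dual_aut scale R \<tau> = Psi \<tau>"
    unfolding dual_aut_def dual_eq
  proof (rule the_equality)
    show "Psi \<tau> \<in> graded_aut E \<and> Psi \<tau> \<in> extensional (carrier E) \<and> (\<forall>\<alpha>\<in>Vs. Psi \<tau> (?g \<alpha>) = ?g (\<alpha> \<circ> rs \<tau>))"
      using aut gens by (simp add: Psi_def)
    fix f assume f: "f \<in> graded_aut E \<and> f \<in> extensional (carrier E) \<and> (\<forall>\<alpha>\<in>Vs. f (?g \<alpha>) = ?g (\<alpha> \<circ> rs \<tau>))"
    show "f = Psi \<tau>"
    proof (rule extensionalityI[where A = "carrier E"])
      show "f \<in> extensional (carrier E)" using f by blast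
      show "Psi \<tau> \<in> extensional (carrier E)" by (simp add: Psi_def)
      show "f a = Psi \<tau> a" if "a \<in> carrier E" for a
        by (rule Vd.graded_hom_QA_eqI[OF _ hom _ that]) (use f gens in \<open>simp_all add: graded_iso_def\<close>)
    qed
  qed
qed

end

section \<open>The isomorphism\<close>

lemma kap_outside: "length y \<notin> length ` Poly_Mapping.keys p \<Longrightarrow> kap cf p y = 0"
  unfolding kap_def by (rule sum.neutral) (metis image_eqI mult_zero_right wm_length)

lemma kap_scalar: "kap cf (Poly_Mapping.single [] c * p) y = c * kap cf p y"
proof -
  have "kap cf (Poly_Mapping.single [] c * p) y = (\<Sum>i\<le>length y. if i = 0 then c * kap cf p y else 0)"
    unfolding kap_mult conv_def by (intro sum.cong refl) (auto simp: take_eq_Nil)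
  then show ?thesis by simp
qed

lemma sgnp_scalar: "sgnp (Poly_Mapping.single [] c) = Poly_Mapping.single [] c"
  by (rule poly_mapping_eqI) (auto simp: lookup_sgnp lookup_single when_def)

context coord
begin

lemma proj_eq_iff_dp:
  assumes "isF p" "isF q"
  shows "proj p = proj q \<longleftrightarrow> (\<forall>n. \<forall>w\<in>Wn n. dp (words X n) (kap cf p) w = dp (words X n) (kap cf q) w)"
  unfolding proj_eq_iff[OF assms] vanish_def dp_def by (simp add: left_diff_distrib sum_subtractf)

text \<open>Only the part of \<open>p\<close> in degree \<open>i\<close> is seen by
  \<open>W\<close>, so truncating \<open>p\<close> to that degree does not change its class.\<close>

lemma proj_deg_if:
  assumes p: "isF p" and z: "\<And>n w. int n \<noteq> i \<Longrightarrow> w \<in> Wn n \<Longrightarrow> dp (words X n) (kap cf p) w = 0"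
  shows "proj p \<in> deg QA i"
proof -
  let ?q = "if i < 0 then 0 else restr p (nat i)"
  have k: "Poly_Mapping.keys ?q \<subseteq> {s \<in> lists W. int (length s) = i}"
    using p by (auto simp: keys_restr)
  then have q: "isF ?q" by blast
  have "dp (words X n) (kap cf p) w = dp (words X n) (kap cf ?q) w" if w: "w \<in> Wn n" for n w
  proof (cases "int n = i")
    case True
    then show ?thesis unfolding dp_def by (intro sum.cong refl) (auto simp: kap_restr words_length)
  next
    case False
    have "dp (words X n) (kap cf ?q) w = 0"
      unfolding dp_def using False by (intro sum.neutral) (auto simp: kap_restr words_length)
    then show ?thesis using z[OF False w] by simp
  qed
  then have "proj p = proj ?q" unfolding proj_eq_iff_dp[OF p q] by blast
  then show ?thesis using proj_deg[OF k] by simp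
qed

end

section \<open>The map from the trivial extension to the Yoneda algebra\<close>

locale yoneda_setting = quad_setting scale Basis R
  for scale :: "'k::field \<Rightarrow> 'v::ab_group_add \<Rightarrow> 'v" and Basis and R +
  fixes \<sigma> \<tau> and P :: "nat \<Rightarrow> (nat \<Rightarrow> ('v list \<Rightarrow>\<^sub>0 'k) set set, 'q) module" and d and e
  assumes \<tau>: "ghom \<tau>"
    and SK: "skew_koszul V.QA \<sigma> Basis (\<lambda>b. V.xw [b]) Rp (Tm \<tau>)"
    and res: "proj_resolution (skew_poly V.QA \<sigma>) (trivial_module (skew_poly V.QA \<sigma>)) P d e"
begin

sublocale S: skew_koszul V.QA \<sigma> Basis "\<lambda>b. V.xw [b]" Rp "Tm \<tau>" by (rule SK)
sublocale C: ext_compare S.B P d e S.Qm S.dQ S.eQ by (rule S.ext_compare_Q[OF res])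

abbreviation Xt where "Xt n \<equiv> Ext S.B P d n"
abbreviation Y where "Y \<equiv> yoneda_algebra S.B P d e"
abbreviation \<Gamma> where "\<Gamma> \<equiv> trivial_extension E (shift (twist (sign_aut E) (regular_bimodule E) (Psi \<tau>)) (-1))"

text \<open>The class on the given resolution of a pair of functionals, the second of which lives
  one degree lower.\<close>

definition TH where "TH n \<alpha> \<beta> = C.Theta n (S.fn n \<alpha> \<beta>)"

lemma TH_in: "TH n \<alpha> \<beta> \<in> carrier (Xt n)"
  unfolding TH_def by (rule C.Theta_in[OF S.fn_hom])

lemma TH_eq_iff: "TH n \<alpha> \<beta> = TH n \<alpha>' \<beta>' \<longleftrightarrow>
    (\<forall>w\<in>Vd.Wn n. dp (words Basis n) \<alpha> w = dp (words Basis n) \<alpha>' w) \<and>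
    (\<forall>w\<in>S.W' n. dp (S.words' n) \<beta> w = dp (S.words' n) \<beta>' w)"
proof
  assume "TH n \<alpha> \<beta> = TH n \<alpha>' \<beta>'"
  then have "S.fn n \<alpha> \<beta> f = S.fn n \<alpha>' \<beta>' f" if "f \<in> carrier (S.Qm n)" for f
    unfolding TH_def by (rule C.Theta_inj[OF S.fn_hom S.fn_hom _ that])
  from S.fn_eqD[OF this] show "(\<forall>w\<in>Vd.Wn n. dp (words Basis n) \<alpha> w = dp (words Basis n) \<alpha>' w) \<and>
    (\<forall>w\<in>S.W' n. dp (S.words' n) \<beta> w = dp (S.words' n) \<beta>' w)" by blast
next
  assume "(\<forall>w\<in>Vd.Wn n. dp (words Basis n) \<alpha> w = dp (words Basis n) \<alpha>' w) \<and>
    (\<forall>w\<in>S.W' n. dp (S.words' n) \<beta> w = dp (S.words' n) \<beta>' w)"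
  then show "TH n \<alpha> \<beta> = TH n \<alpha>' \<beta>'"
    unfolding TH_def by (intro C.Theta_cong[OF S.fn_hom S.fn_hom] S.fn_cong) blast+
qed

lemma TH_eqI: "(\<And>y. y \<in> words Basis n \<Longrightarrow> \<alpha> y = \<alpha>' y) \<Longrightarrow> (\<And>y. y \<in> S.words' n \<Longrightarrow> \<beta> y = \<beta>' y) \<Longrightarrow>
    TH n \<alpha> \<beta> = TH n \<alpha>' \<beta>'"
  unfolding TH_eq_iff dp_def by simp

lemma TH_zero: "TH n (\<lambda>_. 0) (\<lambda>_. 0) = \<zero>\<^bsub>Xt n\<^esub>"
proof -
  have "S.fn n (\<lambda>_. 0) (\<lambda>_. 0) = (\<lambda>x. 0)" by (simp add: S.fn_def fun_eq_iff)
  then show ?thesis unfolding TH_def by (simp only: C.Theta_zero)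
qed

lemma TH_zeroI: "(\<And>y. y \<in> words Basis n \<Longrightarrow> \<alpha> y = 0) \<Longrightarrow> (\<And>y. y \<in> S.words' n \<Longrightarrow> \<beta> y = 0) \<Longrightarrow>
    TH n \<alpha> \<beta> = \<zero>\<^bsub>Xt n\<^esub>"
  unfolding TH_zero[symmetric] by (rule TH_eqI)

lemma TH_add: "TH n \<alpha> \<beta> \<oplus>\<^bsub>Xt n\<^esub> TH n \<alpha>' \<beta>' = TH n (\<lambda>y. \<alpha> y + \<alpha>' y) (\<lambda>y. \<beta> y + \<beta>' y)"
proof -
  have "(\<lambda>x. S.fn n \<alpha> \<beta> x + S.fn n \<alpha>' \<beta>' x) = S.fn n (\<lambda>y. \<alpha> y + \<alpha>' y) (\<lambda>y. \<beta> y + \<beta>' y)"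
    by (simp add: S.fn_def distrib_right sum.distrib fun_eq_iff)
  then show ?thesis unfolding TH_def C.Theta_add[OF S.fn_hom S.fn_hom] by (simp only:)
qed

lemma TH_smult: "c \<odot>\<^bsub>Xt n\<^esub> TH n \<alpha> \<beta> = TH n (\<lambda>y. c * \<alpha> y) (\<lambda>y. c * \<beta> y)"
proof -
  have "(\<lambda>x. c * S.fn n \<alpha> \<beta> x) = S.fn n (\<lambda>y. c * \<alpha> y) (\<lambda>y. c * \<beta> y)"
    by (simp add: S.fn_def distrib_left sum_distrib_left fun_eq_iff mult.assoc)
  then show ?thesis unfolding TH_def C.Theta_smult[OF S.fn_hom] by (simp only:)
qed

lemma TH_sum:
  assumes "finite I"
  shows "(\<Oplus>\<^bsub>Xt n\<^esub>i\<in>I. TH n (\<alpha> i) (\<beta> i)) = TH n (\<lambda>y. \<Sum>i\<in>I. \<alpha> i y) (\<lambda>y. \<Sum>i\<in>I. \<beta> i y)"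
  using assms
proof (induction I rule: finite_induct)
  interpret X: abelian_group "Xt n" by (rule C.Ext_abelian_group)
  case empty
  show ?case unfolding X.finsum_empty by (simp add: TH_zero)
next
  interpret X: abelian_group "Xt n" by (rule C.Ext_abelian_group)
  case (insert i I)
  have "(\<Oplus>\<^bsub>Xt n\<^esub>i\<in>insert i I. TH n (\<alpha> i) (\<beta> i)) = TH n (\<alpha> i) (\<beta> i) \<oplus>\<^bsub>Xt n\<^esub> (\<Oplus>\<^bsub>Xt n\<^esub>i\<in>I. TH n (\<alpha> i) (\<beta> i))"
    by (rule X.finsum_insert) (use insert.hyps TH_in in auto)
  then show ?case unfolding insert.IH TH_add sum.insert[OF insert.hyps] .
qed

lemma TH_prod: "yoneda_prod S.B P d e k n (TH k \<alpha>' \<beta>') (TH n \<alpha> \<beta>) =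
    TH (n + k) (\<lambda>y. \<alpha>' (take k y) * \<alpha> (drop k y))
      (\<lambda>y. (if n = 0 then 0 else (-1) ^ k * \<alpha>' (take k y) * \<beta> (drop k y)) +
         (if k = 0 then 0 else \<beta>' (take (k - 1) y) * S.tr n \<alpha> (drop (k - 1) y)))"
  unfolding TH_def C.Theta_prod[OF S.fn_hom S.fn_hom S.\<gamma>_clifts]
  by (rule C.Theta_cong[OF module_hom_comp[OF S.\<gamma>_hom S.fn_hom] S.fn_hom]) (rule S.fn_\<gamma>)

lemma TH_surj: "x \<in> carrier (Xt n) \<Longrightarrow> \<exists>\<alpha> \<beta>. x = TH n \<alpha> \<beta>"
proof -
  assume "x \<in> carrier (Xt n)"
  then obtain a where a: "a \<in> module_hom S.B (S.Qm n) (trivial_module S.B)" "x = C.Theta n a"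
    using C.Theta_surj by blast
  obtain \<alpha> \<beta> where "\<forall>f\<in>carrier (S.Qm n). a f = S.fn n \<alpha> \<beta> f" using S.fn_repr[OF a(1)] by blast
  then have "x = TH n \<alpha> \<beta>" unfolding TH_def a(2) by (intro C.Theta_cong[OF a(1) S.fn_hom]) blast
  then show ?thesis by blast
qed

lemma Y_simps:
  "carrier Y = {x. (\<forall>n. x n \<in> carrier (Xt n)) \<and> finite {n. x n \<noteq> \<zero>\<^bsub>Xt n\<^esub>}}"
  "x \<otimes>\<^bsub>Y\<^esub> y = (\<lambda>n. \<Oplus>\<^bsub>Xt n\<^esub>i\<in>{..n}. yoneda_prod S.B P d e i (n - i) (x i) (y (n - i)))"
  "\<one>\<^bsub>Y\<^esub> = (\<lambda>n. if n = 0 then ext_class S.B P d 0 e else \<zero>\<^bsub>Xt n\<^esub>)"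
  "x \<oplus>\<^bsub>Y\<^esub> y = (\<lambda>n. x n \<oplus>\<^bsub>Xt n\<^esub> y n)" "c \<odot>\<^bsub>Y\<^esub> x = (\<lambda>n. c \<odot>\<^bsub>Xt n\<^esub> x n)"
  "deg Y j = {x \<in> carrier Y. \<forall>n. int n \<noteq> j \<longrightarrow> x n = \<zero>\<^bsub>Xt n\<^esub>}"
  by (simp_all add: yoneda_algebra_def Let_def)

lemma \<Gamma>_simps:
  "carrier \<Gamma> = carrier E \<times> carrier E" "\<one>\<^bsub>\<Gamma>\<^esub> = (\<one>\<^bsub>E\<^esub>, \<zero>\<^bsub>E\<^esub>)"
  "(x1, m1) \<otimes>\<^bsub>\<Gamma>\<^esub> (x2, m2) = (x1 \<otimes>\<^bsub>E\<^esub> x2, (sign_aut E x1 \<otimes>\<^bsub>E\<^esub> m2) \<oplus>\<^bsub>E\<^esub> (m1 \<otimes>\<^bsub>E\<^esub> Psi \<tau> x2))"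
  "(x1, m1) \<oplus>\<^bsub>\<Gamma>\<^esub> (x2, m2) = (x1 \<oplus>\<^bsub>E\<^esub> x2, m1 \<oplus>\<^bsub>E\<^esub> m2)"
  "c \<odot>\<^bsub>\<Gamma>\<^esub> (x1, m1) = (c \<odot>\<^bsub>E\<^esub> x1, sign_aut E (c \<odot>\<^bsub>E\<^esub> \<one>\<^bsub>E\<^esub>) \<otimes>\<^bsub>E\<^esub> m1)"
  "deg \<Gamma> j = deg E j \<times> deg E (- 1 + j)"
  by (simp_all add: trivial_extension_def shift_def twist_def regular_bimodule_def)

text \<open>The choice of representatives is harmless: only their values on \<open>W n\<close> matter.\<close>

definition H where
  "H = (\<lambda>(a, m) n. TH n (ke (SOME p. Vd.isF p \<and> a = Vd.proj p)) (ke (SOME p. Vd.isF p \<and> m = Vd.proj p)))"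

text \<open>In degree \<open>n\<close> the second functional sees words of length
  \<open>n - 1\<close>; since all \<open>n\<close> are considered together, the shift disappears and
  \<open>proj_eq_iff_dp\<close> applies to both components.\<close>

lemma TH_ke_eq_iff:
  assumes "Vd.isF p" "Vd.isF q" "Vd.isF p'" "Vd.isF q'"
  shows "(\<forall>n. TH n (ke p) (ke q) = TH n (ke p') (ke q')) \<longleftrightarrow> Vd.proj p = Vd.proj p' \<and> Vd.proj q = Vd.proj q'"
proof -
  have "(\<forall>n. \<forall>w\<in>S.W' n. dp (S.words' n) (ke q) w = dp (S.words' n) (ke q') w) \<longleftrightarrow>
    (\<forall>n. \<forall>w\<in>Vd.Wn n. dp (words Basis n) (ke q) w = dp (words Basis n) (ke q') w)"
  proof (intro iffI allI)
    fix n assume "\<forall>n. \<forall>w\<in>S.W' n. dp (S.words' n) (ke q) w = dp (S.words' n) (ke q') w"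
    from spec[OF this, of "Suc n"]
    show "\<forall>w\<in>Vd.Wn n. dp (words Basis n) (ke q) w = dp (words Basis n) (ke q') w" by simp
  next
    fix n assume "\<forall>n. \<forall>w\<in>Vd.Wn n. dp (words Basis n) (ke q) w = dp (words Basis n) (ke q') w"
    then show "\<forall>w\<in>S.W' n. dp (S.words' n) (ke q) w = dp (S.words' n) (ke q') w" by (cases n) (simp_all add: dp_def)
  qed
  then show ?thesis
    unfolding TH_eq_iff Vd.proj_eq_iff_dp[OF assms(1,3)] Vd.proj_eq_iff_dp[OF assms(2,4)] all_conj_distrib by blast
qed

lemma H_proj:
  assumes p: "Vd.isF p" and q: "Vd.isF q"
  shows "H (Vd.proj p, Vd.proj q) = (\<lambda>n. TH n (ke p) (ke q))"
proof -
  let ?r = "\<lambda>p. SOME p'. Vd.isF p' \<and> Vd.proj p = Vd.proj p'"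
  have r: "Vd.isF (?r p) \<and> Vd.proj p = Vd.proj (?r p)" if "Vd.isF p" for p
    by (rule someI[of _ p]) (use that in simp)
  have "\<forall>n. TH n (ke (?r p)) (ke (?r q)) = TH n (ke p) (ke q)"
    unfolding TH_ke_eq_iff[OF conjunct1[OF r[OF p]] conjunct1[OF r[OF q]] p q]
    using r[OF p] r[OF q] by simp
  then show ?thesis by (simp add: H_def fun_eq_iff)
qed

lemma \<Gamma>E:
  assumes "u \<in> carrier \<Gamma>"
  obtains p q where "Vd.isF p" "Vd.isF q" "u = (Vd.proj p, Vd.proj q)"
proof -
  have c: "fst u \<in> carrier E" "snd u \<in> carrier E" using assms unfolding \<Gamma>_simps(1) by (simp_all add: mem_Times_iff)
  obtain p where p: "Vd.isF p" "fst u = Vd.proj p" using Vd.proj_surj[OF c(1)] by (elim exE conjE)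
  obtain q where q: "Vd.isF q" "snd u = Vd.proj q" using Vd.proj_surj[OF c(2)] by (elim exE conjE)
  show ?thesis by (rule that[OF p(1) q(1)]) (simp only: p(2)[symmetric] q(2)[symmetric] prod.collapse)
qed

lemma \<Gamma>I: "Vd.isF p \<Longrightarrow> Vd.isF q \<Longrightarrow> (Vd.proj p, Vd.proj q) \<in> carrier \<Gamma>"
  unfolding \<Gamma>_simps(1) by (intro SigmaI Vd.proj_closed)

lemma H_closed: "u \<in> carrier \<Gamma> \<Longrightarrow> H u \<in> carrier Y"
proof -
  assume "u \<in> carrier \<Gamma>"
  then obtain p q where u: "Vd.isF p" "Vd.isF q" "u = (Vd.proj p, Vd.proj q)" by (rule \<Gamma>E)
  let ?F = "length ` Poly_Mapping.keys p \<union> Suc ` length ` Poly_Mapping.keys q"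
  have "TH n (ke p) (ke q) = \<zero>\<^bsub>Xt n\<^esub>" if n: "n \<notin> ?F" for n
  proof (rule TH_zeroI)
    show "ke p y = 0" if "y \<in> words Basis n" for y
      using n words_length[OF that] by (intro kap_outside) auto
    show "ke q y = 0" if "y \<in> S.words' n" for y
      using n that by (intro kap_outside) (cases n, auto dest: words_length)
  qed
  then have sub: "{n. TH n (ke p) (ke q) \<noteq> \<zero>\<^bsub>Xt n\<^esub>} \<subseteq> ?F" by blast
  have "finite {n. TH n (ke p) (ke q) \<noteq> \<zero>\<^bsub>Xt n\<^esub>}" by (rule finite_subset[OF sub]) simp
  then show ?thesis
    unfolding u(3) H_proj[OF u(1,2)] Y_simps(1) by (intro CollectI conjI allI TH_in)
qed

lemma H_inj: "u \<in> carrier \<Gamma> \<Longrightarrow> v \<in> carrier \<Gamma> \<Longrightarrow> H u = H v \<Longrightarrow> u = v"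
proof -
  assume uv: "u \<in> carrier \<Gamma>" "v \<in> carrier \<Gamma>" and eq: "H u = H v"
  obtain p q where u: "Vd.isF p" "Vd.isF q" "u = (Vd.proj p, Vd.proj q)" using uv(1) by (rule \<Gamma>E)
  obtain p' q' where v: "Vd.isF p'" "Vd.isF q'" "v = (Vd.proj p', Vd.proj q')" using uv(2) by (rule \<Gamma>E)
  have "\<forall>n. TH n (ke p) (ke q) = TH n (ke p') (ke q')"
    using eq unfolding u(3) v(3) H_proj[OF u(1,2)] H_proj[OF v(1,2)] fun_eq_iff .
  then show ?thesis unfolding TH_ke_eq_iff[OF u(1,2) v(1,2)] u(3) v(3) by simp
qed

text \<open>Homogeneous representatives for the finitely many degrees are added up; words of
  different lengths do not interfere.\<close>

lemma ke_repr:
  assumes F: "finite F" and z: "\<And>n. n \<notin> F \<Longrightarrow> \<alpha> n = (\<lambda>_. 0)"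
  shows "\<exists>p. Vd.isF p \<and> (\<forall>n. \<forall>y\<in>words Basis n. ke p y = \<alpha> n y)"
proof -
  have "\<forall>n. \<exists>p. Poly_Mapping.keys p \<subseteq> {s \<in> lists Vs. length s = n} \<and> (\<forall>y\<in>words Basis n. ke p y = \<alpha> n y)"
    by (intro allI Vd.array_repr)
  then obtain p where *: "\<forall>n. Poly_Mapping.keys (p n) \<subseteq> {s \<in> lists Vs. length s = n} \<and> (\<forall>y\<in>words Basis n. ke (p n) y = \<alpha> n y)"
    unfolding choice_iff by (elim exE)
  have p: "Poly_Mapping.keys (p n) \<subseteq> {s \<in> lists Vs. length s = n}"
    "y \<in> words Basis n \<Longrightarrow> ke (p n) y = \<alpha> n y" for n y using spec[OF *, of n] by simp_all
  have iF: "Vd.isF (p i)" for i using p(1)[of i] by blast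
  have "ke (\<Sum>i\<in>F. p i) y = \<alpha> n y" if y: "y \<in> words Basis n" for n y
  proof -
    have "ke (p i) y = (if i = n then \<alpha> n y else 0)" for i
      using p(2)[OF y] p(1)[of i] words_length[OF y] by (auto intro!: kap_outside)
    then show ?thesis unfolding kap_sum using F z[of n] by simp
  qed
  moreover have "Vd.isF (\<Sum>i\<in>F. p i)" using Vd.proj_sum[of F p] iF by blast
  ultimately show ?thesis by blast
qed

lemma H_surj: "x \<in> carrier Y \<Longrightarrow> \<exists>u\<in>carrier \<Gamma>. H u = x"
proof -
  assume x: "x \<in> carrier Y"
  let ?F = "{n. x n \<noteq> \<zero>\<^bsub>Xt n\<^esub>}"
  have xc: "x n \<in> carrier (Xt n)" for n using x unfolding Y_simps(1) by blast
  have F: "finite ?F" using x unfolding Y_simps(1) by blast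
  have "\<forall>n. \<exists>\<alpha> \<beta>. x n = TH n \<alpha> \<beta> \<and> (n \<notin> ?F \<longrightarrow> \<alpha> = (\<lambda>_. 0) \<and> \<beta> = (\<lambda>_. 0))"
  proof
    fix n show "\<exists>\<alpha> \<beta>. x n = TH n \<alpha> \<beta> \<and> (n \<notin> ?F \<longrightarrow> \<alpha> = (\<lambda>_. 0) \<and> \<beta> = (\<lambda>_. 0))"
    proof (cases "n \<in> ?F")
      case True then show ?thesis using TH_surj[OF xc] by blast
    next
      case False
      then have "x n = TH n (\<lambda>_. 0) (\<lambda>_. 0)" by (simp add: TH_zero)
      then show ?thesis by blast
    qed
  qed
  then obtain \<alpha> \<beta> where *: "\<forall>n. x n = TH n (\<alpha> n) (\<beta> n) \<and> (n \<notin> ?F \<longrightarrow> \<alpha> n = (\<lambda>_. 0) \<and> \<beta> n = (\<lambda>_. 0))"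
    unfolding choice_iff by (elim exE)
  have ab: "x n = TH n (\<alpha> n) (\<beta> n)" "n \<notin> ?F \<Longrightarrow> \<alpha> n = (\<lambda>_. 0)" "n \<notin> ?F \<Longrightarrow> \<beta> n = (\<lambda>_. 0)" for n
    using spec[OF *, of n] by blast+
  obtain p where p: "Vd.isF p" "\<And>n y. y \<in> words Basis n \<Longrightarrow> ke p y = \<alpha> n y"
    using ke_repr[of ?F \<alpha>, OF F ab(2)] by blast
  \<comment> \<open>The second component in degree \<open>Suc n\<close> has to come from an element
    of degree \<open>n\<close> in \<open>E\<close>, so the support is shifted down by one.\<close>
  have "finite (Suc -` ?F)" by (rule finite_vimageI[OF F]) simp
  then obtain q where q: "Vd.isF q" "\<And>n y. y \<in> words Basis n \<Longrightarrow> ke q y = \<beta> (Suc n) y"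
    using ke_repr[of "Suc -` ?F" "\<lambda>n. \<beta> (Suc n)"] ab(3) by blast
  have "TH n (ke p) (ke q) = x n" for n
    unfolding ab(1) by (rule TH_eqI) (use p(2) q(2) in \<open>cases n; auto\<close>)+
  then have "H (Vd.proj p, Vd.proj q) = x" unfolding H_proj[OF p(1) q(1)] by (intro ext)
  then show ?thesis using \<Gamma>I[OF p(1) q(1)] by blast
qed

lemma H_add:
  assumes "u \<in> carrier \<Gamma>" "v \<in> carrier \<Gamma>"
  shows "u \<oplus>\<^bsub>\<Gamma>\<^esub> v \<in> carrier \<Gamma> \<and> H (u \<oplus>\<^bsub>\<Gamma>\<^esub> v) = H u \<oplus>\<^bsub>Y\<^esub> H v"
proof -
  obtain p q where u: "Vd.isF p" "Vd.isF q" "u = (Vd.proj p, Vd.proj q)" using assms(1) by (rule \<Gamma>E)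
  obtain p' q' where v: "Vd.isF p'" "Vd.isF q'" "v = (Vd.proj p', Vd.proj q')" using assms(2) by (rule \<Gamma>E)
  have F: "Vd.isF (p + p')" "Vd.isF (q + q')" using u v Vd.isF_add by blast+
  have eq: "u \<oplus>\<^bsub>\<Gamma>\<^esub> v = (Vd.proj (p + p'), Vd.proj (q + q'))"
    unfolding u(3) v(3) \<Gamma>_simps(4) Vd.proj_add[OF u(1) v(1)] Vd.proj_add[OF u(2) v(2)] ..
  have "ke (p + p') = (\<lambda>y. ke p y + ke p' y)" "ke (q + q') = (\<lambda>y. ke q y + ke q' y)"
    by (simp_all add: kap_add fun_eq_iff)
  then have "H (u \<oplus>\<^bsub>\<Gamma>\<^esub> v) = H u \<oplus>\<^bsub>Y\<^esub> H v"
    unfolding eq unfolding u(3) v(3) H_proj[OF F] H_proj[OF u(1,2)] H_proj[OF v(1,2)] Y_simps(4) TH_add by (simp only:)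
  then show ?thesis unfolding eq using \<Gamma>I[OF F] by blast
qed

text \<open>Scalars act on the bimodule through \<open>sign_aut\<close> of
  \<open>c \<odot> \<one>\<close>, which has degree zero and is therefore unchanged.\<close>

lemma H_smult:
  assumes "u \<in> carrier \<Gamma>"
  shows "c \<odot>\<^bsub>\<Gamma>\<^esub> u \<in> carrier \<Gamma> \<and> H (c \<odot>\<^bsub>\<Gamma>\<^esub> u) = c \<odot>\<^bsub>Y\<^esub> H u"
proof -
  obtain p q where u: "Vd.isF p" "Vd.isF q" "u = (Vd.proj p, Vd.proj q)" using assms(1) by (rule \<Gamma>E)
  let ?c = "Poly_Mapping.single [] c :: ('v \<Rightarrow> 'k) list \<Rightarrow>\<^sub>0 'k"
  have c: "Vd.isF ?c" by (rule Vd.isF_single) simp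
  have F: "Vd.isF (?c * p)" "Vd.isF (?c * q)" using Vd.isF_mult[OF c] u by blast+
  have eq: "c \<odot>\<^bsub>\<Gamma>\<^esub> u = (Vd.proj (?c * p), Vd.proj (?c * q))"
    unfolding u(3) \<Gamma>_simps(5) Vd.proj_scalar[symmetric] Vd.sign_aut_proj[OF c] sgnp_scalar
      Vd.proj_smult[OF u(1)] Vd.proj_mult[OF c u(2)] ..
  have "ke (?c * p) = (\<lambda>y. c * ke p y)" "ke (?c * q) = (\<lambda>y. c * ke q y)"
    by (simp_all add: kap_scalar fun_eq_iff)
  then have "H (c \<odot>\<^bsub>\<Gamma>\<^esub> u) = c \<odot>\<^bsub>Y\<^esub> H u"
    unfolding eq unfolding u(3) H_proj[OF F] H_proj[OF u(1,2)] Y_simps(5) TH_smult by (simp only:)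
  then show ?thesis unfolding eq using \<Gamma>I[OF F] by blast
qed

lemma H_one: "\<one>\<^bsub>\<Gamma>\<^esub> \<in> carrier \<Gamma>" "H \<one>\<^bsub>\<Gamma>\<^esub> = \<one>\<^bsub>Y\<^esub>"
proof -
  have F: "Vd.isF (Vd.s1 [])" "Vd.isF 0" by simp_all
  have eq: "\<one>\<^bsub>\<Gamma>\<^esub> = (Vd.proj (Vd.s1 []), Vd.proj 0)" by (simp only: \<Gamma>_simps(2) Vd.proj_Nil Vd.proj_zero)
  show "\<one>\<^bsub>\<Gamma>\<^esub> \<in> carrier \<Gamma>" unfolding eq by (rule \<Gamma>I[OF F])
  have "TH n (ke (Vd.s1 [])) (ke 0) = (if n = 0 then ext_class S.B P d 0 e else \<zero>\<^bsub>Xt n\<^esub>)" for n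
  proof (cases n)
    case 0
    have "S.fn 0 (ke (Vd.s1 [])) (ke 0) = S.eQ" by (simp add: S.fn_def S.eQ_def fun_eq_iff)
    then have "TH 0 (ke (Vd.s1 [])) (ke 0) = ext_class S.B P d 0 e" unfolding TH_def by (simp only: C.Theta_one)
    then show ?thesis using 0 by simp
  next
    case (Suc m)
    have "TH n (ke (Vd.s1 [])) (ke 0) = \<zero>\<^bsub>Xt n\<^esub>"
      using Suc by (intro TH_zeroI) (auto dest: words_length)
    then show ?thesis using Suc by simp
  qed
  then show "H \<one>\<^bsub>\<Gamma>\<^esub> = \<one>\<^bsub>Y\<^esub>" unfolding eq H_proj[OF F] Y_simps(3) by (intro ext)
qed

text \<open>On representatives the bimodule component is
  \<open>sgnp p1 * q2 + q1 * dm \<tau> p2\<close>. Both products are sums over the cuts of a word,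
  to be compared with the sum over \<open>i\<close> in the Yoneda product: the sign
  \<open>(-1)^i\<close> is that of the prefix of length \<open>i\<close>, and \<open>S.tr\<close> is
  the transpose performed by \<open>dm \<tau>\<close>.\<close>

lemma H_mult:
  assumes "u \<in> carrier \<Gamma>" "v \<in> carrier \<Gamma>"
  shows "u \<otimes>\<^bsub>\<Gamma>\<^esub> v \<in> carrier \<Gamma> \<and> H (u \<otimes>\<^bsub>\<Gamma>\<^esub> v) = H u \<otimes>\<^bsub>Y\<^esub> H v"
proof -
  obtain p1 q1 where u: "Vd.isF p1" "Vd.isF q1" "u = (Vd.proj p1, Vd.proj q1)" using assms(1) by (rule \<Gamma>E)
  obtain p2 q2 where v: "Vd.isF p2" "Vd.isF q2" "v = (Vd.proj p2, Vd.proj q2)" using assms(2) by (rule \<Gamma>E)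
  let ?r = "sgnp p1 * q2 + q1 * dm \<tau> p2"
  have F: "Vd.isF (sgnp p1)" "Vd.isF (dm \<tau> p2)" using u(1) dm_isF[OF \<tau> v(1)] by simp_all
  note F1 = Vd.isF_mult[OF F(1) v(2)] and F2 = Vd.isF_mult[OF u(2) F(2)]
  note FF = Vd.isF_mult[OF u(1) v(1)] Vd.isF_add[OF F1 F2]
  have eq: "u \<otimes>\<^bsub>\<Gamma>\<^esub> v = (Vd.proj (p1 * p2), Vd.proj ?r)"
    unfolding u(3) v(3) \<Gamma>_simps(3) Vd.proj_mult[OF u(1) v(1)] Vd.proj_add[OF F1 F2]
      Vd.proj_mult[OF F(1) v(2)] Vd.proj_mult[OF u(2) F(2)] Vd.sign_aut_proj[OF u(1)] Psi_proj[OF \<tau> v(1)] ..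
  have "TH n (ke (p1 * p2)) (ke ?r) =
    (\<Oplus>\<^bsub>Xt n\<^esub>i\<in>{..n}. yoneda_prod S.B P d e i (n - i) (TH i (ke p1) (ke q1)) (TH (n - i) (ke p2) (ke q2)))" for n
  proof -
    interpret X: abelian_group "Xt n" by (rule C.Ext_abelian_group)
    let ?a = "\<lambda>i y. ke p1 (take i y) * ke p2 (drop i y)"
    let ?b = "\<lambda>i y. (if n - i = 0 then 0 else (-1) ^ i * ke p1 (take i y) * ke q2 (drop i y)) +
         (if i = 0 then 0 else ke q1 (take (i - 1) y) * S.tr (n - i) (ke p2) (drop (i - 1) y))"
    have "(\<Oplus>\<^bsub>Xt n\<^esub>i\<in>{..n}. yoneda_prod S.B P d e i (n - i) (TH i (ke p1) (ke q1)) (TH (n - i) (ke p2) (ke q2))) =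
      (\<Oplus>\<^bsub>Xt n\<^esub>i\<in>{..n}. TH n (?a i) (?b i))"
      by (rule X.finsum_cong2) (simp_all add: TH_prod TH_in)
    also have "\<dots> = TH n (\<lambda>y. \<Sum>i\<le>n. ?a i y) (\<lambda>y. \<Sum>i\<le>n. ?b i y)"
      by (rule TH_sum) simp
    also have "\<dots> = TH n (ke (p1 * p2)) (ke ?r)"
    proof (rule TH_eqI)
      fix y assume y: "y \<in> words Basis n"
      show "(\<Sum>i\<le>n. ?a i y) = ke (p1 * p2) y" unfolding kap_mult conv_def words_length[OF y] ..
    next
      fix y assume y: "y \<in> S.words' n"
      show "(\<Sum>i\<le>n. ?b i y) = ke ?r y"
      proof (cases n)
        case 0 then show ?thesis using y by simp
      next
        case (Suc m)
        then have l: "length y = m" using y by (simp add: words_length)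
        \<comment> \<open>The term \<open>i = n\<close> drops out: the right factor then has degree
          zero and no second component. What remains are the cuts of a word of length
          \<open>m = n - 1\<close>.\<close>
        have "(\<Sum>i\<le>n. if n - i = 0 then 0 else (-1) ^ i * ke p1 (take i y) * ke q2 (drop i y)) =
          (\<Sum>i\<le>m. (-1) ^ i * ke p1 (take i y) * ke q2 (drop i y))"
          unfolding Suc sum.atMost_Suc by (simp add: Suc_diff_le cong: sum.cong_simp)
        also have "\<dots> = ke (sgnp p1 * q2) y"
          unfolding kap_mult conv_def l by (intro sum.cong refl) (simp add: kap_sgnp l)
        finally have 1: "(\<Sum>i\<le>n. if n - i = 0 then 0 else (-1) ^ i * ke p1 (take i y) * ke q2 (drop i y)) = ke (sgnp p1 * q2) y" .
        \<comment> \<open>Here the left factor has no second component for \<open>i = 0\<close>;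
          replacing \<open>i\<close> by \<open>i + 1\<close> gives the cuts of the same
          word.\<close>
        have "(\<Sum>i\<le>n. if i = 0 then 0 else ke q1 (take (i - 1) y) * S.tr (n - i) (ke p2) (drop (i - 1) y)) =
          (\<Sum>i\<le>m. ke q1 (take i y) * S.tr (m - i) (ke p2) (drop i y))"
          unfolding Suc sum.atMost_Suc_shift by simp
        also have "\<dots> = ke (q1 * dm \<tau> p2) y"
          unfolding kap_mult conv_def l
        proof (intro sum.cong refl)
          fix i assume "i \<in> {..m}"
          have "ke (dm \<tau> p2) (drop i y) = S.tr (m - i) (ke p2) (drop i y)"
            unfolding ke_dm[OF v(1)] S.tr_def by (simp add: l)
          then show "ke q1 (take i y) * S.tr (m - i) (ke p2) (drop i y) = ke q1 (take i y) * ke (dm \<tau> p2) (drop i y)"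
            by simp
        qed
        finally show ?thesis unfolding sum.distrib 1 kap_add by simp
      qed
    qed
    finally show ?thesis by simp
  qed
  then have "H (u \<otimes>\<^bsub>\<Gamma>\<^esub> v) = H u \<otimes>\<^bsub>Y\<^esub> H v"
    unfolding eq unfolding u(3) v(3) H_proj[OF FF] H_proj[OF u(1,2)] H_proj[OF v(1,2)] Y_simps(2) by (intro ext)
  then show ?thesis unfolding eq using \<Gamma>I[OF FF] by blast
qed

text \<open>By \<open>TH_eq_iff\<close> the vanishing of classes outside degree \<open>j\<close>
  means that the two functionals vanish on \<open>W\<close> outside degrees \<open>j\<close> and
  \<open>j - 1\<close>, and \<open>proj_deg_if\<close> turns this into homogeneity.\<close>

lemma H_deg: "u \<in> carrier \<Gamma> \<Longrightarrow> H u \<in> deg Y j \<Longrightarrow> u \<in> deg \<Gamma> j"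
proof -
  assume uc: "u \<in> carrier \<Gamma>" and h: "H u \<in> deg Y j"
  obtain p q where u: "Vd.isF p" "Vd.isF q" "u = (Vd.proj p, Vd.proj q)" using uc by (rule \<Gamma>E)
  have "TH n (ke p) (ke q) = \<zero>\<^bsub>Xt n\<^esub>" if "int n \<noteq> j" for n
    using h that unfolding u(3) H_proj[OF u(1,2)] Y_simps(6) by blast
  then have z: "(\<forall>w\<in>Vd.Wn n. dp (words Basis n) (ke p) w = 0) \<and> (\<forall>w\<in>S.W' n. dp (S.words' n) (ke q) w = 0)"
    if "int n \<noteq> j" for n
    using that unfolding TH_zero[symmetric] TH_eq_iff by (simp add: dp_def)
  have "Vd.proj p \<in> deg E j"
    by (rule Vd.proj_deg_if[OF u(1)]) (use z in blast)
  moreover have "Vd.proj q \<in> deg E (- 1 + j)"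
  proof (rule Vd.proj_deg_if[OF u(2)])
    fix n w assume n: "int n \<noteq> - 1 + j" and w: "w \<in> Vd.Wn n"
    have "int (Suc n) \<noteq> j" using n by simp
    from z[OF this] show "dp (words Basis n) (ke q) w = 0" using w by simp
  qed
  ultimately show ?thesis unfolding u(3) \<Gamma>_simps(6) by blast
qed

lemma yoneda_iso: "graded_isomorphic Y \<Gamma>"
proof -
  have "inv_into (carrier \<Gamma>) H \<in> graded_iso Y \<Gamma>"
  proof (rule graded_iso_inv[OF _ H_one H_add H_mult H_smult H_deg])
    show "bij_betw H (carrier \<Gamma>) (carrier Y)"
      unfolding bij_betw_def
    proof
      show "inj_on H (carrier \<Gamma>)" by (rule inj_onI) (rule H_inj)
      show "H ` carrier \<Gamma> = carrier Y" using H_closed H_surj by blast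
    qed
    show "deg Y i \<subseteq> carrier Y" for i unfolding Y_simps(6) by blast
  qed
  then show ?thesis unfolding graded_isomorphic_def by blast
qed

end

theorem proposition2p2:
  fixes scale :: "'k::field_char_0 \<Rightarrow> 'v::ab_group_add \<Rightarrow> 'v"
    and Basis :: "'v set"
    and R :: "('v list \<Rightarrow>\<^sub>0 'k) set set"
    and A :: "('k, ('v list \<Rightarrow>\<^sub>0 'k) set set) graded_algebra"
    and \<sigma> :: "('v list \<Rightarrow>\<^sub>0 'k) set set \<Rightarrow> ('v list \<Rightarrow>\<^sub>0 'k) set set"
    and B :: "('k, nat \<Rightarrow> ('v list \<Rightarrow>\<^sub>0 'k) set set) graded_algebra"
    and P :: "nat \<Rightarrow> (nat \<Rightarrow> ('v list \<Rightarrow>\<^sub>0 'k) set set, 'q) module"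
    and d :: "nat \<Rightarrow> 'q \<Rightarrow> 'q"
    and e :: "'q \<Rightarrow> 'k"
  assumes "finite_dimensional_vector_space scale Basis"
    and "R \<subseteq> deg (tensor_algebra scale UNIV) 2"
    and "A = quadratic_algebra scale UNIV R"
    and "koszul TYPE('p) A"
    and "\<sigma> \<in> graded_aut A"
    and "B = skew_poly A \<sigma>"
    and "proj_resolution B (trivial_module B) P d e"
  shows "graded_isomorphic (yoneda_algebra B P d e)
    (trivial_extension (quadratic_dual scale R)
      (shift
        (twist (sign_aut (quadratic_dual scale R))
          (regular_bimodule (quadratic_dual scale R))
          (dual_aut scale R (inv_into (carrier A) \<sigma>)))
        (-1)))"
proof -
  interpret quad_setting scale Basis R
    by (intro quad_setting.intro quad_setting_axioms.intro assms(1,2))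
  let ?\<tau> = "inv_into (carrier V.QA) \<sigma>" and ?B = "skew_poly V.QA \<sigma>"
  have \<sigma>: "\<sigma> \<in> graded_aut V.QA" using assms(3,5) by simp
  have res: "proj_resolution ?B (trivial_module ?B) P d e" using assms(3,6,7) by simp
  have \<tau>: "ghom ?\<tau>" and dual: "dual_aut scale R ?\<tau> = Psi ?\<tau>" using dual_aut_Psi[OF \<sigma> refl] by blast+
  have g\<sigma>: "ghom \<sigma>" using \<sigma> by (simp add: ghom_def graded_iso_def)
  obtain P' :: "nat \<Rightarrow> (('v list \<Rightarrow>\<^sub>0 'k) set set, 'p) module" and d' e' gr where kz:
    "proj_resolution V.QA (trivial_module V.QA) P' d' e' \<and> (\<forall>n. graded_module V.QA (P' n) (gr n)) \<and>
     (\<forall>n j. d' n ` gr (Suc n) j \<subseteq> gr n j) \<and> (\<forall>j. e' ` gr 0 j \<subseteq> (if j = 0 then UNIV else {0})) \<and>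
     (\<forall>n. generated_by V.QA (P' n) (gr n (int n)))"
    using assms(4) unfolding assms(3) koszul_def by (elim exE)
  interpret K: koszul_res V.QA Basis "\<lambda>b. V.xw [b]" Rp P' d' e' gr
    by (intro koszul_res.intro koszul_res_axioms.intro VK.koszul_alg_axioms) (use kz in \<open>elim conjE; blast\<close>)+
  \<comment> \<open>The ring axioms for the skew polynomials are contained in the module axioms for
    any term of the given resolution.\<close>
  have "projective ?B (P 0)" using res by (simp add: proj_resolution_def)
  then have "left_module ?B (P 0)" by (simp add: projective_def)
  then have ring: "ring ?B" by (rule left_module.axioms(1))
  have SK: "skew_koszul V.QA \<sigma> Basis (\<lambda>b. V.xw [b]) Rp (Tm ?\<tau>)"
  proof (intro skew_koszul.intro skew_koszul_axioms.intro skew.intro skew_axioms.intro)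
    show "galg V.QA" by (rule V.galg_QA)
    show "\<sigma> \<in> graded_aut V.QA" by (rule \<sigma>)
    show "ring ?B" by (rule ring)
    show "koszul_alg V.QA Basis (\<lambda>b. V.xw [b]) Rp" by (rule VK.koszul_alg_axioms)
    show "\<exists>f'\<in>carrier (VK.K 1). VK.dK f' = f" if "f \<in> carrier (VK.K 0)" "VK.aug (f []) = 0" for f
      using K.K_exact[of 0 f] that by (simp add: K.cycle_def del: words_0)
    show "\<exists>f'\<in>carrier (VK.K (Suc (Suc n))). VK.dK f' = f"
      if "f \<in> carrier (VK.K (Suc n))" "VK.dK f = (\<lambda>_. \<zero>\<^bsub>V.QA\<^esub>)" for f n
      using K.K_exact[of "Suc n" f] that by (simp add: K.cycle_def)
    show "preserves_rel Basis Rp (Tm ?\<tau>)" by (rule Tm_preserves[OF \<tau>])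
    \<comment> \<open>The rows of \<open>Tm ?\<tau>\<close> expand the images of basis vectors under
      the inverse of \<open>\<sigma>\<close>; applying \<open>\<sigma>\<close> to such an expansion
      recovers the basis vector.\<close>
    fix c assume c: "c \<in> Basis"
    have bij: "bij_betw \<sigma> (carrier V.QA) (carrier V.QA)" using \<sigma> by (simp add: graded_iso_def)
    have "V.xw [c] = \<sigma> (?\<tau> (gn c))"
      unfolding xw_gn by (rule bij_betw_inv_into_right[OF bij gn_closed, symmetric])
    also have "\<dots> = \<sigma> (\<Oplus>\<^bsub>V.QA\<^esub>b\<in>Basis. Tm ?\<tau> c b \<odot>\<^bsub>V.QA\<^esub> V.xw [b])"
      unfolding rs[OF \<tau>] gn_expand[of "rs ?\<tau> c"] ..
    also have "\<dots> = (\<Oplus>\<^bsub>V.QA\<^esub>b\<in>Basis. \<sigma> (Tm ?\<tau> c b \<odot>\<^bsub>V.QA\<^esub> V.xw [b]))"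
      by (rule finsum_additive) (simp_all add: V.QA.abelian_group_axioms ghomD(1,2)[OF g\<sigma>])
    also have "\<dots> = (\<Oplus>\<^bsub>V.QA\<^esub>b\<in>Basis. Tm ?\<tau> c b \<odot>\<^bsub>V.QA\<^esub> \<sigma> (V.xw [b]))"
      by (intro V.QA.finsum_cong2) (simp_all add: ghomD(1,5)[OF g\<sigma>])
    finally show "V.xw [c] = (\<Oplus>\<^bsub>V.QA\<^esub>b\<in>Basis. Tm ?\<tau> c b \<odot>\<^bsub>V.QA\<^esub> \<sigma> (V.xw [b]))" .
  qed
  interpret Yo: yoneda_setting scale Basis R \<sigma> ?\<tau> P d e
    by (intro yoneda_setting.intro yoneda_setting_axioms.intro quad_setting_axioms \<tau> SK res)
  show ?thesis
    unfolding assms(3,6) dual_eq dual by (rule Yo.yoneda_iso)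
qed

end
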